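(* Let $(\mathcal{A},\Sigma)$ be a $\sigma$-filtered pair, let $\mathcal{I}$ be a finite $2$-category, and let $F:\mathcal{A}\times\mathcal{I}\to\mathbf{Cat}$ and $W:\mathcal{I}\to\mathbf{Cat}$ be $2$-functors, with $W$ a finite weight. Then the canonical comparison functor $$\Diamond:\ \sigma\text{-}\varinjlim_{A\in\mathcal{A}}\ {}_{bi}\{W,F(A,-)\}\ \longrightarrow\ {}_{bi}\{W,\ \sigma\text{-}\varinjlim_{A\in\mathcal{A}}F(A,-)\}$$ is an equivalence of categories. (That is, $\sigma$-filtered $\sigma$-colimits commute with finite weighted bilimits in $\mathbf{Cat}$.)
   Context: 2-categories and 2-functors are strict. $\mathbf{Cat}$ is the 2-category of (small) categories, functors and natural transformations; size issues are disregarded. A pair $(\mathcal{A},\Sigma)$ consists of a 2-category $\mathcal{A}$ and a family $\Sigma$ of arrows of $\mathcal{A}$ containing all identities and closed under composition. **$\sigma$-filtered.** $(\mathcal{A},\Sigma)$ is $\sigma$-filtered if $\mathcal{A}$ is non-empty and: ($\sigma$F0) for all $A,B\in\mathcal{A}$ there are $E\in\mathcal{A}$ and arrows $A\to E$, $B\to E$ in $\Sigma$; ($\sigma$F1) for all $f,g:A\to B$ with $g\in\Sigma$ there are $h:B\to E$ in $\Sigma$ and a 2-cell $\alpha:hf\Rightarrow hg$, and if $f\in\Sigma$ then $\alpha$ may be chosen invertible; ($\sigma$F2) for all 2-cells $\alpha,\beta:f\Rightarrow g$ with $f,g:A\to B$ and $g\in\Sigma$ there is $h:B\to E$ in $\Sigma$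 with $h\alpha=h\beta$. **$\sigma$-cones and $\sigma$-colimits.** A $\sigma$-cone (with respect to $\Sigma$) for a 2-functor $G:\mathcal{A}\to\mathbf{Cat}$ with vertex a category $E$ consists of functors $\theta_A:GA\to E$ ($A\in\mathcal{A}$) and natural transformations $\theta_f:\theta_B\,Gf\Rightarrow\theta_A$ ($f:A\to B$ in $\mathcal{A}$) such that $\theta_{\mathrm{id}_A}=\mathrm{id}_{\theta_A}$; $\theta_{gf}=\theta_f\circ(\theta_g\,Gf)$ for composable $f,g$; $\theta_f=\theta_g\circ(\theta_B\,G\gamma)$ for every 2-cell $\gamma:f\Rightarrow g:A\to B$; and $\theta_f$ is invertible for every $f\in\Sigma$. A morphism $\varphi:\theta\to\theta'$ is a family of 2-cells $\varphi_A:\theta_A\Rightarrow\theta'_A$ with $\theta'_f\circ(\varphi_B\,Gf)=\varphi_A\circ\theta_f$ for all $f:A\to B$. This gives a category $\mathrm{Cones}_\sigma(G,E)$. The $\sigma$-colimit $\sigma\text{-}\varinjlim_{A\in\mathcal{A}}GA$ (with respect to $\Sigma$) is the vertex $L$ of a universal $\sigma$-cone $\lambda$: for every category $E$, composing with $\lambda$ is an isomorphism of categories $\mathbf{Cat}(L,E)\to\mathrm{Cones}_\sigma(G,E)$. Such $\sigma$-colimits exist in $\mathbf{Cat}$. The 2-functor $\sigma\text{-}\varinjlim_{A\in\mathcal{A}}F(A,-):\mathcal{I}\to\mathbf{Cat}$ is computed pointwise, $i\mapsto\sigma\text{-}\varinjlim_{A\in\mathcal{A}}F(A,i)$. **Finite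 weights and bilimits.** A 2-category is finite if it has finitely many objects, arrows and 2-cells. A 2-functor $W:\mathcal{I}\to\mathbf{Cat}$ is a finite weight if $\mathcal{I}$ is a finite 2-category and $W(i)$ is a finite category for every $i\in\mathcal{I}$. For $G:\mathcal{I}\to\mathbf{Cat}$, ${}_{bi}\{W,G\}$ is the bilimit of $G$ weighted by $W$; in $\mathbf{Cat}$ it can be computed as the weighted pseudo-limit, i.e. as the category whose objects are the pseudonatural transformations $W\Rightarrow G$ and whose arrows are the modifications between them. With this choice $A\mapsto{}_{bi}\{W,F(A,-)\}$ is a 2-functor $\mathcal{A}\to\mathbf{Cat}$. **The comparison functor.** For $i\in\mathcal{I}$ let $\lambda_{A,i}:F(A,i)\to\sigma\text{-}\varinjlim_{A}F(A,i)$ and $\lambda_{f,i}$ be the universal $\sigma$-cone; the $\lambda_{A,i}$ are 2-natural in $i$. The functors ${}_{bi}\{W,F(A,-)\}\to{}_{bi}\{W,\sigma\text{-}\varinjlim_{A}F(A,-)\}$, $\theta\mapsto\lambda_{A,-}\circ\theta$, together with the 2-cells obtained by whiskering with $\lambda_{f,-}$, form a $\sigma$-cone; $\Diamond$ is the functor it induces out of the $\sigma$-colimit. *)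

theory Defs
  imports "HOL-Library.FuncSet"
begin

text \<open>Categories, functors and transformations have explicit carriers. All maps that belong to a
  functor, a natural transformation, a cone or a modification are required to be extensional
  (\<^term>\<open>undefined\<close> outside the carrier), so that HOL equality is equality of the mathematical
  objects.\<close>

section \<open>Categories\<close>

record ('o, 'm) cat =
  Obj :: "'o set"
  Arr :: "'m set"
  Dom :: "'m \<Rightarrow> 'o"
  Cod :: "'m \<Rightarrow> 'o"
  Ident :: "'o \<Rightarrow> 'm"
  Comp :: "'m \<Rightarrow> 'm \<Rightarrow> 'm"  (infixl "\<cdot>\<index>" 70)

definition hom :: "('o, 'm) cat \<Rightarrow> 'o \<Rightarrow> 'o \<Rightarrow> 'm set" where
  "hom C x y = {f \<in> Arr C. Dom C f = x \<and> Cod C f = y}"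

locale category =
  fixes C :: "('o, 'm) cat" (structure)
  assumes dom_obj: "f \<in> Arr C \<Longrightarrow> Dom C f \<in> Obj C"
    and cod_obj: "f \<in> Arr C \<Longrightarrow> Cod C f \<in> Obj C"
    and ident_hom: "x \<in> Obj C \<Longrightarrow> Ident C x \<in> hom C x x"
    and comp_hom: "\<lbrakk>f \<in> hom C x y; g \<in> hom C y z\<rbrakk> \<Longrightarrow> g \<cdot> f \<in> hom C x z"
    and comp_ident: "f \<in> hom C x y \<Longrightarrow> f \<cdot> Ident C x = f"
    and ident_comp: "f \<in> hom C x y \<Longrightarrow> Ident C y \<cdot> f = f"
    and comp_assoc: "\<lbrakk>f \<in> hom C w x; g \<in> hom C x y; h \<in> hom C y z\<rbrakk>
          \<Longrightarrow> h \<cdot> (g \<cdot> f) = (h \<cdot> g) \<cdot> f"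

definition is_iso :: "('o, 'm) cat \<Rightarrow> 'm \<Rightarrow> bool" where
  "is_iso C f \<longleftrightarrow> f \<in> Arr C \<and>
     (\<exists>g \<in> hom C (Cod C f) (Dom C f).
        g \<cdot>\<^bsub>C\<^esub> f = Ident C (Dom C f) \<and> f \<cdot>\<^bsub>C\<^esub> g = Ident C (Cod C f))"

definition finite_cat :: "('o, 'm) cat \<Rightarrow> bool" where
  "finite_cat C \<longleftrightarrow> finite (Obj C) \<and> finite (Arr C)"

definition prod_cat :: "('o, 'm) cat \<Rightarrow> ('p, 'n) cat \<Rightarrow> ('o \<times> 'p, 'm \<times> 'n) cat" where
  "prod_cat C D =
    \<lparr>Obj = Obj C \<times> Obj D, Arr = Arr C \<times> Arr D,
     Dom = map_prod (Dom C) (Dom D), Cod = map_prod (Cod C) (Cod D),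
     Ident = map_prod (Ident C) (Ident D),
     Comp = (\<lambda>(g, g') (f, f'). (g \<cdot>\<^bsub>C\<^esub> f, g' \<cdot>\<^bsub>D\<^esub> f'))\<rparr>"


section \<open>Functors and natural transformations\<close>

record ('o, 'm, 'p, 'n) cfunctor =
  FSrc :: "('o, 'm) cat"
  FTgt :: "('p, 'n) cat"
  FObj :: "'o \<Rightarrow> 'p"
  FArr :: "'m \<Rightarrow> 'n"

definition is_functor :: "('o, 'm, 'p, 'n) cfunctor \<Rightarrow> bool" where
  "is_functor F \<longleftrightarrow>
     category (FSrc F) \<and> category (FTgt F) \<and>
     FObj F \<in> Obj (FSrc F) \<rightarrow>\<^sub>E Obj (FTgt F) \<and>
     FArr F \<in> extensional (Arr (FSrc F)) \<and>
     (\<forall>f \<in> Arr (FSrc F).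
        FArr F f \<in> hom (FTgt F) (FObj F (Dom (FSrc F) f)) (FObj F (Cod (FSrc F) f))) \<and>
     (\<forall>x \<in> Obj (FSrc F). FArr F (Ident (FSrc F) x) = Ident (FTgt F) (FObj F x)) \<and>
     (\<forall>f \<in> Arr (FSrc F). \<forall>g \<in> Arr (FSrc F). Cod (FSrc F) f = Dom (FSrc F) g \<longrightarrow>
        FArr F (g \<cdot>\<^bsub>FSrc F\<^esub> f) = FArr F g \<cdot>\<^bsub>FTgt F\<^esub> FArr F f)"

definition idf :: "('o, 'm) cat \<Rightarrow> ('o, 'm, 'o, 'm) cfunctor" where
  "idf C = \<lparr>FSrc = C, FTgt = C, FObj = (\<lambda>x\<in>Obj C. x), FArr = (\<lambda>f\<in>Arr C. f)\<rparr>"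

definition fcomp ::
    "('p, 'n, 'q, 'r) cfunctor \<Rightarrow> ('o, 'm, 'p, 'n) cfunctor \<Rightarrow> ('o, 'm, 'q, 'r) cfunctor"
    (infixl "\<cdot>F" 70) where
  "G \<cdot>F F =
    \<lparr>FSrc = FSrc F, FTgt = FTgt G,
     FObj = (\<lambda>x\<in>Obj (FSrc F). FObj G (FObj F x)),
     FArr = (\<lambda>f\<in>Arr (FSrc F). FArr G (FArr F f))\<rparr>"

record ('o, 'm, 'p, 'n) ntrans =
  NSrc :: "('o, 'm, 'p, 'n) cfunctor"
  NTgt :: "('o, 'm, 'p, 'n) cfunctor"
  NCmp :: "'o \<Rightarrow> 'n"

definition is_ntrans :: "('o, 'm, 'p, 'n) ntrans \<Rightarrow> bool" where
  "is_ntrans \<alpha> \<longleftrightarrow>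
     is_functor (NSrc \<alpha>) \<and> is_functor (NTgt \<alpha>) \<and>
     FSrc (NSrc \<alpha>) = FSrc (NTgt \<alpha>) \<and> FTgt (NSrc \<alpha>) = FTgt (NTgt \<alpha>) \<and>
     NCmp \<alpha> \<in> extensional (Obj (FSrc (NSrc \<alpha>))) \<and>
     (\<forall>x \<in> Obj (FSrc (NSrc \<alpha>)).
        NCmp \<alpha> x \<in> hom (FTgt (NSrc \<alpha>)) (FObj (NSrc \<alpha>) x) (FObj (NTgt \<alpha>) x)) \<and>
     (\<forall>f \<in> Arr (FSrc (NSrc \<alpha>)).
        NCmp \<alpha> (Cod (FSrc (NSrc \<alpha>)) f) \<cdot>\<^bsub>FTgt (NSrc \<alpha>)\<^esub> FArr (NSrc \<alpha>) f
          = FArr (NTgt \<alpha>) f \<cdot>\<^bsub>FTgt (NSrc \<alpha>)\<^esub> NCmp \<alpha> (Dom (FSrc (NSrc \<alpha>)) f))"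

definition idn :: "('o, 'm, 'p, 'n) cfunctor \<Rightarrow> ('o, 'm, 'p, 'n) ntrans" where
  "idn F = \<lparr>NSrc = F, NTgt = F, NCmp = (\<lambda>x\<in>Obj (FSrc F). Ident (FTgt F) (FObj F x))\<rparr>"

definition vcomp ::
    "('o, 'm, 'p, 'n) ntrans \<Rightarrow> ('o, 'm, 'p, 'n) ntrans \<Rightarrow> ('o, 'm, 'p, 'n) ntrans"
    (infixl "\<cdot>N" 70) where
  "\<beta> \<cdot>N \<alpha> =
    \<lparr>NSrc = NSrc \<alpha>, NTgt = NTgt \<beta>,
     NCmp = (\<lambda>x\<in>Obj (FSrc (NSrc \<alpha>)). NCmp \<beta> x \<cdot>\<^bsub>FTgt (NSrc \<alpha>)\<^esub> NCmp \<alpha> x)\<rparr>"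

definition hcomp ::
    "('p, 'n, 'q, 'r) ntrans \<Rightarrow> ('o, 'm, 'p, 'n) ntrans \<Rightarrow> ('o, 'm, 'q, 'r) ntrans" where
  "hcomp \<beta> \<alpha> =
    \<lparr>NSrc = NSrc \<beta> \<cdot>F NSrc \<alpha>, NTgt = NTgt \<beta> \<cdot>F NTgt \<alpha>,
     NCmp = (\<lambda>x\<in>Obj (FSrc (NSrc \<alpha>)).
       NCmp \<beta> (FObj (NTgt \<alpha>) x) \<cdot>\<^bsub>FTgt (NSrc \<beta>)\<^esub> FArr (NSrc \<beta>) (NCmp \<alpha> x))\<rparr>"

definition whisker_left ::
    "('p, 'n, 'q, 'r) cfunctor \<Rightarrow> ('o, 'm, 'p, 'n) ntrans \<Rightarrow> ('o, 'm, 'q, 'r) ntrans"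
    (infixl "\<cdot>L" 70) where
  "H \<cdot>L \<alpha> =
    \<lparr>NSrc = H \<cdot>F NSrc \<alpha>, NTgt = H \<cdot>F NTgt \<alpha>,
     NCmp = (\<lambda>x\<in>Obj (FSrc (NSrc \<alpha>)). FArr H (NCmp \<alpha> x))\<rparr>"

definition whisker_right ::
    "('p, 'n, 'q, 'r) ntrans \<Rightarrow> ('o, 'm, 'p, 'n) cfunctor \<Rightarrow> ('o, 'm, 'q, 'r) ntrans"
    (infixl "\<cdot>R" 70) where
  "\<alpha> \<cdot>R H =
    \<lparr>NSrc = NSrc \<alpha> \<cdot>F H, NTgt = NTgt \<alpha> \<cdot>F H,
     NCmp = (\<lambda>x\<in>Obj (FSrc H). NCmp \<alpha> (FObj H x))\<rparr>"

text \<open>The functor category \<open>\<^bold>C\<^bold>a\<^bold>t(C, D)\<close>; unlike the 2-category \<open>Cat\<close> below, which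
  lives on a fixed pair of types, it allows \<open>C\<close> and \<open>D\<close> to have different types.\<close>

definition Fun ::
    "('o, 'm) cat \<Rightarrow> ('p, 'n) cat \<Rightarrow> (('o, 'm, 'p, 'n) cfunctor, ('o, 'm, 'p, 'n) ntrans) cat" where
  "Fun C D =
    \<lparr>Obj = {F. is_functor F \<and> FSrc F = C \<and> FTgt F = D},
     Arr = {\<alpha>. is_ntrans \<alpha> \<and> FSrc (NSrc \<alpha>) = C \<and> FTgt (NSrc \<alpha>) = D},
     Dom = NSrc, Cod = NTgt, Ident = idn, Comp = vcomp\<rparr>"

definition is_cat_isomorphism ::
    "('o, 'm) cat \<Rightarrow> ('p, 'n) cat \<Rightarrow> ('o, 'm, 'p, 'n) cfunctor \<Rightarrow> bool" where
  "is_cat_isomorphism C D K \<longleftrightarrow> K \<in> Obj (Fun C D) \<and>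
     (\<exists>K' \<in> Obj (Fun D C). K' \<cdot>F K = idf C \<and> K \<cdot>F K' = idf D)"

definition is_equivalence ::
    "('o, 'm) cat \<Rightarrow> ('p, 'n) cat \<Rightarrow> ('o, 'm, 'p, 'n) cfunctor \<Rightarrow> bool" where
  "is_equivalence C D K \<longleftrightarrow> K \<in> Obj (Fun C D) \<and>
     (\<exists>K' \<in> Obj (Fun D C).
        (\<exists>\<eta> \<in> hom (Fun C C) (idf C) (K' \<cdot>F K). is_iso (Fun C C) \<eta>) \<and>
        (\<exists>\<epsilon> \<in> hom (Fun D D) (K \<cdot>F K') (idf D). is_iso (Fun D D) \<epsilon>))"


section \<open>2-categories and 2-functors\<close>

text \<open>\<open>Under A\<close> is the underlying category; \<open>Cells A\<close> has the arrows as objects, the 2-cells as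
  arrows and vertical composition; \<open>HComp A \<beta> \<alpha>\<close> is horizontal composition.\<close>

record ('a, 'f, 'c) twocat =
  Under :: "('a, 'f) cat"
  Cells :: "('f, 'c) cat"
  HComp :: "'c \<Rightarrow> 'c \<Rightarrow> 'c"

definition cell_src :: "('a, 'f, 'c) twocat \<Rightarrow> 'c \<Rightarrow> 'a" where
  "cell_src A \<alpha> = Dom (Under A) (Dom (Cells A) \<alpha>)"

definition cell_tgt :: "('a, 'f, 'c) twocat \<Rightarrow> 'c \<Rightarrow> 'a" where
  "cell_tgt A \<alpha> = Cod (Under A) (Dom (Cells A) \<alpha>)"

locale two_category =
  fixes A :: "('a, 'f, 'c) twocat"
  assumes under: "category (Under A)"
    and cells: "category (Cells A)"
    and cells_obj: "Obj (Cells A) = Arr (Under A)"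
    and globular_src: "\<alpha> \<in> Arr (Cells A)
          \<Longrightarrow> Dom (Under A) (Cod (Cells A) \<alpha>) = Dom (Under A) (Dom (Cells A) \<alpha>)"
    and globular_tgt: "\<alpha> \<in> Arr (Cells A)
          \<Longrightarrow> Cod (Under A) (Cod (Cells A) \<alpha>) = Cod (Under A) (Dom (Cells A) \<alpha>)"
    and hcomp_hom: "\<lbrakk>\<alpha> \<in> hom (Cells A) f g; \<beta> \<in> hom (Cells A) h k; cell_tgt A \<alpha> = cell_src A \<beta>\<rbrakk>
          \<Longrightarrow> HComp A \<beta> \<alpha> \<in> hom (Cells A) (h \<cdot>\<^bsub>Under A\<^esub> f) (k \<cdot>\<^bsub>Under A\<^esub> g)"
    and hcomp_ident: "\<lbrakk>f \<in> hom (Under A) x y; g \<in> hom (Under A) y z\<rbrakk>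
          \<Longrightarrow> HComp A (Ident (Cells A) g) (Ident (Cells A) f) = Ident (Cells A) (g \<cdot>\<^bsub>Under A\<^esub> f)"
    and interchange: "\<lbrakk>\<alpha> \<in> hom (Cells A) f g; \<alpha>' \<in> hom (Cells A) g h;
            \<beta> \<in> hom (Cells A) k l; \<beta>' \<in> hom (Cells A) l m; cell_tgt A \<alpha> = cell_src A \<beta>\<rbrakk>
          \<Longrightarrow> HComp A (\<beta>' \<cdot>\<^bsub>Cells A\<^esub> \<beta>) (\<alpha>' \<cdot>\<^bsub>Cells A\<^esub> \<alpha>)
              = HComp A \<beta>' \<alpha>' \<cdot>\<^bsub>Cells A\<^esub> HComp A \<beta> \<alpha>"
    and hcomp_assoc: "\<lbrakk>\<alpha> \<in> Arr (Cells A); \<beta> \<in> Arr (Cells A); \<gamma> \<in> Arr (Cells A);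
            cell_tgt A \<alpha> = cell_src A \<beta>; cell_tgt A \<beta> = cell_src A \<gamma>\<rbrakk>
          \<Longrightarrow> HComp A \<gamma> (HComp A \<beta> \<alpha>) = HComp A (HComp A \<gamma> \<beta>) \<alpha>"
    and hcomp_unit_right: "\<alpha> \<in> Arr (Cells A)
          \<Longrightarrow> HComp A \<alpha> (Ident (Cells A) (Ident (Under A) (cell_src A \<alpha>))) = \<alpha>"
    and hcomp_unit_left: "\<alpha> \<in> Arr (Cells A)
          \<Longrightarrow> HComp A (Ident (Cells A) (Ident (Under A) (cell_tgt A \<alpha>))) \<alpha> = \<alpha>"

definition finite_two_category :: "('a, 'f, 'c) twocat \<Rightarrow> bool" where
  "finite_two_category A \<longleftrightarrow>
     two_category A \<and> finite (Obj (Under A)) \<and> finite (Arr (Under A)) \<and> finite (Arr (Cells A))"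

definition prod_twocat ::
    "('a, 'f, 'c) twocat \<Rightarrow> ('i, 'j, 'k) twocat \<Rightarrow> ('a \<times> 'i, 'f \<times> 'j, 'c \<times> 'k) twocat" where
  "prod_twocat A B =
    \<lparr>Under = prod_cat (Under A) (Under B), Cells = prod_cat (Cells A) (Cells B),
     HComp = (\<lambda>(\<beta>, \<beta>') (\<alpha>, \<alpha>'). (HComp A \<beta> \<alpha>, HComp B \<beta>' \<alpha>'))\<rparr>"

text \<open>The 2-category of all categories with objects and arrows in the given types.\<close>

definition Cat ::
    "(('o, 'm) cat, ('o, 'm, 'o, 'm) cfunctor, ('o, 'm, 'o, 'm) ntrans) twocat" where
  "Cat =
    \<lparr>Under = \<lparr>Obj = {C. category C}, Arr = {F. is_functor F},
              Dom = FSrc, Cod = FTgt, Ident = idf, Comp = fcomp\<rparr>,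
     Cells = \<lparr>Obj = {F. is_functor F}, Arr = {\<alpha>. is_ntrans \<alpha>},
              Dom = NSrc, Cod = NTgt, Ident = idn, Comp = vcomp\<rparr>,
     HComp = hcomp\<rparr>"

record ('a, 'f, 'c, 'b, 'g, 'd) twofunctor =
  Map0 :: "'a \<Rightarrow> 'b"
  Map1 :: "'f \<Rightarrow> 'g"
  Map2 :: "'c \<Rightarrow> 'd"

definition two_functor ::
    "('a, 'f, 'c) twocat \<Rightarrow> ('b, 'g, 'd) twocat \<Rightarrow> ('a, 'f, 'c, 'b, 'g, 'd) twofunctor \<Rightarrow> bool" where
  "two_functor A B F \<longleftrightarrow>
     (\<forall>a \<in> Obj (Under A). Map0 F a \<in> Obj (Under B)) \<and>
     (\<forall>f \<in> Arr (Under A).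
        Map1 F f \<in> hom (Under B) (Map0 F (Dom (Under A) f)) (Map0 F (Cod (Under A) f))) \<and>
     (\<forall>\<alpha> \<in> Arr (Cells A).
        Map2 F \<alpha> \<in> hom (Cells B) (Map1 F (Dom (Cells A) \<alpha>)) (Map1 F (Cod (Cells A) \<alpha>))) \<and>
     (\<forall>a \<in> Obj (Under A). Map1 F (Ident (Under A) a) = Ident (Under B) (Map0 F a)) \<and>
     (\<forall>f \<in> Arr (Under A). \<forall>g \<in> Arr (Under A). Cod (Under A) f = Dom (Under A) g \<longrightarrow>
        Map1 F (g \<cdot>\<^bsub>Under A\<^esub> f) = Map1 F g \<cdot>\<^bsub>Under B\<^esub> Map1 F f) \<and>
     (\<forall>f \<in> Arr (Under A). Map2 F (Ident (Cells A) f) = Ident (Cells B) (Map1 F f)) \<and>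
     (\<forall>\<alpha> \<in> Arr (Cells A). \<forall>\<beta> \<in> Arr (Cells A). Cod (Cells A) \<alpha> = Dom (Cells A) \<beta> \<longrightarrow>
        Map2 F (\<beta> \<cdot>\<^bsub>Cells A\<^esub> \<alpha>) = Map2 F \<beta> \<cdot>\<^bsub>Cells B\<^esub> Map2 F \<alpha>) \<and>
     (\<forall>\<alpha> \<in> Arr (Cells A). \<forall>\<beta> \<in> Arr (Cells A). cell_tgt A \<alpha> = cell_src A \<beta> \<longrightarrow>
        Map2 F (HComp A \<beta> \<alpha>) = HComp B (Map2 F \<beta>) (Map2 F \<alpha>))"

type_synonym ('a, 'f, 'c, 'o, 'm) cat_valued =
  "('a, 'f, 'c, ('o, 'm) cat, ('o, 'm, 'o, 'm) cfunctor, ('o, 'm, 'o, 'm) ntrans) twofunctor"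

text \<open>The 2-functors \<open>F(a, -)\<close> and \<open>F(-, i)\<close> of a 2-functor \<open>F\<close> on \<open>A \<times> I\<close>.\<close>

definition fix_left ::
    "('a, 'f, 'c) twocat \<Rightarrow> ('a \<times> 'i, 'f \<times> 'j, 'c \<times> 'k, 'b, 'g, 'd) twofunctor \<Rightarrow> 'a
      \<Rightarrow> ('i, 'j, 'k, 'b, 'g, 'd) twofunctor" where
  "fix_left A F a =
    \<lparr>Map0 = (\<lambda>i. Map0 F (a, i)),
     Map1 = (\<lambda>u. Map1 F (Ident (Under A) a, u)),
     Map2 = (\<lambda>\<mu>. Map2 F (Ident (Cells A) (Ident (Under A) a), \<mu>))\<rparr>"

definition fix_right ::
    "('i, 'j, 'k) twocat \<Rightarrow> ('a \<times> 'i, 'f \<times> 'j, 'c \<times> 'k, 'b, 'g, 'd) twofunctor \<Rightarrow> 'i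
      \<Rightarrow> ('a, 'f, 'c, 'b, 'g, 'd) twofunctor" where
  "fix_right I F i =
    \<lparr>Map0 = (\<lambda>a. Map0 F (a, i)),
     Map1 = (\<lambda>f. Map1 F (f, Ident (Under I) i)),
     Map2 = (\<lambda>\<alpha>. Map2 F (\<alpha>, Ident (Cells I) (Ident (Under I) i)))\<rparr>"

definition finite_weight :: "('i, 'j, 'k) twocat \<Rightarrow> ('i, 'j, 'k, 'o, 'm) cat_valued \<Rightarrow> bool" where
  "finite_weight I W \<longleftrightarrow>
     finite_two_category I \<and> two_functor I Cat W \<and> (\<forall>i \<in> Obj (Under I). finite_cat (Map0 W i))"


section \<open>\<open>\<sigma>\<close>-filtered pairs\<close>

definition two_category_pair :: "('a, 'f, 'c) twocat \<Rightarrow> 'f set \<Rightarrow> bool" where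
  "two_category_pair A \<Sigma> \<longleftrightarrow>
     two_category A \<and> \<Sigma> \<subseteq> Arr (Under A) \<and>
     (\<forall>a \<in> Obj (Under A). Ident (Under A) a \<in> \<Sigma>) \<and>
     (\<forall>f \<in> \<Sigma>. \<forall>g \<in> \<Sigma>. Cod (Under A) f = Dom (Under A) g \<longrightarrow> g \<cdot>\<^bsub>Under A\<^esub> f \<in> \<Sigma>)"

definition sigma_filtered :: "('a, 'f, 'c) twocat \<Rightarrow> 'f set \<Rightarrow> bool" where
  "sigma_filtered A \<Sigma> \<longleftrightarrow>
     two_category_pair A \<Sigma> \<and> Obj (Under A) \<noteq> {} \<and>
     (\<forall>a \<in> Obj (Under A). \<forall>b \<in> Obj (Under A). \<exists>e \<in> Obj (Under A).
        hom (Under A) a e \<inter> \<Sigma> \<noteq> {} \<and> hom (Under A) b e \<inter> \<Sigma> \<noteq> {}) \<and>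
     (\<forall>a \<in> Obj (Under A). \<forall>b \<in> Obj (Under A).
        \<forall>f \<in> hom (Under A) a b. \<forall>g \<in> hom (Under A) a b \<inter> \<Sigma>.
        \<exists>e \<in> Obj (Under A). \<exists>h \<in> hom (Under A) b e \<inter> \<Sigma>.
        \<exists>\<alpha> \<in> hom (Cells A) (h \<cdot>\<^bsub>Under A\<^esub> f) (h \<cdot>\<^bsub>Under A\<^esub> g).
          f \<in> \<Sigma> \<longrightarrow> is_iso (Cells A) \<alpha>) \<and>
     (\<forall>a \<in> Obj (Under A). \<forall>b \<in> Obj (Under A).
        \<forall>f \<in> hom (Under A) a b. \<forall>g \<in> hom (Under A) a b \<inter> \<Sigma>.
        \<forall>\<alpha> \<in> hom (Cells A) f g. \<forall>\<beta> \<in> hom (Cells A) f g.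
        \<exists>e \<in> Obj (Under A). \<exists>h \<in> hom (Under A) b e \<inter> \<Sigma>.
          HComp A (Ident (Cells A) h) \<alpha> = HComp A (Ident (Cells A) h) \<beta>)"


section \<open>Transformations and modifications\<close>

text \<open>These records carry the data of \<open>\<sigma>\<close>-cones and their morphisms as well as of pseudonatural
  transformations and modifications: one functor \<open>\<theta>\<^sub>i\<close> for each object and one natural
  transformation \<open>\<theta>\<^sub>u\<close> for each arrow of the indexing 2-category.\<close>

record ('i, 'j, 'o, 'm, 'p, 'n) transf =
  T0 :: "'i \<Rightarrow> ('o, 'm, 'p, 'n) cfunctor"
  T1 :: "'j \<Rightarrow> ('o, 'm, 'p, 'n) ntrans"

record ('i, 'j, 'o, 'm, 'p, 'n) modif =
  MSrc :: "('i, 'j, 'o, 'm, 'p, 'n) transf"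
  MTgt :: "('i, 'j, 'o, 'm, 'p, 'n) transf"
  MCmp :: "'i \<Rightarrow> ('o, 'm, 'p, 'n) ntrans"

text \<open>The category with objects \<open>S\<close> whose arrows \<open>\<theta> \<rightarrow> \<theta>'\<close> are the families of natural
  transformations \<open>\<rho>\<^sub>i : \<theta>\<^sub>i \<Rightarrow> \<theta>'\<^sub>i\<close>, for \<open>i \<in> X\<close>, that satisfy the condition \<open>R \<theta> \<theta>' \<rho>\<close>.\<close>

definition modif_cat ::
    "'i set \<Rightarrow> ('i, 'j, 'o, 'm, 'p, 'n) transf set
      \<Rightarrow> (('i, 'j, 'o, 'm, 'p, 'n) transf \<Rightarrow> ('i, 'j, 'o, 'm, 'p, 'n) transf
            \<Rightarrow> ('i \<Rightarrow> ('o, 'm, 'p, 'n) ntrans) \<Rightarrow> bool)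
      \<Rightarrow> (('i, 'j, 'o, 'm, 'p, 'n) transf, ('i, 'j, 'o, 'm, 'p, 'n) modif) cat" where
  "modif_cat X S R =
    \<lparr>Obj = S,
     Arr = {\<rho>. MSrc \<rho> \<in> S \<and> MTgt \<rho> \<in> S \<and> MCmp \<rho> \<in> extensional X \<and>
              (\<forall>i \<in> X. is_ntrans (MCmp \<rho> i) \<and>
                 NSrc (MCmp \<rho> i) = T0 (MSrc \<rho>) i \<and> NTgt (MCmp \<rho> i) = T0 (MTgt \<rho>) i) \<and>
              R (MSrc \<rho>) (MTgt \<rho>) (MCmp \<rho>)},
     Dom = MSrc, Cod = MTgt,
     Ident = (\<lambda>\<theta>. \<lparr>MSrc = \<theta>, MTgt = \<theta>, MCmp = (\<lambda>i\<in>X. idn (T0 \<theta> i))\<rparr>),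
     Comp = (\<lambda>\<rho>' \<rho>. \<lparr>MSrc = MSrc \<rho>, MTgt = MTgt \<rho>', MCmp = (\<lambda>i\<in>X. MCmp \<rho>' i \<cdot>N MCmp \<rho> i)\<rparr>)\<rparr>"

text \<open>Composition of a transformation indexed by \<open>X\<close> with a 2-natural family of functors \<open>t\<^sub>i\<close>, with a
  modification \<open>m\<^sub>i : s\<^sub>i \<Rightarrow> t\<^sub>i\<close> between two such families (\<open>post\<close>), and with a 2-natural family on the
  other side (\<open>pre\<close>).\<close>

definition post_transf ::
    "('i, 'j, 'k) twocat \<Rightarrow> ('i \<Rightarrow> ('p, 'n, 'q, 'r) cfunctor) \<Rightarrow> ('i, 'j, 'o, 'm, 'p, 'n) transf
      \<Rightarrow> ('i, 'j, 'o, 'm, 'q, 'r) transf" where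
  "post_transf X t \<theta> =
    \<lparr>T0 = (\<lambda>i\<in>Obj (Under X). t i \<cdot>F T0 \<theta> i),
     T1 = (\<lambda>u\<in>Arr (Under X). t (Cod (Under X) u) \<cdot>L T1 \<theta> u)\<rparr>"

definition post_modif ::
    "('i, 'j, 'k) twocat \<Rightarrow> ('i \<Rightarrow> ('p, 'n, 'q, 'r) cfunctor) \<Rightarrow> ('i, 'j, 'o, 'm, 'p, 'n) modif
      \<Rightarrow> ('i, 'j, 'o, 'm, 'q, 'r) modif" where
  "post_modif X t \<rho> =
    \<lparr>MSrc = post_transf X t (MSrc \<rho>), MTgt = post_transf X t (MTgt \<rho>),
     MCmp = (\<lambda>i\<in>Obj (Under X). t i \<cdot>L MCmp \<rho> i)\<rparr>"

definition post_cell ::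
    "('i, 'j, 'k) twocat \<Rightarrow> ('i \<Rightarrow> ('p, 'n, 'q, 'r) cfunctor) \<Rightarrow> ('i \<Rightarrow> ('p, 'n, 'q, 'r) cfunctor)
      \<Rightarrow> ('i \<Rightarrow> ('p, 'n, 'q, 'r) ntrans) \<Rightarrow> ('i, 'j, 'o, 'm, 'p, 'n) transf
      \<Rightarrow> ('i, 'j, 'o, 'm, 'q, 'r) modif" where
  "post_cell X s t m \<theta> =
    \<lparr>MSrc = post_transf X s \<theta>, MTgt = post_transf X t \<theta>,
     MCmp = (\<lambda>i\<in>Obj (Under X). m i \<cdot>R T0 \<theta> i)\<rparr>"

definition pre_transf ::
    "('i, 'j, 'k) twocat \<Rightarrow> ('i, 'j, 'p, 'n, 'q, 'r) transf \<Rightarrow> ('i \<Rightarrow> ('o, 'm, 'p, 'n) cfunctor)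
      \<Rightarrow> ('i, 'j, 'o, 'm, 'q, 'r) transf" where
  "pre_transf X \<theta> s =
    \<lparr>T0 = (\<lambda>i\<in>Obj (Under X). T0 \<theta> i \<cdot>F s i),
     T1 = (\<lambda>u\<in>Arr (Under X). T1 \<theta> u \<cdot>R s (Dom (Under X) u))\<rparr>"


section \<open>\<open>\<sigma>\<close>-cones and \<open>\<sigma>\<close>-colimits\<close>

definition sigma_cone ::
    "('a, 'f, 'c) twocat \<Rightarrow> 'f set \<Rightarrow> ('a, 'f, 'c, 'o, 'm) cat_valued \<Rightarrow> ('p, 'n) cat
      \<Rightarrow> ('a, 'f, 'o, 'm, 'p, 'n) transf \<Rightarrow> bool" where
  "sigma_cone A \<Sigma> G E \<theta> \<longleftrightarrow>
     T0 \<theta> \<in> (\<Pi>\<^sub>E a\<in>Obj (Under A). Obj (Fun (Map0 G a) E)) \<and>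
     T1 \<theta> \<in> (\<Pi>\<^sub>E f\<in>Arr (Under A).
        hom (Fun (Map0 G (Dom (Under A) f)) E)
          (T0 \<theta> (Cod (Under A) f) \<cdot>F Map1 G f) (T0 \<theta> (Dom (Under A) f))) \<and>
     (\<forall>a \<in> Obj (Under A). T1 \<theta> (Ident (Under A) a) = idn (T0 \<theta> a)) \<and>
     (\<forall>f \<in> Arr (Under A). \<forall>g \<in> Arr (Under A). Cod (Under A) f = Dom (Under A) g \<longrightarrow>
        T1 \<theta> (g \<cdot>\<^bsub>Under A\<^esub> f) = T1 \<theta> f \<cdot>N (T1 \<theta> g \<cdot>R Map1 G f)) \<and>
     (\<forall>\<gamma> \<in> Arr (Cells A).
        T1 \<theta> (Dom (Cells A) \<gamma>)
          = T1 \<theta> (Cod (Cells A) \<gamma>) \<cdot>N (T0 \<theta> (cell_tgt A \<gamma>) \<cdot>L Map2 G \<gamma>)) \<and>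
     (\<forall>f \<in> \<Sigma>. is_iso (Fun (Map0 G (Dom (Under A) f)) E) (T1 \<theta> f))"

definition Cones ::
    "('a, 'f, 'c) twocat \<Rightarrow> 'f set \<Rightarrow> ('a, 'f, 'c, 'o, 'm) cat_valued \<Rightarrow> ('p, 'n) cat
      \<Rightarrow> (('a, 'f, 'o, 'm, 'p, 'n) transf, ('a, 'f, 'o, 'm, 'p, 'n) modif) cat" where
  "Cones A \<Sigma> G E =
     modif_cat (Obj (Under A)) {\<theta>. sigma_cone A \<Sigma> G E \<theta>}
       (\<lambda>\<theta> \<theta>' \<phi>. \<forall>f \<in> Arr (Under A).
          T1 \<theta>' f \<cdot>N (\<phi> (Cod (Under A) f) \<cdot>R Map1 G f) = \<phi> (Dom (Under A) f) \<cdot>N T1 \<theta> f)"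

definition cone_functor ::
    "('a, 'f, 'c) twocat \<Rightarrow> 'f set \<Rightarrow> ('a, 'f, 'c, 'o, 'm) cat_valued \<Rightarrow> ('l, 'h) cat
      \<Rightarrow> ('a, 'f, 'o, 'm, 'l, 'h) transf \<Rightarrow> ('p, 'n) cat
      \<Rightarrow> (('l, 'h, 'p, 'n) cfunctor, ('l, 'h, 'p, 'n) ntrans,
          ('a, 'f, 'o, 'm, 'p, 'n) transf, ('a, 'f, 'o, 'm, 'p, 'n) modif) cfunctor" where
  "cone_functor A \<Sigma> G L lam E =
    \<lparr>FSrc = Fun L E, FTgt = Cones A \<Sigma> G E,
     FObj = (\<lambda>H\<in>Obj (Fun L E). post_transf A (\<lambda>_. H) lam),
     FArr = (\<lambda>\<alpha>\<in>Arr (Fun L E). post_cell A (\<lambda>_. NSrc \<alpha>) (\<lambda>_. NTgt \<alpha>) (\<lambda>_. \<alpha>) lam)\<rparr>"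

definition universal_sigma_cone ::
    "'u itself \<Rightarrow> ('a, 'f, 'c) twocat \<Rightarrow> 'f set \<Rightarrow> ('a, 'f, 'c, 'o, 'm) cat_valued \<Rightarrow> ('l, 'h) cat
      \<Rightarrow> ('a, 'f, 'o, 'm, 'l, 'h) transf \<Rightarrow> bool" where
  "universal_sigma_cone TYPE('u) A \<Sigma> G L lam \<longleftrightarrow>
     category L \<and> sigma_cone A \<Sigma> G L lam \<and>
     (\<forall>E :: ('u, 'u) cat. category E \<longrightarrow>
        is_cat_isomorphism (Fun L E) (Cones A \<Sigma> G E) (cone_functor A \<Sigma> G L lam E))"

text \<open>HOL cannot quantify over the types of the test categories \<open>E\<close> inside a formula, so they are
  taken in the infinite sum type below. This is no restriction: a functor \<open>L \<rightarrow> E\<close>, a \<open>\<sigma>\<close>-cone with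
  vertex \<open>E\<close>, or an arrow between two such, into a category \<open>E\<close> on arbitrary types, takes its values
  (together with the inverses of the components \<open>\<theta>\<^sub>f\<close>, \<open>f \<in> \<Sigma>\<close>) in a subcategory of \<open>E\<close> generated by at
  most as many objects and arrows as this type has elements. That subcategory is isomorphic to a
  category on this type, so universality for the latter categories yields universality for all of
  them.\<close>

definition is_sigma_colimit ::
    "('a, 'f, 'c) twocat \<Rightarrow> 'f set \<Rightarrow> ('a, 'f, 'c, 'o, 'm) cat_valued \<Rightarrow> ('l, 'h) cat
      \<Rightarrow> ('a, 'f, 'o, 'm, 'l, 'h) transf \<Rightarrow> bool" where
  "is_sigma_colimit A \<Sigma> G L (lam :: ('a, 'f, 'o, 'm, 'l, 'h) transf) \<longleftrightarrow>
     universal_sigma_cone TYPE(nat + 'a + 'f + 'o + 'm + 'l + 'h) A \<Sigma> G L lam"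

definition induced_functor ::
    "('a, 'f, 'c) twocat \<Rightarrow> 'f set \<Rightarrow> ('a, 'f, 'c, 'o, 'm) cat_valued \<Rightarrow> ('l, 'h) cat
      \<Rightarrow> ('a, 'f, 'o, 'm, 'l, 'h) transf \<Rightarrow> ('p, 'n) cat \<Rightarrow> ('a, 'f, 'o, 'm, 'p, 'n) transf
      \<Rightarrow> ('l, 'h, 'p, 'n) cfunctor" where
  "induced_functor A \<Sigma> G L lam E \<theta> =
     (THE H. H \<in> Obj (Fun L E) \<and> FObj (cone_functor A \<Sigma> G L lam E) H = \<theta>)"

definition induced_ntrans ::
    "('a, 'f, 'c) twocat \<Rightarrow> 'f set \<Rightarrow> ('a, 'f, 'c, 'o, 'm) cat_valued \<Rightarrow> ('l, 'h) cat
      \<Rightarrow> ('a, 'f, 'o, 'm, 'l, 'h) transf \<Rightarrow> ('p, 'n) cat \<Rightarrow> ('a, 'f, 'o, 'm, 'p, 'n) modif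
      \<Rightarrow> ('l, 'h, 'p, 'n) ntrans" where
  "induced_ntrans A \<Sigma> G L lam E \<phi> =
     (THE \<alpha>. \<alpha> \<in> Arr (Fun L E) \<and> FArr (cone_functor A \<Sigma> G L lam E) \<alpha> = \<phi>)"

text \<open>The 2-functor \<open>i \<mapsto> \<sigma>-colim\<^sub>a F(a, i)\<close>, for given \<open>\<sigma>\<close>-colimits \<open>L i\<close> with universal \<open>\<sigma>\<close>-cones
  \<open>lam i\<close>: its value at \<open>u : i \<rightarrow> j\<close> is induced by the \<open>\<sigma>\<close>-cone
  \<open>\<lambda>\<^sub>a\<^sub>,\<^sub>j F(a, u) : F(a, i) \<rightarrow> L j\<close>, and its value at a 2-cell \<open>\<mu>\<close> by the morphism of
  \<open>\<sigma>\<close>-cones \<open>\<lambda>\<^sub>a\<^sub>,\<^sub>j F(a, \<mu>)\<close>.\<close>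

definition colim_functor ::
    "('a, 'f, 'c) twocat \<Rightarrow> 'f set \<Rightarrow> ('i, 'j, 'k) twocat
      \<Rightarrow> ('a \<times> 'i, 'f \<times> 'j, 'c \<times> 'k, 'o, 'm) cat_valued
      \<Rightarrow> ('i \<Rightarrow> ('l, 'h) cat) \<Rightarrow> ('i \<Rightarrow> ('a, 'f, 'o, 'm, 'l, 'h) transf)
      \<Rightarrow> ('i, 'j, 'k, 'l, 'h) cat_valued" where
  "colim_functor A \<Sigma> I F L lam =
    (let cone = (\<lambda>u. pre_transf A (lam (Cod (Under I) u)) (\<lambda>a. Map1 (fix_left A F a) u)) in
     \<lparr>Map0 = L,
      Map1 = (\<lambda>u. let i = Dom (Under I) u; j = Cod (Under I) u in
        induced_functor A \<Sigma> (fix_right I F i) (L i) (lam i) (L j) (cone u)),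
      Map2 = (\<lambda>\<mu>. let i = cell_src I \<mu>; j = cell_tgt I \<mu> in
        induced_ntrans A \<Sigma> (fix_right I F i) (L i) (lam i) (L j)
          \<lparr>MSrc = cone (Dom (Cells I) \<mu>), MTgt = cone (Cod (Cells I) \<mu>),
           MCmp = (\<lambda>a\<in>Obj (Under A). T0 (lam j) a \<cdot>L Map2 (fix_left A F a) \<mu>)\<rparr>)\<rparr>)"


section \<open>Weighted bilimits in \<open>Cat\<close>\<close>

text \<open>The structure cells \<open>\<theta>\<^sub>u\<close> of a pseudonatural transformation \<open>\<theta> : W \<Rightarrow> G\<close> are oriented like those
  of \<open>\<sigma>\<close>-cones, \<open>\<theta>\<^sub>u : \<theta>\<^sub>j W(u) \<Rightarrow> G(u) \<theta>\<^sub>i\<close> for \<open>u : i \<rightarrow> j\<close>.\<close>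

definition pseudonatural ::
    "('i, 'j, 'k) twocat \<Rightarrow> ('i, 'j, 'k, 'v, 'w) cat_valued \<Rightarrow> ('i, 'j, 'k, 'o, 'm) cat_valued
      \<Rightarrow> ('i, 'j, 'v, 'w, 'o, 'm) transf \<Rightarrow> bool" where
  "pseudonatural I W G \<theta> \<longleftrightarrow>
     T0 \<theta> \<in> (\<Pi>\<^sub>E i\<in>Obj (Under I). Obj (Fun (Map0 W i) (Map0 G i))) \<and>
     T1 \<theta> \<in> (\<Pi>\<^sub>E u\<in>Arr (Under I).
        hom (Fun (Map0 W (Dom (Under I) u)) (Map0 G (Cod (Under I) u)))
          (T0 \<theta> (Cod (Under I) u) \<cdot>F Map1 W u) (Map1 G u \<cdot>F T0 \<theta> (Dom (Under I) u))) \<and>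
     (\<forall>u \<in> Arr (Under I).
        is_iso (Fun (Map0 W (Dom (Under I) u)) (Map0 G (Cod (Under I) u))) (T1 \<theta> u)) \<and>
     (\<forall>i \<in> Obj (Under I). T1 \<theta> (Ident (Under I) i) = idn (T0 \<theta> i)) \<and>
     (\<forall>u \<in> Arr (Under I). \<forall>v \<in> Arr (Under I). Cod (Under I) u = Dom (Under I) v \<longrightarrow>
        T1 \<theta> (v \<cdot>\<^bsub>Under I\<^esub> u) = (Map1 G v \<cdot>L T1 \<theta> u) \<cdot>N (T1 \<theta> v \<cdot>R Map1 W u)) \<and>
     (\<forall>\<mu> \<in> Arr (Cells I).
        (Map2 G \<mu> \<cdot>R T0 \<theta> (cell_src I \<mu>)) \<cdot>N T1 \<theta> (Dom (Cells I) \<mu>)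
          = T1 \<theta> (Cod (Cells I) \<mu>) \<cdot>N (T0 \<theta> (cell_tgt I \<mu>) \<cdot>L Map2 W \<mu>))"

definition bilim ::
    "('i, 'j, 'k) twocat \<Rightarrow> ('i, 'j, 'k, 'v, 'w) cat_valued \<Rightarrow> ('i, 'j, 'k, 'o, 'm) cat_valued
      \<Rightarrow> (('i, 'j, 'v, 'w, 'o, 'm) transf, ('i, 'j, 'v, 'w, 'o, 'm) modif) cat" where
  "bilim I W G =
     modif_cat (Obj (Under I)) {\<theta>. pseudonatural I W G \<theta>}
       (\<lambda>\<theta> \<theta>' \<rho>. \<forall>u \<in> Arr (Under I).
          T1 \<theta>' u \<cdot>N (\<rho> (Cod (Under I) u) \<cdot>R Map1 W u)
            = (Map1 G u \<cdot>L \<rho> (Dom (Under I) u)) \<cdot>N T1 \<theta> u)"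

text \<open>The action of \<open>bilim I W -\<close> on a 2-natural transformation \<open>t : G \<Rightarrow> G'\<close> and on a modification
  \<open>m : s \<rightarrow> t\<close> between two such.\<close>

definition bilim_map ::
    "('i, 'j, 'k) twocat \<Rightarrow> ('i, 'j, 'k, 'v, 'w) cat_valued \<Rightarrow> ('i, 'j, 'k, 'o, 'm) cat_valued
      \<Rightarrow> ('i, 'j, 'k, 'p, 'n) cat_valued \<Rightarrow> ('i \<Rightarrow> ('o, 'm, 'p, 'n) cfunctor)
      \<Rightarrow> (('i, 'j, 'v, 'w, 'o, 'm) transf, ('i, 'j, 'v, 'w, 'o, 'm) modif,
          ('i, 'j, 'v, 'w, 'p, 'n) transf, ('i, 'j, 'v, 'w, 'p, 'n) modif) cfunctor" where
  "bilim_map I W G G' t =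
    \<lparr>FSrc = bilim I W G, FTgt = bilim I W G',
     FObj = (\<lambda>\<theta>\<in>Obj (bilim I W G). post_transf I t \<theta>),
     FArr = (\<lambda>\<rho>\<in>Arr (bilim I W G). post_modif I t \<rho>)\<rparr>"

definition bilim_cell ::
    "('i, 'j, 'k) twocat \<Rightarrow> ('i, 'j, 'k, 'v, 'w) cat_valued \<Rightarrow> ('i, 'j, 'k, 'o, 'm) cat_valued
      \<Rightarrow> ('i, 'j, 'k, 'p, 'n) cat_valued \<Rightarrow> ('i \<Rightarrow> ('o, 'm, 'p, 'n) cfunctor)
      \<Rightarrow> ('i \<Rightarrow> ('o, 'm, 'p, 'n) cfunctor) \<Rightarrow> ('i \<Rightarrow> ('o, 'm, 'p, 'n) ntrans)
      \<Rightarrow> (('i, 'j, 'v, 'w, 'o, 'm) transf, ('i, 'j, 'v, 'w, 'o, 'm) modif,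
          ('i, 'j, 'v, 'w, 'p, 'n) transf, ('i, 'j, 'v, 'w, 'p, 'n) modif) ntrans" where
  "bilim_cell I W G G' s t m =
    \<lparr>NSrc = bilim_map I W G G' s, NTgt = bilim_map I W G G' t,
     NCmp = (\<lambda>\<theta>\<in>Obj (bilim I W G). post_cell I s t m \<theta>)\<rparr>"

text \<open>The 2-functor \<open>a \<mapsto> bilim I W F(a, -)\<close>.\<close>

definition bilim_functor ::
    "('a, 'f, 'c) twocat \<Rightarrow> ('i, 'j, 'k) twocat \<Rightarrow> ('i, 'j, 'k, 'v, 'w) cat_valued
      \<Rightarrow> ('a \<times> 'i, 'f \<times> 'j, 'c \<times> 'k, 'o, 'm) cat_valued
      \<Rightarrow> ('a, 'f, 'c, ('i, 'j, 'v, 'w, 'o, 'm) transf, ('i, 'j, 'v, 'w, 'o, 'm) modif) cat_valued" where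
  "bilim_functor A I W F =
    \<lparr>Map0 = (\<lambda>a. bilim I W (fix_left A F a)),
     Map1 = (\<lambda>f. bilim_map I W
        (fix_left A F (Dom (Under A) f)) (fix_left A F (Cod (Under A) f))
        (\<lambda>i. Map1 (fix_right I F i) f)),
     Map2 = (\<lambda>\<alpha>. bilim_cell I W
        (fix_left A F (cell_src A \<alpha>)) (fix_left A F (cell_tgt A \<alpha>))
        (\<lambda>i. Map1 (fix_right I F i) (Dom (Cells A) \<alpha>))
        (\<lambda>i. Map1 (fix_right I F i) (Cod (Cells A) \<alpha>))
        (\<lambda>i. Map2 (fix_right I F i) \<alpha>))\<rparr>"


section \<open>The comparison functor\<close>

definition comparison_cone ::
    "('a, 'f, 'c) twocat \<Rightarrow> 'f set \<Rightarrow> ('i, 'j, 'k) twocat \<Rightarrow> ('i, 'j, 'k, 'v, 'w) cat_valued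
      \<Rightarrow> ('a \<times> 'i, 'f \<times> 'j, 'c \<times> 'k, 'o, 'm) cat_valued
      \<Rightarrow> ('i \<Rightarrow> ('l, 'h) cat) \<Rightarrow> ('i \<Rightarrow> ('a, 'f, 'o, 'm, 'l, 'h) transf)
      \<Rightarrow> ('a, 'f, ('i, 'j, 'v, 'w, 'o, 'm) transf, ('i, 'j, 'v, 'w, 'o, 'm) modif,
          ('i, 'j, 'v, 'w, 'l, 'h) transf, ('i, 'j, 'v, 'w, 'l, 'h) modif) transf" where
  "comparison_cone A \<Sigma> I W F L lam =
    \<lparr>T0 = (\<lambda>a\<in>Obj (Under A).
        bilim_map I W (fix_left A F a) (colim_functor A \<Sigma> I F L lam) (\<lambda>i. T0 (lam i) a)),
     T1 = (\<lambda>f\<in>Arr (Under A).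
        bilim_cell I W (fix_left A F (Dom (Under A) f)) (colim_functor A \<Sigma> I F L lam)
          (\<lambda>i. T0 (lam i) (Cod (Under A) f) \<cdot>F Map1 (fix_right I F i) f)
          (\<lambda>i. T0 (lam i) (Dom (Under A) f))
          (\<lambda>i. T1 (lam i) f))\<rparr>"

definition comparison_functor ::
    "('a, 'f, 'c) twocat \<Rightarrow> 'f set \<Rightarrow> ('i, 'j, 'k) twocat \<Rightarrow> ('i, 'j, 'k, 'v, 'w) cat_valued
      \<Rightarrow> ('a \<times> 'i, 'f \<times> 'j, 'c \<times> 'k, 'o, 'm) cat_valued
      \<Rightarrow> ('i \<Rightarrow> ('l, 'h) cat) \<Rightarrow> ('i \<Rightarrow> ('a, 'f, 'o, 'm, 'l, 'h) transf)
      \<Rightarrow> ('p, 'q) cat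
      \<Rightarrow> ('a, 'f, ('i, 'j, 'v, 'w, 'o, 'm) transf, ('i, 'j, 'v, 'w, 'o, 'm) modif, 'p, 'q) transf
      \<Rightarrow> ('p, 'q, ('i, 'j, 'v, 'w, 'l, 'h) transf, ('i, 'j, 'v, 'w, 'l, 'h) modif) cfunctor" where
  "comparison_functor A \<Sigma> I W F L lam P \<kappa> =
     induced_functor A \<Sigma> (bilim_functor A I W F) P \<kappa>
       (bilim I W (colim_functor A \<Sigma> I F L lam)) (comparison_cone A \<Sigma> I W F L lam)"

end

theory Submission imports Defs begin

text \<open>Every object of a \<open>\<sigma>\<close>-colimit \<open>L\<close> of \<open>G\<close> is the image of an object of some \<open>G(a)\<close>, every arrow is a
  fraction \<open>\<lambda>\<^sub>v \<lambda>(f) \<lambda>\<^sub>u\<^sup>-\<^sup>1\<close> with \<open>u, v \<in> \<Sigma>\<close>, and two parallel arrows of \<open>G(a)\<close> have the same image only if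
  they are equalized by some \<open>u \<in> \<Sigma>\<close>. All three facts come from the universal property alone: the first
  two from the \<open>\<sigma>\<close>-cone with values in the category of fractions, through which the universal cone
  factors; the last from a \<open>\<sigma>\<close>-cone of germs of arrows out of a fixed object, which separates arrows
  that no \<open>u \<in> \<Sigma>\<close> equalizes. Since \<open>(A, \<Sigma>)\<close> is \<open>\<sigma>\<close>-filtered, finitely many objects, arrows and equations
  in the categories \<open>L(i)\<close> can be lifted to one and the same \<open>a\<close>. A pseudonatural transformation \<open>W \<Rightarrow> L\<close>
  or a modification consists of finitely many such data because \<open>I\<close> and \<open>W\<close> are finite, so lifting
  them proves that the comparison functor is essentially surjective, full and faithful.\<close>

section \<open>Categories, functors and natural transformations\<close>

text \<open>The vertex of a colimit is known only through its universal property, and that property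
  is tested on categories over one fixed type, so every auxiliary category has to be small in this
  sense. Over a cone with vertex \<open>E\<close>, fractions are therefore not formed as a quotient:
  they are arrows of \<open>E\<close> that admit a presentation. A presentation determines the
  arrow, which bounds their number independently of \<open>E\<close>. This says nothing about when
  two presentations give the same arrow, so equality needs a second cone, built from the diagram
  alone. The difficulty there is that F1 yields only a directed 2-cell for an arrow outside
  \<open>\<Sigma>\<close>, and that F2 equates only 2-cells with target in \<open>\<Sigma>\<close>.
  In the lifting argument, objects of the \<open>L i\<close> can be moved to a common index only up
  to isomorphism, while a pseudonatural transformation is strict data. Transporting it along these
  isomorphisms restores equality on objects, and then only arrows and equations remain.
  Invertibility of a structure cell becomes two equations once its inverse is lifted as
  well.\<close>

lemma in_hom_iff [simp]: "f \<in> hom C x y \<longleftrightarrow> f \<in> Arr C \<and> Dom C f = x \<and> Cod C f = y"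
  by (simp add: hom_def)

lemma cat_dom [simp]: "category C \<Longrightarrow> f \<in> Arr C \<Longrightarrow> Dom C f \<in> Obj C"
  and cat_cod [simp]: "category C \<Longrightarrow> f \<in> Arr C \<Longrightarrow> Cod C f \<in> Obj C"
  by (auto simp: category_def)

lemma cat_ident [simp]:
  assumes "category C" "x \<in> Obj C"
  shows "Ident C x \<in> Arr C" "Dom C (Ident C x) = x" "Cod C (Ident C x) = x"
  using category.ident_hom[OF assms] by auto

lemma cat_comp [simp]:
  assumes "category C" "f \<in> Arr C" "g \<in> Arr C" "Cod C f = Dom C g"
  shows "g \<cdot>\<^bsub>C\<^esub> f \<in> Arr C" "Dom C (g \<cdot>\<^bsub>C\<^esub> f) = Dom C f" "Cod C (g \<cdot>\<^bsub>C\<^esub> f) = Cod C g"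
  using category.comp_hom[OF assms(1), of f "Dom C f" "Cod C f" g "Cod C g"] assms by auto

lemma cat_comp_ident [simp]: "category C \<Longrightarrow> f \<in> Arr C \<Longrightarrow> Dom C f = x \<Longrightarrow> f \<cdot>\<^bsub>C\<^esub> Ident C x = f"
  using category.comp_ident[of C f x "Cod C f"] by auto

lemma cat_ident_comp [simp]: "category C \<Longrightarrow> f \<in> Arr C \<Longrightarrow> Cod C f = x \<Longrightarrow> Ident C x \<cdot>\<^bsub>C\<^esub> f = f"
  using category.ident_comp[of C f "Dom C f" x] by auto

lemma cat_assoc:
  assumes "category C" "f \<in> Arr C" "g \<in> Arr C" "h \<in> Arr C" "Cod C f = Dom C g" "Cod C g = Dom C h"
  shows "(h \<cdot>\<^bsub>C\<^esub> g) \<cdot>\<^bsub>C\<^esub> f = h \<cdot>\<^bsub>C\<^esub> (g \<cdot>\<^bsub>C\<^esub> f)"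
  using category.comp_assoc[OF assms(1), of f "Dom C f" "Cod C f" g "Cod C g" h "Cod C h"] assms by auto

lemma categoryI:
  assumes "\<And>f. f \<in> Arr C \<Longrightarrow> Dom C f \<in> Obj C" "\<And>f. f \<in> Arr C \<Longrightarrow> Cod C f \<in> Obj C"
    and "\<And>x. x \<in> Obj C \<Longrightarrow> Ident C x \<in> Arr C \<and> Dom C (Ident C x) = x \<and> Cod C (Ident C x) = x"
    and "\<And>f g. \<lbrakk>f \<in> Arr C; g \<in> Arr C; Cod C f = Dom C g\<rbrakk>
           \<Longrightarrow> g \<cdot>\<^bsub>C\<^esub> f \<in> Arr C \<and> Dom C (g \<cdot>\<^bsub>C\<^esub> f) = Dom C f \<and> Cod C (g \<cdot>\<^bsub>C\<^esub> f) = Cod C g"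
    and "\<And>f. f \<in> Arr C \<Longrightarrow> f \<cdot>\<^bsub>C\<^esub> Ident C (Dom C f) = f"
    and "\<And>f. f \<in> Arr C \<Longrightarrow> Ident C (Cod C f) \<cdot>\<^bsub>C\<^esub> f = f"
    and "\<And>f g h. \<lbrakk>f \<in> Arr C; g \<in> Arr C; h \<in> Arr C; Cod C f = Dom C g; Cod C g = Dom C h\<rbrakk>
           \<Longrightarrow> h \<cdot>\<^bsub>C\<^esub> (g \<cdot>\<^bsub>C\<^esub> f) = (h \<cdot>\<^bsub>C\<^esub> g) \<cdot>\<^bsub>C\<^esub> f"
  shows "category C"
  using assms by unfold_locales auto

section \<open>Isomorphisms and chosen inverses\<close>

definition cinv :: "('o, 'm) cat \<Rightarrow> 'm \<Rightarrow> 'm" where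
  "cinv C f = (SOME g. g \<in> hom C (Cod C f) (Dom C f) \<and>
     g \<cdot>\<^bsub>C\<^esub> f = Ident C (Dom C f) \<and> f \<cdot>\<^bsub>C\<^esub> g = Ident C (Cod C f))"

lemma cinv_props:
  assumes "is_iso C f"
  shows "cinv C f \<in> Arr C" "Dom C (cinv C f) = Cod C f" "Cod C (cinv C f) = Dom C f"
    "cinv C f \<cdot>\<^bsub>C\<^esub> f = Ident C (Dom C f)" "f \<cdot>\<^bsub>C\<^esub> cinv C f = Ident C (Cod C f)" "f \<in> Arr C"
proof -
  have "\<exists>g. g \<in> hom C (Cod C f) (Dom C f) \<and>
     g \<cdot>\<^bsub>C\<^esub> f = Ident C (Dom C f) \<and> f \<cdot>\<^bsub>C\<^esub> g = Ident C (Cod C f)"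
    using assms unfolding is_iso_def by blast
  from someI_ex[OF this] assms
  show "cinv C f \<in> Arr C" "Dom C (cinv C f) = Cod C f" "Cod C (cinv C f) = Dom C f"
    "cinv C f \<cdot>\<^bsub>C\<^esub> f = Ident C (Dom C f)" "f \<cdot>\<^bsub>C\<^esub> cinv C f = Ident C (Cod C f)" "f \<in> Arr C"
    by (auto simp: cinv_def is_iso_def)
qed

declare cinv_props(1-5) [simp]

lemma is_isoI:
  assumes "f \<in> Arr C" "g \<in> Arr C" "Dom C g = Cod C f" "Cod C g = Dom C f"
    "g \<cdot>\<^bsub>C\<^esub> f = Ident C (Dom C f)" "f \<cdot>\<^bsub>C\<^esub> g = Ident C (Cod C f)"
  shows "is_iso C f"
  unfolding is_iso_def using assms by (auto intro!: bexI[of _ g])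

lemma is_iso_ident [simp]: "category C \<Longrightarrow> x \<in> Obj C \<Longrightarrow> is_iso C (Ident C x)"
  by (rule is_isoI[of _ _ "Ident C x"]) auto

lemma is_iso_cinv [simp]: "is_iso C f \<Longrightarrow> is_iso C (cinv C f)"
  by (rule is_isoI[of _ _ f]) (auto simp: cinv_props)

lemma cinv_cancel:
  assumes "category C" "is_iso C f" "g \<in> Arr C" "Cod C g = Dom C f"
  shows "cinv C f \<cdot>\<^bsub>C\<^esub> (f \<cdot>\<^bsub>C\<^esub> g) = g"
  using cat_assoc[of C g f "cinv C f"] assms by (simp add: cinv_props)

lemma cinv_cancel':
  assumes "category C" "is_iso C f" "g \<in> Arr C" "Cod C g = Cod C f"
  shows "f \<cdot>\<^bsub>C\<^esub> (cinv C f \<cdot>\<^bsub>C\<^esub> g) = g"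
  using cat_assoc[of C g "cinv C f" f] assms by (simp add: cinv_props)

lemma is_iso_comp [simp]:
  assumes "category C" "is_iso C f" "is_iso C g" "Cod C f = Dom C g"
  shows "is_iso C (g \<cdot>\<^bsub>C\<^esub> f)"
  by (rule is_isoI[of _ _ "cinv C f \<cdot>\<^bsub>C\<^esub> cinv C g"])
    (use assms in \<open>simp_all add: cinv_props cat_assoc cinv_cancel cinv_cancel'\<close>)

lemma iso_epi:
  assumes "category C" "is_iso C e" "a \<in> Arr C" "b \<in> Arr C" "Dom C a = Cod C e" "Dom C b = Cod C e"
    "a \<cdot>\<^bsub>C\<^esub> e = b \<cdot>\<^bsub>C\<^esub> e"
  shows "a = b"
  by (metis assms cat_assoc cat_comp_ident cinv_props)

lemma iso_mono:
  assumes "category C" "is_iso C e" "a \<in> Arr C" "b \<in> Arr C" "Cod C a = Dom C e" "Cod C b = Dom C e"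
    "e \<cdot>\<^bsub>C\<^esub> a = e \<cdot>\<^bsub>C\<^esub> b"
  shows "a = b"
  by (metis assms cinv_cancel)

subsection \<open>Functors\<close>

lemma in_Fun [simp]: "F \<in> Obj (Fun C D) \<longleftrightarrow> is_functor F \<and> FSrc F = C \<and> FTgt F = D"
  and in_Fun_arr [simp]:
    "\<alpha> \<in> Arr (Fun C D) \<longleftrightarrow> is_ntrans \<alpha> \<and> FSrc (NSrc \<alpha>) = C \<and> FTgt (NSrc \<alpha>) = D"
  and Fun_sel [simp]: "Dom (Fun C D) = NSrc" "Cod (Fun C D) = NTgt"
    "Ident (Fun C D) = idn" "Comp (Fun C D) = vcomp"
  by (auto simp: Fun_def)

lemma functor_props:
  assumes "is_functor F" "FSrc F = C" "FTgt F = D"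
  shows "category C" "category D" "FObj F \<in> extensional (Obj C)" "FArr F \<in> extensional (Arr C)"
  using assms by (auto simp: is_functor_def PiE_def)

lemma functor_cat [simp]: "is_functor F \<Longrightarrow> category (FSrc F)" "is_functor F \<Longrightarrow> category (FTgt F)"
  by (auto dest: functor_props)

lemma functor_obj [simp]: "is_functor F \<Longrightarrow> FTgt F = D \<Longrightarrow> x \<in> Obj (FSrc F) \<Longrightarrow> FObj F x \<in> Obj D"
  by (auto simp: is_functor_def)

lemma functor_arr [simp]:
  assumes "is_functor F" "FTgt F = D" "m \<in> Arr (FSrc F)"
  shows "FArr F m \<in> Arr D" "Dom D (FArr F m) = FObj F (Dom (FSrc F) m)"
    "Cod D (FArr F m) = FObj F (Cod (FSrc F) m)"
  using assms(1,3) unfolding assms(2)[symmetric] is_functor_def by simp_all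

lemma functor_ident [simp]:
  assumes "is_functor F" "FSrc F = C" "x \<in> Obj C"
  shows "FArr F (Ident C x) = Ident (FTgt F) (FObj F x)"
  using assms(1,3) unfolding assms(2)[symmetric] is_functor_def by blast

lemma functor_comp [simp]:
  assumes "is_functor F" "FSrc F = C" "m \<in> Arr C" "n \<in> Arr C" "Cod C m = Dom C n"
  shows "FArr F (n \<cdot>\<^bsub>C\<^esub> m) = FArr F n \<cdot>\<^bsub>FTgt F\<^esub> FArr F m"
  using assms(1,3-) unfolding assms(2)[symmetric] is_functor_def by blast

lemma is_functorI:
  assumes "category (FSrc F)" "category (FTgt F)"
    "FObj F \<in> extensional (Obj (FSrc F))" "FArr F \<in> extensional (Arr (FSrc F))"
    "\<And>x. x \<in> Obj (FSrc F) \<Longrightarrow> FObj F x \<in> Obj (FTgt F)"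
    "\<And>m. m \<in> Arr (FSrc F) \<Longrightarrow> FArr F m \<in> Arr (FTgt F) \<and>
       Dom (FTgt F) (FArr F m) = FObj F (Dom (FSrc F) m) \<and> Cod (FTgt F) (FArr F m) = FObj F (Cod (FSrc F) m)"
    "\<And>x. x \<in> Obj (FSrc F) \<Longrightarrow> FArr F (Ident (FSrc F) x) = Ident (FTgt F) (FObj F x)"
    "\<And>m n. m \<in> Arr (FSrc F) \<Longrightarrow> n \<in> Arr (FSrc F) \<Longrightarrow> Cod (FSrc F) m = Dom (FSrc F) n \<Longrightarrow>
       FArr F (n \<cdot>\<^bsub>FSrc F\<^esub> m) = FArr F n \<cdot>\<^bsub>FTgt F\<^esub> FArr F m"
  shows "is_functor F"
  unfolding is_functor_def PiE_def in_hom_iff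
  by (intro conjI ballI impI IntI Pi_I) (simp_all add: assms)

lemma functor_eqI:
  assumes "is_functor F" "is_functor G" "FSrc F = FSrc G" "FTgt F = FTgt G"
    "\<And>x. x \<in> Obj (FSrc G) \<Longrightarrow> FObj F x = FObj G x" "\<And>m. m \<in> Arr (FSrc G) \<Longrightarrow> FArr F m = FArr G m"
  shows "F = G"
  using assms by (auto intro!: cfunctor.equality extensionalityI[of _ "Obj (FSrc G)"]
      extensionalityI[of _ "Arr (FSrc G)"] dest: functor_props(3,4)[OF _ refl refl])

definition mkF :: "('o, 'm) cat \<Rightarrow> ('p, 'n) cat \<Rightarrow> ('o \<Rightarrow> 'p) \<Rightarrow> ('m \<Rightarrow> 'n) \<Rightarrow> ('o, 'm, 'p, 'n) cfunctor" where
  "mkF C D fo fa = \<lparr>FSrc = C, FTgt = D, FObj = restrict fo (Obj C), FArr = restrict fa (Arr C)\<rparr>"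

lemma mkF_sel [simp]: "FSrc (mkF C D fo fa) = C" "FTgt (mkF C D fo fa) = D"
    "x \<in> Obj C \<Longrightarrow> FObj (mkF C D fo fa) x = fo x" "m \<in> Arr C \<Longrightarrow> FArr (mkF C D fo fa) m = fa m"
  by (auto simp: mkF_def)

lemma is_functor_mkF:
  assumes "category C" "category D" "\<And>x. x \<in> Obj C \<Longrightarrow> fo x \<in> Obj D"
    "\<And>m. m \<in> Arr C \<Longrightarrow> fa m \<in> Arr D \<and> Dom D (fa m) = fo (Dom C m) \<and> Cod D (fa m) = fo (Cod C m)"
    "\<And>x. x \<in> Obj C \<Longrightarrow> fa (Ident C x) = Ident D (fo x)"
    "\<And>m n. m \<in> Arr C \<Longrightarrow> n \<in> Arr C \<Longrightarrow> Cod C m = Dom C n \<Longrightarrow> fa (n \<cdot>\<^bsub>C\<^esub> m) = fa n \<cdot>\<^bsub>D\<^esub> fa m"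
  shows "is_functor (mkF C D fo fa)"
  by (rule is_functorI) (use assms in \<open>simp_all, simp_all add: mkF_def\<close>)

lemma idf_sel [simp]: "FSrc (idf C) = C" "FTgt (idf C) = C"
    "x \<in> Obj C \<Longrightarrow> FObj (idf C) x = x" "m \<in> Arr C \<Longrightarrow> FArr (idf C) m = m"
  by (auto simp: idf_def)

lemma is_functor_idf [simp]: "category C \<Longrightarrow> is_functor (idf C)"
  by (rule is_functorI) (simp_all, simp_all add: idf_def)

lemma fcomp_sel [simp]: "FSrc (G \<cdot>F F) = FSrc F" "FTgt (G \<cdot>F F) = FTgt G"
    "x \<in> Obj (FSrc F) \<Longrightarrow> FObj (G \<cdot>F F) x = FObj G (FObj F x)"
    "m \<in> Arr (FSrc F) \<Longrightarrow> FArr (G \<cdot>F F) m = FArr G (FArr F m)"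
  by (auto simp: fcomp_def)

lemma is_functor_fcomp [simp]:
  assumes "is_functor G" "is_functor F" "FTgt F = FSrc G"
  shows "is_functor (G \<cdot>F F)"
  by (rule is_functorI)
    (use assms functor_props[OF assms(1) refl refl] functor_props[OF assms(2) refl refl]
      in \<open>simp_all add: assms(3)\<close>, simp_all add: fcomp_def)

lemma functor_is_iso [simp]:
  assumes "is_functor F" "is_iso (FSrc F) m" "FTgt F = D"
  shows "is_iso D (FArr F m)"
proof (rule is_isoI[of _ _ "FArr F (cinv (FSrc F) m)"])
  note p = cinv_props[OF assms(2)] functor_props[OF assms(1) refl assms(3)]
  show "FArr F (cinv (FSrc F) m) \<cdot>\<^bsub>D\<^esub> FArr F m = Ident D (Dom D (FArr F m))"
    using assms p functor_comp[OF assms(1) refl, of m "cinv (FSrc F) m"] by simp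
  show "FArr F m \<cdot>\<^bsub>D\<^esub> FArr F (cinv (FSrc F) m) = Ident D (Cod D (FArr F m))"
    using assms p functor_comp[OF assms(1) refl, of "cinv (FSrc F) m" m] by simp
qed (use assms cinv_props[OF assms(2)] in simp_all)

subsection \<open>Natural transformations\<close>

lemma ntrans_props:
  assumes "is_ntrans \<alpha>"
  shows "is_functor (NSrc \<alpha>)" "is_functor (NTgt \<alpha>)"
    "NCmp \<alpha> \<in> extensional (Obj (FSrc (NSrc \<alpha>)))"
  using assms unfolding is_ntrans_def by blast+

lemma ntrans_tgt [simp]:
  assumes "is_ntrans \<alpha>"
  shows "FSrc (NTgt \<alpha>) = FSrc (NSrc \<alpha>)" "FTgt (NTgt \<alpha>) = FTgt (NSrc \<alpha>)"
    "is_functor (NSrc \<alpha>)" "is_functor (NTgt \<alpha>)"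
  using assms[unfolded is_ntrans_def] by metis+

lemma ntrans_cmp [simp]:
  assumes "is_ntrans \<alpha>" "x \<in> Obj (FSrc (NSrc \<alpha>))" "FTgt (NSrc \<alpha>) = D"
  shows "NCmp \<alpha> x \<in> Arr D" "Dom D (NCmp \<alpha> x) = FObj (NSrc \<alpha>) x" "Cod D (NCmp \<alpha> x) = FObj (NTgt \<alpha>) x"
  using assms(1)[unfolded is_ntrans_def in_hom_iff] assms(2) unfolding assms(3)[symmetric] by blast+

lemma ntrans_nat:
  assumes "is_ntrans \<alpha>" "m \<in> Arr (FSrc (NSrc \<alpha>))" "FTgt (NSrc \<alpha>) = D" "FSrc (NSrc \<alpha>) = C"
  shows "NCmp \<alpha> (Cod C m) \<cdot>\<^bsub>D\<^esub> FArr (NSrc \<alpha>) m = FArr (NTgt \<alpha>) m \<cdot>\<^bsub>D\<^esub> NCmp \<alpha> (Dom C m)"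
  using assms(1)[unfolded is_ntrans_def] assms(2) unfolding assms(3,4)[symmetric] by blast

lemma is_ntransI:
  assumes "is_functor (NSrc \<alpha>)" "is_functor (NTgt \<alpha>)" "FSrc (NTgt \<alpha>) = FSrc (NSrc \<alpha>)"
    "FTgt (NTgt \<alpha>) = FTgt (NSrc \<alpha>)" "NCmp \<alpha> \<in> extensional (Obj (FSrc (NSrc \<alpha>)))"
    "\<And>x. x \<in> Obj (FSrc (NSrc \<alpha>)) \<Longrightarrow> NCmp \<alpha> x \<in> Arr (FTgt (NSrc \<alpha>)) \<and>
       Dom (FTgt (NSrc \<alpha>)) (NCmp \<alpha> x) = FObj (NSrc \<alpha>) x \<and>
       Cod (FTgt (NSrc \<alpha>)) (NCmp \<alpha> x) = FObj (NTgt \<alpha>) x"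
    "\<And>m. m \<in> Arr (FSrc (NSrc \<alpha>)) \<Longrightarrow>
       NCmp \<alpha> (Cod (FSrc (NSrc \<alpha>)) m) \<cdot>\<^bsub>FTgt (NSrc \<alpha>)\<^esub> FArr (NSrc \<alpha>) m
         = FArr (NTgt \<alpha>) m \<cdot>\<^bsub>FTgt (NSrc \<alpha>)\<^esub> NCmp \<alpha> (Dom (FSrc (NSrc \<alpha>)) m)"
  shows "is_ntrans \<alpha>"
  unfolding is_ntrans_def in_hom_iff
  by (intro conjI ballI impI) (simp_all only: assms)

lemma ntrans_eqI:
  assumes "is_ntrans \<alpha>" "is_ntrans \<beta>" "NSrc \<alpha> = NSrc \<beta>" "NTgt \<alpha> = NTgt \<beta>"
    "\<And>x. x \<in> Obj (FSrc (NSrc \<beta>)) \<Longrightarrow> NCmp \<alpha> x = NCmp \<beta> x"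
  shows "\<alpha> = \<beta>"
  using assms by (auto intro!: ntrans.equality extensionalityI[of _ "Obj (FSrc (NSrc \<beta>))"]
      dest: ntrans_props(3))

definition mkN :: "('o, 'm, 'p, 'n) cfunctor \<Rightarrow> ('o, 'm, 'p, 'n) cfunctor \<Rightarrow> ('o \<Rightarrow> 'n) \<Rightarrow> ('o, 'm, 'p, 'n) ntrans" where
  "mkN F G c = \<lparr>NSrc = F, NTgt = G, NCmp = restrict c (Obj (FSrc F))\<rparr>"

lemma mkN_sel [simp]: "NSrc (mkN F G c) = F" "NTgt (mkN F G c) = G"
    "x \<in> Obj (FSrc F) \<Longrightarrow> NCmp (mkN F G c) x = c x"
  by (auto simp: mkN_def)

lemma is_ntrans_mkN:
  assumes "is_functor F" "is_functor G" "FSrc F = C" "FTgt F = D" "FSrc G = C" "FTgt G = D"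
    "\<And>x. x \<in> Obj C \<Longrightarrow> c x \<in> Arr D \<and> Dom D (c x) = FObj F x \<and> Cod D (c x) = FObj G x"
    "\<And>m. m \<in> Arr C \<Longrightarrow> c (Cod C m) \<cdot>\<^bsub>D\<^esub> FArr F m = FArr G m \<cdot>\<^bsub>D\<^esub> c (Dom C m)"
  shows "is_ntrans (mkN F G c)"
  by (rule is_ntransI) (use assms functor_props[OF assms(1,3,4)] in \<open>simp_all, simp_all add: mkN_def\<close>)

lemma idn_sel [simp]: "NSrc (idn F) = F" "NTgt (idn F) = F"
    "x \<in> Obj (FSrc F) \<Longrightarrow> NCmp (idn F) x = Ident (FTgt F) (FObj F x)"
  by (auto simp: idn_def)

lemma is_ntrans_idn [simp]: "is_functor F \<Longrightarrow> is_ntrans (idn F)"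
  by (rule is_ntransI) (use functor_props[of F, OF _ refl refl] in \<open>simp_all, simp_all add: idn_def\<close>)

lemma vcomp_sel [simp]: "NSrc (\<beta> \<cdot>N \<alpha>) = NSrc \<alpha>" "NTgt (\<beta> \<cdot>N \<alpha>) = NTgt \<beta>"
    "x \<in> Obj (FSrc (NSrc \<alpha>)) \<Longrightarrow> NCmp (\<beta> \<cdot>N \<alpha>) x = NCmp \<beta> x \<cdot>\<^bsub>FTgt (NSrc \<alpha>)\<^esub> NCmp \<alpha> x"
  by (auto simp: vcomp_def)

lemma is_ntrans_vcomp [simp]:
  assumes "is_ntrans \<beta>" "is_ntrans \<alpha>" "NTgt \<alpha> = NSrc \<beta>"
  shows "is_ntrans (\<beta> \<cdot>N \<alpha>)"
proof (rule is_ntransI)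
  let ?C = "FSrc (NSrc \<alpha>)" and ?D = "FTgt (NSrc \<alpha>)"
  have s [simp]: "FSrc (NSrc \<beta>) = ?C" "FTgt (NSrc \<beta>) = ?D"
    using assms(3) ntrans_tgt(1,2)[OF assms(2)] by auto
  have c [simp]: "category ?C" "category ?D" using functor_props[OF ntrans_props(1)[OF assms(2)] refl refl] by auto
  fix m assume m: "m \<in> Arr (FSrc (NSrc (\<beta> \<cdot>N \<alpha>)))"
  have n1: "NCmp \<alpha> (Cod ?C m) \<cdot>\<^bsub>?D\<^esub> FArr (NSrc \<alpha>) m = FArr (NSrc \<beta>) m \<cdot>\<^bsub>?D\<^esub> NCmp \<alpha> (Dom ?C m)"
    using ntrans_nat[of \<alpha> m ?D ?C] assms m by simp
  have n2: "NCmp \<beta> (Cod ?C m) \<cdot>\<^bsub>?D\<^esub> FArr (NSrc \<beta>) m = FArr (NTgt \<beta>) m \<cdot>\<^bsub>?D\<^esub> NCmp \<beta> (Dom ?C m)"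
    using ntrans_nat[of \<beta> m ?D ?C] assms m by simp
  have a1: "NCmp \<beta> (Cod ?C m) \<cdot>\<^bsub>?D\<^esub> (FArr (NSrc \<beta>) m \<cdot>\<^bsub>?D\<^esub> NCmp \<alpha> (Dom ?C m))
      = (NCmp \<beta> (Cod ?C m) \<cdot>\<^bsub>?D\<^esub> FArr (NSrc \<beta>) m) \<cdot>\<^bsub>?D\<^esub> NCmp \<alpha> (Dom ?C m)"
    using m assms by (simp add: cat_assoc)
  show "NCmp (\<beta> \<cdot>N \<alpha>) (Cod (FSrc (NSrc (\<beta> \<cdot>N \<alpha>))) m) \<cdot>\<^bsub>FTgt (NSrc (\<beta> \<cdot>N \<alpha>))\<^esub> FArr (NSrc (\<beta> \<cdot>N \<alpha>)) m =
    FArr (NTgt (\<beta> \<cdot>N \<alpha>)) m \<cdot>\<^bsub>FTgt (NSrc (\<beta> \<cdot>N \<alpha>))\<^esub> NCmp (\<beta> \<cdot>N \<alpha>) (Dom (FSrc (NSrc (\<beta> \<cdot>N \<alpha>))) m)"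
    using m n1 n2 a1 assms by (simp add: cat_assoc)
qed (use assms ntrans_tgt[OF assms(2)] functor_props[OF ntrans_props(1)[OF assms(2)] refl refl] in
  \<open>simp_all add: vcomp_def del: ntrans_tgt\<close>, auto)

lemma whisker_left_sel [simp]: "NSrc (H \<cdot>L \<alpha>) = H \<cdot>F NSrc \<alpha>" "NTgt (H \<cdot>L \<alpha>) = H \<cdot>F NTgt \<alpha>"
    "x \<in> Obj (FSrc (NSrc \<alpha>)) \<Longrightarrow> NCmp (H \<cdot>L \<alpha>) x = FArr H (NCmp \<alpha> x)"
  by (auto simp: whisker_left_def)

lemma is_ntrans_whisker_left [simp]:
  assumes "is_functor H" "is_ntrans \<alpha>" "FTgt (NSrc \<alpha>) = FSrc H"
  shows "is_ntrans (H \<cdot>L \<alpha>)"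
proof (rule is_ntransI)
  have c: "category (FSrc (NSrc \<alpha>))" using functor_props[OF ntrans_props(1)[OF assms(2)] refl refl] by auto
  fix m assume m: "m \<in> Arr (FSrc (NSrc (H \<cdot>L \<alpha>)))"
  have "FArr H (NCmp \<alpha> (Cod (FSrc (NSrc \<alpha>)) m) \<cdot>\<^bsub>FSrc H\<^esub> FArr (NSrc \<alpha>) m)
      = FArr H (FArr (NTgt \<alpha>) m \<cdot>\<^bsub>FSrc H\<^esub> NCmp \<alpha> (Dom (FSrc (NSrc \<alpha>)) m))"
    using ntrans_nat[of \<alpha> m "FSrc H"] assms m by simp
  then show "NCmp (H \<cdot>L \<alpha>) (Cod (FSrc (NSrc (H \<cdot>L \<alpha>))) m) \<cdot>\<^bsub>FTgt (NSrc (H \<cdot>L \<alpha>))\<^esub> FArr (NSrc (H \<cdot>L \<alpha>)) m =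
    FArr (NTgt (H \<cdot>L \<alpha>)) m \<cdot>\<^bsub>FTgt (NSrc (H \<cdot>L \<alpha>))\<^esub> NCmp (H \<cdot>L \<alpha>) (Dom (FSrc (NSrc (H \<cdot>L \<alpha>))) m)"
    using m assms c by simp
qed (use assms in \<open>simp_all\<close>, simp add: whisker_left_def)

lemma whisker_right_sel [simp]: "NSrc (\<alpha> \<cdot>R H) = NSrc \<alpha> \<cdot>F H" "NTgt (\<alpha> \<cdot>R H) = NTgt \<alpha> \<cdot>F H"
    "x \<in> Obj (FSrc H) \<Longrightarrow> NCmp (\<alpha> \<cdot>R H) x = NCmp \<alpha> (FObj H x)"
  by (auto simp: whisker_right_def)

lemma is_ntrans_whisker_right [simp]:
  assumes "is_functor H" "is_ntrans \<alpha>" "FSrc (NSrc \<alpha>) = FTgt H"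
  shows "is_ntrans (\<alpha> \<cdot>R H)"
proof (rule is_ntransI)
  have c: "category (FSrc H)" using functor_props[OF assms(1) refl refl] by auto
  fix m assume m: "m \<in> Arr (FSrc (NSrc (\<alpha> \<cdot>R H)))"
  show "NCmp (\<alpha> \<cdot>R H) (Cod (FSrc (NSrc (\<alpha> \<cdot>R H))) m) \<cdot>\<^bsub>FTgt (NSrc (\<alpha> \<cdot>R H))\<^esub> FArr (NSrc (\<alpha> \<cdot>R H)) m =
    FArr (NTgt (\<alpha> \<cdot>R H)) m \<cdot>\<^bsub>FTgt (NSrc (\<alpha> \<cdot>R H))\<^esub> NCmp (\<alpha> \<cdot>R H) (Dom (FSrc (NSrc (\<alpha> \<cdot>R H))) m)"
    using ntrans_nat[of \<alpha> "FArr H m" "FTgt (NSrc \<alpha>)" "FTgt H"] assms m c by simp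
qed (use assms in \<open>simp_all\<close>, simp add: whisker_right_def)

lemma hcomp_sel [simp]: "NSrc (hcomp \<beta> \<alpha>) = NSrc \<beta> \<cdot>F NSrc \<alpha>" "NTgt (hcomp \<beta> \<alpha>) = NTgt \<beta> \<cdot>F NTgt \<alpha>"
    "x \<in> Obj (FSrc (NSrc \<alpha>)) \<Longrightarrow> NCmp (hcomp \<beta> \<alpha>) x =
      NCmp \<beta> (FObj (NTgt \<alpha>) x) \<cdot>\<^bsub>FTgt (NSrc \<beta>)\<^esub> FArr (NSrc \<beta>) (NCmp \<alpha> x)"
  by (auto simp: hcomp_def)

lemma hcomp_eq:
  assumes "is_ntrans \<alpha>" "is_ntrans \<beta>" "FTgt (NSrc \<alpha>) = FSrc (NSrc \<beta>)"
  shows "hcomp \<beta> \<alpha> = (\<beta> \<cdot>R NTgt \<alpha>) \<cdot>N (NSrc \<beta> \<cdot>L \<alpha>)"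
  using assms by (auto intro!: ntrans.equality simp: hcomp_def vcomp_def whisker_left_def
      whisker_right_def fcomp_def restrict_def)

lemma is_ntrans_hcomp [simp]:
  assumes "is_ntrans \<alpha>" "is_ntrans \<beta>" "FTgt (NSrc \<alpha>) = FSrc (NSrc \<beta>)"
  shows "is_ntrans (hcomp \<beta> \<alpha>)"
  by (simp add: hcomp_eq assms)

text \<open>Inverting the components gives a natural family for free: composing a naturality square
  of \<open>\<alpha>\<close> with the inverses on both sides yields the square of the inverses.
  Invertibility of cone legs and of structure cells can therefore be tested object by
  object.\<close>

lemma is_iso_Fun_iff:
  assumes "is_ntrans \<alpha>" "FSrc (NSrc \<alpha>) = C" "FTgt (NSrc \<alpha>) = D"
  shows "is_iso (Fun C D) \<alpha> \<longleftrightarrow> (\<forall>x\<in>Obj C. is_iso D (NCmp \<alpha> x))"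
proof
  note [simp] = assms
  assume "is_iso (Fun C D) \<alpha>"
  then obtain \<beta> where h: "\<beta> \<in> hom (Fun C D) (NTgt \<alpha>) (NSrc \<alpha>)"
      and e: "\<beta> \<cdot>N \<alpha> = idn (NSrc \<alpha>)" "\<alpha> \<cdot>N \<beta> = idn (NTgt \<alpha>)"
    unfolding is_iso_def Fun_sel by (elim conjE bexE)
  have b: "is_ntrans \<beta>" "NSrc \<beta> = NTgt \<alpha>" "NTgt \<beta> = NSrc \<alpha>"
    using h unfolding in_hom_iff in_Fun_arr Fun_sel by metis+
  show "\<forall>x\<in>Obj C. is_iso D (NCmp \<alpha> x)"
  proof
    fix x assume x: "x \<in> Obj C"
    have "NCmp (\<beta> \<cdot>N \<alpha>) x = NCmp (idn (NSrc \<alpha>)) x" "NCmp (\<alpha> \<cdot>N \<beta>) x = NCmp (idn (NTgt \<alpha>)) x"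
      using e by auto
    then show "is_iso D (NCmp \<alpha> x)" using x b
      by (intro is_isoI[of _ _ "NCmp \<beta> x"]) auto
  qed
next
  note [simp] = assms
  assume i: "\<forall>x\<in>Obj C. is_iso D (NCmp \<alpha> x)"
  have c: "category C" "category D" using functor_props[OF ntrans_props(1)[OF assms(1)]] by auto
  let ?\<beta> = "mkN (NTgt \<alpha>) (NSrc \<alpha>) (\<lambda>x. cinv D (NCmp \<alpha> x))"
  have b: "is_ntrans ?\<beta>"
  proof (rule is_ntrans_mkN[where C=C and D=D])
    fix m assume m: "m \<in> Arr C"
    have n: "NCmp \<alpha> (Cod C m) \<cdot>\<^bsub>D\<^esub> FArr (NSrc \<alpha>) m = FArr (NTgt \<alpha>) m \<cdot>\<^bsub>D\<^esub> NCmp \<alpha> (Dom C m)"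
      by (rule ntrans_nat) (use m in simp_all)
    have "NCmp \<alpha> (Cod C m) \<cdot>\<^bsub>D\<^esub> (FArr (NSrc \<alpha>) m \<cdot>\<^bsub>D\<^esub> cinv D (NCmp \<alpha> (Dom C m)))
       = (NCmp \<alpha> (Cod C m) \<cdot>\<^bsub>D\<^esub> FArr (NSrc \<alpha>) m) \<cdot>\<^bsub>D\<^esub> cinv D (NCmp \<alpha> (Dom C m))"
      using m c i by (simp add: cat_assoc)
    also have "\<dots> = FArr (NTgt \<alpha>) m" using m c i unfolding n by (simp add: cat_assoc)
    finally have e: "NCmp \<alpha> (Cod C m) \<cdot>\<^bsub>D\<^esub> (FArr (NSrc \<alpha>) m \<cdot>\<^bsub>D\<^esub> cinv D (NCmp \<alpha> (Dom C m))) = FArr (NTgt \<alpha>) m" .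
    show "cinv D (NCmp \<alpha> (Cod C m)) \<cdot>\<^bsub>D\<^esub> FArr (NTgt \<alpha>) m = FArr (NSrc \<alpha>) m \<cdot>\<^bsub>D\<^esub> cinv D (NCmp \<alpha> (Dom C m))"
      unfolding e[symmetric] using m c i by (simp add: cinv_cancel)
  qed (use i in \<open>simp_all\<close>)
  show "is_iso (Fun C D) \<alpha>"
  proof (rule is_isoI[of _ _ ?\<beta>])
    show "Comp (Fun C D) ?\<beta> \<alpha> = Ident (Fun C D) (Dom (Fun C D) \<alpha>)"
      by (simp, rule ntrans_eqI) (use b i in simp_all)
    show "Comp (Fun C D) \<alpha> ?\<beta> = Ident (Fun C D) (Cod (Fun C D) \<alpha>)"
      by (simp, rule ntrans_eqI) (use b i in simp_all)
  qed (use b in simp_all)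
qed

subsection \<open>Fully faithful essentially surjective functors\<close>

text \<open>The quasi-inverse is built from chosen preimages \<open>co d\<close> of objects with
  isomorphisms \<open>e d\<close> from \<open>K (co d)\<close> to \<open>d\<close>; arrows are
  lifted by fullness. The functor laws, the naturality of the unit and its invertibility are checked
  after applying \<open>K\<close>, where they are computations with the \<open>e d\<close>, and
  pulled back by faithfulness.\<close>

lemma is_equivalenceI:
  assumes K: "K \<in> Obj (Fun C D)"
    and faithful: "\<And>m n. \<lbrakk>m \<in> Arr C; n \<in> Arr C; Dom C m = Dom C n; Cod C m = Cod C n;
           FArr K m = FArr K n\<rbrakk> \<Longrightarrow> m = n"
    and full: "\<And>x y g. \<lbrakk>x \<in> Obj C; y \<in> Obj C; g \<in> hom D (FObj K x) (FObj K y)\<rbrakk>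
           \<Longrightarrow> \<exists>m \<in> hom C x y. FArr K m = g"
    and surj: "\<And>d. d \<in> Obj D \<Longrightarrow> \<exists>c \<in> Obj C. \<exists>e \<in> hom D (FObj K c) d. is_iso D e"
  shows "is_equivalence C D K"
proof -
  have Kf [simp]: "is_functor K" "FSrc K = C" "FTgt K = D" using K by auto
  have c [simp]: "category C" "category D" using functor_props[OF Kf] by auto
  obtain co e where ce: "\<And>d. d \<in> Obj D \<Longrightarrow> co d \<in> Obj C \<and> e d \<in> hom D (FObj K (co d)) d \<and> is_iso D (e d)"
    using surj by metis
  have ce [simp]: "co d \<in> Obj C" "e d \<in> Arr D" "Dom D (e d) = FObj K (co d)" "Cod D (e d) = d" "is_iso D (e d)"
    if "d \<in> Obj D" for d using ce that by auto
  define lift where "lift x y g = (SOME m. m \<in> hom C x y \<and> FArr K m = g)" for x y g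
  have lift [simp]: "lift x y g \<in> Arr C" "Dom C (lift x y g) = x" "Cod C (lift x y g) = y" "FArr K (lift x y g) = g"
    if "x \<in> Obj C" "y \<in> Obj C" "g \<in> Arr D" "Dom D g = FObj K x" "Cod D g = FObj K y" for x y g
  proof -
    have "\<exists>m. m \<in> hom C x y \<and> FArr K m = g" using full[of x y g] that by auto
    from someI_ex[OF this] show "lift x y g \<in> Arr C" "Dom C (lift x y g) = x" "Cod C (lift x y g) = y"
      "FArr K (lift x y g) = g" by (auto simp: lift_def)
  qed
  \<comment> \<open>Conjugation by the chosen isomorphisms is forced by the requirement that
    \<open>e\<close> be natural.\<close>
  define ka where "ka g = lift (co (Dom D g)) (co (Cod D g)) (cinv D (e (Cod D g)) \<cdot>\<^bsub>D\<^esub> (g \<cdot>\<^bsub>D\<^esub> e (Dom D g)))" for g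
  have ka [simp]: "ka g \<in> Arr C" "Dom C (ka g) = co (Dom D g)" "Cod C (ka g) = co (Cod D g)"
     "FArr K (ka g) = cinv D (e (Cod D g)) \<cdot>\<^bsub>D\<^esub> (g \<cdot>\<^bsub>D\<^esub> e (Dom D g))" if "g \<in> Arr D" for g
    using that by (auto simp: ka_def)
  have ka_nat: "e (Cod D g) \<cdot>\<^bsub>D\<^esub> FArr K (ka g) = g \<cdot>\<^bsub>D\<^esub> e (Dom D g)" if "g \<in> Arr D" for g
    using that by (simp add: cinv_cancel')
  define K' where "K' = mkF D C co ka"
  have K'f [simp]: "is_functor K'" "FSrc K' = D" "FTgt K' = C"
    unfolding K'_def
  proof (rule is_functor_mkF)
    show "ka (Ident D x) = Ident C (co x)" if "x \<in> Obj D" for x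
      by (rule faithful) (use that in simp_all)
    show "ka (n \<cdot>\<^bsub>D\<^esub> m) = ka n \<cdot>\<^bsub>C\<^esub> ka m" if "m \<in> Arr D" "n \<in> Arr D" "Cod D m = Dom D n" for m n
      by (rule faithful) (use that in \<open>simp_all add: cat_assoc cinv_cancel'\<close>)
  qed simp_all
  have K's [simp]: "x \<in> Obj D \<Longrightarrow> FObj K' x = co x" "m \<in> Arr D \<Longrightarrow> FArr K' m = ka m" for x m
    by (auto simp: K'_def)
  define \<epsilon> where "\<epsilon> = mkN (K \<cdot>F K') (idf D) e"
  have \<epsilon>: "is_ntrans \<epsilon>"
    unfolding \<epsilon>_def by (rule is_ntrans_mkN[where C=D and D=D]) (use ka_nat in simp_all)
  have \<epsilon>i: "is_iso (Fun D D) \<epsilon>"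
    using \<epsilon> by (subst is_iso_Fun_iff) (auto simp: \<epsilon>_def)
  \<comment> \<open>The unit is the preimage of the inverse of the counit component: the triangle
    identity read as a definition.\<close>
  define h where "h x = lift x (co (FObj K x)) (cinv D (e (FObj K x)))" for x
  have h [simp]: "h x \<in> Arr C" "Dom C (h x) = x" "Cod C (h x) = co (FObj K x)"
     "FArr K (h x) = cinv D (e (FObj K x))" if "x \<in> Obj C" for x
    using that by (auto simp: h_def)
  define \<eta> where "\<eta> = mkN (idf C) (K' \<cdot>F K) h"
  have \<eta>: "is_ntrans \<eta>"
    unfolding \<eta>_def
  proof (rule is_ntrans_mkN[where C=C and D=C])
    fix m assume m: "m \<in> Arr C"
    show "h (Cod C m) \<cdot>\<^bsub>C\<^esub> FArr (idf C) m = FArr (K' \<cdot>F K) m \<cdot>\<^bsub>C\<^esub> h (Dom C m)"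
      by (rule faithful) (use m in \<open>simp_all add: cat_assoc\<close>)
  qed simp_all
  have hiso: "is_iso C (h x)" if x: "x \<in> Obj C" for x
  proof (rule is_isoI[of _ _ "lift (co (FObj K x)) x (e (FObj K x))"])
    show "lift (co (FObj K x)) x (e (FObj K x)) \<cdot>\<^bsub>C\<^esub> h x = Ident C (Dom C (h x))"
      by (rule faithful) (use x in simp_all)
    show "h x \<cdot>\<^bsub>C\<^esub> lift (co (FObj K x)) x (e (FObj K x)) = Ident C (Cod C (h x))"
      by (rule faithful) (use x in simp_all)
  qed (use x in simp_all)
  have \<eta>i: "is_iso (Fun C C) \<eta>"
    using \<eta> hiso by (subst is_iso_Fun_iff) (auto simp: \<eta>_def)
  show ?thesis unfolding is_equivalence_def
    using K \<epsilon> \<epsilon>i \<eta> \<eta>i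
    by (intro conjI bexI[of _ K'] bexI[of _ \<eta>] bexI[of _ \<epsilon>]) (auto simp: \<eta>_def \<epsilon>_def)
qed

lemma fcomp_assoc [simp]:
  assumes "is_functor F" "FTgt F = FSrc G"
  shows "(H \<cdot>F G) \<cdot>F F = H \<cdot>F (G \<cdot>F F)"
  using assms by (auto simp: fcomp_def restrict_def fun_eq_iff)

lemma fcomp_idf [simp]: "is_functor F \<Longrightarrow> FSrc F = C \<Longrightarrow> F \<cdot>F idf C = F"
  by (rule functor_eqI) auto

lemma idf_fcomp [simp]: "is_functor F \<Longrightarrow> FTgt F = C \<Longrightarrow> idf C \<cdot>F F = F"
  by (rule functor_eqI) auto

lemma fcomp_whisker_left:
  assumes "is_functor H" "is_functor K" "FTgt H = FSrc K" "is_ntrans \<alpha>" "FTgt (NSrc \<alpha>) = FSrc H"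
  shows "(K \<cdot>F H) \<cdot>L \<alpha> = K \<cdot>L (H \<cdot>L \<alpha>)"
  by (rule ntrans_eqI) (use assms in simp_all)

lemma idf_whisker_left [simp]:
  assumes "is_ntrans \<alpha>" "FTgt (NSrc \<alpha>) = C"
  shows "idf C \<cdot>L \<alpha> = \<alpha>"
  by (rule ntrans_eqI) (use assms functor_props(2)[OF ntrans_props(1)[OF assms(1)] refl refl] in simp_all)

section \<open>2-categories and \<open>Cat\<close>-valued 2-functors\<close>

lemma two_cat [simp]:
  assumes "two_category A"
  shows "category (Under A)" "category (Cells A)" "Obj (Cells A) = Arr (Under A)"
  using assms by (auto simp: two_category_def)

lemma two_cat_cell [simp]:
  assumes "two_category A" "\<alpha> \<in> Arr (Cells A)"
  shows "Dom (Cells A) \<alpha> \<in> Arr (Under A)" "Cod (Cells A) \<alpha> \<in> Arr (Under A)"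
    "Dom (Under A) (Cod (Cells A) \<alpha>) = Dom (Under A) (Dom (Cells A) \<alpha>)"
    "Cod (Under A) (Cod (Cells A) \<alpha>) = Cod (Under A) (Dom (Cells A) \<alpha>)"
  using cat_dom[of "Cells A" \<alpha>] cat_cod[of "Cells A" \<alpha>] assms
    two_category.globular_src[OF assms] two_category.globular_tgt[OF assms] by auto

lemma two_cat_hcomp [simp]:
  assumes "two_category A" "\<alpha> \<in> Arr (Cells A)" "\<beta> \<in> Arr (Cells A)"
    "Cod (Under A) (Dom (Cells A) \<alpha>) = Dom (Under A) (Dom (Cells A) \<beta>)"
  shows "HComp A \<beta> \<alpha> \<in> Arr (Cells A)"
    "Dom (Cells A) (HComp A \<beta> \<alpha>) = Dom (Cells A) \<beta> \<cdot>\<^bsub>Under A\<^esub> Dom (Cells A) \<alpha>"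
    "Cod (Cells A) (HComp A \<beta> \<alpha>) = Cod (Cells A) \<beta> \<cdot>\<^bsub>Under A\<^esub> Cod (Cells A) \<alpha>"
  using two_category.hcomp_hom[OF assms(1), of \<alpha> _ _ \<beta>] assms by (auto simp: cell_src_def cell_tgt_def)

text \<open>By interchange, the horizontal composite of the inverses is inverse to the horizontal
  composite. Whiskering of an invertible 2-cell is included, since identity cells are
  invertible.\<close>

lemma is_iso_hcomp [simp]:
  assumes A: "two_category A" and i: "is_iso (Cells A) \<alpha>" "is_iso (Cells A) \<beta>"
    and c: "Cod (Under A) (Dom (Cells A) \<alpha>) = Dom (Under A) (Dom (Cells A) \<beta>)"
  shows "is_iso (Cells A) (HComp A \<beta> \<alpha>)"
proof -
  let ?a = "cinv (Cells A) \<alpha>" and ?b = "cinv (Cells A) \<beta>"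
  note [simp] = A cinv_props[OF i(1)] cinv_props[OF i(2)] c i
  have aa: "\<alpha> \<in> Arr (Cells A)" "\<beta> \<in> Arr (Cells A)" by simp_all
  have [simp]: "Cod (Under A) (Cod (Cells A) \<alpha>) = Dom (Under A) (Cod (Cells A) \<beta>)"
    using two_cat_cell(3,4)[OF A] aa by simp
  have e1: "HComp A ?b ?a \<cdot>\<^bsub>Cells A\<^esub> HComp A \<beta> \<alpha> = HComp A (?b \<cdot>\<^bsub>Cells A\<^esub> \<beta>) (?a \<cdot>\<^bsub>Cells A\<^esub> \<alpha>)"
    by (subst two_category.interchange[OF A]) (auto simp: cell_src_def cell_tgt_def)
  have e2: "HComp A \<beta> \<alpha> \<cdot>\<^bsub>Cells A\<^esub> HComp A ?b ?a = HComp A (\<beta> \<cdot>\<^bsub>Cells A\<^esub> ?b) (\<alpha> \<cdot>\<^bsub>Cells A\<^esub> ?a)"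
    by (subst two_category.interchange[OF A]) (auto simp: cell_src_def cell_tgt_def)
  show ?thesis
  proof (rule is_isoI[of _ _ "HComp A ?b ?a"])
    show "HComp A ?b ?a \<cdot>\<^bsub>Cells A\<^esub> HComp A \<beta> \<alpha> = Ident (Cells A) (Dom (Cells A) (HComp A \<beta> \<alpha>))"
      unfolding e1 using aa by (simp add: two_category.hcomp_ident[OF A])
    show "HComp A \<beta> \<alpha> \<cdot>\<^bsub>Cells A\<^esub> HComp A ?b ?a = Ident (Cells A) (Cod (Cells A) (HComp A \<beta> \<alpha>))"
      unfolding e2 using aa by (simp add: two_category.hcomp_ident[OF A])
  qed (use aa in simp_all)
qed

lemma Cat_sel [simp]:
  "Obj (Under Cat) = {C. category C}" "Arr (Under Cat) = {F. is_functor F}"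
  "Dom (Under Cat) = FSrc" "Cod (Under Cat) = FTgt" "Ident (Under Cat) = idf" "Comp (Under Cat) = fcomp"
  "Obj (Cells Cat) = {F. is_functor F}" "Arr (Cells Cat) = {\<alpha>. is_ntrans \<alpha>}"
  "Dom (Cells Cat) = NSrc" "Cod (Cells Cat) = NTgt" "Ident (Cells Cat) = idn" "Comp (Cells Cat) = vcomp"
  "HComp Cat = hcomp"
  by (auto simp: Cat_def)

locale diagram =
  fixes A :: "('a, 'f, 'c) twocat" and G :: "('a, 'f, 'c, 'o, 'm) cat_valued"
  assumes twoA [simp]: "two_category A"
    and functorG: "two_functor A Cat G"
begin

lemma Map0_cat [simp]: "a \<in> Obj (Under A) \<Longrightarrow> category (Map0 G a)"
  using functorG by (auto simp: two_functor_def)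

lemma Map1_functor [simp]:
  assumes "f \<in> Arr (Under A)"
  shows "is_functor (Map1 G f)" "FSrc (Map1 G f) = Map0 G (Dom (Under A) f)"
    "FTgt (Map1 G f) = Map0 G (Cod (Under A) f)"
  using functorG assms by (auto simp: two_functor_def)

lemma Map2_ntrans [simp]:
  assumes "\<alpha> \<in> Arr (Cells A)"
  shows "is_ntrans (Map2 G \<alpha>)" "NSrc (Map2 G \<alpha>) = Map1 G (Dom (Cells A) \<alpha>)"
    "NTgt (Map2 G \<alpha>) = Map1 G (Cod (Cells A) \<alpha>)"
  using functorG assms by (auto simp: two_functor_def)

lemma Map_pres [simp]:
  "a \<in> Obj (Under A) \<Longrightarrow> Map1 G (Ident (Under A) a) = idf (Map0 G a)"
  "\<lbrakk>f \<in> Arr (Under A); g \<in> Arr (Under A); Cod (Under A) f = Dom (Under A) g\<rbrakk>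
     \<Longrightarrow> Map1 G (g \<cdot>\<^bsub>Under A\<^esub> f) = Map1 G g \<cdot>F Map1 G f"
  "f \<in> Arr (Under A) \<Longrightarrow> Map2 G (Ident (Cells A) f) = idn (Map1 G f)"
  "\<lbrakk>\<alpha> \<in> Arr (Cells A); \<beta> \<in> Arr (Cells A); Cod (Cells A) \<alpha> = Dom (Cells A) \<beta>\<rbrakk>
     \<Longrightarrow> Map2 G (\<beta> \<cdot>\<^bsub>Cells A\<^esub> \<alpha>) = Map2 G \<beta> \<cdot>N Map2 G \<alpha>"
  "\<lbrakk>\<alpha> \<in> Arr (Cells A); \<beta> \<in> Arr (Cells A);
     Cod (Under A) (Dom (Cells A) \<alpha>) = Dom (Under A) (Dom (Cells A) \<beta>)\<rbrakk>
     \<Longrightarrow> Map2 G (HComp A \<beta> \<alpha>) = hcomp (Map2 G \<beta>) (Map2 G \<alpha>)"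
  using functorG by (simp_all add: two_functor_def cell_src_def cell_tgt_def)

text \<open>A 2-functor sends the inverse of a 2-cell to an inverse of its image. The statement is
  about components because these are what enters the formulas for changing the legs of
  fractions.\<close>

lemma Map2_is_iso [simp]:
  assumes "is_iso (Cells A) \<zeta>" "b = Cod (Under A) (Dom (Cells A) \<zeta>)"
    "x \<in> Obj (Map0 G (Dom (Under A) (Dom (Cells A) \<zeta>)))"
  shows "is_iso (Map0 G b) (NCmp (Map2 G \<zeta>) x)"
proof (rule is_isoI[of _ _ "NCmp (Map2 G (cinv (Cells A) \<zeta>)) x"])
  note p = cinv_props[OF assms(1)]
  have "NCmp (Map2 G (cinv (Cells A) \<zeta> \<cdot>\<^bsub>Cells A\<^esub> \<zeta>)) x = NCmp (Map2 G (Ident (Cells A) (Dom (Cells A) \<zeta>))) x"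
    "NCmp (Map2 G (\<zeta> \<cdot>\<^bsub>Cells A\<^esub> cinv (Cells A) \<zeta>)) x = NCmp (Map2 G (Ident (Cells A) (Cod (Cells A) \<zeta>))) x"
    using p by simp_all
  note this[unfolded Map_pres(4)[OF p(6,1) p(2)[symmetric]] Map_pres(4)[OF p(1,6) p(3)]
    Map_pres(3)[OF two_cat_cell(1)[OF twoA p(6)]] Map_pres(3)[OF two_cat_cell(2)[OF twoA p(6)]]]
  then show "NCmp (Map2 G (cinv (Cells A) \<zeta>)) x \<cdot>\<^bsub>Map0 G b\<^esub> NCmp (Map2 G \<zeta>) x
    = Ident (Map0 G b) (Dom (Map0 G b) (NCmp (Map2 G \<zeta>) x))"
  "NCmp (Map2 G \<zeta>) x \<cdot>\<^bsub>Map0 G b\<^esub> NCmp (Map2 G (cinv (Cells A) \<zeta>)) x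
    = Ident (Map0 G b) (Cod (Map0 G b) (NCmp (Map2 G \<zeta>) x))"
    using p assms by simp_all
qed (use assms cinv_props[OF assms(1)] in simp_all)

lemma Map2_nat:
  assumes "\<alpha> \<in> Arr (Cells A)" "a = Dom (Under A) (Dom (Cells A) \<alpha>)" "b = Cod (Under A) (Dom (Cells A) \<alpha>)"
    "m \<in> Arr (Map0 G a)"
  shows "NCmp (Map2 G \<alpha>) (Cod (Map0 G a) m) \<cdot>\<^bsub>Map0 G b\<^esub> FArr (Map1 G (Dom (Cells A) \<alpha>)) m
    = FArr (Map1 G (Cod (Cells A) \<alpha>)) m \<cdot>\<^bsub>Map0 G b\<^esub> NCmp (Map2 G \<alpha>) (Dom (Map0 G a) m)"
  using ntrans_nat[of "Map2 G \<alpha>" m "Map0 G b" "Map0 G a"] assms by simp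

end

section \<open>\<open>\<sigma>\<close>-filtered pairs\<close>

locale filtered_pair =
  fixes A :: "('a, 'f, 'c) twocat" and \<Sigma> :: "'f set"
  assumes filtered: "sigma_filtered A \<Sigma>"
begin

lemma pair: "two_category_pair A \<Sigma>" using filtered by (auto simp: sigma_filtered_def)

lemma two_catA [simp]: "two_category A" using pair by (auto simp: two_category_pair_def)

lemma Sigma_arr [simp]: "u \<in> \<Sigma> \<Longrightarrow> u \<in> Arr (Under A)"
  using pair by (auto simp: two_category_pair_def)

lemma Sigma_ident [simp]: "a \<in> Obj (Under A) \<Longrightarrow> Ident (Under A) a \<in> \<Sigma>"
  using pair by (auto simp: two_category_pair_def)

lemma Sigma_comp [simp]:
  "\<lbrakk>u \<in> \<Sigma>; v \<in> \<Sigma>; Cod (Under A) u = Dom (Under A) v\<rbrakk> \<Longrightarrow> v \<cdot>\<^bsub>Under A\<^esub> u \<in> \<Sigma>"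
  using pair by (auto simp: two_category_pair_def)

section \<open>Consequences of the filteredness axioms\<close>

lemma F0:
  assumes "a \<in> Obj (Under A)" "b \<in> Obj (Under A)"
  obtains u v where "u \<in> \<Sigma>" "v \<in> \<Sigma>" "Dom (Under A) u = a" "Dom (Under A) v = b"
    "Cod (Under A) v = Cod (Under A) u"
proof -
  from assms filtered obtain e where e: "hom (Under A) a e \<inter> \<Sigma> \<noteq> {}" "hom (Under A) b e \<inter> \<Sigma> \<noteq> {}"
    unfolding sigma_filtered_def by blast
  from e obtain u v where "u \<in> hom (Under A) a e" "u \<in> \<Sigma>" "v \<in> hom (Under A) b e" "v \<in> \<Sigma>" by blast
  then show ?thesis using that[of u v] by auto
qed

lemma F1:
  assumes "f \<in> Arr (Under A)" "g \<in> \<Sigma>" "Dom (Under A) f = Dom (Under A) g" "Cod (Under A) f = Cod (Under A) g"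
  obtains h \<alpha> where "h \<in> \<Sigma>" "Dom (Under A) h = Cod (Under A) f"
    "\<alpha> \<in> Arr (Cells A)" "Dom (Cells A) \<alpha> = h \<cdot>\<^bsub>Under A\<^esub> f" "Cod (Cells A) \<alpha> = h \<cdot>\<^bsub>Under A\<^esub> g"
    "f \<in> \<Sigma> \<Longrightarrow> is_iso (Cells A) \<alpha>"
proof -
  let ?a = "Dom (Under A) f" and ?b = "Cod (Under A) f"
  have o: "?a \<in> Obj (Under A)" "?b \<in> Obj (Under A)" using assms by auto
  have h: "f \<in> hom (Under A) ?a ?b" "g \<in> hom (Under A) ?a ?b \<inter> \<Sigma>" using assms by auto
  have "\<exists>e \<in> Obj (Under A). \<exists>h \<in> hom (Under A) ?b e \<inter> \<Sigma>.
        \<exists>\<alpha> \<in> hom (Cells A) (h \<cdot>\<^bsub>Under A\<^esub> f) (h \<cdot>\<^bsub>Under A\<^esub> g). f \<in> \<Sigma> \<longrightarrow> is_iso (Cells A) \<alpha>"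
    using filtered o h unfolding sigma_filtered_def by blast
  then show ?thesis using that by auto
qed

lemma F2:
  assumes "\<alpha> \<in> Arr (Cells A)" "\<beta> \<in> Arr (Cells A)" "Dom (Cells A) \<beta> = Dom (Cells A) \<alpha>"
    "Cod (Cells A) \<beta> = Cod (Cells A) \<alpha>" "Cod (Cells A) \<alpha> \<in> \<Sigma>"
  obtains h where "h \<in> \<Sigma>" "Dom (Under A) h = Cod (Under A) (Dom (Cells A) \<alpha>)"
    "HComp A (Ident (Cells A) h) \<alpha> = HComp A (Ident (Cells A) h) \<beta>"
proof -
  let ?f = "Dom (Cells A) \<alpha>" and ?g = "Cod (Cells A) \<alpha>"
  let ?a = "Dom (Under A) ?f" and ?b = "Cod (Under A) ?f"
  have o: "?a \<in> Obj (Under A)" "?b \<in> Obj (Under A)" using assms by auto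
  have h: "?f \<in> hom (Under A) ?a ?b" "?g \<in> hom (Under A) ?a ?b \<inter> \<Sigma>" using assms by auto
  have c: "\<alpha> \<in> hom (Cells A) ?f ?g" "\<beta> \<in> hom (Cells A) ?f ?g" using assms by auto
  have "\<exists>e \<in> Obj (Under A). \<exists>h \<in> hom (Under A) ?b e \<inter> \<Sigma>.
          HComp A (Ident (Cells A) h) \<alpha> = HComp A (Ident (Cells A) h) \<beta>"
    using filtered o h c unfolding sigma_filtered_def by blast
  then show ?thesis using that by auto
qed

text \<open>F0 completes the span to a square; its two composites are parallel and the one through
  \<open>q\<close> lies in \<open>\<Sigma>\<close>, so F1 fills the square after one more arrow,
  which is absorbed into both new sides. The filling points from the side of \<open>p\<close> to
  that of \<open>q\<close>, and is invertible when \<open>p\<close> is in \<open>\<Sigma>\<close>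
  too.\<close>

lemma ore:
  assumes "p \<in> Arr (Under A)" "q \<in> \<Sigma>" "Dom (Under A) p = Dom (Under A) q"
  obtains r s \<zeta> where "r \<in> \<Sigma>" "s \<in> \<Sigma>" "Dom (Under A) r = Cod (Under A) p"
    "Dom (Under A) s = Cod (Under A) q" "Cod (Under A) s = Cod (Under A) r"
    "\<zeta> \<in> Arr (Cells A)" "Dom (Cells A) \<zeta> = r \<cdot>\<^bsub>Under A\<^esub> p" "Cod (Cells A) \<zeta> = s \<cdot>\<^bsub>Under A\<^esub> q"
    "p \<in> \<Sigma> \<Longrightarrow> is_iso (Cells A) \<zeta>"
proof -
  obtain r s where rs: "r \<in> \<Sigma>" "s \<in> \<Sigma>" "Dom (Under A) r = Cod (Under A) p"
    "Dom (Under A) s = Cod (Under A) q" "Cod (Under A) s = Cod (Under A) r"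
    by (rule F0[of "Cod (Under A) p" "Cod (Under A) q"]) (use assms in auto)
  obtain h \<alpha> where h: "h \<in> \<Sigma>" "Dom (Under A) h = Cod (Under A) (r \<cdot>\<^bsub>Under A\<^esub> p)"
    "\<alpha> \<in> Arr (Cells A)" "Dom (Cells A) \<alpha> = h \<cdot>\<^bsub>Under A\<^esub> (r \<cdot>\<^bsub>Under A\<^esub> p)"
    "Cod (Cells A) \<alpha> = h \<cdot>\<^bsub>Under A\<^esub> (s \<cdot>\<^bsub>Under A\<^esub> q)"
    "r \<cdot>\<^bsub>Under A\<^esub> p \<in> \<Sigma> \<Longrightarrow> is_iso (Cells A) \<alpha>"
    by (rule F1[of "r \<cdot>\<^bsub>Under A\<^esub> p" "s \<cdot>\<^bsub>Under A\<^esub> q"]) (use assms rs in auto)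
  show ?thesis
    by (rule that[of "h \<cdot>\<^bsub>Under A\<^esub> r" "h \<cdot>\<^bsub>Under A\<^esub> s" \<alpha>]) (use assms rs h in \<open>auto simp: cat_assoc\<close>)
qed

text \<open>Two cospans with the same feet have to be made comparable, not just one span. A square
  for \<open>u\<close> and \<open>u'\<close> need not fit \<open>v\<close> and \<open>v'\<close>;
  the mismatch is a pair of parallel arrows of \<open>\<Sigma>\<close>, to which F1 applies once
  more, and the first 2-cell survives by whiskering.\<close>

lemma merge:
  assumes "u \<in> \<Sigma>" "v \<in> \<Sigma>" "u' \<in> \<Sigma>" "v' \<in> \<Sigma>" "Cod (Under A) v = Cod (Under A) u"
    "Cod (Under A) v' = Cod (Under A) u'" "Dom (Under A) u = Dom (Under A) u'" "Dom (Under A) v = Dom (Under A) v'"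
  obtains r s \<zeta> \<xi> where "r \<in> \<Sigma>" "s \<in> \<Sigma>" "Dom (Under A) r = Cod (Under A) u"
    "Dom (Under A) s = Cod (Under A) u'" "Cod (Under A) s = Cod (Under A) r"
    "is_iso (Cells A) \<zeta>" "Dom (Cells A) \<zeta> = r \<cdot>\<^bsub>Under A\<^esub> u" "Cod (Cells A) \<zeta> = s \<cdot>\<^bsub>Under A\<^esub> u'"
    "is_iso (Cells A) \<xi>" "Dom (Cells A) \<xi> = r \<cdot>\<^bsub>Under A\<^esub> v" "Cod (Cells A) \<xi> = s \<cdot>\<^bsub>Under A\<^esub> v'"
proof -
  obtain r s \<zeta> where rs: "r \<in> \<Sigma>" "s \<in> \<Sigma>" "Dom (Under A) r = Cod (Under A) u"
    "Dom (Under A) s = Cod (Under A) u'" "Cod (Under A) s = Cod (Under A) r"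
    "\<zeta> \<in> Arr (Cells A)" "Dom (Cells A) \<zeta> = r \<cdot>\<^bsub>Under A\<^esub> u" "Cod (Cells A) \<zeta> = s \<cdot>\<^bsub>Under A\<^esub> u'"
    "u \<in> \<Sigma> \<Longrightarrow> is_iso (Cells A) \<zeta>"
    by (rule ore[of u u']) (use assms in auto)
  obtain h \<alpha> where h: "h \<in> \<Sigma>" "Dom (Under A) h = Cod (Under A) (r \<cdot>\<^bsub>Under A\<^esub> v)"
    "\<alpha> \<in> Arr (Cells A)" "Dom (Cells A) \<alpha> = h \<cdot>\<^bsub>Under A\<^esub> (r \<cdot>\<^bsub>Under A\<^esub> v)"
    "Cod (Cells A) \<alpha> = h \<cdot>\<^bsub>Under A\<^esub> (s \<cdot>\<^bsub>Under A\<^esub> v')"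
    "r \<cdot>\<^bsub>Under A\<^esub> v \<in> \<Sigma> \<Longrightarrow> is_iso (Cells A) \<alpha>"
    by (rule F1[of "r \<cdot>\<^bsub>Under A\<^esub> v" "s \<cdot>\<^bsub>Under A\<^esub> v'"]) (use assms rs in auto)
  show ?thesis
    by (rule that[of "h \<cdot>\<^bsub>Under A\<^esub> r" "h \<cdot>\<^bsub>Under A\<^esub> s" "HComp A (Ident (Cells A) h) \<zeta>" \<alpha>])
      (use assms rs h in \<open>auto simp: cat_assoc\<close>)
qed

text \<open>F2 only compares 2-cells whose target lies in \<open>\<Sigma>\<close>, while the legs of
  germs are arbitrary. This provides a target \<open>m\<close> in \<open>\<Sigma>\<close> that both
  arrows reach after composition with one \<open>q\<close>. F0 supplies an arrow of
  \<open>\<Sigma>\<close> out of the common domain, and F1 is then used twice with that arrow on the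
  right.\<close>

lemma extend2:
  assumes "v \<in> Arr (Under A)" "v' \<in> Arr (Under A)" "Dom (Under A) v' = Dom (Under A) v"
    "Cod (Under A) v' = Cod (Under A) v"
  obtains q m \<gamma> \<gamma>' where "q \<in> \<Sigma>" "m \<in> \<Sigma>" "Dom (Under A) q = Cod (Under A) v"
    "Dom (Under A) m = Dom (Under A) v" "Cod (Under A) m = Cod (Under A) q"
    "\<gamma> \<in> Arr (Cells A)" "Dom (Cells A) \<gamma> = q \<cdot>\<^bsub>Under A\<^esub> v" "Cod (Cells A) \<gamma> = m"
    "\<gamma>' \<in> Arr (Cells A)" "Dom (Cells A) \<gamma>' = q \<cdot>\<^bsub>Under A\<^esub> v'" "Cod (Cells A) \<gamma>' = m"
proof -
  obtain r m where rm: "r \<in> \<Sigma>" "m \<in> \<Sigma>" "Dom (Under A) r = Cod (Under A) v"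
    "Dom (Under A) m = Dom (Under A) v" "Cod (Under A) m = Cod (Under A) r"
    by (rule F0[of "Cod (Under A) v" "Dom (Under A) v"]) (use assms in auto)
  obtain h \<gamma> where h: "h \<in> \<Sigma>" "Dom (Under A) h = Cod (Under A) (r \<cdot>\<^bsub>Under A\<^esub> v)"
    "\<gamma> \<in> Arr (Cells A)" "Dom (Cells A) \<gamma> = h \<cdot>\<^bsub>Under A\<^esub> (r \<cdot>\<^bsub>Under A\<^esub> v)"
    "Cod (Cells A) \<gamma> = h \<cdot>\<^bsub>Under A\<^esub> m"
    by (rule F1[of "r \<cdot>\<^bsub>Under A\<^esub> v" m]) (use assms rm in auto)
  obtain k \<gamma>' where k: "k \<in> \<Sigma>" "Dom (Under A) k = Cod (Under A) (h \<cdot>\<^bsub>Under A\<^esub> (r \<cdot>\<^bsub>Under A\<^esub> v'))"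
    "\<gamma>' \<in> Arr (Cells A)" "Dom (Cells A) \<gamma>' = k \<cdot>\<^bsub>Under A\<^esub> (h \<cdot>\<^bsub>Under A\<^esub> (r \<cdot>\<^bsub>Under A\<^esub> v'))"
    "Cod (Cells A) \<gamma>' = k \<cdot>\<^bsub>Under A\<^esub> (h \<cdot>\<^bsub>Under A\<^esub> m)"
    by (rule F1[of "h \<cdot>\<^bsub>Under A\<^esub> (r \<cdot>\<^bsub>Under A\<^esub> v')" "h \<cdot>\<^bsub>Under A\<^esub> m"]) (use assms rm h in auto)
  show ?thesis
    by (rule that[of "k \<cdot>\<^bsub>Under A\<^esub> (h \<cdot>\<^bsub>Under A\<^esub> r)" "k \<cdot>\<^bsub>Under A\<^esub> (h \<cdot>\<^bsub>Under A\<^esub> m)"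
          "HComp A (Ident (Cells A) k) \<gamma>" \<gamma>'])
      (use assms rm h k in \<open>auto simp: cat_assoc\<close>)
qed

text \<open>The arrows of \<open>\<Sigma>\<close> out of \<open>a\<close> serve as stages, a later
  stage being a composite with a further arrow of \<open>\<Sigma>\<close>. A condition that persists
  to later stages and is reachable from every stage can be met jointly with finitely many others of
  this kind, by treating them one after the other. Lifting of arrows and lifting of equations are
  both instances.\<close>

lemma eventually_finite:
  assumes "finite S" "u \<in> \<Sigma>" "Dom (Under A) u = a"
    and pers: "\<And>s u h. s \<in> S \<Longrightarrow> u \<in> \<Sigma> \<Longrightarrow> Dom (Under A) u = a \<Longrightarrow> h \<in> \<Sigma> \<Longrightarrow> Dom (Under A) h = Cod (Under A) u \<Longrightarrow>
       \<Phi> s u \<Longrightarrow> \<Phi> s (h \<cdot>\<^bsub>Under A\<^esub> u)"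
    and dense: "\<And>s u. s \<in> S \<Longrightarrow> u \<in> \<Sigma> \<Longrightarrow> Dom (Under A) u = a \<Longrightarrow>
       \<exists>h\<in>\<Sigma>. Dom (Under A) h = Cod (Under A) u \<and> \<Phi> s (h \<cdot>\<^bsub>Under A\<^esub> u)"
  shows "\<exists>h\<in>\<Sigma>. Dom (Under A) h = Cod (Under A) u \<and> (\<forall>s\<in>S. \<Phi> s (h \<cdot>\<^bsub>Under A\<^esub> u))"
  using assms(1) pers dense
proof (induction S rule: finite_induct)
  case empty
  show ?case using assms(2) by (intro bexI[of _ "Ident (Under A) (Cod (Under A) u)"]) auto
next
  case (insert s S)
  have "\<exists>h\<in>\<Sigma>. Dom (Under A) h = Cod (Under A) u \<and> (\<forall>s\<in>S. \<Phi> s (h \<cdot>\<^bsub>Under A\<^esub> u))"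
    by (rule insert.IH) (use insert.prems in auto)
  then obtain h where h: "h \<in> \<Sigma>" "Dom (Under A) h = Cod (Under A) u" "\<And>s. s \<in> S \<Longrightarrow> \<Phi> s (h \<cdot>\<^bsub>Under A\<^esub> u)" by blast
  obtain k where k: "k \<in> \<Sigma>" "Dom (Under A) k = Cod (Under A) (h \<cdot>\<^bsub>Under A\<^esub> u)" "\<Phi> s (k \<cdot>\<^bsub>Under A\<^esub> (h \<cdot>\<^bsub>Under A\<^esub> u))"
    using insert.prems(2)[of s "h \<cdot>\<^bsub>Under A\<^esub> u"] h assms(2,3) by auto
  have kh: "k \<cdot>\<^bsub>Under A\<^esub> (h \<cdot>\<^bsub>Under A\<^esub> u) = (k \<cdot>\<^bsub>Under A\<^esub> h) \<cdot>\<^bsub>Under A\<^esub> u" using h k assms(2) by (simp add: cat_assoc)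
  have "\<Phi> t (k \<cdot>\<^bsub>Under A\<^esub> (h \<cdot>\<^bsub>Under A\<^esub> u))" if "t \<in> insert s S" for t
  proof (cases "t = s")
    case False
    then show ?thesis using insert.prems(1)[of t "h \<cdot>\<^bsub>Under A\<^esub> u" k] that h k assms(2,3) by simp
  qed (use k in simp)
  then show ?case unfolding kh using h k assms(2) by (intro bexI[of _ "k \<cdot>\<^bsub>Under A\<^esub> h"]) auto
qed

text \<open>The conditions start at unrelated objects rather than at stages under one object, so F0
  is what joins them; for an empty family it matters that \<open>A\<close> has an object.\<close>

lemma common_object:
  assumes "finite S" "\<And>s. s \<in> S \<Longrightarrow> \<exists>a\<in>Obj (Under A). \<Psi> s a"
    and pers: "\<And>s u. s \<in> S \<Longrightarrow> u \<in> \<Sigma> \<Longrightarrow> \<Psi> s (Dom (Under A) u) \<Longrightarrow> \<Psi> s (Cod (Under A) u)"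
  shows "\<exists>a\<in>Obj (Under A). \<forall>s\<in>S. \<Psi> s a"
  using assms
proof (induction S rule: finite_induct)
  case empty
  have "Obj (Under A) \<noteq> {}" using filtered by (simp add: sigma_filtered_def)
  then show ?case by auto
next
  case (insert s S)
  have "\<exists>a\<in>Obj (Under A). \<forall>s\<in>S. \<Psi> s a" by (rule insert.IH) (use insert.prems in auto)
  then obtain a where a: "a \<in> Obj (Under A)" "\<And>s. s \<in> S \<Longrightarrow> \<Psi> s a" by blast
  obtain b where b: "b \<in> Obj (Under A)" "\<Psi> s b" using insert.prems(1)[of s] by blast
  obtain u v where u: "u \<in> \<Sigma>" "v \<in> \<Sigma>" "Dom (Under A) u = a" "Dom (Under A) v = b" "Cod (Under A) v = Cod (Under A) u"
    by (rule F0[OF a(1) b(1)])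
  have "\<Psi> t (Cod (Under A) u)" if "t \<in> insert s S" for t
    using insert.prems(2)[of t u] insert.prems(2)[of s v] a(2) b u that by (cases "t = s") auto
  then show ?case using u by (intro bexI[of _ "Cod (Under A) u"]) auto
qed

end

section \<open>\<open>\<sigma>\<close>-cones componentwise\<close>

locale filtered_diagram = filtered_pair A \<Sigma> + diagram A G
  for A :: "('a, 'f, 'c) twocat" and \<Sigma> :: "'f set" and G :: "('a, 'f, 'c, 'o, 'm) cat_valued"
begin

abbreviation ucomp (infixl "\<odot>" 70) where "g \<odot> f \<equiv> g \<cdot>\<^bsub>Under A\<^esub> f"
abbreviation "Go f \<equiv> FObj (Map1 G f)"
abbreviation "Ga f \<equiv> FArr (Map1 G f)"
abbreviation "Gc \<alpha> \<equiv> NCmp (Map2 G \<alpha>)"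

text \<open>All equations between natural transformations are reduced to components. The cones
  constructed below (of fractions, of germs, along an arrow of \<open>I\<close>, and the comparison
  cone) are verified in this form.\<close>

lemma sigma_coneI:
  assumes E: "category E"
    and ext: "T0 \<theta> \<in> extensional (Obj (Under A))" "T1 \<theta> \<in> extensional (Arr (Under A))"
    and T0: "\<And>a. a \<in> Obj (Under A) \<Longrightarrow>
      is_functor (T0 \<theta> a) \<and> FSrc (T0 \<theta> a) = Map0 G a \<and> FTgt (T0 \<theta> a) = E"
    and T1: "\<And>f. f \<in> Arr (Under A) \<Longrightarrow> is_ntrans (T1 \<theta> f) \<and>
      NSrc (T1 \<theta> f) = T0 \<theta> (Cod (Under A) f) \<cdot>F Map1 G f \<and> NTgt (T1 \<theta> f) = T0 \<theta> (Dom (Under A) f)"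
    and id: "\<And>a x. a \<in> Obj (Under A) \<Longrightarrow> x \<in> Obj (Map0 G a) \<Longrightarrow>
      NCmp (T1 \<theta> (Ident (Under A) a)) x = Ident E (FObj (T0 \<theta> a) x)"
    and comp: "\<And>f g x. f \<in> Arr (Under A) \<Longrightarrow> g \<in> Arr (Under A) \<Longrightarrow> Cod (Under A) f = Dom (Under A) g \<Longrightarrow>
      x \<in> Obj (Map0 G (Dom (Under A) f)) \<Longrightarrow>
      NCmp (T1 \<theta> (g \<odot> f)) x = NCmp (T1 \<theta> f) x \<cdot>\<^bsub>E\<^esub> NCmp (T1 \<theta> g) (Go f x)"
    and cell: "\<And>\<gamma> x. \<gamma> \<in> Arr (Cells A) \<Longrightarrow> x \<in> Obj (Map0 G (Dom (Under A) (Dom (Cells A) \<gamma>))) \<Longrightarrow>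
      NCmp (T1 \<theta> (Dom (Cells A) \<gamma>)) x = NCmp (T1 \<theta> (Cod (Cells A) \<gamma>)) x \<cdot>\<^bsub>E\<^esub>
        FArr (T0 \<theta> (Cod (Under A) (Dom (Cells A) \<gamma>))) (Gc \<gamma> x)"
    and iso: "\<And>f x. f \<in> \<Sigma> \<Longrightarrow> x \<in> Obj (Map0 G (Dom (Under A) f)) \<Longrightarrow> is_iso E (NCmp (T1 \<theta> f) x)"
  shows "sigma_cone A \<Sigma> G E \<theta>"
proof -
  have T0s: "is_functor (T0 \<theta> a)" "FSrc (T0 \<theta> a) = Map0 G a" "FTgt (T0 \<theta> a) = E"
    if "a \<in> Obj (Under A)" for a using T0 that by auto
  have T1s: "is_ntrans (T1 \<theta> f)" "NSrc (T1 \<theta> f) = T0 \<theta> (Cod (Under A) f) \<cdot>F Map1 G f"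
    "NTgt (T1 \<theta> f) = T0 \<theta> (Dom (Under A) f)" if "f \<in> Arr (Under A)" for f using T1 that by auto
  note [simp] = T0s T1s
  have "T1 \<theta> (Ident (Under A) a) = idn (T0 \<theta> a)" if "a \<in> Obj (Under A)" for a
    by (rule ntrans_eqI) (use that in \<open>simp_all add: id\<close>)
  moreover have "T1 \<theta> (g \<odot> f) = T1 \<theta> f \<cdot>N (T1 \<theta> g \<cdot>R Map1 G f)"
    if "f \<in> Arr (Under A)" "g \<in> Arr (Under A)" "Cod (Under A) f = Dom (Under A) g" for f g
    by (rule ntrans_eqI) (use that in \<open>simp_all add: comp\<close>)
  moreover have "T1 \<theta> (Dom (Cells A) \<gamma>) = T1 \<theta> (Cod (Cells A) \<gamma>) \<cdot>N (T0 \<theta> (cell_tgt A \<gamma>) \<cdot>L Map2 G \<gamma>)"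
    if "\<gamma> \<in> Arr (Cells A)" for \<gamma>
    unfolding cell_tgt_def by (rule ntrans_eqI) (use that in \<open>simp_all add: cell\<close>)
  moreover have "is_iso (Fun (Map0 G (Dom (Under A) f)) E) (T1 \<theta> f)" if "f \<in> \<Sigma>" for f
    by (subst is_iso_Fun_iff) (use that in \<open>simp_all add: iso\<close>)
  ultimately show ?thesis
    using ext by (auto simp: sigma_cone_def PiE_def)
qed

end

locale cone = filtered_diagram A \<Sigma> G
  for A :: "('a, 'f, 'c) twocat" and \<Sigma> and G :: "('a, 'f, 'c, 'o, 'm) cat_valued" +
  fixes E :: "('p, 'n) cat" and \<theta> :: "('a, 'f, 'o, 'm, 'p, 'n) transf"
  assumes catE [simp]: "category E" and is_cone: "sigma_cone A \<Sigma> G E \<theta>"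
begin

abbreviation ecomp (infixr "\<star>" 70) where "g \<star> f \<equiv> g \<cdot>\<^bsub>E\<^esub> f"
abbreviation "To a \<equiv> FObj (T0 \<theta> a)"
abbreviation "Ta a \<equiv> FArr (T0 \<theta> a)"
abbreviation "Tc f \<equiv> NCmp (T1 \<theta> f)"

lemma T0_functor [simp]:
  assumes "a \<in> Obj (Under A)"
  shows "is_functor (T0 \<theta> a)" "FSrc (T0 \<theta> a) = Map0 G a" "FTgt (T0 \<theta> a) = E"
  using is_cone assms by (auto simp: sigma_cone_def)

lemma T_ext: "T0 \<theta> \<in> extensional (Obj (Under A))" "T1 \<theta> \<in> extensional (Arr (Under A))"
  using is_cone by (auto simp: sigma_cone_def PiE_def)

lemma T1_ntrans [simp]:
  assumes "f \<in> Arr (Under A)"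
  shows "is_ntrans (T1 \<theta> f)" "NSrc (T1 \<theta> f) = T0 \<theta> (Cod (Under A) f) \<cdot>F Map1 G f"
    "NTgt (T1 \<theta> f) = T0 \<theta> (Dom (Under A) f)"
proof -
  have "T1 \<theta> f \<in> hom (Fun (Map0 G (Dom (Under A) f)) E)
          (T0 \<theta> (Cod (Under A) f) \<cdot>F Map1 G f) (T0 \<theta> (Dom (Under A) f))"
    using is_cone assms unfolding sigma_cone_def by blast
  then show "is_ntrans (T1 \<theta> f)" "NSrc (T1 \<theta> f) = T0 \<theta> (Cod (Under A) f) \<cdot>F Map1 G f"
    "NTgt (T1 \<theta> f) = T0 \<theta> (Dom (Under A) f)" by simp_all
qed

lemma Tc_ident [simp]:
  "a \<in> Obj (Under A) \<Longrightarrow> x \<in> Obj (Map0 G a) \<Longrightarrow> Tc (Ident (Under A) a) x = Ident E (To a x)"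
  using is_cone by (auto simp: sigma_cone_def)

lemma Tc_comp [simp]:
  assumes "f \<in> Arr (Under A)" "g \<in> Arr (Under A)" "Cod (Under A) f = Dom (Under A) g"
    "x \<in> Obj (Map0 G (Dom (Under A) f))"
  shows "Tc (g \<odot> f) x = Tc f x \<star> Tc g (Go f x)"
proof -
  have "T1 \<theta> (g \<odot> f) = T1 \<theta> f \<cdot>N (T1 \<theta> g \<cdot>R Map1 G f)"
    using is_cone assms unfolding sigma_cone_def by blast
  then show ?thesis using assms by simp
qed

lemma Tc_cell:
  assumes "\<gamma> \<in> Arr (Cells A)" "x \<in> Obj (Map0 G (Dom (Under A) (Dom (Cells A) \<gamma>)))"
    "b = Cod (Under A) (Dom (Cells A) \<gamma>)"
  shows "Tc (Dom (Cells A) \<gamma>) x = Tc (Cod (Cells A) \<gamma>) x \<star> Ta b (Gc \<gamma> x)"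
proof -
  have "T1 \<theta> (Dom (Cells A) \<gamma>) = T1 \<theta> (Cod (Cells A) \<gamma>) \<cdot>N (T0 \<theta> (cell_tgt A \<gamma>) \<cdot>L Map2 G \<gamma>)"
    using is_cone assms unfolding sigma_cone_def by blast
  then have "Tc (Dom (Cells A) \<gamma>) x = NCmp (T1 \<theta> (Cod (Cells A) \<gamma>) \<cdot>N (T0 \<theta> (cell_tgt A \<gamma>) \<cdot>L Map2 G \<gamma>)) x"
    by simp
  then show ?thesis using assms by (simp add: cell_tgt_def)
qed

lemma Tc_iso [simp]:
  assumes "f \<in> \<Sigma>" "x \<in> Obj (Map0 G (Dom (Under A) f))"
  shows "is_iso E (Tc f x)"
proof -
  have "is_iso (Fun (Map0 G (Dom (Under A) f)) E) (T1 \<theta> f)"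
    using is_cone assms unfolding sigma_cone_def by blast
  then show ?thesis using assms by (subst (asm) is_iso_Fun_iff) auto
qed

lemma Tc_nat:
  assumes "f \<in> Arr (Under A)" "m \<in> Arr (Map0 G a)" "a = Dom (Under A) f" "b = Cod (Under A) f"
  shows "Tc f (Cod (Map0 G a) m) \<star> Ta b (Ga f m) = Ta a m \<star> Tc f (Dom (Map0 G a) m)"
  using ntrans_nat[of "T1 \<theta> f" m E "Map0 G a"] assms by simp

lemma post_cone:
  assumes "is_functor K" "FSrc K = E" "FTgt K = E'"
  shows "sigma_cone A \<Sigma> G E' (post_transf A (\<lambda>_. K) \<theta>)"
proof (rule sigma_coneI)
  show "category E'" using functor_cat(2)[OF assms(1)] assms(3) by simp
  fix \<gamma> x assume a: "\<gamma> \<in> Arr (Cells A)" "x \<in> Obj (Map0 G (Dom (Under A) (Dom (Cells A) \<gamma>)))"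
  show "NCmp (T1 (post_transf A (\<lambda>_. K) \<theta>) (Dom (Cells A) \<gamma>)) x =
       NCmp (T1 (post_transf A (\<lambda>_. K) \<theta>) (Cod (Cells A) \<gamma>)) x \<cdot>\<^bsub>E'\<^esub>
       FArr (T0 (post_transf A (\<lambda>_. K) \<theta>) (Cod (Under A) (Dom (Cells A) \<gamma>))) (Gc \<gamma> x)"
    using a assms by (simp add: post_transf_def Tc_cell)
qed (use assms in \<open>simp_all add: post_transf_def\<close>)

lemma post_transf_fcomp:
  assumes "is_functor H" "FSrc H = E" "is_functor K" "FSrc K = FTgt H"
  shows "post_transf A (\<lambda>_. K \<cdot>F H) \<theta> = post_transf A (\<lambda>_. K) (post_transf A (\<lambda>_. H) \<theta>)"
  using assms by (auto simp: post_transf_def restrict_def fcomp_whisker_left fun_eq_iff)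

lemma post_transf_idf: "post_transf A (\<lambda>_. idf E) \<theta> = \<theta>"
  by (rule transf.equality) (auto simp: post_transf_def intro!: extensionalityI[OF _ T_ext(1)] extensionalityI[OF _ T_ext(2)])

subsection \<open>Fractions\<close>

text \<open>\<open>frac m x y u v f\<close> says that \<open>m = \<theta>\<^sub>v \<theta>(f) \<theta>\<^sub>u\<^sup>-\<^sup>1\<close>.\<close>

definition frac where
  "frac m x y u v f \<longleftrightarrow> u \<in> \<Sigma> \<and> v \<in> \<Sigma> \<and> Cod (Under A) v = Cod (Under A) u \<and>
     x \<in> Obj (Map0 G (Dom (Under A) u)) \<and> y \<in> Obj (Map0 G (Dom (Under A) v)) \<and>
     f \<in> hom (Map0 G (Cod (Under A) u)) (Go u x) (Go v y) \<and>
     m \<in> hom E (To (Dom (Under A) u) x) (To (Dom (Under A) v) y) \<and>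
     m \<star> Tc u x = Tc v y \<star> Ta (Cod (Under A) u) f"

lemma fracD:
  assumes "frac m x y u v f"
  shows "u \<in> \<Sigma>" "v \<in> \<Sigma>" "Cod (Under A) v = Cod (Under A) u"
    "x \<in> Obj (Map0 G (Dom (Under A) u))" "y \<in> Obj (Map0 G (Dom (Under A) v))"
    "f \<in> Arr (Map0 G (Cod (Under A) u))" "Dom (Map0 G (Cod (Under A) u)) f = Go u x"
    "Cod (Map0 G (Cod (Under A) u)) f = Go v y"
    "m \<in> Arr E" "Dom E m = To (Dom (Under A) u) x" "Cod E m = To (Dom (Under A) v) y"
    "m \<star> Tc u x = Tc v y \<star> Ta (Cod (Under A) u) f"
  using assms by (auto simp: frac_def)

lemma frac_eq:
  assumes "frac m x y u v f"
  shows "m = (Tc v y \<star> Ta (Cod (Under A) u) f) \<star> cinv E (Tc u x)"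
  using fracD[OF assms] fracD(12)[OF assms, symmetric] by (simp add: cat_assoc cinv_props)

text \<open>Naturality of \<open>\<theta>\<^sub>h\<close> slides \<open>f\<close> to its image under
  \<open>G(h)\<close>, and the cone law splits the leg of a composite. A fraction can thus be
  re-expressed at any later stage.\<close>

lemma frac_ext:
  assumes "frac m x y u v f" "h \<in> \<Sigma>" "Dom (Under A) h = Cod (Under A) u"
  shows "frac m x y (h \<odot> u) (h \<odot> v) (Ga h f)"
proof -
  note d = fracD[OF assms(1)]
  have n: "Tc h (Go v y) \<star> Ta (Cod (Under A) h) (Ga h f) = Ta (Cod (Under A) u) f \<star> Tc h (Go u x)"
    using Tc_nat[OF Sigma_arr[OF assms(2)] d(6) assms(3)[symmetric] refl] unfolding d(7,8) .
  have "m \<star> (Tc u x \<star> Tc h (Go u x)) = (m \<star> Tc u x) \<star> Tc h (Go u x)"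
    using d(1-11) assms by (simp add: cat_assoc)
  also have "\<dots> = Tc v y \<star> (Tc h (Go v y) \<star> Ta (Cod (Under A) h) (Ga h f))"
    unfolding d(12) n using d(1-11) assms by (simp add: cat_assoc)
  finally have e: "m \<star> (Tc u x \<star> Tc h (Go u x)) = Tc v y \<star> (Tc h (Go v y) \<star> Ta (Cod (Under A) h) (Ga h f))" .
  have "m \<star> Tc (h \<odot> u) x = Tc (h \<odot> v) y \<star> Ta (Cod (Under A) h) (Ga h f)"
    using d(1-11) assms(2,3) by (simp add: cat_assoc e)
  then show ?thesis unfolding frac_def using d(1-11) assms(2,3) by simp
qed

text \<open>With the inner legs linked by \<open>\<zeta> : v \<Rightarrow> u'\<close>, the cone law
  gives \<open>\<theta>\<^sub>v = \<theta>\<^sub>u\<^sub>' \<theta>(\<zeta>\<^sub>y)\<close>, so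
  they cancel up to one more arrow in the value of \<open>G\<close> at the common codomain. The
  direction of \<open>\<zeta>\<close> is what matters, not its invertibility.\<close>

lemma frac_comp':
  assumes m: "frac m x y u v f" and n: "frac n y z u' v' g" and c: "Cod (Under A) u' = Cod (Under A) u"
    and \<zeta>: "\<zeta> \<in> Arr (Cells A)" "Dom (Cells A) \<zeta> = v" "Cod (Cells A) \<zeta> = u'"
  shows "\<exists>k. frac (n \<star> m) x z u v' k"
proof -
  note d = fracD[OF m] and e = fracD[OF n]
  let ?c = "Cod (Under A) u"
  let ?k = "g \<cdot>\<^bsub>Map0 G ?c\<^esub> (Gc \<zeta> y \<cdot>\<^bsub>Map0 G ?c\<^esub> f)"
  have v: "Dom (Under A) u' = Dom (Under A) v" using \<zeta> two_cat_cell(3)[OF twoA \<zeta>(1)] by simp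
  have z: "Tc v y = Tc u' y \<star> Ta ?c (Gc \<zeta> y)" using Tc_cell[of \<zeta> y ?c] \<zeta> d by simp
  have [simp]: "Cod (Under A) u' = ?c" "Cod (Under A) v' = ?c" using c e by auto
  have "(n \<star> m) \<star> Tc u x = n \<star> (m \<star> Tc u x)" using d(1-11) e(1-11) v by (simp add: cat_assoc)
  also have "\<dots> = (n \<star> Tc u' y) \<star> (Ta ?c (Gc \<zeta> y) \<star> Ta ?c f)"
    unfolding d(12) z using d(1-11) e(1-11) v \<zeta> by (simp add: cat_assoc)
  also have "\<dots> = Tc v' z \<star> Ta ?c ?k"
    unfolding e(12) using d(1-11) e(1-11) v \<zeta> by (simp add: cat_assoc)
  finally have "frac (n \<star> m) x z u v' ?k"
    unfolding frac_def using d(1-11) e(1-11) v \<zeta> by simp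
  then show ?thesis ..
qed

text \<open>An Ore square brings the inner legs \<open>v\<close> and \<open>u'\<close> into the
  linked position required by \<open>frac_comp'\<close>.\<close>

lemma frac_comp:
  assumes m: "frac m x y u v f" and n: "frac n y z u' v' g" and c: "Dom (Under A) u' = Dom (Under A) v"
  shows "\<exists>U V k. frac (n \<star> m) x z U V k \<and> Dom (Under A) U = Dom (Under A) u \<and> Dom (Under A) V = Dom (Under A) v'"
proof -
  note d = fracD[OF m] and e = fracD[OF n]
  obtain r s \<zeta> where r: "r \<in> \<Sigma>" "s \<in> \<Sigma>" "Dom (Under A) r = Cod (Under A) v"
    "Dom (Under A) s = Cod (Under A) u'" "Cod (Under A) s = Cod (Under A) r"
    "\<zeta> \<in> Arr (Cells A)" "Dom (Cells A) \<zeta> = r \<odot> v" "Cod (Cells A) \<zeta> = s \<odot> u'"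
    by (rule ore[of v u']) (use d e c in auto)
  have "\<exists>k. frac (n \<star> m) x z (r \<odot> u) (s \<odot> v') k"
    by (rule frac_comp'[of _ _ _ _ "r \<odot> v" "Ga r f" _ _ "s \<odot> u'" _ "Ga s g" \<zeta>])
      (use r d e frac_ext[OF m, of r] frac_ext[OF n, of s] in auto)
  then show ?thesis using r d e by (intro exI[of _ "r \<odot> u"] exI[of _ "s \<odot> v'"]) auto
qed

text \<open>Passing to isomorphic legs conjugates the representative by the components of the
  2-cells; since \<open>u\<close> enters inverted, it is the inverse of \<open>\<zeta>\<close> that
  appears at the source.\<close>

lemma frac_cell:
  assumes m: "frac m x y u v f" and \<zeta>: "is_iso (Cells A) \<zeta>" "Dom (Cells A) \<zeta> = u" "Cod (Cells A) \<zeta> = u'" "u' \<in> \<Sigma>"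
    and \<xi>: "is_iso (Cells A) \<xi>" "Dom (Cells A) \<xi> = v" "Cod (Cells A) \<xi> = v'" "v' \<in> \<Sigma>"
  shows "\<exists>f'. frac m x y u' v' f'"
proof -
  let ?c = "Cod (Under A) u"
  note d = fracD[OF m]
  note z = cinv_props(6)[OF \<zeta>(1)] cinv_props(6)[OF \<xi>(1)]
  have b [simp]: "Cod (Under A) u' = ?c" "Cod (Under A) v' = ?c" "Dom (Under A) u' = Dom (Under A) u"
    "Dom (Under A) v' = Dom (Under A) v" "\<zeta> \<in> Arr (Cells A)" "\<xi> \<in> Arr (Cells A)"
    using two_cat_cell(3,4)[OF twoA z(1)] two_cat_cell(3,4)[OF twoA z(2)] \<zeta> \<xi> d z by simp_all
  note [simp] = \<zeta> \<xi> d(1-11)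
  have i [simp]: "is_iso (Map0 G ?c) (Gc \<zeta> x)" by simp
  have u: "Tc u' x = Tc u x \<star> Ta ?c (cinv (Map0 G ?c) (Gc \<zeta> x))"
  proof -
    have "Tc u x = Tc u' x \<star> Ta ?c (Gc \<zeta> x)" using Tc_cell[of \<zeta> x ?c] by simp
    then have "Tc u x \<star> Ta ?c (cinv (Map0 G ?c) (Gc \<zeta> x))
        = Tc u' x \<star> (Ta ?c (Gc \<zeta> x) \<star> Ta ?c (cinv (Map0 G ?c) (Gc \<zeta> x)))"
      by (simp add: cat_assoc)
    also have "Ta ?c (Gc \<zeta> x) \<star> Ta ?c (cinv (Map0 G ?c) (Gc \<zeta> x))
        = Ta ?c (Gc \<zeta> x \<cdot>\<^bsub>Map0 G ?c\<^esub> cinv (Map0 G ?c) (Gc \<zeta> x))" by (simp del: cinv_props(5))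
    finally show ?thesis by simp
  qed
  have v: "Tc v y = Tc v' y \<star> Ta ?c (Gc \<xi> y)" using Tc_cell[of \<xi> y ?c] by simp
  let ?f = "Gc \<xi> y \<cdot>\<^bsub>Map0 G ?c\<^esub> (f \<cdot>\<^bsub>Map0 G ?c\<^esub> cinv (Map0 G ?c) (Gc \<zeta> x))"
  have "m \<star> Tc u' x = (m \<star> Tc u x) \<star> Ta ?c (cinv (Map0 G ?c) (Gc \<zeta> x))"
    unfolding u by (simp add: cat_assoc)
  also have "\<dots> = Tc v' y \<star> Ta ?c ?f"
    unfolding d(12) v by (simp add: cat_assoc)
  finally have "frac m x y u' v' ?f" unfolding frac_def by simp
  then show ?thesis ..
qed

text \<open>\<open>merge\<close> makes the old and the prescribed legs isomorphic after composition,
  and the representative is carried along. This is how fractions found independently are put over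
  the same legs; with both prescribed legs equal, an arrow between objects of one index becomes a
  fraction with two equal legs.\<close>

lemma frac_legs:
  assumes m: "frac m x y u v f" and u: "u' \<in> \<Sigma>" "v' \<in> \<Sigma>" "Cod (Under A) v' = Cod (Under A) u'"
    "Dom (Under A) u' = Dom (Under A) u" "Dom (Under A) v' = Dom (Under A) v"
  obtains h f' where "h \<in> \<Sigma>" "Dom (Under A) h = Cod (Under A) u'" "frac m x y (h \<odot> u') (h \<odot> v') f'"
proof -
  note d = fracD[OF m]
  obtain r s \<zeta> \<xi> where r: "r \<in> \<Sigma>" "s \<in> \<Sigma>" "Dom (Under A) r = Cod (Under A) u"
    "Dom (Under A) s = Cod (Under A) u'" "Cod (Under A) s = Cod (Under A) r"
    "is_iso (Cells A) \<zeta>" "Dom (Cells A) \<zeta> = r \<odot> u" "Cod (Cells A) \<zeta> = s \<odot> u'"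
    "is_iso (Cells A) \<xi>" "Dom (Cells A) \<xi> = r \<odot> v" "Cod (Cells A) \<xi> = s \<odot> v'"
    by (rule merge[of u v u' v']) (use d u in auto)
  obtain f' where "frac m x y (s \<odot> u') (s \<odot> v') f'"
    using frac_cell[OF frac_ext[OF m, of r], of \<zeta> "s \<odot> u'" \<xi> "s \<odot> v'"] r u d by auto
  then show ?thesis using that r by blast
qed

lemma frac_arr:
  assumes "a \<in> Obj (Under A)" "f \<in> Arr (Map0 G a)"
  shows "frac (Ta a f) (Dom (Map0 G a) f) (Cod (Map0 G a) f) (Ident (Under A) a) (Ident (Under A) a) f"
  using assms by (simp add: frac_def)

text \<open>Structure cells exist for arbitrary \<open>h\<close>, but fractions only have legs in
  \<open>\<Sigma>\<close>. An Ore square of \<open>h\<close> against an identity gives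
  \<open>\<zeta> : r h \<Rightarrow> s\<close> with \<open>r\<close>, \<open>s\<close> in
  \<open>\<Sigma>\<close>, and \<open>\<theta>\<^sub>h \<theta>\<^sub>r = \<theta>\<^sub>s
  \<theta>(\<zeta>\<^sub>x)\<close> presents \<open>\<theta>\<^sub>h\<close>. For \<open>h\<close>
  in \<open>\<Sigma>\<close> the cell is invertible, and the same equation solved for the inverse of
  \<open>\<theta>\<^sub>h\<close> presents that inverse.\<close>

lemma frac_leg:
  assumes "h \<in> Arr (Under A)" "x \<in> Obj (Map0 G (Dom (Under A) h))"
  shows "\<exists>u v f. frac (Tc h x) (Go h x) x u v f \<and> Dom (Under A) u = Cod (Under A) h \<and> Dom (Under A) v = Dom (Under A) h"
    and "h \<in> \<Sigma> \<Longrightarrow> \<exists>u v f. frac (cinv E (Tc h x)) x (Go h x) u v f \<and>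
      Dom (Under A) u = Dom (Under A) h \<and> Dom (Under A) v = Cod (Under A) h"
proof -
  obtain r s \<zeta> where r: "r \<in> \<Sigma>" "s \<in> \<Sigma>" "Dom (Under A) r = Cod (Under A) h"
    "Dom (Under A) s = Dom (Under A) h" "Cod (Under A) s = Cod (Under A) r"
    and \<zeta>: "\<zeta> \<in> Arr (Cells A)" "Dom (Cells A) \<zeta> = r \<odot> h" "Cod (Cells A) \<zeta> = s"
    and i: "h \<in> \<Sigma> \<Longrightarrow> is_iso (Cells A) \<zeta>"
    by (rule ore[of h "Ident (Under A) (Dom (Under A) h)"]) (use assms in auto)
  note [simp] = r \<zeta> assms
  let ?c = "Cod (Under A) r"
  have e: "Tc h x \<star> Tc r (Go h x) = Tc s x \<star> Ta ?c (Gc \<zeta> x)"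
    using Tc_cell[of \<zeta> x ?c] by simp
  then have "frac (Tc h x) (Go h x) x r s (Gc \<zeta> x)" by (simp add: frac_def)
  then show "\<exists>u v f. frac (Tc h x) (Go h x) x u v f \<and> Dom (Under A) u = Cod (Under A) h \<and> Dom (Under A) v = Dom (Under A) h"
    using r by blast
  assume h [simp]: "h \<in> \<Sigma>"
  note i [simp]
  have gi [simp]: "is_iso (Map0 G ?c) (Gc \<zeta> x)" by simp
  have "cinv E (Tc h x) \<star> Tc s x = Tc r (Go h x) \<star> Ta ?c (cinv (Map0 G ?c) (Gc \<zeta> x))"
  proof (rule iso_epi[of E "Ta ?c (Gc \<zeta> x)"])
    have "(Tc r (Go h x) \<star> Ta ?c (cinv (Map0 G ?c) (Gc \<zeta> x))) \<star> Ta ?c (Gc \<zeta> x)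
       = Tc r (Go h x) \<star> Ta ?c (cinv (Map0 G ?c) (Gc \<zeta> x) \<cdot>\<^bsub>Map0 G ?c\<^esub> Gc \<zeta> x)"
      by (simp add: cat_assoc del: cinv_props(4))
    also have "\<dots> = Tc r (Go h x)" by simp
    also have "\<dots> = cinv E (Tc h x) \<star> (Tc h x \<star> Tc r (Go h x))" by (simp add: cinv_cancel)
    finally show "(cinv E (Tc h x) \<star> Tc s x) \<star> Ta ?c (Gc \<zeta> x)
      = (Tc r (Go h x) \<star> Ta ?c (cinv (Map0 G ?c) (Gc \<zeta> x))) \<star> Ta ?c (Gc \<zeta> x)"
      unfolding e by (simp add: cat_assoc)
  qed simp_all
  then have "frac (cinv E (Tc h x)) x (Go h x) s r (cinv (Map0 G ?c) (Gc \<zeta> x))"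
    by (simp add: frac_def)
  then show "\<exists>u v f. frac (cinv E (Tc h x)) x (Go h x) u v f \<and>
      Dom (Under A) u = Dom (Under A) h \<and> Dom (Under A) v = Cod (Under A) h"
    using r by blast
qed

text \<open>With equal legs throughout, representatives compose on the nose and no new stage is
  needed. An equation between arrows of the vertex thereby becomes a comparison of two
  representatives at one stage.\<close>

lemma frac_same_comp:
  assumes m: "frac m x y u u f" and n: "frac n y z u u g"
  shows "frac (n \<star> m) x z u u (g \<cdot>\<^bsub>Map0 G (Cod (Under A) u)\<^esub> f)"
proof -
  note d = fracD[OF m] and e = fracD[OF n]
  have "(n \<star> m) \<star> Tc u x = n \<star> (m \<star> Tc u x)" using d(1-11) e(1-11) by (simp add: cat_assoc)
  also have "\<dots> = (n \<star> Tc u y) \<star> Ta (Cod (Under A) u) f"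
    unfolding d(12) using d(1-11) e(1-11) by (simp add: cat_assoc)
  also have "\<dots> = Tc u z \<star> Ta (Cod (Under A) u) (g \<cdot>\<^bsub>Map0 G (Cod (Under A) u)\<^esub> f)"
    unfolding e(12) using d(1-11) e(1-11) by (simp add: cat_assoc)
  finally show ?thesis unfolding frac_def using d(1-11) e(1-11) by simp
qed

lemma frac_same_arr:
  assumes "u \<in> \<Sigma>" "a = Dom (Under A) u" "f \<in> Arr (Map0 G a)"
  shows "frac (Ta a f) (Dom (Map0 G a) f) (Cod (Map0 G a) f) u u (Ga u f)"
proof -
  have a: "a \<in> Obj (Under A)" and d: "Dom (Under A) u = Cod (Under A) (Ident (Under A) a)"
    and e: "u \<odot> Ident (Under A) a = u" using assms by simp_all
  show ?thesis using frac_ext[OF frac_arr[OF a assms(3)] assms(1) d] unfolding e .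
qed

text \<open>Cancelling the invertible leg leaves equality of images under the cone. Passing from
  there to equality in \<open>G\<close> at a later stage is the content of
  \<open>colim_arr_eq\<close>, for the universal cone.\<close>

lemma frac_same_unique:
  assumes m: "frac m x y u u f" and n: "frac m x y u u g"
  shows "Ta (Cod (Under A) u) f = Ta (Cod (Under A) u) g"
proof -
  note d = fracD[OF m] and e = fracD[OF n]
  have "Tc u y \<star> Ta (Cod (Under A) u) f = Tc u y \<star> Ta (Cod (Under A) u) g" using d(12) e(12) by simp
  from iso_mono[OF catE _ _ _ _ _ this] show ?thesis using d(1-11) e(1-11) by simp
qed

lemma Ta_eq_Ga:
  assumes u: "u \<in> \<Sigma>" "Dom (Under A) u = a" and f: "f \<in> Arr (Map0 G a)" "g \<in> Arr (Map0 G a)"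
    "Dom (Map0 G a) g = Dom (Map0 G a) f" "Cod (Map0 G a) g = Cod (Map0 G a) f" and e: "Ta a f = Ta a g"
  shows "Ta (Cod (Under A) u) (Ga u f) = Ta (Cod (Under A) u) (Ga u g)"
  using frac_same_unique[OF frac_same_arr[OF u(1) u(2)[symmetric] f(1)]]
    frac_same_arr[OF u(1) u(2)[symmetric] f(2)] f(3,4) e by simp

text \<open>The invertible leg \<open>\<theta>\<^sub>u\<close> relates the image of an arrow at
  \<open>a\<close> to that of its push along \<open>u\<close>, so arrows identified at a later stage
  have equal images.\<close>

lemma Ga_eq_Ta:
  assumes u: "u \<in> \<Sigma>" "Dom (Under A) u = a" and f: "f \<in> Arr (Map0 G a)" "g \<in> Arr (Map0 G a)"
    "Dom (Map0 G a) g = Dom (Map0 G a) f" "Cod (Map0 G a) g = Cod (Map0 G a) f" and e: "Ga u f = Ga u g"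
  shows "Ta a f = Ta a g"
proof -
  have "Ta a f \<star> Tc u (Dom (Map0 G a) f) = Ta a g \<star> Tc u (Dom (Map0 G a) f)"
    using Tc_nat[OF Sigma_arr[OF u(1)] f(1) u(2)[symmetric] refl]
      Tc_nat[OF Sigma_arr[OF u(1)] f(2) u(2)[symmetric] refl] unfolding f(3,4) e by (rule trans[OF sym])
  note eq = this
  have a: "a \<in> Obj (Under A)" using u by auto
  have i: "is_iso E (Tc u (Dom (Map0 G a) f))" by (rule Tc_iso[OF u(1)]) (use u(2) f(1) a in simp)
  have c: "Cod E (Tc u (Dom (Map0 G a) f)) = To a (Dom (Map0 G a) f)" using u f(1) a by simp
  have d: "Dom E (Ta a g) = To a (Dom (Map0 G a) f)" using f(2,3) a by simp
  show ?thesis by (rule iso_epi[OF catE i _ _ _ _ eq]) (use f(1,2) a in \<open>simp_all add: c d\<close>)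
qed

subsection \<open>The category of fractions of a cone\<close>

text \<open>Objects keep their index, so that a functor into \<open>Fr\<close> returns coordinates.
  An arrow consists of its endpoints and an arrow of \<open>E\<close> for which some presentation
  exists; the presentation itself is not part of the data, so no quotient is taken and composition
  is that of \<open>E\<close>.\<close>

definition Fr :: "('a \<times> 'o, ('a \<times> 'o) \<times> 'n \<times> ('a \<times> 'o)) cat" where
  "Fr = \<lparr>Obj = {(a, x). a \<in> Obj (Under A) \<and> x \<in> Obj (Map0 G a)},
    Arr = {((a, x), m, (b, y)). \<exists>u v f. frac m x y u v f \<and> Dom (Under A) u = a \<and> Dom (Under A) v = b},
    Dom = fst, Cod = snd \<circ> snd, Ident = (\<lambda>p. (p, Ident E (To (fst p) (snd p)), p)),
    Comp = (\<lambda>q p. (fst p, fst (snd q) \<star> fst (snd p), snd (snd q)))\<rparr>"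

lemma Fr_arrE:
  assumes "p \<in> Arr Fr"
  obtains a x m b y u v f where "p = ((a, x), m, (b, y))" "frac m x y u v f" "a = Dom (Under A) u" "b = Dom (Under A) v"
    "a \<in> Obj (Under A)" "b \<in> Obj (Under A)" "x \<in> Obj (Map0 G a)" "y \<in> Obj (Map0 G b)"
    "m \<in> Arr E" "Dom E m = To a x" "Cod E m = To b y"
proof -
  from assms obtain a x m b y u v f where p: "p = ((a, x), m, (b, y))" "frac m x y u v f"
    "Dom (Under A) u = a" "Dom (Under A) v = b" unfolding Fr_def by auto
  show ?thesis by (rule that[OF p(1,2) p(3,4)[symmetric]]) (use fracD[OF p(2)] p in auto)
qed

lemma Fr_sel [simp]: "(a, x) \<in> Obj Fr \<longleftrightarrow> a \<in> Obj (Under A) \<and> x \<in> Obj (Map0 G a)"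
  "Dom Fr p = fst p" "Cod Fr p = snd (snd p)" "Ident Fr z = (z, Ident E (To (fst z) (snd z)), z)"
  "Comp Fr q p = (fst p, fst (snd q) \<star> fst (snd p), snd (snd q))"
  by (auto simp: Fr_def)

lemma Fr_cat [simp]: "category Fr"
proof (rule categoryI)
  fix p assume "p \<in> Arr Fr"
  then show "Dom Fr p \<in> Obj Fr" "Cod Fr p \<in> Obj Fr"
    "Comp Fr p (Ident Fr (Dom Fr p)) = p" "Comp Fr (Ident Fr (Cod Fr p)) p = p"
    by (auto elim!: Fr_arrE)
next
  fix p assume "p \<in> Obj Fr"
  then obtain a x where p: "p = (a, x)" "a \<in> Obj (Under A)" "x \<in> Obj (Map0 G a)" by (cases p) auto
  show "Ident Fr p \<in> Arr Fr \<and> Dom Fr (Ident Fr p) = p \<and> Cod Fr (Ident Fr p) = p"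
    using p frac_arr[of a "Ident (Map0 G a) x"] by (auto simp: Fr_def intro!: exI)
next
  fix p q assume pq: "p \<in> Arr Fr" "q \<in> Arr Fr" "Cod Fr p = Dom Fr q"
  then show "Comp Fr q p \<in> Arr Fr \<and> Dom Fr (Comp Fr q p) = Dom Fr p \<and> Cod Fr (Comp Fr q p) = Cod Fr q"
  proof -
    obtain a x m b y u v f where p: "p = ((a, x), m, (b, y))" "frac m x y u v f"
      "a = Dom (Under A) u" "b = Dom (Under A) v" using pq(1) by (rule Fr_arrE)
    obtain b' y' n c z u' v' g where q: "q = ((b', y'), n, (c, z))" "frac n y' z u' v' g"
      "b' = Dom (Under A) u'" "c = Dom (Under A) v'" using pq(2) by (rule Fr_arrE)
    have e: "b' = b" "y' = y" using pq(3) p q by simp_all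
    have "Dom (Under A) u' = Dom (Under A) v" using e p q by simp
    from frac_comp[OF p(2) q(2)[unfolded e] this] show ?thesis
      using p q e by (auto simp: Fr_def)
  qed
next
  fix f g h assume "f \<in> Arr Fr" "g \<in> Arr Fr" "h \<in> Arr Fr" "Cod Fr f = Dom Fr g" "Cod Fr g = Dom Fr h"
  then show "Comp Fr h (Comp Fr g f) = Comp Fr (Comp Fr h g) f"
    by (auto elim!: Fr_arrE simp: cat_assoc)
qed

definition Fr_incl where "Fr_incl = mkF Fr E (\<lambda>p. To (fst p) (snd p)) (\<lambda>p. fst (snd p))"

lemma Fr_incl [simp]: "is_functor Fr_incl" "FSrc Fr_incl = Fr" "FTgt Fr_incl = E"
proof -
  show "is_functor Fr_incl" unfolding Fr_incl_def
  proof (rule is_functor_mkF)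
    fix p q assume "p \<in> Arr Fr" "q \<in> Arr Fr"
    then show "fst (snd (q \<cdot>\<^bsub>Fr\<^esub> p)) = fst (snd q) \<star> fst (snd p)" by simp
  qed (auto elim!: Fr_arrE)
qed (simp_all add: Fr_incl_def)

definition Fr_cone :: "('a, 'f, 'o, 'm, 'a \<times> 'o, ('a \<times> 'o) \<times> 'n \<times> ('a \<times> 'o)) transf" where
  "Fr_cone = (let t = (\<lambda>a. mkF (Map0 G a) Fr (Pair a) (\<lambda>m. ((a, Dom (Map0 G a) m), Ta a m, (a, Cod (Map0 G a) m))))
    in \<lparr>T0 = restrict t (Obj (Under A)),
      T1 = (\<lambda>f\<in>Arr (Under A). mkN (t (Cod (Under A) f) \<cdot>F Map1 G f) (t (Dom (Under A) f))
         (\<lambda>x. ((Cod (Under A) f, Go f x), Tc f x, (Dom (Under A) f, x))))\<rparr>)"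

text \<open>The structure cells are those of \<open>\<theta>\<close> with endpoints attached. They
  lie in \<open>Fr\<close> by the first part of \<open>frac_leg\<close>; for arrows of
  \<open>\<Sigma>\<close> their inverses lie there by the second part, which is what makes this a
  \<open>\<sigma>\<close>-cone.\<close>

lemma Fr_cone: "sigma_cone A \<Sigma> G Fr Fr_cone"
proof -
  let ?t = "\<lambda>a. mkF (Map0 G a) Fr (Pair a) (\<lambda>m. ((a, Dom (Map0 G a) m), Ta a m, (a, Cod (Map0 G a) m)))"
  have t [simp]: "is_functor (?t a)" if "a \<in> Obj (Under A)" for a
  proof (rule is_functor_mkF)
    fix m assume "m \<in> Arr (Map0 G a)"
    then show "((a, Dom (Map0 G a) m), Ta a m, (a, Cod (Map0 G a) m)) \<in> Arr Fr \<and>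
       Dom Fr ((a, Dom (Map0 G a) m), Ta a m, (a, Cod (Map0 G a) m)) = (a, Dom (Map0 G a) m) \<and>
       Cod Fr ((a, Dom (Map0 G a) m), Ta a m, (a, Cod (Map0 G a) m)) = (a, Cod (Map0 G a) m)"
      using frac_arr[OF that, of m] that by (auto simp: Fr_def intro!: exI)
  qed (use that in simp_all)
  have arr: "((Cod (Under A) f, Go f x), Tc f x, (Dom (Under A) f, x)) \<in> Arr Fr"
    if "f \<in> Arr (Under A)" "x \<in> Obj (Map0 G (Dom (Under A) f))" for f x
    using frac_leg(1)[OF that] by (auto simp: Fr_def)
  have n [simp]: "is_ntrans (mkN (?t (Cod (Under A) f) \<cdot>F Map1 G f) (?t (Dom (Under A) f))
         (\<lambda>x. ((Cod (Under A) f, Go f x), Tc f x, (Dom (Under A) f, x))))" if f: "f \<in> Arr (Under A)" for f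
    by (rule is_ntrans_mkN[where C="Map0 G (Dom (Under A) f)" and D=Fr])
      (use f arr[OF f] Tc_nat[OF f _ refl refl] in simp_all)
  show ?thesis
  proof (rule sigma_coneI)
    fix f x assume fx: "f \<in> \<Sigma>" "x \<in> Obj (Map0 G (Dom (Under A) f))"
    then have "((Dom (Under A) f, x), cinv E (Tc f x), (Cod (Under A) f, Go f x)) \<in> Arr Fr"
      using frac_leg(2)[of f x] by (auto simp: Fr_def)
    moreover have "NCmp (T1 Fr_cone f) x = ((Cod (Under A) f, Go f x), Tc f x, (Dom (Under A) f, x))"
      using fx by (simp add: Fr_cone_def Let_def)
    ultimately show "is_iso Fr (NCmp (T1 Fr_cone f) x)"
      using fx arr[of f x]
      by (intro is_isoI[of _ _ "((Dom (Under A) f, x), cinv E (Tc f x), (Cod (Under A) f, Go f x))"]) simp_all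
  next
    fix \<gamma> x assume "\<gamma> \<in> Arr (Cells A)" "x \<in> Obj (Map0 G (Dom (Under A) (Dom (Cells A) \<gamma>)))"
    then show "NCmp (T1 Fr_cone (Dom (Cells A) \<gamma>)) x = NCmp (T1 Fr_cone (Cod (Cells A) \<gamma>)) x \<cdot>\<^bsub>Fr\<^esub>
        FArr (T0 Fr_cone (Cod (Under A) (Dom (Cells A) \<gamma>))) (Gc \<gamma> x)"
      by (simp add: Fr_cone_def Let_def Tc_cell)
  qed (simp_all add: Fr_cone_def Let_def)
qed

lemma post_Fr_incl: "post_transf A (\<lambda>_. Fr_incl) Fr_cone = \<theta>"
proof -
  interpret F: cone A \<Sigma> G Fr Fr_cone
    by (intro cone.intro filtered_diagram_axioms cone_axioms.intro Fr_cat Fr_cone)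
  have e0: "T0 (post_transf A (\<lambda>_. Fr_incl) Fr_cone) a = T0 \<theta> a" if "a \<in> Obj (Under A)" for a
  proof (rule functor_eqI)
    fix m assume "m \<in> Arr (FSrc (T0 \<theta> a))"
    then have m: "m \<in> Arr (Map0 G a)" using that by simp
    then have "((a, Dom (Map0 G a) m), Ta a m, (a, Cod (Map0 G a) m)) \<in> Arr Fr"
      using frac_arr[OF that m] that by (auto simp: Fr_def intro!: exI)
    then show "FArr (T0 (post_transf A (\<lambda>_. Fr_incl) Fr_cone) a) m = FArr (T0 \<theta> a) m"
      using m that F.T0_functor[OF that] by (simp add: post_transf_def) (simp add: Fr_cone_def Let_def Fr_incl_def)
  next
    fix x assume "x \<in> Obj (FSrc (T0 \<theta> a))"
    then show "FObj (T0 (post_transf A (\<lambda>_. Fr_incl) Fr_cone) a) x = FObj (T0 \<theta> a) x"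
      using that F.T0_functor[OF that] by (simp add: post_transf_def) (simp add: Fr_cone_def Let_def Fr_incl_def)
  qed (use that in \<open>simp_all add: post_transf_def\<close>)
  have e1: "T1 (post_transf A (\<lambda>_. Fr_incl) Fr_cone) f = T1 \<theta> f" if f: "f \<in> Arr (Under A)" for f
  proof (rule ntrans_eqI)
    have "T0 (post_transf A (\<lambda>_. Fr_incl) Fr_cone) (Cod (Under A) f) = T0 \<theta> (Cod (Under A) f)"
      "T0 (post_transf A (\<lambda>_. Fr_incl) Fr_cone) (Dom (Under A) f) = T0 \<theta> (Dom (Under A) f)" using f e0 by simp_all
    then have *: "Fr_incl \<cdot>F T0 Fr_cone (Cod (Under A) f) = T0 \<theta> (Cod (Under A) f)"
       "Fr_incl \<cdot>F T0 Fr_cone (Dom (Under A) f) = T0 \<theta> (Dom (Under A) f)"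
      using f by (simp_all add: post_transf_def)
    show "NSrc (T1 (post_transf A (\<lambda>_. Fr_incl) Fr_cone) f) = NSrc (T1 \<theta> f)"
      "NTgt (T1 (post_transf A (\<lambda>_. Fr_incl) Fr_cone) f) = NTgt (T1 \<theta> f)"
      using f by (simp_all add: post_transf_def *[symmetric])
    fix x assume "x \<in> Obj (FSrc (NSrc (T1 \<theta> f)))"
    then show "NCmp (T1 (post_transf A (\<lambda>_. Fr_incl) Fr_cone) f) x = NCmp (T1 \<theta> f) x"
      using f F.T1_ntrans[OF f] frac_leg(1)[OF f, of x]
      by (auto simp: post_transf_def Fr_incl_def mkF_def Fr_cone_def Let_def Fr_def)
  qed (use f in \<open>simp_all add: post_transf_def\<close>)
  have p: "T0 (post_transf A (\<lambda>_. Fr_incl) Fr_cone) \<in> extensional (Obj (Under A))"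
    "T1 (post_transf A (\<lambda>_. Fr_incl) Fr_cone) \<in> extensional (Arr (Under A))"
    by (simp_all add: post_transf_def)
  show ?thesis
    by (rule transf.equality)
      (use p e0 e1 T_ext in \<open>auto intro: extensionalityI\<close>)
qed

text \<open>By \<open>frac_eq\<close> an arrow of \<open>Fr\<close> is determined by its endpoints,
  legs and representative, so seven parameters over the types of \<open>A\<close> and
  \<open>G\<close> enumerate all arrows. The arrow type of \<open>E\<close>, which may be
  arbitrarily large, does not enter the bound.\<close>

lemma Fr_small:
  assumes "inj (c :: 'a \<times> 'o \<times> 'f \<times> 'f \<times> 'm \<times> 'a \<times> 'o \<Rightarrow> 'u)"
  shows "\<exists>d :: ('a \<times> 'o) \<times> 'n \<times> ('a \<times> 'o) \<Rightarrow> 'u. inj_on d (Arr Fr)"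
proof -
  define k :: "'a \<times> 'o \<times> 'f \<times> 'f \<times> 'm \<times> 'a \<times> 'o \<Rightarrow> _" where "k = (\<lambda>(a, x, u, v, f, b, y). ((a, x), (Tc v y \<star> Ta (Cod (Under A) u) f) \<star> cinv E (Tc u x), (b, y)))"
  have "Arr Fr \<subseteq> range k"
  proof
    fix p assume "p \<in> Arr Fr"
    then obtain a x m b y u v f where p: "p = ((a, x), m, (b, y))" "frac m x y u v f" by (rule Fr_arrE)
    then have "p = k (a, x, u, v, f, b, y)" using frac_eq[OF p(2)] by (simp add: k_def)
    then show "p \<in> range k" by blast
  qed
  then have "inj_on (c \<circ> inv k) (Arr Fr)"
    using assms by (intro comp_inj_on inj_on_inv_into) (auto intro: inj_on_subset)
  then show ?thesis by (intro exI[of _ "c \<circ> inv k"])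
qed

end

section \<open>Universality of \<open>\<sigma>\<close>-colimits\<close>

lemma inj_pair_exists:
  assumes "infinite (UNIV :: 'u set)"
  shows "\<exists>p :: 'u \<times> 'u \<Rightarrow> 'u. inj p"
proof -
  have "(card_of (UNIV \<times> UNIV :: ('u \<times> 'u) set), card_of (UNIV :: 'u set)) \<in> ordIso"
    by (rule card_of_Times_same_infinite[OF assms])
  then obtain p :: "'u \<times> 'u \<Rightarrow> 'u" where "bij_betw p (UNIV \<times> UNIV) UNIV"
    unfolding card_of_ordIso[symmetric] by blast
  then show ?thesis by (auto simp: bij_betw_def)
qed

text \<open>The summand \<open>nat\<close> makes the type infinite, so it absorbs its own square,
  and iterating one pairing packs the seven parameters of a fraction. The target is the type over
  which universality is tested.\<close>

lemma inj_code_exists: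
  "\<exists>c :: 'a \<times> 'o \<times> 'f \<times> 'f \<times> 'm \<times> 'a \<times> 'o \<Rightarrow> nat + 'a + 'f + 'o + 'm + 'l + 'h. inj c"
proof -
  have "infinite (UNIV :: (nat + 'a + 'f + 'o + 'm + 'l + 'h) set)"
    using finite_imageD[of Inl UNIV] infinite_UNIV_nat finite_subset[of "range Inl" UNIV] by auto
  from inj_pair_exists[OF this]
  obtain p :: "(nat + 'a + 'f + 'o + 'm + 'l + 'h) \<times> (nat + 'a + 'f + 'o + 'm + 'l + 'h)
     \<Rightarrow> nat + 'a + 'f + 'o + 'm + 'l + 'h" where p: "inj p" by blast
  define ia :: "'a \<Rightarrow> nat + 'a + 'f + 'o + 'm + 'l + 'h" where "ia = Inr \<circ> Inl"
  define jf :: "'f \<Rightarrow> nat + 'a + 'f + 'o + 'm + 'l + 'h" where "jf = Inr \<circ> Inr \<circ> Inl"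
  define io :: "'o \<Rightarrow> nat + 'a + 'f + 'o + 'm + 'l + 'h" where "io = Inr \<circ> Inr \<circ> Inr \<circ> Inl"
  define im :: "'m \<Rightarrow> nat + 'a + 'f + 'o + 'm + 'l + 'h" where "im = Inr \<circ> Inr \<circ> Inr \<circ> Inr \<circ> Inl"
  define c where "c = (\<lambda>(a, x, u, v, f, b, y). p (ia a, p (io x, p (jf u, p (jf v, p (im f, p (ia b, io y)))))))"
  have "inj c"
    unfolding c_def by (rule injI) (auto simp: inj_eq[OF p] ia_def jf_def io_def im_def)
  then show ?thesis by (rule exI[of _ c])
qed

section \<open>Objects and arrows of a colimit, and functors out of it\<close>

locale sigma_colimit = filtered_diagram A \<Sigma> G
  for A :: "('a, 'f, 'c) twocat" and \<Sigma> and G :: "('a, 'f, 'c, 'o, 'm) cat_valued" +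
  fixes L :: "('l, 'h) cat" and lam :: "('a, 'f, 'o, 'm, 'l, 'h) transf"
  assumes colim: "is_sigma_colimit A \<Sigma> G L lam"
begin

sublocale l: cone A \<Sigma> G L lam
  using colim by (intro cone.intro filtered_diagram_axioms cone_axioms.intro)
    (auto simp: is_sigma_colimit_def universal_sigma_cone_def)

text \<open>This extracts the bijection on objects from the isomorphism of categories. Natural
  transformations out of \<open>L\<close> are obtained in \<open>induced_ntrans_exists\<close>, from
  the presentation of arrows as fractions.\<close>

lemma universal:
  fixes E :: "(nat + 'a + 'f + 'o + 'm + 'l + 'h, nat + 'a + 'f + 'o + 'm + 'l + 'h) cat"
  assumes "category E"
  shows "sigma_cone A \<Sigma> G E \<theta> \<Longrightarrow> \<exists>H. H \<in> Obj (Fun L E) \<and> post_transf A (\<lambda>_. H) lam = \<theta>"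
    and "H \<in> Obj (Fun L E) \<Longrightarrow> H' \<in> Obj (Fun L E) \<Longrightarrow>
      post_transf A (\<lambda>_. H) lam = post_transf A (\<lambda>_. H') lam \<Longrightarrow> H = H'"
proof -
  let ?K = "cone_functor A \<Sigma> G L lam E"
  have "is_cat_isomorphism (Fun L E) (Cones A \<Sigma> G E) ?K"
    using colim assms by (auto simp: is_sigma_colimit_def universal_sigma_cone_def)
  then obtain K' where K: "is_functor ?K" "is_functor K'" "FSrc K' = Cones A \<Sigma> G E" "FTgt K' = Fun L E"
      "K' \<cdot>F ?K = idf (Fun L E)" "?K \<cdot>F K' = idf (Cones A \<Sigma> G E)"
    unfolding is_cat_isomorphism_def in_Fun by (elim conjE bexE) (rule that, assumption+, simp_all)
  have s [simp]: "FSrc ?K = Fun L E" "FTgt ?K = Cones A \<Sigma> G E" by (auto simp: cone_functor_def)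
  have ko: "FObj ?K H = post_transf A (\<lambda>_. H) lam" if "H \<in> Obj (Fun L E)" for H
    using that by (simp add: cone_functor_def del: in_Fun)
  {
    assume t: "sigma_cone A \<Sigma> G E \<theta>"
    then have c: "\<theta> \<in> Obj (Cones A \<Sigma> G E)" by (simp add: Cones_def modif_cat_def)
    have h: "FObj K' \<theta> \<in> Obj (Fun L E)" using functor_obj[OF K(2,4)] c K(3) by (simp del: in_Fun)
    have "FObj (?K \<cdot>F K') \<theta> = \<theta>" using K(6) c by simp
    then have "FObj ?K (FObj K' \<theta>) = \<theta>" using c K(3) by simp
    then show "\<exists>H. H \<in> Obj (Fun L E) \<and> post_transf A (\<lambda>_. H) lam = \<theta>"
      using h ko by metis
  next
    assume h: "H \<in> Obj (Fun L E)" "H' \<in> Obj (Fun L E)"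
      "post_transf A (\<lambda>_. H) lam = post_transf A (\<lambda>_. H') lam"
    have "FObj (K' \<cdot>F ?K) H = H" "FObj (K' \<cdot>F ?K) H' = H'" using K(5) h(1,2) by (simp_all del: in_Fun)
    then have "FObj K' (FObj ?K H) = H" "FObj K' (FObj ?K H') = H'" using h(1,2) by (simp_all del: in_Fun)
    then show "H = H'" using ko h by metis
  }
qed

text \<open>By transport of \<open>D\<close> along \<open>c\<close> to the type of the test categories in the definition of \<open>\<sigma>\<close>-colimits.\<close>

lemma universal_small:
  fixes D :: "('p, 'n) cat" and c :: "'n \<Rightarrow> nat + 'a + 'f + 'o + 'm + 'l + 'h"
  assumes D: "category D" and c: "inj_on c (Arr D)"
  shows "sigma_cone A \<Sigma> G D \<theta> \<Longrightarrow> \<exists>H. H \<in> Obj (Fun L D) \<and> post_transf A (\<lambda>_. H) lam = \<theta>"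
    and "H \<in> Obj (Fun L D) \<Longrightarrow> H' \<in> Obj (Fun L D) \<Longrightarrow>
      post_transf A (\<lambda>_. H) lam = post_transf A (\<lambda>_. H') lam \<Longrightarrow> H = H'"
proof -
  define dec where "dec = inv_into (Arr D) c"
  \<comment> \<open>Objects are encoded by their identities, so an injection on arrows
    suffices.\<close>
  define co where "co x = c (Ident D x)" for x
  define deco where "deco z = Dom D (dec z)" for z
  note [simp] = D
  have dec [simp]: "dec (c m) = m" if "m \<in> Arr D" for m using that c by (simp add: dec_def)
  have deco [simp]: "deco (co x) = x" if "x \<in> Obj D" for x using that by (simp add: deco_def co_def)
  define D' where "D' = \<lparr>Obj = co ` Obj D, Arr = c ` Arr D, Dom = (\<lambda>z. co (Dom D (dec z))),
     Cod = (\<lambda>z. co (Cod D (dec z))), Ident = (\<lambda>z. c (Ident D (deco z))),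
     Comp = (\<lambda>z w. c (dec z \<cdot>\<^bsub>D\<^esub> dec w))\<rparr>"
  have [simp]: "Obj D' = co ` Obj D" "Arr D' = c ` Arr D" "Dom D' z = co (Dom D (dec z))"
     "Cod D' z = co (Cod D (dec z))" "Ident D' z = c (Ident D (deco z))" "z \<cdot>\<^bsub>D'\<^esub> w = c (dec z \<cdot>\<^bsub>D\<^esub> dec w)" for z w
    by (auto simp: D'_def)
  have coi [simp]: "co x = co y \<longleftrightarrow> x = y" if "x \<in> Obj D" "y \<in> Obj D" for x y using deco that by metis
  have D' [simp]: "category D'"
    by (rule categoryI) (auto simp: cat_assoc)
  define J where "J = mkF D D' co c"
  define J' where "J' = mkF D' D deco dec"
  have J [simp]: "is_functor J" "FSrc J = D" "FTgt J = D'"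
    unfolding J_def by (auto intro!: is_functor_mkF)
  have J' [simp]: "is_functor J'" "FSrc J' = D'" "FTgt J' = D"
    unfolding J'_def by (auto intro!: is_functor_mkF)
  have JJ: "J' \<cdot>F J = idf D"
    by (rule functor_eqI) (auto simp: J_def J'_def intro!: is_functor_fcomp is_functor_mkF)
  {
    assume t: "sigma_cone A \<Sigma> G D \<theta>"
    interpret t: cone A \<Sigma> G D \<theta> using t by (intro cone.intro filtered_diagram_axioms cone_axioms.intro D)
    obtain H where H: "is_functor H" "FSrc H = L" "FTgt H = D'" "post_transf A (\<lambda>_. H) lam = post_transf A (\<lambda>_. J) \<theta>"
      using universal(1)[OF D' t.post_cone[OF J]] by auto
    have "post_transf A (\<lambda>_. J' \<cdot>F H) lam = post_transf A (\<lambda>_. J') (post_transf A (\<lambda>_. J) \<theta>)"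
      unfolding H(4)[symmetric] by (rule l.post_transf_fcomp) (simp_all add: H)
    also have "\<dots> = post_transf A (\<lambda>_. J' \<cdot>F J) \<theta>"
      by (rule t.post_transf_fcomp[symmetric]) simp_all
    also have "\<dots> = \<theta>" unfolding JJ by (rule t.post_transf_idf)
    finally show "\<exists>H. H \<in> Obj (Fun L D) \<and> post_transf A (\<lambda>_. H) lam = \<theta>"
      using H by (intro exI[of _ "J' \<cdot>F H"]) auto
  next
    assume h: "H \<in> Obj (Fun L D)" "H' \<in> Obj (Fun L D)"
      "post_transf A (\<lambda>_. H) lam = post_transf A (\<lambda>_. H') lam"
    then have f [simp]: "is_functor H" "FSrc H = L" "FTgt H = D" "is_functor H'" "FSrc H' = L" "FTgt H' = D" by auto
    have "post_transf A (\<lambda>_. J \<cdot>F H) lam = post_transf A (\<lambda>_. J \<cdot>F H') lam"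
      using h(3) by (simp add: l.post_transf_fcomp)
    then have "J \<cdot>F H = J \<cdot>F H'" by (intro universal(2)[OF D']) auto
    then have "J' \<cdot>F (J \<cdot>F H) = J' \<cdot>F (J \<cdot>F H')" by simp
    then have "(J' \<cdot>F J) \<cdot>F H = (J' \<cdot>F J) \<cdot>F H'" by (subst (1 2) fcomp_assoc) auto
    then show "H = H'" by (simp add: JJ)
  }
qed

text \<open>A vertex \<open>E\<close> on arbitrary types is not itself a test category, but every
  cone factors through its category of fractions, which is small enough to be encoded as one. The
  functor induced into \<open>Fr\<close> is then composed with the inclusion.\<close>

lemma induced_exists:
  assumes "category E" "sigma_cone A \<Sigma> G E \<theta>"
  shows "\<exists>H. H \<in> Obj (Fun L E) \<and> post_transf A (\<lambda>_. H) lam = \<theta>"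
proof -
  interpret t: cone A \<Sigma> G E \<theta> using assms by (intro cone.intro filtered_diagram_axioms cone_axioms.intro)
  obtain c :: "'a \<times> 'o \<times> 'f \<times> 'f \<times> 'm \<times> 'a \<times> 'o \<Rightarrow> nat + 'a + 'f + 'o + 'm + 'l + 'h" where "inj c"
    using inj_code_exists by blast
  from t.Fr_small[OF this] obtain d where d: "inj_on (d :: _ \<Rightarrow> nat + 'a + 'f + 'o + 'm + 'l + 'h) (Arr t.Fr)" by blast
  obtain H where H: "is_functor H" "FSrc H = L" "FTgt H = t.Fr" "post_transf A (\<lambda>_. H) lam = t.Fr_cone"
    using universal_small(1)[OF t.Fr_cat d t.Fr_cone] by auto
  have "post_transf A (\<lambda>_. t.Fr_incl \<cdot>F H) lam = \<theta>"
    by (subst l.post_transf_fcomp) (simp_all add: H t.post_Fr_incl)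
  then show ?thesis using H by (intro exI[of _ "t.Fr_incl \<cdot>F H"]) auto
qed

text \<open>Applied to the universal cone, the factorization through fractions is a section of the
  inclusion: \<open>Fr_incl \<cdot>F H\<close> and the identity induce the same cone
  \<open>lam\<close>, and uniqueness identifies them. Hence every object and every arrow of
  \<open>L\<close> is recovered from its coordinates in \<open>Fr\<close>.\<close>

lemma coords:
  obtains H where "is_functor H" "FSrc H = L" "FTgt H = l.Fr" "post_transf A (\<lambda>_. H) lam = l.Fr_cone"
    "l.Fr_incl \<cdot>F H = idf L"
proof -
  obtain c :: "'a \<times> 'o \<times> 'f \<times> 'f \<times> 'm \<times> 'a \<times> 'o \<Rightarrow> nat + 'a + 'f + 'o + 'm + 'l + 'h" where "inj c"
    using inj_code_exists by blast
  from l.Fr_small[OF this] obtain d where d: "inj_on (d :: _ \<Rightarrow> nat + 'a + 'f + 'o + 'm + 'l + 'h) (Arr l.Fr)" by blast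
  obtain H where H: "is_functor H" "FSrc H = L" "FTgt H = l.Fr" "post_transf A (\<lambda>_. H) lam = l.Fr_cone"
    using universal_small(1)[OF l.Fr_cat d l.Fr_cone] by auto
  have e: "post_transf A (\<lambda>_. l.Fr_incl \<cdot>F H) lam = post_transf A (\<lambda>_. idf L) lam"
    by (subst l.post_transf_fcomp) (simp_all add: H l.post_Fr_incl l.post_transf_idf)
  \<comment> \<open>The arrow type of \<open>L\<close> is the last summand of the test type, so
    uniqueness is available for functors from \<open>L\<close> to itself.\<close>
  have i: "inj_on (Inr \<circ> Inr \<circ> Inr \<circ> Inr \<circ> Inr \<circ> Inr :: 'h \<Rightarrow> nat + 'a + 'f + 'o + 'm + 'l + 'h) (Arr L)"
    by (auto intro!: inj_onI)
  have "l.Fr_incl \<cdot>F H = idf L"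
    by (rule universal_small(2)[OF l.catE i _ _ e]) (use H in auto)
  then show ?thesis using H that by blast
qed

lemma colim_obj:
  assumes "p \<in> Obj L"
  obtains a x where "a \<in> Obj (Under A)" "x \<in> Obj (Map0 G a)" "p = l.To a x"
proof -
  obtain H where H: "is_functor H" "FSrc H = L" "FTgt H = l.Fr" "l.Fr_incl \<cdot>F H = idf L" by (rule coords)
  have o: "FObj H p \<in> Obj l.Fr" using H assms by auto
  obtain a x where ax: "FObj H p = (a, x)" by (cases "FObj H p")
  have "FObj l.Fr_incl (FObj H p) = FObj (l.Fr_incl \<cdot>F H) p" using H(1-3) assms by simp
  then have "FObj l.Fr_incl (a, x) = p" unfolding H(4) ax using assms by simp
  then have "l.To a x = p" using o ax by (simp add: l.Fr_incl_def)
  then show ?thesis using o ax that by auto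
qed

lemma Fr_cone_obj: "a \<in> Obj (Under A) \<Longrightarrow> x \<in> Obj (Map0 G a) \<Longrightarrow> FObj (T0 l.Fr_cone a) x = (a, x)"
  by (simp add: l.Fr_cone_def Let_def)

lemma coords_obj:
  assumes "post_transf A (\<lambda>_. H) lam = l.Fr_cone" "a \<in> Obj (Under A)" "x \<in> Obj (Map0 G a)"
  shows "FObj H (l.To a x) = (a, x)"
proof -
  have "FObj (T0 (post_transf A (\<lambda>_. H) lam) a) x = (a, x)" using assms Fr_cone_obj by simp
  then show ?thesis using assms by (simp add: post_transf_def)
qed

text \<open>The coordinate functor sends \<open>\<lambda>\<^sub>a(x)\<close> to exactly
  \<open>(a, x)\<close>, so an arrow whose endpoints are given as such images goes to a fraction
  between just these pairs. The presentations of the endpoints may therefore be prescribed.\<close>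

lemma colim_arr:
  assumes "a \<in> Obj (Under A)" "x \<in> Obj (Map0 G a)" "b \<in> Obj (Under A)" "y \<in> Obj (Map0 G b)"
    "m \<in> Arr L" "Dom L m = l.To a x" "Cod L m = l.To b y"
  obtains u v f where "l.frac m x y u v f" "Dom (Under A) u = a" "Dom (Under A) v = b"
proof -
  obtain H where H: "is_functor H" "FSrc H = L" "FTgt H = l.Fr" "post_transf A (\<lambda>_. H) lam = l.Fr_cone"
    "l.Fr_incl \<cdot>F H = idf L" by (rule coords)
  have h: "FArr H m \<in> Arr l.Fr" "Dom l.Fr (FArr H m) = (a, x)" "Cod l.Fr (FArr H m) = (b, y)"
    using functor_arr[OF H(1,3), of m] H(2) assms coords_obj[OF H(4)] by auto
  from h(1) obtain a' x' m' b' y' u v f where e: "FArr H m = ((a', x'), m', (b', y'))" "l.frac m' x' y' u v f"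
    "a' = Dom (Under A) u" "b' = Dom (Under A) v" by (rule l.Fr_arrE)
  have "FArr l.Fr_incl (FArr H m) = FArr (l.Fr_incl \<cdot>F H) m" using H(1-3) assms by simp
  then have "FArr l.Fr_incl (FArr H m) = m" unfolding H(5) using assms by simp
  then have "m' = m" using h(1) e by (simp add: l.Fr_incl_def)
  then show ?thesis using that[of u v f] e h by simp
qed

text \<open>Naturality is known at images of arrows and at structure cells. Along a fraction it
  passes through \<open>f\<close> and the leg \<open>v\<close> directly; the inverted leg is handled
  by composing with the image of \<open>\<lambda>\<^sub>u\<close> under \<open>H\<close> and
  cancelling that isomorphism.\<close>

lemma cone_morphism_natural:
  assumes H: "H \<in> Obj (Fun L E)" "H' \<in> Obj (Fun L E)"
    and t: "\<And>a x. a \<in> Obj (Under A) \<Longrightarrow> x \<in> Obj (Map0 G a) \<Longrightarrow>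
       t a x \<in> hom E (FObj H (l.To a x)) (FObj H' (l.To a x))"
    and nat: "\<And>a g. a \<in> Obj (Under A) \<Longrightarrow> g \<in> Arr (Map0 G a) \<Longrightarrow>
       t a (Cod (Map0 G a) g) \<cdot>\<^bsub>E\<^esub> FArr H (l.Ta a g) = FArr H' (l.Ta a g) \<cdot>\<^bsub>E\<^esub> t a (Dom (Map0 G a) g)"
    and leg: "\<And>f x. f \<in> Arr (Under A) \<Longrightarrow> x \<in> Obj (Map0 G (Dom (Under A) f)) \<Longrightarrow>
       t (Dom (Under A) f) x \<cdot>\<^bsub>E\<^esub> FArr H (l.Tc f x) = FArr H' (l.Tc f x) \<cdot>\<^bsub>E\<^esub> t (Cod (Under A) f) (Go f x)"
    and m: "l.frac m x y u v f"
  shows "t (Dom (Under A) v) y \<cdot>\<^bsub>E\<^esub> FArr H m = FArr H' m \<cdot>\<^bsub>E\<^esub> t (Dom (Under A) u) x"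
proof -
  note d = l.fracD[OF m]
  have [simp]: "is_functor H" "FSrc H = L" "FTgt H = E" "is_functor H'" "FSrc H' = L" "FTgt H' = E" using H by auto
  have [simp]: "category E" using functor_cat(2)[of H] by simp
  have T [simp]: "t a x \<in> Arr E" "Dom E (t a x) = FObj H (l.To a x)" "Cod E (t a x) = FObj H' (l.To a x)"
    if "a \<in> Obj (Under A)" "x \<in> Obj (Map0 G a)" for a x using t[OF that] by auto
  note [simp] = d(1-11)
  let ?c = "Cod (Under A) u"
  have n: "t ?c (Go v y) \<cdot>\<^bsub>E\<^esub> FArr H (l.Ta ?c f) = FArr H' (l.Ta ?c f) \<cdot>\<^bsub>E\<^esub> t ?c (Go u x)"
    using nat[of ?c f] by simp
  have lu: "t (Dom (Under A) u) x \<cdot>\<^bsub>E\<^esub> FArr H (l.Tc u x) = FArr H' (l.Tc u x) \<cdot>\<^bsub>E\<^esub> t ?c (Go u x)"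
    using leg[of u x] by simp
  have lv: "t (Dom (Under A) v) y \<cdot>\<^bsub>E\<^esub> FArr H (l.Tc v y) = FArr H' (l.Tc v y) \<cdot>\<^bsub>E\<^esub> t ?c (Go v y)"
    using leg[of v y] by simp
  have h: "FArr H m \<cdot>\<^bsub>E\<^esub> FArr H (l.Tc u x) = FArr H (l.Tc v y) \<cdot>\<^bsub>E\<^esub> FArr H (l.Ta ?c f)"
    using arg_cong[OF d(12), of "FArr H"] by simp
  have h': "FArr H' m \<cdot>\<^bsub>E\<^esub> FArr H' (l.Tc u x) = FArr H' (l.Tc v y) \<cdot>\<^bsub>E\<^esub> FArr H' (l.Ta ?c f)"
    using arg_cong[OF d(12), of "FArr H'"] by simp
  show ?thesis
  proof (rule iso_epi[of E "FArr H (l.Tc u x)"])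
    have "(t (Dom (Under A) v) y \<cdot>\<^bsub>E\<^esub> FArr H m) \<cdot>\<^bsub>E\<^esub> FArr H (l.Tc u x)
      = t (Dom (Under A) v) y \<cdot>\<^bsub>E\<^esub> (FArr H m \<cdot>\<^bsub>E\<^esub> FArr H (l.Tc u x))" by (simp add: cat_assoc)
    also have "\<dots> = (t (Dom (Under A) v) y \<cdot>\<^bsub>E\<^esub> FArr H (l.Tc v y)) \<cdot>\<^bsub>E\<^esub> FArr H (l.Ta ?c f)"
      unfolding h by (simp add: cat_assoc)
    also have "\<dots> = FArr H' (l.Tc v y) \<cdot>\<^bsub>E\<^esub> (t ?c (Go v y) \<cdot>\<^bsub>E\<^esub> FArr H (l.Ta ?c f))"
      unfolding lv by (simp add: cat_assoc)
    also have "\<dots> = (FArr H' (l.Tc v y) \<cdot>\<^bsub>E\<^esub> FArr H' (l.Ta ?c f)) \<cdot>\<^bsub>E\<^esub> t ?c (Go u x)"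
      unfolding n by (simp add: cat_assoc)
    also have "\<dots> = FArr H' m \<cdot>\<^bsub>E\<^esub> (FArr H' (l.Tc u x) \<cdot>\<^bsub>E\<^esub> t ?c (Go u x))"
      unfolding h'[symmetric] by (simp add: cat_assoc)
    also have "\<dots> = (FArr H' m \<cdot>\<^bsub>E\<^esub> t (Dom (Under A) u) x) \<cdot>\<^bsub>E\<^esub> FArr H (l.Tc u x)"
      unfolding lu[symmetric] by (simp add: cat_assoc)
    finally show "(t (Dom (Under A) v) y \<cdot>\<^bsub>E\<^esub> FArr H m) \<cdot>\<^bsub>E\<^esub> FArr H (l.Tc u x)
      = (FArr H' m \<cdot>\<^bsub>E\<^esub> t (Dom (Under A) u) x) \<cdot>\<^bsub>E\<^esub> FArr H (l.Tc u x)" .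
  qed simp_all
qed

text \<open>Distinct pairs \<open>(a, x)\<close> have distinct images in \<open>L\<close>, because
  the coordinate functor recovers them, so a component may simply be read off at the coordinates of
  an object; naturality is then checked on fractions. This is the two-dimensional half of
  universality, for vertices on arbitrary types.\<close>

lemma induced_ntrans_exists:
  assumes H: "H \<in> Obj (Fun L E)" "H' \<in> Obj (Fun L E)"
    and t: "\<And>a x. a \<in> Obj (Under A) \<Longrightarrow> x \<in> Obj (Map0 G a) \<Longrightarrow>
       t a x \<in> hom E (FObj H (l.To a x)) (FObj H' (l.To a x))"
    and nat: "\<And>a g. a \<in> Obj (Under A) \<Longrightarrow> g \<in> Arr (Map0 G a) \<Longrightarrow>
       t a (Cod (Map0 G a) g) \<cdot>\<^bsub>E\<^esub> FArr H (l.Ta a g) = FArr H' (l.Ta a g) \<cdot>\<^bsub>E\<^esub> t a (Dom (Map0 G a) g)"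
    and leg: "\<And>f x. f \<in> Arr (Under A) \<Longrightarrow> x \<in> Obj (Map0 G (Dom (Under A) f)) \<Longrightarrow>
       t (Dom (Under A) f) x \<cdot>\<^bsub>E\<^esub> FArr H (l.Tc f x) = FArr H' (l.Tc f x) \<cdot>\<^bsub>E\<^esub> t (Cod (Under A) f) (Go f x)"
  obtains \<alpha> where "is_ntrans \<alpha>" "NSrc \<alpha> = H" "NTgt \<alpha> = H'"
    "\<And>a x. a \<in> Obj (Under A) \<Longrightarrow> x \<in> Obj (Map0 G a) \<Longrightarrow> NCmp \<alpha> (l.To a x) = t a x"
proof -
  obtain K where K: "post_transf A (\<lambda>_. K) lam = l.Fr_cone" by (rule coords)
  note k = coords_obj[OF K]
  let ?s = "\<lambda>p. t (fst (FObj K p)) (snd (FObj K p))"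
  have "is_ntrans (mkN H H' ?s)"
  proof (rule is_ntrans_mkN[where C=L and D=E])
    fix p assume "p \<in> Obj L"
    then obtain a x where "a \<in> Obj (Under A)" "x \<in> Obj (Map0 G a)" "p = l.To a x" by (rule colim_obj)
    then show "?s p \<in> Arr E \<and> Dom E (?s p) = FObj H p \<and> Cod E (?s p) = FObj H' p" using t k by auto
  next
    fix m assume m: "m \<in> Arr L"
    obtain a x where a: "a \<in> Obj (Under A)" "x \<in> Obj (Map0 G a)" "Dom L m = l.To a x"
      by (rule colim_obj[of "Dom L m"]) (use m in auto)
    obtain b y where b: "b \<in> Obj (Under A)" "y \<in> Obj (Map0 G b)" "Cod L m = l.To b y"
      by (rule colim_obj[of "Cod L m"]) (use m in auto)
    obtain u v f where f: "l.frac m x y u v f" "Dom (Under A) u = a" "Dom (Under A) v = b"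
      by (rule colim_arr[of a x b y m]) (use a b m in auto)
    show "?s (Cod L m) \<cdot>\<^bsub>E\<^esub> FArr H m = FArr H' m \<cdot>\<^bsub>E\<^esub> ?s (Dom L m)"
      using cone_morphism_natural[OF H t nat leg f(1)] k a b f by simp
  qed (use H in auto)
  then show ?thesis using H by (intro that[of "mkN H H' ?s"]) (auto simp: k)
qed

text \<open>Identities on the common object values form a family that is natural on generators,
  hence on all fractions, and a naturality square with identity sides is an equality of arrows.
  Uniqueness thus extends to vertices on arbitrary types.\<close>

lemma functor_colim_eqI:
  assumes H: "H \<in> Obj (Fun L E)" "H' \<in> Obj (Fun L E)"
    and o: "\<And>a x. a \<in> Obj (Under A) \<Longrightarrow> x \<in> Obj (Map0 G a) \<Longrightarrow> FObj H (l.To a x) = FObj H' (l.To a x)"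
    and m: "\<And>a g. a \<in> Obj (Under A) \<Longrightarrow> g \<in> Arr (Map0 G a) \<Longrightarrow> FArr H (l.Ta a g) = FArr H' (l.Ta a g)"
    and c: "\<And>f x. f \<in> Arr (Under A) \<Longrightarrow> x \<in> Obj (Map0 G (Dom (Under A) f)) \<Longrightarrow>
       FArr H (l.Tc f x) = FArr H' (l.Tc f x)"
  shows "H = H'"
proof (rule functor_eqI)
  have f [simp]: "is_functor H" "FSrc H = L" "FTgt H = E" "is_functor H'" "FSrc H' = L" "FTgt H' = E" using H by auto
  have [simp]: "category E" using functor_cat(2)[of H] by simp
  show "FObj H p = FObj H' p" if "p \<in> Obj (FSrc H')" for p
    using that o by (auto elim!: colim_obj)
  show "FArr H m = FArr H' m" if "m \<in> Arr (FSrc H')" for m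
  proof -
    from that have m: "m \<in> Arr L" by simp
    obtain a x where a: "a \<in> Obj (Under A)" "x \<in> Obj (Map0 G a)" "Dom L m = l.To a x"
      by (rule colim_obj[of "Dom L m"]) (use m in auto)
    obtain b y where b: "b \<in> Obj (Under A)" "y \<in> Obj (Map0 G b)" "Cod L m = l.To b y"
      by (rule colim_obj[of "Cod L m"]) (use m in auto)
    obtain u v f where uvf: "l.frac m x y u v f" "Dom (Under A) u = a" "Dom (Under A) v = b"
      by (rule colim_arr[of a x b y m]) (use a b m in auto)
    have "Ident E (FObj H' (l.To b y)) \<cdot>\<^bsub>E\<^esub> FArr H m = FArr H' m \<cdot>\<^bsub>E\<^esub> Ident E (FObj H' (l.To a x))"
      using cone_morphism_natural[OF H, of "\<lambda>a x. Ident E (FObj H' (l.To a x))" m x y u v f] uvf o assms(4,5) by simp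
    then show ?thesis using m a b o by simp
  qed
qed (use H in auto)

lemma post_transf_eqD:
  assumes "post_transf A (\<lambda>_. H) lam = \<theta>"
  shows "a \<in> Obj (Under A) \<Longrightarrow> x \<in> Obj (Map0 G a) \<Longrightarrow> FObj H (l.To a x) = FObj (T0 \<theta> a) x"
    "a \<in> Obj (Under A) \<Longrightarrow> m \<in> Arr (Map0 G a) \<Longrightarrow> FArr H (l.Ta a m) = FArr (T0 \<theta> a) m"
    "f \<in> Arr (Under A) \<Longrightarrow> z \<in> Obj (Map0 G (Dom (Under A) f)) \<Longrightarrow> FArr H (l.Tc f z) = NCmp (T1 \<theta> f) z"
  unfolding assms[symmetric] by (simp_all add: post_transf_def)

text \<open>The definite description is justified by \<open>induced_exists\<close> and
  \<open>functor_colim_eqI\<close>, again without restriction on the types of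
  \<open>E\<close>.\<close>

lemma induced_functor_props:
  assumes "category E" "sigma_cone A \<Sigma> G E \<theta>"
  shows "induced_functor A \<Sigma> G L lam E \<theta> \<in> Obj (Fun L E)"
    "post_transf A (\<lambda>_. induced_functor A \<Sigma> G L lam E \<theta>) lam = \<theta>"
proof -
  obtain H where H: "H \<in> Obj (Fun L E)" "post_transf A (\<lambda>_. H) lam = \<theta>" using induced_exists[OF assms] by blast
  have k: "FObj (cone_functor A \<Sigma> G L lam E) K = post_transf A (\<lambda>_. K) lam" if "K \<in> Obj (Fun L E)" for K
    using that by (simp add: cone_functor_def del: in_Fun)
  have "induced_functor A \<Sigma> G L lam E \<theta> = H"
    unfolding induced_functor_def
  proof (rule the_equality)
    show "H \<in> Obj (Fun L E) \<and> FObj (cone_functor A \<Sigma> G L lam E) H = \<theta>" using H k by blast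
    fix K assume K: "K \<in> Obj (Fun L E) \<and> FObj (cone_functor A \<Sigma> G L lam E) K = \<theta>"
    then have e: "post_transf A (\<lambda>_. K) lam = \<theta>" using k by metis
    show "K = H"
      by (rule functor_colim_eqI[OF _ H(1)]) (use K post_transf_eqD[OF e] post_transf_eqD[OF H(2)] in simp_all)
  qed
  then show "induced_functor A \<Sigma> G L lam E \<theta> \<in> Obj (Fun L E)"
    "post_transf A (\<lambda>_. induced_functor A \<Sigma> G L lam E \<theta>) lam = \<theta>" using H by simp_all
qed

end

section \<open>Partial equivalence relations as a category\<close>

text \<open>A partial equivalence relation on \<open>'t\<close> stands for the set of its classes, and a saturated relation
  between two of them for a correspondence between these sets; maps of sets enter through \<open>per_map\<close>.\<close>

definition per :: "'t rel \<Rightarrow> bool" where "per R \<longleftrightarrow> sym R \<and> trans R"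

definition Per :: "('t rel, 't rel \<times> 't rel \<times> 't rel) cat" where
  "Per = \<lparr>Obj = {R. per R},
     Arr = {(R, \<phi>, S). per R \<and> per S \<and> R O \<phi> = \<phi> \<and> \<phi> O S = \<phi>},
     Dom = fst, Cod = snd \<circ> snd, Ident = (\<lambda>R. (R, R, R)),
     Comp = (\<lambda>q p. (fst p, fst (snd p) O fst (snd q), snd (snd q)))\<rparr>"

lemma perD:
  assumes "per R"
  shows "(a, b) \<in> R \<Longrightarrow> (b, a) \<in> R" "(a, b) \<in> R \<Longrightarrow> (b, c) \<in> R \<Longrightarrow> (a, c) \<in> R"
    "(a, b) \<in> R \<Longrightarrow> (a, a) \<in> R" "(a, b) \<in> R \<Longrightarrow> (b, b) \<in> R"
proof -
  have sy: "sym R" and tr: "trans R" using assms by (auto simp: per_def)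
  have s: "(b, a) \<in> R" if "(a, b) \<in> R" for a b using sy that by (rule symD)
  have t: "(a, c) \<in> R" if "(a, b) \<in> R" "(b, c) \<in> R" for a b c using tr that by (rule transD)
  show "(a, b) \<in> R \<Longrightarrow> (b, a) \<in> R" "(a, b) \<in> R \<Longrightarrow> (b, c) \<in> R \<Longrightarrow> (a, c) \<in> R" by (fact s, fact t)
  assume h: "(a, b) \<in> R"
  show "(a, a) \<in> R" "(b, b) \<in> R" by (rule t[OF h s[OF h]], rule t[OF s[OF h] h])
qed

lemma per_idem: "per R \<Longrightarrow> R O R = R"
  by (rule equalityI) (auto intro: perD(2) perD(3) relcompI)

lemma Per_sel [simp]: "R \<in> Obj Per \<longleftrightarrow> per R" "Dom Per p = fst p" "Cod Per p = snd (snd p)"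
  "Ident Per R = (R, R, R)" "Comp Per q p = (fst p, fst (snd p) O fst (snd q), snd (snd q))"
  by (auto simp: Per_def)

lemma Per_arr: "(R, \<phi>, S) \<in> Arr Per \<longleftrightarrow> per R \<and> per S \<and> R O \<phi> = \<phi> \<and> \<phi> O S = \<phi>"
  by (auto simp: Per_def)

lemma Per_cat [simp]: "category Per"
proof (rule categoryI)
  fix p assume "p \<in> Arr (Per :: ('t rel, _) cat)"
  moreover obtain R \<phi> S where "p = (R, \<phi>, S)" by (cases p)
  ultimately show "Dom Per p \<in> Obj Per" "Cod Per p \<in> Obj Per" "Comp Per p (Ident Per (Dom Per p)) = p"
    "Comp Per (Ident Per (Cod Per p)) p = p" by (auto simp: Per_arr)
next
  fix p q assume a: "p \<in> Arr (Per :: ('t rel, _) cat)" "q \<in> Arr Per" "Cod Per p = Dom Per q"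
  obtain R \<phi> S where p: "p = (R, \<phi>, S)" by (cases p)
  obtain \<psi> T where q: "q = (S, \<psi>, T)" using a(3) p by (cases q) auto
  have "R O (\<phi> O \<psi>) = \<phi> O \<psi>" using a p q unfolding Per_arr O_assoc[symmetric] by (simp add: Per_arr)
  then show "Comp Per q p \<in> Arr Per \<and> Dom Per (Comp Per q p) = Dom Per p \<and> Cod Per (Comp Per q p) = Cod Per q"
    using a p q by (simp add: Per_arr O_assoc)
qed (auto simp: Per_arr per_idem O_assoc)

text \<open>The graph of the map induced by \<open>k\<close> on classes, saturated in
  \<open>S\<close>, so that functions agreeing up to \<open>S\<close> give the same arrow.\<close>

definition per_map :: "'t rel \<Rightarrow> ('t \<Rightarrow> 't) \<Rightarrow> 't rel \<Rightarrow> 't rel \<times> 't rel \<times> 't rel" where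
  "per_map R k S = (R, {(e, e'). (e, e) \<in> R \<and> (k e, e') \<in> S}, S)"

definition per_cong :: "'t rel \<Rightarrow> ('t \<Rightarrow> 't) \<Rightarrow> 't rel \<Rightarrow> bool" where
  "per_cong R k S \<longleftrightarrow> per R \<and> per S \<and> (\<forall>(e, e') \<in> R. (k e, k e') \<in> S)"

lemma per_map_sel [simp]: "fst (per_map R k S) = R" "snd (snd (per_map R k S)) = S"
  by (auto simp: per_map_def)

lemma per_congD:
  assumes "per_cong R k S"
  shows "per R" "per S" "(e, e') \<in> R \<Longrightarrow> (k e, k e') \<in> S"
  using assms by (auto simp: per_cong_def)

lemma per_map_arr [simp]:
  assumes "per_cong R k S"
  shows "per_map R k S \<in> Arr Per"
proof -
  note c = per_congD[OF assms] and r = perD[OF per_congD(1)[OF assms]] and s = perD[OF per_congD(2)[OF assms]]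
  let ?p = "{(e, e'). (e, e) \<in> R \<and> (k e, e') \<in> S}"
  have "R O ?p = ?p"
  proof (intro equalityI subsetI)
    fix z assume "z \<in> R O ?p"
    then obtain e e1 e' where "z = (e, e')" "(e, e1) \<in> R" "(k e1, e') \<in> S" by auto
    then show "z \<in> ?p" using r(3) s(2)[OF c(3)] by auto
  qed auto
  moreover have "?p O S = ?p"
  proof (intro equalityI subsetI)
    fix z assume "z \<in> ?p"
    then obtain e e' where "z = (e, e')" "(e, e) \<in> R" "(k e, e') \<in> S" by auto
    then show "z \<in> ?p O S" using s(4) by blast
  qed (auto intro: s(2))
  ultimately show ?thesis using c by (simp add: per_map_def Per_arr)
qed

lemma per_map_comp:
  assumes "per_cong R k S" "per_cong S k' T"
  shows "per_map S k' T \<cdot>\<^bsub>Per\<^esub> per_map R k S = per_map R (k' \<circ> k) T"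
proof -
  note c = per_congD[OF assms(1)] per_congD[OF assms(2)]
  note s = perD[OF c(2)] and t = perD[OF c(5)]
  have "{(e, e'). (e, e) \<in> R \<and> (k e, e') \<in> S} O {(e, e'). (e, e) \<in> S \<and> (k' e, e') \<in> T}
     = {(e, e'). (e, e) \<in> R \<and> (k' (k e), e') \<in> T}" (is "?l = ?r")
  proof (intro equalityI subsetI)
    fix z assume "z \<in> ?l"
    then obtain e d e' where "z = (e, e')" "(e, e) \<in> R" "(k e, d) \<in> S" "(k' d, e') \<in> T" by auto
    then show "z \<in> ?r" using t(2)[OF c(6)] by auto
  next
    fix z assume "z \<in> ?r"
    then obtain e e' where e: "z = (e, e')" "(e, e) \<in> R" "(k' (k e), e') \<in> T" by auto
    moreover have "(k e, k e) \<in> S" using c(3)[OF e(2)] .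
    ultimately show "z \<in> ?l" by blast
  qed
  then show ?thesis by (simp add: per_map_def)
qed

lemma per_map_cong:
  assumes "per S" "\<And>e. (e, e) \<in> R \<Longrightarrow> (k e, k' e) \<in> S"
  shows "per_map R k S = per_map R k' S"
proof -
  note s = perD[OF assms(1)]
  have "(k e, e') \<in> S \<longleftrightarrow> (k' e, e') \<in> S" if "(e, e) \<in> R" for e e'
    using assms(2)[OF that] s(2)[of "k e" "k' e" e'] s(2)[of "k' e" "k e" e'] s(1) by blast
  then show ?thesis by (auto simp: per_map_def)
qed

lemma per_map_id:
  assumes "per R" "\<And>e. (e, e) \<in> R \<Longrightarrow> (k e, e) \<in> R"
  shows "per_map R k R = Ident Per R"
proof -
  have "per_map R k R = per_map R (\<lambda>e. e) R" by (rule per_map_cong) (use assms in auto)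
  also have "\<dots> = Ident Per R" using perD(3)[OF assms(1)] by (auto simp: per_map_def)
  finally show ?thesis .
qed

text \<open>The hypotheses say that \<open>k\<close> is injective and surjective on classes. The
  inverse is the converse relation, so no inverse function on representatives has to be
  chosen.\<close>

lemma per_map_iso:
  assumes c: "per_cong R k S"
    and refl: "\<And>e e'. (e, e) \<in> R \<Longrightarrow> (e', e') \<in> R \<Longrightarrow> (k e, k e') \<in> S \<Longrightarrow> (e, e') \<in> R"
    and surj: "\<And>d. (d, d) \<in> S \<Longrightarrow> \<exists>e. (e, e) \<in> R \<and> (k e, d) \<in> S"
  shows "is_iso Per (per_map R k S)"
proof (rule is_isoI[of _ _ "(S, {(e', e). (e, e) \<in> R \<and> (k e, e') \<in> S}, R)"])
  note r = perD[OF per_congD(1)[OF c]] and s = perD[OF per_congD(2)[OF c]] and k = per_congD(3)[OF c]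
  let ?p = "{(e, e'). (e, e) \<in> R \<and> (k e, e') \<in> S}" and ?q = "{(e', e). (e, e) \<in> R \<and> (k e, e') \<in> S}"
  have pq: "?p O ?q = R"
  proof (intro equalityI subsetI)
    fix z assume "z \<in> ?p O ?q"
    then obtain e e' d where z: "z = (e, e')" "(e, e) \<in> R" "(k e, d) \<in> S" "(e', e') \<in> R" "(k e', d) \<in> S" by auto
    show "z \<in> R" using refl[OF z(2,4) s(2)[OF z(3) s(1)[OF z(5)]]] z by simp
  next
    fix z assume z: "z \<in> R"
    obtain e e' where e: "z = (e, e')" by (cases z)
    have "(e, k e') \<in> ?p" "(k e', e') \<in> ?q" using z k r(3,4) e by auto
    then show "z \<in> ?p O ?q" using e by blast
  qed
  have qp: "?q O ?p = S"
  proof (intro equalityI subsetI)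
    fix z assume "z \<in> ?q O ?p"
    then obtain d d' e where z: "z = (d, d')" "(k e, d) \<in> S" "(k e, d') \<in> S" by auto
    show "z \<in> S" unfolding z(1) by (rule s(2)[OF s(1)[OF z(2)] z(3)])
  next
    fix z assume z: "z \<in> S"
    obtain d d' where e: "z = (d, d')" by (cases z)
    then have "(d, d) \<in> S" using z s(3) by simp
    from surj[OF this] obtain e0 where e0: "(e0, e0) \<in> R" "(k e0, d) \<in> S" by blast
    then have "(d, e0) \<in> ?q" "(e0, d') \<in> ?p" using z e s(2)[OF e0(2)] by auto
    then show "z \<in> ?q O ?p" using e by blast
  qed
  have "S O ?q = ?q"
  proof (intro equalityI subsetI)
    fix z assume "z \<in> S O ?q"
    then obtain d d' e where z: "z = (d, e)" "(d, d') \<in> S" "(e, e) \<in> R" "(k e, d') \<in> S" by auto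
    show "z \<in> ?q" using s(2)[OF z(4) s(1)[OF z(2)]] z by simp
  next
    fix z assume z: "z \<in> ?q"
    then obtain d e where e: "z = (d, e)" "(e, e) \<in> R" "(k e, d) \<in> S" by auto
    then show "z \<in> S O ?q" using s(4) by blast
  qed
  moreover have "?q O R = ?q"
  proof (intro equalityI subsetI)
    fix z assume "z \<in> ?q O R"
    then obtain d e e' where e: "z = (d, e')" "(e, e) \<in> R" "(k e, d) \<in> S" "(e, e') \<in> R" by auto
    have "(k e', d) \<in> S" using s(2)[OF s(1)[OF k[OF e(4)]] e(3)] .
    then show "z \<in> ?q" using e r(4) by auto
  qed auto
  ultimately show "(S, ?q, R) \<in> Arr Per" using per_congD(1,2)[OF c] by (simp add: Per_arr)
  show "Comp Per (S, ?q, R) (per_map R k S) = Ident Per (Dom Per (per_map R k S))"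
    using pq by (simp add: per_map_def)
  show "Comp Per (per_map R k S) (S, ?q, R) = Ident Per (Cod Per (per_map R k S))"
    using qp by (simp add: per_map_def)
qed (use c in simp_all)

section \<open>Equality of arrows in a \<open>\<sigma>\<close>-colimit\<close>

text \<open>An element \<open>(u, v, f)\<close> of \<open>germ b y\<close> represents the arrow \<open>\<theta>\<^sub>v \<theta>(f) \<theta>\<^sub>u\<^sup>-\<^sup>1\<close> from \<open>x\<^sub>0\<close> to \<open>y\<close>.
  Unlike in fractions, \<open>v\<close> need not be in \<open>\<Sigma>\<close>: then the structure cells of the cone act by composition
  without any choice. The relation \<open>step\<close> is a confluent preorder.\<close>

locale germs = filtered_diagram A \<Sigma> G
  for A :: "('a, 'f, 'c) twocat" and \<Sigma> and G :: "('a, 'f, 'c, 'o, 'm) cat_valued" +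
  fixes a0 :: 'a and x0 :: 'o
  assumes a0 [simp]: "a0 \<in> Obj (Under A)" and x0 [simp]: "x0 \<in> Obj (Map0 G a0)"
begin

abbreviation "uc \<equiv> Cod (Under A)"
abbreviation "ud \<equiv> Dom (Under A)"
abbreviation whisk (infixr "\<triangleright>" 71) where "h \<triangleright> \<alpha> \<equiv> HComp A (Ident (Cells A) h) \<alpha>"
abbreviation whiskr (infixl "\<triangleleft>" 71) where "\<alpha> \<triangleleft> h \<equiv> HComp A \<alpha> (Ident (Cells A) h)"

definition germ :: "'a \<Rightarrow> 'o \<Rightarrow> 'f \<times> 'f \<times> 'm \<Rightarrow> bool" where
  "germ b y = (\<lambda>(u, v, f). u \<in> \<Sigma> \<and> ud u = a0 \<and> v \<in> Arr (Under A) \<and> ud v = b \<and> uc v = uc u \<and>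
     y \<in> Obj (Map0 G b) \<and> f \<in> hom (Map0 G (uc u)) (Go u x0) (Go v y))"

text \<open>A move to the later stage \<open>p\<close> followed by a change of legs. The represented
  arrow stays the same in every cone, because \<open>\<theta>\<^sub>p\<^sub>v =
  \<theta>\<^sub>v\<^sub>' \<theta>(\<beta>)\<close> and \<open>\<theta>\<^sub>u\<^sub>' =
  \<theta>\<^sub>p\<^sub>u \<theta>(\<alpha>)\<close>. The cell \<open>\<beta>\<close> is merely
  directed, as the 2-cells of \<open>A\<close> acting on the cone are; \<open>\<alpha>\<close> is
  invertible so that two steps can be joined over one first leg.\<close>

definition cell_step where
  "cell_step y p \<alpha> \<beta> u v f u' v' f' \<longleftrightarrow> p \<in> \<Sigma> \<and> ud p = uc u \<and>
     is_iso (Cells A) \<alpha> \<and> Dom (Cells A) \<alpha> = u' \<and> Cod (Cells A) \<alpha> = p \<odot> u \<and>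
     \<beta> \<in> Arr (Cells A) \<and> Dom (Cells A) \<beta> = p \<odot> v \<and> Cod (Cells A) \<beta> = v' \<and>
     f' = Gc \<beta> y \<cdot>\<^bsub>Map0 G (uc p)\<^esub> (Ga p f \<cdot>\<^bsub>Map0 G (uc p)\<^esub> Gc \<alpha> x0)"

definition step :: "'a \<Rightarrow> 'o \<Rightarrow> 'f \<times> 'f \<times> 'm \<Rightarrow> 'f \<times> 'f \<times> 'm \<Rightarrow> bool" where
  "step b y = (\<lambda>(u, v, f) (u', v', f'). germ b y (u, v, f) \<and> germ b y (u', v', f') \<and>
     (\<exists>p \<alpha> \<beta>. cell_step y p \<alpha> \<beta> u v f u' v' f'))"

lemma germD:
  assumes "germ b y (u, v, f)"
  shows "u \<in> \<Sigma>" "ud u = a0" "v \<in> Arr (Under A)" "ud v = b" "uc v = uc u" "b \<in> Obj (Under A)"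
    "y \<in> Obj (Map0 G b)" "f \<in> Arr (Map0 G (uc u))" "Dom (Map0 G (uc u)) f = Go u x0" "Cod (Map0 G (uc u)) f = Go v y"
  using assms by (auto simp: germ_def)

lemma stepI:
  assumes g: "germ b y (u, v, f)" and p: "p \<in> \<Sigma>" "ud p = uc u"
    and \<alpha>: "is_iso (Cells A) \<alpha>" "Dom (Cells A) \<alpha> = u'" "Cod (Cells A) \<alpha> = p \<odot> u" "u' \<in> \<Sigma>"
    and \<beta>: "\<beta> \<in> Arr (Cells A)" "Dom (Cells A) \<beta> = p \<odot> v" "Cod (Cells A) \<beta> = v'"
    and f': "f' = Gc \<beta> y \<cdot>\<^bsub>Map0 G (uc p)\<^esub> (Ga p f \<cdot>\<^bsub>Map0 G (uc p)\<^esub> Gc \<alpha> x0)"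
  shows "step b y (u, v, f) (u', v', f')"
proof -
  note d = germD[OF g]
  note a = cinv_props(6)[OF \<alpha>(1)]
  have u: "ud u' = a0" "uc u' = uc p" "uc v' = uc p" "ud v' = b" "v' \<in> Arr (Under A)"
    using two_cat_cell[OF twoA a] two_cat_cell[OF twoA \<beta>(1)] \<alpha> \<beta> p d by simp_all
  have "germ b y (u', v', f')"
    unfolding germ_def f' using u d \<alpha> \<beta> p a by simp
  then show ?thesis unfolding step_def using g assms by (auto simp: cell_step_def)
qed

lemma stepE:
  assumes "step b y (u, v, f) (u', v', f')"
  obtains p \<alpha> \<beta> where "p \<in> \<Sigma>" "ud p = uc u" "uc p = uc u'"
    "is_iso (Cells A) \<alpha>" "\<alpha> \<in> Arr (Cells A)" "Dom (Cells A) \<alpha> = u'" "Cod (Cells A) \<alpha> = p \<odot> u"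
    "\<beta> \<in> Arr (Cells A)" "Dom (Cells A) \<beta> = p \<odot> v" "Cod (Cells A) \<beta> = v'"
    "f' = Gc \<beta> y \<cdot>\<^bsub>Map0 G (uc u')\<^esub> (Ga p f \<cdot>\<^bsub>Map0 G (uc u')\<^esub> Gc \<alpha> x0)"
    "germ b y (u, v, f)" "germ b y (u', v', f')"
proof -
  from assms obtain p \<alpha> \<beta> where g: "germ b y (u, v, f)" "germ b y (u', v', f')"
    and c: "cell_step y p \<alpha> \<beta> u v f u' v' f'" unfolding step_def by blast
  note d = germD[OF g(1)] germD[OF g(2)]
  have a: "\<alpha> \<in> Arr (Cells A)" using c cinv_props(6) by (auto simp: cell_step_def)
  have u: "uc p = uc u'" using two_cat_cell(4)[OF twoA a] c d by (simp add: cell_step_def)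
  show ?thesis by (rule that[of p \<alpha> \<beta>]) (use c a g u in \<open>simp_all add: cell_step_def\<close>)
qed

lemma step_refl: "germ b y e \<Longrightarrow> step b y e e"
proof (cases e)
  case (fields u v f)
  assume "germ b y e"
  then have g: "germ b y (u, v, f)" using fields by simp
  note [simp] = germD[OF g]
  show ?thesis unfolding fields
    by (rule stepI[OF g, of "Ident (Under A) (uc u)" "Ident (Cells A) u" _ "Ident (Cells A) v"]) simp_all
qed

text \<open>Stages compose, and the cells of the second step are pasted onto the whiskered cells of
  the first.\<close>

lemma step_trans:
  assumes "step b y e d" "step b y d c"
  shows "step b y e c"
proof -
  obtain u v f where e: "e = (u, v, f)" by (cases e)
  obtain u1 v1 f1 where d: "d = (u1, v1, f1)" by (cases d)
  obtain u2 v2 f2 where c: "c = (u2, v2, f2)" by (cases c)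
  obtain p \<alpha> \<beta> where p: "p \<in> \<Sigma>" "ud p = uc u" "uc p = uc u1"
    "is_iso (Cells A) \<alpha>" "\<alpha> \<in> Arr (Cells A)" "Dom (Cells A) \<alpha> = u1" "Cod (Cells A) \<alpha> = p \<odot> u"
    "\<beta> \<in> Arr (Cells A)" "Dom (Cells A) \<beta> = p \<odot> v" "Cod (Cells A) \<beta> = v1"
    "f1 = Gc \<beta> y \<cdot>\<^bsub>Map0 G (uc u1)\<^esub> (Ga p f \<cdot>\<^bsub>Map0 G (uc u1)\<^esub> Gc \<alpha> x0)"
    "germ b y (u, v, f)" "germ b y (u1, v1, f1)"
    using assms(1) unfolding e d by (rule stepE)
  obtain q \<alpha>' \<beta>' where q: "q \<in> \<Sigma>" "ud q = uc u1" "uc q = uc u2"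
    "is_iso (Cells A) \<alpha>'" "\<alpha>' \<in> Arr (Cells A)" "Dom (Cells A) \<alpha>' = u2" "Cod (Cells A) \<alpha>' = q \<odot> u1"
    "\<beta>' \<in> Arr (Cells A)" "Dom (Cells A) \<beta>' = q \<odot> v1" "Cod (Cells A) \<beta>' = v2"
    "f2 = Gc \<beta>' y \<cdot>\<^bsub>Map0 G (uc u2)\<^esub> (Ga q f1 \<cdot>\<^bsub>Map0 G (uc u2)\<^esub> Gc \<alpha>' x0)"
    "germ b y (u1, v1, f1)" "germ b y (u2, v2, f2)"
    using assms(2) unfolding d c by (rule stepE)
  note [simp] = germD[OF p(12)] germD(1-7)[OF p(13)] germD(1-7)[OF q(13)] p(1-10) q(1-10)
  show ?thesis unfolding e c
    by (rule stepI[OF p(12), of "q \<odot> p" "(q \<triangleright> \<alpha>) \<cdot>\<^bsub>Cells A\<^esub> \<alpha>'" _ "\<beta>' \<cdot>\<^bsub>Cells A\<^esub> (q \<triangleright> \<beta>)"])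
      (simp_all add: cat_assoc p(11) q(11))
qed

text \<open>The stages \<open>p\<close> and \<open>q\<close> are in \<open>\<Sigma>\<close>, so an
  Ore square with invertible \<open>\<zeta>\<close> joins them and leads to a common first leg. For
  the second legs \<open>extend2\<close> supplies a common target \<open>m\<close> in
  \<open>\<Sigma>\<close>; the two ways of reaching it need not agree, but F2 makes them agree after
  one more arrow. Confluence is what makes having a common successor a transitive relation.\<close>

lemma step_confluent:
  assumes "step b y e d1" "step b y e d2"
  shows "\<exists>d. step b y d1 d \<and> step b y d2 d"
proof -
  obtain u v f where e: "e = (u, v, f)" by (cases e)
  obtain u1 v1 f1 where d1: "d1 = (u1, v1, f1)" by (cases d1)
  obtain u2 v2 f2 where d2: "d2 = (u2, v2, f2)" by (cases d2)
  obtain p \<alpha> \<beta> where p: "p \<in> \<Sigma>" "ud p = uc u" "uc p = uc u1"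
    "is_iso (Cells A) \<alpha>" "\<alpha> \<in> Arr (Cells A)" "Dom (Cells A) \<alpha> = u1" "Cod (Cells A) \<alpha> = p \<odot> u"
    "\<beta> \<in> Arr (Cells A)" "Dom (Cells A) \<beta> = p \<odot> v" "Cod (Cells A) \<beta> = v1"
    "f1 = Gc \<beta> y \<cdot>\<^bsub>Map0 G (uc u1)\<^esub> (Ga p f \<cdot>\<^bsub>Map0 G (uc u1)\<^esub> Gc \<alpha> x0)"
    "germ b y (u, v, f)" "germ b y (u1, v1, f1)"
    using assms(1) unfolding e d1 by (rule stepE)
  obtain q \<alpha>' \<beta>' where q: "q \<in> \<Sigma>" "ud q = uc u" "uc q = uc u2"
    "is_iso (Cells A) \<alpha>'" "\<alpha>' \<in> Arr (Cells A)" "Dom (Cells A) \<alpha>' = u2" "Cod (Cells A) \<alpha>' = q \<odot> u"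
    "\<beta>' \<in> Arr (Cells A)" "Dom (Cells A) \<beta>' = q \<odot> v" "Cod (Cells A) \<beta>' = v2"
    "f2 = Gc \<beta>' y \<cdot>\<^bsub>Map0 G (uc u2)\<^esub> (Ga q f \<cdot>\<^bsub>Map0 G (uc u2)\<^esub> Gc \<alpha>' x0)"
    "germ b y (u, v, f)" "germ b y (u2, v2, f2)"
    using assms(2) unfolding e d2 by (rule stepE)
  note [simp] = germD[OF p(12)] germD(1-7)[OF p(13)] germD(1-7)[OF q(13)] p(1-10) q(1-10)
  obtain r s \<zeta> where r: "r \<in> \<Sigma>" "s \<in> \<Sigma>" "ud r = uc u1" "ud s = uc u2" "uc s = uc r"
    "\<zeta> \<in> Arr (Cells A)" "Dom (Cells A) \<zeta> = r \<odot> p" "Cod (Cells A) \<zeta> = s \<odot> q" "is_iso (Cells A) \<zeta>"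
    by (rule ore[of p q]) simp_all
  note [simp] = r
  obtain k m \<gamma> \<gamma>' where k: "k \<in> \<Sigma>" "m \<in> \<Sigma>" "ud k = uc r" "ud m = b" "uc m = uc k"
    "\<gamma> \<in> Arr (Cells A)" "Dom (Cells A) \<gamma> = k \<odot> (r \<odot> v1)" "Cod (Cells A) \<gamma> = m"
    "\<gamma>' \<in> Arr (Cells A)" "Dom (Cells A) \<gamma>' = k \<odot> (s \<odot> v2)" "Cod (Cells A) \<gamma>' = m"
    by (rule extend2[of "r \<odot> v1" "s \<odot> v2"]) simp_all
  note [simp] = k
  \<comment> \<open>Both cells run from \<open>k r p v\<close> to \<open>m\<close>, one through the
    leg \<open>v1\<close>, the other through \<open>\<zeta>\<close> and the leg \<open>v2\<close>;
    their target is in \<open>\<Sigma>\<close>, as F2 requires.\<close>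
  let ?c1 = "\<gamma> \<cdot>\<^bsub>Cells A\<^esub> (k \<triangleright> (r \<triangleright> \<beta>))"
  let ?c2 = "\<gamma>' \<cdot>\<^bsub>Cells A\<^esub> ((k \<triangleright> (s \<triangleright> \<beta>')) \<cdot>\<^bsub>Cells A\<^esub> (k \<triangleright> (\<zeta> \<triangleleft> v)))"
  have c: "?c1 \<in> Arr (Cells A)" "?c2 \<in> Arr (Cells A)"
    "Dom (Cells A) ?c2 = Dom (Cells A) ?c1" "Cod (Cells A) ?c2 = Cod (Cells A) ?c1" "Cod (Cells A) ?c1 \<in> \<Sigma>"
    "uc (Dom (Cells A) ?c1) = uc k"
    by (simp_all add: cat_assoc)
  obtain h where h: "h \<in> \<Sigma>" "ud h = uc k" "h \<triangleright> ?c1 = h \<triangleright> ?c2"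
    by (rule F2[OF c(1-5)]) (use c(6) in simp)
  note [simp] = h(1,2)
  let ?H = "h \<odot> k" and ?K = "Map0 G (uc h)"
  have "Gc (h \<triangleright> ?c1) y = Gc (h \<triangleright> ?c2) y" using h(3) by simp
  then have eq: "Ga h (Gc \<gamma> y) \<cdot>\<^bsub>?K\<^esub> Ga h (Ga k (Ga r (Gc \<beta> y)))
    = Ga h (Gc \<gamma>' y) \<cdot>\<^bsub>?K\<^esub> (Ga h (Ga k (Ga s (Gc \<beta>' y))) \<cdot>\<^bsub>?K\<^esub> Ga h (Ga k (Gc \<zeta> (Go v y))))"
    by (simp add: cat_assoc)
  let ?u = "?H \<odot> (r \<odot> u1)"
  \<comment> \<open>The first leg of the common successor is taken from \<open>d1\<close>; for
    \<open>d2\<close> it is linked by the invertible pasting of \<open>\<alpha>\<close>,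
    \<open>\<zeta>\<close> and the inverse of \<open>\<alpha>'\<close>.\<close>
  let ?a = "(?H \<triangleright> (s \<triangleright> cinv (Cells A) \<alpha>')) \<cdot>\<^bsub>Cells A\<^esub> ((?H \<triangleright> (\<zeta> \<triangleleft> u)) \<cdot>\<^bsub>Cells A\<^esub> (?H \<triangleright> (r \<triangleright> \<alpha>)))"
  have ia: "Gc \<alpha>' x0 \<cdot>\<^bsub>Map0 G (uc u2)\<^esub> Gc (cinv (Cells A) \<alpha>') x0 = Ident (Map0 G (uc u2)) (Go q (Go u x0))"
  proof -
    have "Gc (\<alpha>' \<cdot>\<^bsub>Cells A\<^esub> cinv (Cells A) \<alpha>') x0 = Ident (Map0 G (uc u2)) (Go q (Go u x0))"
      by (subst cinv_props(5)) simp_all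
    then show ?thesis by (simp del: cinv_props(5))
  qed
  have ia': "Ga h (Ga k (Ga s (Gc \<alpha>' x0))) \<cdot>\<^bsub>?K\<^esub> (Ga h (Ga k (Ga s (Gc (cinv (Cells A) \<alpha>') x0))) \<cdot>\<^bsub>?K\<^esub> z) = z"
    if "z \<in> Arr ?K" "Cod ?K z = Go h (Go k (Go s (Go q (Go u x0))))" for z
  proof -
    have "Ga h (Ga k (Ga s (Gc \<alpha>' x0 \<cdot>\<^bsub>Map0 G (uc u2)\<^esub> Gc (cinv (Cells A) \<alpha>') x0))) \<cdot>\<^bsub>?K\<^esub> z = z"
      unfolding ia using that by simp
    then show ?thesis using that by (simp add: cat_assoc)
  qed
  have nat: "Ga h (Ga k (Gc \<zeta> (Go v y))) \<cdot>\<^bsub>?K\<^esub> Ga h (Ga k (Ga r (Ga p f)))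
     = Ga h (Ga k (Ga s (Ga q f))) \<cdot>\<^bsub>?K\<^esub> Ga h (Ga k (Gc \<zeta> (Go u x0)))"
  proof -
    have "Gc \<zeta> (Go v y) \<cdot>\<^bsub>Map0 G (uc r)\<^esub> Ga r (Ga p f) = Ga s (Ga q f) \<cdot>\<^bsub>Map0 G (uc r)\<^esub> Gc \<zeta> (Go u x0)"
      using Map2_nat[of \<zeta> "uc u" "uc r" f] by simp
    then have "Ga h (Ga k (Gc \<zeta> (Go v y) \<cdot>\<^bsub>Map0 G (uc r)\<^esub> Ga r (Ga p f)))
      = Ga h (Ga k (Ga s (Ga q f) \<cdot>\<^bsub>Map0 G (uc r)\<^esub> Gc \<zeta> (Go u x0)))" by simp
    then show ?thesis by simp
  qed
  let ?f = "Ga h (Gc \<gamma> y) \<cdot>\<^bsub>?K\<^esub> Ga h (Ga k (Ga r f1))"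
  have s1: "step b y d1 (?u, h \<odot> m, ?f)"
    unfolding d1
    by (rule stepI[OF p(13), of "?H \<odot> r" "Ident (Cells A) ?u" _ "h \<triangleright> \<gamma>"])
      (use germD[OF p(13)] in \<open>simp_all add: cat_assoc\<close>)
  have "?f = (Ga h (Gc \<gamma> y) \<cdot>\<^bsub>?K\<^esub> Ga h (Ga k (Ga r (Gc \<beta> y)))) \<cdot>\<^bsub>?K\<^esub>
      (Ga h (Ga k (Ga r (Ga p f))) \<cdot>\<^bsub>?K\<^esub> Ga h (Ga k (Ga r (Gc \<alpha> x0))))"
    unfolding p(11) by (simp add: cat_assoc)
  also have "\<dots> = Ga h (Gc \<gamma>' y) \<cdot>\<^bsub>?K\<^esub> (Ga h (Ga k (Ga s (Gc \<beta>' y))) \<cdot>\<^bsub>?K\<^esub>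
     ((Ga h (Ga k (Gc \<zeta> (Go v y))) \<cdot>\<^bsub>?K\<^esub> Ga h (Ga k (Ga r (Ga p f)))) \<cdot>\<^bsub>?K\<^esub> Ga h (Ga k (Ga r (Gc \<alpha> x0)))))"
    unfolding eq by (simp add: cat_assoc)
  also have "\<dots> = Ga h (Gc \<gamma>' y) \<cdot>\<^bsub>?K\<^esub> (Ga h (Ga k (Ga s f2)) \<cdot>\<^bsub>?K\<^esub> Gc ?a x0)"
    unfolding nat q(11) by (simp add: cat_assoc ia')
  finally have ff: "?f = Ga h (Gc \<gamma>' y) \<cdot>\<^bsub>?K\<^esub> (Ga h (Ga k (Ga s f2)) \<cdot>\<^bsub>?K\<^esub> Gc ?a x0)" .
  have s2: "step b y d2 (?u, h \<odot> m, ?f)"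
    unfolding d2 ff
    by (rule stepI[OF q(13), of "?H \<odot> s" ?a _ "h \<triangleright> \<gamma>'"])
      (use germD[OF q(13)] in \<open>simp_all add: cat_assoc\<close>)
  from s1 s2 show ?thesis by blast
qed

section \<open>Classes of germs and the cone they form\<close>

definition germ_eq where
  "germ_eq b y = {(e, e'). \<exists>d. step b y e d \<and> step b y e' d}"

lemma step_germ: "step b y e d \<Longrightarrow> germ b y e" "step b y e d \<Longrightarrow> germ b y d"
  by (auto simp: step_def split: prod.splits)

lemma germ_eq_refl: "(e, e) \<in> germ_eq b y \<longleftrightarrow> germ b y e"
  unfolding germ_eq_def using step_germ step_refl by blast

lemma step_germ_eq: "step b y e d \<Longrightarrow> (e, d) \<in> germ_eq b y" "step b y e d \<Longrightarrow> (d, e) \<in> germ_eq b y"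
  unfolding germ_eq_def using step_germ step_refl by blast+

lemma per_germ_eq [simp]: "per (germ_eq b y)"
  unfolding per_def
proof
  show "sym (germ_eq b y)" by (auto simp: germ_eq_def sym_def)
  show "trans (germ_eq b y)"
  proof (rule transI)
    fix x y' z assume "(x, y') \<in> germ_eq b y" "(y', z) \<in> germ_eq b y"
    then obtain d d' where d: "step b y x d" "step b y y' d" "step b y y' d'" "step b y z d'"
      unfolding germ_eq_def by blast
    from step_confluent[OF d(2,3)] obtain c where "step b y d c" "step b y d' c" by blast
    then show "(x, z) \<in> germ_eq b y" unfolding germ_eq_def using step_trans d by blast
  qed
qed

text \<open>On represented arrows this is composition with \<open>\<theta>(g)\<close>, which
  naturality of \<open>\<theta>\<^sub>v\<close> moves across the leg.\<close>

definition push :: "'m \<Rightarrow> 'f \<times> 'f \<times> 'm \<Rightarrow> 'f \<times> 'f \<times> 'm" where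
  "push g = (\<lambda>(u, v, f). (u, v, Ga v g \<cdot>\<^bsub>Map0 G (uc u)\<^esub> f))"

text \<open>On represented arrows this is composition with \<open>\<theta>\<^sub>h\<close>, by the
  cone law for the composite \<open>v h\<close>.\<close>

definition pull :: "'f \<Rightarrow> 'f \<times> 'f \<times> 'm \<Rightarrow> 'f \<times> 'f \<times> 'm" where
  "pull h = (\<lambda>(u, v, f). (u, v \<odot> h, f))"

lemma germ_push: "germ b y e \<Longrightarrow> g \<in> Arr (Map0 G b) \<Longrightarrow> Dom (Map0 G b) g = y
    \<Longrightarrow> germ b (Cod (Map0 G b) g) (push g e)"
  by (cases e) (auto simp: germ_def push_def)

lemma germ_pull: "germ b (Go h y) e \<Longrightarrow> h \<in> Arr (Under A) \<Longrightarrow> uc h = b \<Longrightarrow> y \<in> Obj (Map0 G (ud h))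
    \<Longrightarrow> germ (ud h) y (pull h e)"
  by (cases e) (auto simp: germ_def pull_def)

lemma step_push:
  assumes "step b y e d" "g \<in> Arr (Map0 G b)" "Dom (Map0 G b) g = y"
  shows "step b (Cod (Map0 G b) g) (push g e) (push g d)"
proof -
  obtain u v f where e: "e = (u, v, f)" by (cases e)
  obtain u1 v1 f1 where d: "d = (u1, v1, f1)" by (cases d)
  obtain p \<alpha> \<beta> where p: "p \<in> \<Sigma>" "ud p = uc u" "uc p = uc u1"
    "is_iso (Cells A) \<alpha>" "\<alpha> \<in> Arr (Cells A)" "Dom (Cells A) \<alpha> = u1" "Cod (Cells A) \<alpha> = p \<odot> u"
    "\<beta> \<in> Arr (Cells A)" "Dom (Cells A) \<beta> = p \<odot> v" "Cod (Cells A) \<beta> = v1"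
    "f1 = Gc \<beta> y \<cdot>\<^bsub>Map0 G (uc u1)\<^esub> (Ga p f \<cdot>\<^bsub>Map0 G (uc u1)\<^esub> Gc \<alpha> x0)"
    "germ b y (u, v, f)" "germ b y (u1, v1, f1)"
    using assms(1) unfolding e d by (rule stepE)
  note [simp] = germD[OF p(12)] germD(1-7)[OF p(13)] p(1-10) assms(2,3)
  have n: "Gc \<beta> (Cod (Map0 G b) g) \<cdot>\<^bsub>Map0 G (uc u1)\<^esub> Ga p (Ga v g) = Ga v1 g \<cdot>\<^bsub>Map0 G (uc u1)\<^esub> Gc \<beta> y"
    using Map2_nat[of \<beta> b "uc u1" g] by simp
  have "Ga v1 g \<cdot>\<^bsub>Map0 G (uc u1)\<^esub> f1 = (Ga v1 g \<cdot>\<^bsub>Map0 G (uc u1)\<^esub> Gc \<beta> y) \<cdot>\<^bsub>Map0 G (uc u1)\<^esub>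
      (Ga p f \<cdot>\<^bsub>Map0 G (uc u1)\<^esub> Gc \<alpha> x0)"
    unfolding p(11) by (simp add: cat_assoc)
  also have "\<dots> = Gc \<beta> (Cod (Map0 G b) g) \<cdot>\<^bsub>Map0 G (uc u1)\<^esub>
      (Ga p (Ga v g \<cdot>\<^bsub>Map0 G (uc u)\<^esub> f) \<cdot>\<^bsub>Map0 G (uc u1)\<^esub> Gc \<alpha> x0)"
    unfolding n[symmetric] by (simp add: cat_assoc)
  finally have q: "Ga v1 g \<cdot>\<^bsub>Map0 G (uc u1)\<^esub> f1 = \<dots>" .
  have g: "germ b (Cod (Map0 G b) g) (u, v, Ga v g \<cdot>\<^bsub>Map0 G (uc u)\<^esub> f)"
    using germ_push[OF p(12) assms(2,3)] by (simp add: push_def)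
  show ?thesis unfolding e d push_def prod.case
    by (rule stepI[OF g, of p \<alpha> _ \<beta>]) (simp_all add: q)
qed

lemma step_pull:
  assumes "step b (Go h y) e d" "h \<in> Arr (Under A)" "uc h = b" "y \<in> Obj (Map0 G (ud h))"
  shows "step (ud h) y (pull h e) (pull h d)"
proof -
  obtain u v f where e: "e = (u, v, f)" by (cases e)
  obtain u1 v1 f1 where d: "d = (u1, v1, f1)" by (cases d)
  obtain p \<alpha> \<beta> where p: "p \<in> \<Sigma>" "ud p = uc u" "uc p = uc u1"
    "is_iso (Cells A) \<alpha>" "\<alpha> \<in> Arr (Cells A)" "Dom (Cells A) \<alpha> = u1" "Cod (Cells A) \<alpha> = p \<odot> u"
    "\<beta> \<in> Arr (Cells A)" "Dom (Cells A) \<beta> = p \<odot> v" "Cod (Cells A) \<beta> = v1"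
    "f1 = Gc \<beta> (Go h y) \<cdot>\<^bsub>Map0 G (uc u1)\<^esub> (Ga p f \<cdot>\<^bsub>Map0 G (uc u1)\<^esub> Gc \<alpha> x0)"
    "germ b (Go h y) (u, v, f)" "germ b (Go h y) (u1, v1, f1)"
    using assms(1) unfolding e d by (rule stepE)
  note [simp] = germD[OF p(12)] germD(1-7)[OF p(13)] p(1-10) assms(2,3,4)
  have g: "germ (ud h) y (u, v \<odot> h, f)"
    using germ_pull[OF p(12) assms(2,3,4)] by (simp add: pull_def)
  show ?thesis unfolding e d pull_def prod.case
    by (rule stepI[OF g, of p \<alpha> _ "\<beta> \<triangleleft> h"]) (simp_all add: p(11) cat_assoc)
qed

text \<open>An Ore square of \<open>v\<close> against \<open>h\<close> gives
  \<open>\<zeta> : r v \<Rightarrow> s h\<close>. Its direction is the one that a step allows on the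
  second leg, so the germ steps to one whose second leg factors through \<open>h\<close>.\<close>

lemma pull_surj:
  assumes g: "germ (ud h) y e" and h: "h \<in> \<Sigma>"
  shows "\<exists>d. germ (uc h) (Go h y) d \<and> step (ud h) y e (pull h d)"
proof -
  obtain u v f where e: "e = (u, v, f)" by (cases e)
  note [simp] = germD[OF g[unfolded e]] h
  obtain r s \<zeta> where r: "r \<in> \<Sigma>" "s \<in> \<Sigma>" "ud r = uc u" "ud s = uc h" "uc s = uc r"
    "\<zeta> \<in> Arr (Cells A)" "Dom (Cells A) \<zeta> = r \<odot> v" "Cod (Cells A) \<zeta> = s \<odot> h"
    by (rule ore[of v h]) simp_all
  note [simp] = r
  let ?f = "Gc \<zeta> y \<cdot>\<^bsub>Map0 G (uc r)\<^esub> Ga r f"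
  have "germ (uc h) (Go h y) (r \<odot> u, s, ?f)" by (simp add: germ_def)
  moreover have "step (ud h) y (u, v, f) (r \<odot> u, s \<odot> h, ?f)"
    by (rule stepI[OF g[unfolded e], of r "Ident (Cells A) (r \<odot> u)" _ \<zeta>]) simp_all
  ultimately show ?thesis unfolding e by (intro exI[of _ "(r \<odot> u, s, ?f)"]) (simp add: pull_def)
qed

text \<open>The given 2-cell goes from \<open>p v h\<close> to \<open>v1 h\<close> and need not
  arise by whiskering from a cell between \<open>p v\<close> and \<open>v1\<close>. Sending both
  legs to a common \<open>m\<close> in \<open>\<Sigma>\<close> leaves two cells into
  \<open>m h\<close>; this target is in \<open>\<Sigma>\<close> because \<open>h\<close> is, so F2
  reconciles them.\<close>

lemma pull_reflect:
  assumes s: "step (ud h) y (pull h e) (pull h d)" and h: "h \<in> \<Sigma>"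
    and g: "germ (uc h) (Go h y) e" "germ (uc h) (Go h y) d"
  shows "(e, d) \<in> germ_eq (uc h) (Go h y)"
proof -
  obtain u v f where e: "e = (u, v, f)" by (cases e)
  obtain u1 v1 f1 where d: "d = (u1, v1, f1)" by (cases d)
  obtain p \<alpha> \<beta> where p: "p \<in> \<Sigma>" "ud p = uc u" "uc p = uc u1"
    "is_iso (Cells A) \<alpha>" "\<alpha> \<in> Arr (Cells A)" "Dom (Cells A) \<alpha> = u1" "Cod (Cells A) \<alpha> = p \<odot> u"
    "\<beta> \<in> Arr (Cells A)" "Dom (Cells A) \<beta> = p \<odot> (v \<odot> h)" "Cod (Cells A) \<beta> = v1 \<odot> h"
    "f1 = Gc \<beta> y \<cdot>\<^bsub>Map0 G (uc u1)\<^esub> (Ga p f \<cdot>\<^bsub>Map0 G (uc u1)\<^esub> Gc \<alpha> x0)"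
    "germ (ud h) y (u, v \<odot> h, f)" "germ (ud h) y (u1, v1 \<odot> h, f1)"
    using s unfolding e d pull_def prod.case by (rule stepE)
  note [simp] = germD[OF g(1)[unfolded e]] germD(1-7)[OF g(2)[unfolded d]] germD(7)[OF p(12)] p(1-10) h
  obtain k m \<gamma> \<gamma>' where k: "k \<in> \<Sigma>" "m \<in> \<Sigma>" "ud k = uc u1" "ud m = uc h" "uc m = uc k"
    "\<gamma> \<in> Arr (Cells A)" "Dom (Cells A) \<gamma> = k \<odot> (p \<odot> v)" "Cod (Cells A) \<gamma> = m"
    "\<gamma>' \<in> Arr (Cells A)" "Dom (Cells A) \<gamma>' = k \<odot> v1" "Cod (Cells A) \<gamma>' = m"
    by (rule extend2[of "p \<odot> v" v1]) simp_all
  note [simp] = k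
  let ?c1 = "\<gamma> \<triangleleft> h" and ?c2 = "(\<gamma>' \<triangleleft> h) \<cdot>\<^bsub>Cells A\<^esub> (k \<triangleright> \<beta>)"
  have c: "?c1 \<in> Arr (Cells A)" "?c2 \<in> Arr (Cells A)"
    "Dom (Cells A) ?c2 = Dom (Cells A) ?c1" "Cod (Cells A) ?c2 = Cod (Cells A) ?c1" "Cod (Cells A) ?c1 \<in> \<Sigma>"
    "uc (Dom (Cells A) ?c1) = uc k"
    by (simp_all add: cat_assoc)
  obtain t where t: "t \<in> \<Sigma>" "ud t = uc k" "t \<triangleright> ?c1 = t \<triangleright> ?c2"
    by (rule F2[OF c(1-5)]) (use c(6) in simp)
  note [simp] = t(1,2)
  let ?K = "Map0 G (uc t)"
  have "Gc (t \<triangleright> ?c1) y = Gc (t \<triangleright> ?c2) y" using t(3) by simp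
  then have eq: "Ga t (Gc \<gamma> (Go h y)) = Ga t (Gc \<gamma>' (Go h y)) \<cdot>\<^bsub>?K\<^esub> Ga t (Ga k (Gc \<beta> y))"
    by (simp add: cat_assoc)
  let ?f = "Ga t (Gc \<gamma>' (Go h y)) \<cdot>\<^bsub>?K\<^esub> Ga t (Ga k f1)"
  let ?u = "t \<odot> (k \<odot> u1)"
  have s1: "step (uc h) (Go h y) d (?u, t \<odot> m, ?f)"
    unfolding d
    by (rule stepI[OF g(2)[unfolded d], of "t \<odot> k" "Ident (Cells A) ?u" _ "t \<triangleright> \<gamma>'"])
      (use germD[OF g(2)[unfolded d]] in \<open>simp_all add: cat_assoc\<close>)
  have ff: "?f = Ga t (Gc \<gamma> (Go h y)) \<cdot>\<^bsub>?K\<^esub> (Ga t (Ga k (Ga p f)) \<cdot>\<^bsub>?K\<^esub> Ga t (Ga k (Gc \<alpha> x0)))"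
    unfolding p(11) eq by (simp add: cat_assoc)
  have s2: "step (uc h) (Go h y) e (?u, t \<odot> m, ?f)"
    unfolding e ff
    by (rule stepI[OF g(1)[unfolded e], of "t \<odot> (k \<odot> p)" "t \<triangleright> (k \<triangleright> \<alpha>)" _ "t \<triangleright> \<gamma>"])
      (simp_all add: cat_assoc)
  from s1 s2 show ?thesis unfolding germ_eq_def by blast
qed

text \<open>Compatibility of the germs with a 2-cell \<open>\<gamma>\<close> is not an equality of
  representatives but a single step, whose second cell is \<open>\<gamma>\<close> whiskered by
  \<open>v\<close>. This is why that cell must be allowed to be non-invertible.\<close>

lemma step_cell:
  assumes g: "germ b (Go (Dom (Cells A) \<gamma>) y) e" and c: "\<gamma> \<in> Arr (Cells A)" "b = uc (Dom (Cells A) \<gamma>)"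
     "a = ud (Dom (Cells A) \<gamma>)" and y: "y \<in> Obj (Map0 G a)"
  shows "step a y (pull (Dom (Cells A) \<gamma>) e) (pull (Cod (Cells A) \<gamma>) (push (Gc \<gamma> y) e))"
proof -
  obtain u v f where e: "e = (u, v, f)" by (cases e)
  note [simp] = germD[OF g[unfolded e]] c y[unfolded c(3)]
  have g': "germ a y (u, v \<odot> Dom (Cells A) \<gamma>, f)"
    using germ_pull[OF g] by (simp add: pull_def e)
  show ?thesis unfolding e pull_def push_def prod.case
    by (rule stepI[OF g', of "Ident (Under A) (uc u)" "Ident (Cells A) u" _ "v \<triangleright> \<gamma>"])
      simp_all
qed

lemma step_cong:
  assumes "\<And>e d. step b y e d \<Longrightarrow> step b' y' (k e) (k d)"
  shows "per_cong (germ_eq b y) k (germ_eq b' y')"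
proof -
  have "(k e, k e') \<in> germ_eq b' y'" if "(e, e') \<in> germ_eq b y" for e e'
    using that assms unfolding germ_eq_def by blast
  then show ?thesis unfolding per_cong_def by auto
qed

lemma push_cong:
  assumes "g \<in> Arr (Map0 G b)"
  shows "per_cong (germ_eq b (Dom (Map0 G b) g)) (push g) (germ_eq b (Cod (Map0 G b) g))"
  by (rule step_cong) (rule step_push[OF _ assms refl])

lemma pull_cong:
  assumes "h \<in> Arr (Under A)" "y \<in> Obj (Map0 G (ud h))"
  shows "per_cong (germ_eq (uc h) (Go h y)) (pull h) (germ_eq (ud h) y)"
  by (rule step_cong) (rule step_pull[OF _ assms(1) refl assms(2)])

lemma germ_per_cong:
  assumes "\<And>e. germ b y e \<Longrightarrow> k e = k' e" "\<And>e. germ b y e \<Longrightarrow> germ b' y' (k e)"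
  shows "per_map (germ_eq b y) k (germ_eq b' y') = per_map (germ_eq b y) k' (germ_eq b' y')"
  by (rule per_map_cong) (use assms in \<open>auto simp: germ_eq_refl simp flip: assms(1)\<close>)

definition germ_cone :: "('a, 'f, 'o, 'm, ('f \<times> 'f \<times> 'm) rel,
    ('f \<times> 'f \<times> 'm) rel \<times> ('f \<times> 'f \<times> 'm) rel \<times> ('f \<times> 'f \<times> 'm) rel) transf" where
  "germ_cone = (let t = (\<lambda>b. mkF (Map0 G b) Per (germ_eq b)
        (\<lambda>g. per_map (germ_eq b (Dom (Map0 G b) g)) (push g) (germ_eq b (Cod (Map0 G b) g))))
    in \<lparr>T0 = restrict t (Obj (Under A)),
      T1 = (\<lambda>h\<in>Arr (Under A). mkN (t (uc h) \<cdot>F Map1 G h) (t (ud h))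
         (\<lambda>y. per_map (germ_eq (uc h) (Go h y)) (pull h) (germ_eq (ud h) y)))\<rparr>)"

text \<open>The unit, composition and naturality laws hold already on representatives, the 2-cell
  law after one step. For \<open>h\<close> in \<open>\<Sigma>\<close>, bijectivity of
  \<open>pull h\<close> on classes rests on \<open>pull_surj\<close> and
  \<open>pull_reflect\<close>.\<close>

lemma germ_cone: "sigma_cone A \<Sigma> G Per germ_cone"
proof -
  let ?t = "\<lambda>b. mkF (Map0 G b) Per (germ_eq b)
        (\<lambda>g. per_map (germ_eq b (Dom (Map0 G b) g)) (push g) (germ_eq b (Cod (Map0 G b) g)))"
  have t [simp]: "is_functor (?t b)" if b: "b \<in> Obj (Under A)" for b
  proof (rule is_functor_mkF)
    fix m assume "m \<in> Arr (Map0 G b)"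
    from push_cong[OF this]
    show "per_map (germ_eq b (Dom (Map0 G b) m)) (push m) (germ_eq b (Cod (Map0 G b) m)) \<in> Arr Per \<and>
       Dom Per (per_map (germ_eq b (Dom (Map0 G b) m)) (push m) (germ_eq b (Cod (Map0 G b) m))) = germ_eq b (Dom (Map0 G b) m) \<and>
       Cod Per (per_map (germ_eq b (Dom (Map0 G b) m)) (push m) (germ_eq b (Cod (Map0 G b) m))) = germ_eq b (Cod (Map0 G b) m)"
      by simp
  next
    fix x assume x: "x \<in> Obj (Map0 G b)"
    have "push (Ident (Map0 G b) x) e = e" if "germ b x e" for e
      using that x by (cases e) (auto simp: push_def germ_def)
    then have "per_map (germ_eq b x) (push (Ident (Map0 G b) x)) (germ_eq b x) = Ident Per (germ_eq b x)"
      by (intro per_map_id) (auto simp: germ_eq_refl)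
    then show "per_map (germ_eq b (Dom (Map0 G b) (Ident (Map0 G b) x))) (push (Ident (Map0 G b) x))
       (germ_eq b (Cod (Map0 G b) (Ident (Map0 G b) x))) = Ident Per (germ_eq b x)"
      using b x by simp
  next
    fix m n assume mn: "m \<in> Arr (Map0 G b)" "n \<in> Arr (Map0 G b)" "Cod (Map0 G b) m = Dom (Map0 G b) n"
    have "push (n \<cdot>\<^bsub>Map0 G b\<^esub> m) e = (push n \<circ> push m) e" if "germ b (Dom (Map0 G b) m) e" for e
      using that mn by (cases e) (auto simp: push_def germ_def cat_assoc)
    moreover have "germ b (Cod (Map0 G b) n) (push (n \<cdot>\<^bsub>Map0 G b\<^esub> m) e)" if "germ b (Dom (Map0 G b) m) e" for e
      using germ_push[OF that, of "n \<cdot>\<^bsub>Map0 G b\<^esub> m"] b mn by simp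
    ultimately have "per_map (germ_eq b (Dom (Map0 G b) m)) (push (n \<cdot>\<^bsub>Map0 G b\<^esub> m)) (germ_eq b (Cod (Map0 G b) n))
      = per_map (germ_eq b (Dom (Map0 G b) m)) (push n \<circ> push m) (germ_eq b (Cod (Map0 G b) n))"
      by (intro germ_per_cong) auto
    then show "per_map (germ_eq b (Dom (Map0 G b) (n \<cdot>\<^bsub>Map0 G b\<^esub> m))) (push (n \<cdot>\<^bsub>Map0 G b\<^esub> m))
          (germ_eq b (Cod (Map0 G b) (n \<cdot>\<^bsub>Map0 G b\<^esub> m)))
      = per_map (germ_eq b (Dom (Map0 G b) n)) (push n) (germ_eq b (Cod (Map0 G b) n)) \<cdot>\<^bsub>Per\<^esub>
        per_map (germ_eq b (Dom (Map0 G b) m)) (push m) (germ_eq b (Cod (Map0 G b) m))"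
      using b mn per_map_comp[OF push_cong[OF mn(1)] push_cong[OF mn(2), folded mn(3)]] by (simp del: Per_sel)
  qed (use b in \<open>simp_all del: Per_sel(2-5)\<close>)
  have n [simp]: "is_ntrans (mkN (?t (uc h) \<cdot>F Map1 G h) (?t (ud h))
         (\<lambda>y. per_map (germ_eq (uc h) (Go h y)) (pull h) (germ_eq (ud h) y)))" if h: "h \<in> Arr (Under A)" for h
  proof (rule is_ntrans_mkN[where C="Map0 G (ud h)" and D=Per])
    fix y assume "y \<in> Obj (Map0 G (ud h))"
    with pull_cong[OF h this] show "per_map (germ_eq (uc h) (Go h y)) (pull h) (germ_eq (ud h) y) \<in> Arr Per \<and>
      Dom Per (per_map (germ_eq (uc h) (Go h y)) (pull h) (germ_eq (ud h) y)) = FObj (?t (uc h) \<cdot>F Map1 G h) y \<and>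
      Cod Per (per_map (germ_eq (uc h) (Go h y)) (pull h) (germ_eq (ud h) y)) = FObj (?t (ud h)) y"
      using h by simp
  next
    fix m assume m: "m \<in> Arr (Map0 G (ud h))"
    let ?x = "Dom (Map0 G (ud h)) m" and ?y = "Cod (Map0 G (ud h)) m"
    have e: "(pull h \<circ> push (Ga h m)) e = (push m \<circ> pull h) e" if "germ (uc h) (Go h ?x) e" for e
      using that m h by (cases e) (auto simp: push_def pull_def germ_def)
    have ge: "germ (ud h) ?y ((pull h \<circ> push (Ga h m)) e)" if "germ (uc h) (Go h ?x) e" for e
      unfolding e[OF that] using germ_push[OF germ_pull[OF that h refl]] m h by simp
    have x: "?x \<in> Obj (Map0 G (ud h))" "?y \<in> Obj (Map0 G (ud h))" using m h by simp_all
    have pm: "per_cong (germ_eq (uc h) (Go h ?x)) (push (Ga h m)) (germ_eq (uc h) (Go h ?y))"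
      using push_cong[of "Ga h m" "uc h"] m h by simp
    have "per_map (germ_eq (uc h) (Go h ?y)) (pull h) (germ_eq (ud h) ?y) \<cdot>\<^bsub>Per\<^esub>
        per_map (germ_eq (uc h) (Go h ?x)) (push (Ga h m)) (germ_eq (uc h) (Go h ?y))
      = per_map (germ_eq (uc h) (Go h ?x)) (pull h \<circ> push (Ga h m)) (germ_eq (ud h) ?y)"
      by (rule per_map_comp[OF pm pull_cong[OF h x(2)]])
    also have "\<dots> = per_map (germ_eq (uc h) (Go h ?x)) (push m \<circ> pull h) (germ_eq (ud h) ?y)"
      by (rule germ_per_cong) (use e ge in auto)
    also have "\<dots> = per_map (germ_eq (ud h) ?x) (push m) (germ_eq (ud h) ?y) \<cdot>\<^bsub>Per\<^esub>
       per_map (germ_eq (uc h) (Go h ?x)) (pull h) (germ_eq (ud h) ?x)"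
      by (rule per_map_comp[OF pull_cong[OF h x(1)] push_cong[OF m], symmetric])
    finally show "per_map (germ_eq (uc h) (Go h ?y)) (pull h) (germ_eq (ud h) ?y) \<cdot>\<^bsub>Per\<^esub> FArr (?t (uc h) \<cdot>F Map1 G h) m
      = FArr (?t (ud h)) m \<cdot>\<^bsub>Per\<^esub> per_map (germ_eq (uc h) (Go h ?x)) (pull h) (germ_eq (ud h) ?x)"
      using h m by (simp del: Per_sel)
  qed (use h in simp_all)
  show ?thesis
  proof (rule sigma_coneI)
    fix a x assume a: "a \<in> Obj (Under A)" "x \<in> Obj (Map0 G a)"
    have "pull (Ident (Under A) a) e = e" if "germ a x e" for e
      using that by (cases e) (auto simp: pull_def germ_def)
    then have "per_map (germ_eq a x) (pull (Ident (Under A) a)) (germ_eq a x) = Ident Per (germ_eq a x)"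
      by (intro per_map_id) (auto simp: germ_eq_refl)
    then show "NCmp (T1 germ_cone (Ident (Under A) a)) x = Ident Per (FObj (T0 germ_cone a) x)"
      using a by (simp add: germ_cone_def Let_def)
  next
    fix f g x assume a: "f \<in> Arr (Under A)" "g \<in> Arr (Under A)" "uc f = ud g" "x \<in> Obj (Map0 G (ud f))"
    have e: "pull (g \<odot> f) e = (pull f \<circ> pull g) e" if "germ (uc g) (Go g (Go f x)) e" for e
      using that a by (cases e) (auto simp: pull_def germ_def cat_assoc)
    have "per_map (germ_eq (uc g) (Go g (Go f x))) (pull (g \<odot> f)) (germ_eq (ud f) x)
      = per_map (germ_eq (uc g) (Go g (Go f x))) (pull f \<circ> pull g) (germ_eq (ud f) x)"
    proof (rule germ_per_cong)
      fix e assume "germ (uc g) (Go g (Go f x)) e"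
      then show "germ (ud f) x (pull (g \<odot> f) e)"
        using a germ_pull[of "uc g" "g \<odot> f" x e] by simp
    qed (use e in auto)
    also have "\<dots> = per_map (germ_eq (uc f) (Go f x)) (pull f) (germ_eq (ud f) x) \<cdot>\<^bsub>Per\<^esub>
       per_map (germ_eq (uc g) (Go g (Go f x))) (pull g) (germ_eq (uc f) (Go f x))"
      by (rule per_map_comp[symmetric]) (use pull_cong[of g "Go f x"] pull_cong[of f x] a in auto)
    finally show "NCmp (T1 germ_cone (g \<odot> f)) x = NCmp (T1 germ_cone f) x \<cdot>\<^bsub>Per\<^esub> NCmp (T1 germ_cone g) (Go f x)"
      using a by (simp add: germ_cone_def Let_def del: Per_sel)
  next
    fix \<gamma> x assume g: "\<gamma> \<in> Arr (Cells A)" "x \<in> Obj (Map0 G (ud (Dom (Cells A) \<gamma>)))"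
    let ?f = "Dom (Cells A) \<gamma>" and ?g = "Cod (Cells A) \<gamma>"
    have pc: "per_cong (germ_eq (uc ?f) (Go ?f x)) (push (Gc \<gamma> x)) (germ_eq (uc ?f) (Go ?g x))"
      using push_cong[of "Gc \<gamma> x" "uc ?f"] g by simp
    have lc: "per_cong (germ_eq (uc ?f) (Go ?g x)) (pull ?g) (germ_eq (ud ?f) x)"
      using pull_cong[of ?g x] g by simp
    have "per_map (germ_eq (uc ?f) (Go ?f x)) (pull ?f) (germ_eq (ud ?f) x)
      = per_map (germ_eq (uc ?f) (Go ?f x)) (pull ?g \<circ> push (Gc \<gamma> x)) (germ_eq (ud ?f) x)"
    proof (rule per_map_cong)
      fix e assume "(e, e) \<in> germ_eq (uc ?f) (Go ?f x)"
      then have "germ (uc ?f) (Go ?f x) e" by (simp add: germ_eq_refl)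
      from step_germ_eq(1)[OF step_cell[OF this g(1) refl refl g(2)]]
      show "(pull ?f e, (pull ?g \<circ> push (Gc \<gamma> x)) e) \<in> germ_eq (ud ?f) x" by simp
    qed simp
    also have "\<dots> = per_map (germ_eq (uc ?f) (Go ?g x)) (pull ?g) (germ_eq (ud ?f) x) \<cdot>\<^bsub>Per\<^esub>
      per_map (germ_eq (uc ?f) (Go ?f x)) (push (Gc \<gamma> x)) (germ_eq (uc ?f) (Go ?g x))"
      by (rule per_map_comp[OF pc lc, symmetric])
    finally show "NCmp (T1 germ_cone ?f) x = NCmp (T1 germ_cone ?g) x \<cdot>\<^bsub>Per\<^esub>
        FArr (T0 germ_cone (uc ?f)) (Gc \<gamma> x)"
      using g by (simp add: germ_cone_def Let_def del: Per_sel)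
  next
    fix h y assume h: "h \<in> \<Sigma>" "y \<in> Obj (Map0 G (ud h))"
    have "is_iso Per (per_map (germ_eq (uc h) (Go h y)) (pull h) (germ_eq (ud h) y))"
    proof (rule per_map_iso)
      show "per_cong (germ_eq (uc h) (Go h y)) (pull h) (germ_eq (ud h) y)" using pull_cong h by simp
      fix d assume "(d, d) \<in> germ_eq (ud h) y"
      then have "germ (ud h) y d" by (simp add: germ_eq_refl)
      from pull_surj[OF this h(1)] show "\<exists>e. (e, e) \<in> germ_eq (uc h) (Go h y) \<and> (pull h e, d) \<in> germ_eq (ud h) y"
        using step_germ_eq germ_eq_refl by blast
    next
      fix e e' assume e: "(e, e) \<in> germ_eq (uc h) (Go h y)" "(e', e') \<in> germ_eq (uc h) (Go h y)"
        "(pull h e, pull h e') \<in> germ_eq (ud h) y"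
      then have g: "germ (uc h) (Go h y) e" "germ (uc h) (Go h y) e'" by (auto simp: germ_eq_refl)
      from e(3) obtain d where d: "step (ud h) y (pull h e) d" "step (ud h) y (pull h e') d"
        by (auto simp: germ_eq_def)
      \<comment> \<open>A common successor of the two pulled germs need not be pulled itself; moving
        on to one that is gives a single germ \<open>c\<close> to which both reflect.\<close>
      from pull_surj[OF step_germ(2)[OF d(1)] h(1)] obtain c where
        c: "germ (uc h) (Go h y) c" "step (ud h) y d (pull h c)" by blast
      have "(e, c) \<in> germ_eq (uc h) (Go h y)" "(e', c) \<in> germ_eq (uc h) (Go h y)"
        using pull_reflect[OF step_trans[OF d(1) c(2)] h(1) g(1) c(1)]
          pull_reflect[OF step_trans[OF d(2) c(2)] h(1) g(2) c(1)] by auto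
      then show "(e, e') \<in> germ_eq (uc h) (Go h y)"
        using perD(1,2)[OF per_germ_eq] by metis
    qed
    then show "is_iso Per (NCmp (T1 germ_cone h) y)"
      using h by (simp add: germ_cone_def Let_def)
  qed (simp_all add: germ_cone_def Let_def)
qed

text \<open>A common successor \<open>(u, w, k)\<close> shows only that \<open>G(w) f\<close> after
  \<open>\<beta> \<alpha>\<close> equals \<open>G(w) g\<close> after
  \<open>\<beta>' \<alpha>'\<close>, where the two cells \<open>u \<Rightarrow> w\<close> may differ
  and need not be invertible. After moving \<open>w\<close> to some \<open>m\<close> in
  \<open>\<Sigma>\<close>, F1 gives an invertible cell between later composites of \<open>m\<close>
  and \<open>u\<close>, and F2 makes both pasted cells equal to its inverse at a still later stage.
  There they cancel.\<close>

lemma germ_eq_arr: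
  assumes f: "f \<in> hom (Map0 G a0) x0 y" "g \<in> hom (Map0 G a0) x0 y"
    and i: "i = Ident (Under A) a0" and fg: "((i, i, f), (i, i, g)) \<in> germ_eq a0 y"
  shows "\<exists>u\<in>\<Sigma>. ud u = a0 \<and> Ga u f = Ga u g"
proof -
  obtain u w k where d: "step a0 y (i, i, f) (u, w, k)" "step a0 y (i, i, g) (u, w, k)"
    using fg unfolding germ_eq_def by auto
  obtain p \<alpha> \<beta> where p: "p \<in> \<Sigma>" "ud p = uc i" "uc p = uc u"
    "is_iso (Cells A) \<alpha>" "\<alpha> \<in> Arr (Cells A)" "Dom (Cells A) \<alpha> = u" "Cod (Cells A) \<alpha> = p \<odot> i"
    "\<beta> \<in> Arr (Cells A)" "Dom (Cells A) \<beta> = p \<odot> i" "Cod (Cells A) \<beta> = w"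
    "k = Gc \<beta> y \<cdot>\<^bsub>Map0 G (uc u)\<^esub> (Ga p f \<cdot>\<^bsub>Map0 G (uc u)\<^esub> Gc \<alpha> x0)"
    "germ a0 y (i, i, f)" "germ a0 y (u, w, k)"
    using d(1) by (rule stepE)
  obtain q \<alpha>' \<beta>' where q: "q \<in> \<Sigma>" "ud q = uc i" "uc q = uc u"
    "is_iso (Cells A) \<alpha>'" "\<alpha>' \<in> Arr (Cells A)" "Dom (Cells A) \<alpha>' = u" "Cod (Cells A) \<alpha>' = q \<odot> i"
    "\<beta>' \<in> Arr (Cells A)" "Dom (Cells A) \<beta>' = q \<odot> i" "Cod (Cells A) \<beta>' = w"
    "k = Gc \<beta>' y \<cdot>\<^bsub>Map0 G (uc u)\<^esub> (Ga q g \<cdot>\<^bsub>Map0 G (uc u)\<^esub> Gc \<alpha>' x0)"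
    "germ a0 y (i, i, g)" "germ a0 y (u, w, k)"
    using d(2) by (rule stepE)
  have [simp]: "ud i = a0" "uc i = a0" "i \<in> Arr (Under A)" using i by simp_all
  have pi [simp]: "p \<odot> i = p" "q \<odot> i = q" using p q i by simp_all
  note [simp] = germD(1-7)[OF p(13)] p(1-10)[simplified] q(1-10)[simplified]
  have fg' [simp]: "f \<in> Arr (Map0 G a0)" "Dom (Map0 G a0) f = x0" "Cod (Map0 G a0) f = y"
    "g \<in> Arr (Map0 G a0)" "Dom (Map0 G a0) g = x0" "Cod (Map0 G a0) g = y" using f by auto
  obtain r m \<gamma> where r: "r \<in> \<Sigma>" "m \<in> \<Sigma>" "ud r = uc u" "ud m = a0" "uc m = uc r"
    "\<gamma> \<in> Arr (Cells A)" "Dom (Cells A) \<gamma> = r \<odot> w" "Cod (Cells A) \<gamma> = m"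
    by (rule extend2[of w w]) simp_all
  note [simp] = r
  obtain h \<epsilon> where h: "h \<in> \<Sigma>" "ud h = uc m" "\<epsilon> \<in> Arr (Cells A)" "Dom (Cells A) \<epsilon> = h \<odot> m"
    "Cod (Cells A) \<epsilon> = h \<odot> (r \<odot> u)" "m \<in> \<Sigma> \<Longrightarrow> is_iso (Cells A) \<epsilon>"
    by (rule F1[of m "r \<odot> u"]) simp_all
  have [simp]: "is_iso (Cells A) \<epsilon>" "ud h = uc r" using h(2,6) by simp_all
  note [simp] = h(1,3-5)
  \<comment> \<open>All three cells go from \<open>h r u\<close> to \<open>h m\<close>, which is in
    \<open>\<Sigma>\<close>. The first is invertible, and two uses of F2 equate each of the others
    with it.\<close>
  let ?c0 = "cinv (Cells A) \<epsilon>"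
  let ?c1 = "h \<triangleright> (\<gamma> \<cdot>\<^bsub>Cells A\<^esub> (r \<triangleright> (\<beta> \<cdot>\<^bsub>Cells A\<^esub> \<alpha>)))"
  let ?c2 = "h \<triangleright> (\<gamma> \<cdot>\<^bsub>Cells A\<^esub> (r \<triangleright> (\<beta>' \<cdot>\<^bsub>Cells A\<^esub> \<alpha>')))"
  obtain s where s: "s \<in> \<Sigma>" "ud s = uc (Dom (Cells A) ?c0)" "s \<triangleright> ?c0 = s \<triangleright> ?c1"
    by (rule F2[of ?c0 ?c1]) simp_all
  have [simp]: "s \<in> \<Sigma>" "ud s = uc h" using s by simp_all
  obtain t where t: "t \<in> \<Sigma>" "ud t = uc (Dom (Cells A) (s \<triangleright> ?c0))" "t \<triangleright> (s \<triangleright> ?c0) = t \<triangleright> (s \<triangleright> ?c2)"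
    by (rule F2[of "s \<triangleright> ?c0" "s \<triangleright> ?c2"]) simp_all
  have [simp]: "t \<in> \<Sigma>" "ud t = uc s" using t by simp_all
  have cell: "s \<triangleright> ?c0 \<in> Arr (Cells A)" "s \<triangleright> ?c1 \<in> Arr (Cells A)" "s \<triangleright> ?c2 \<in> Arr (Cells A)" by simp_all
  let ?K = "Map0 G (uc t)" and ?T = "\<lambda>z. Ga t (Ga s z)"
  let ?x = "?T (Gc ?c0 x0)"
  have iso: "is_iso ?K ?x" by simp
  have x1: "?x = ?T (Ga h (Gc \<gamma> x0)) \<cdot>\<^bsub>?K\<^esub> (?T (Ga h (Ga r (Gc \<beta> x0))) \<cdot>\<^bsub>?K\<^esub> ?T (Ga h (Ga r (Gc \<alpha> x0))))"
  proof -
    have "Gc (t \<triangleright> (s \<triangleright> ?c0)) x0 = Gc (t \<triangleright> (s \<triangleright> ?c1)) x0" using s(3) by simp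
    then show ?thesis by simp
  qed
  have x2: "?x = ?T (Ga h (Gc \<gamma> x0)) \<cdot>\<^bsub>?K\<^esub> (?T (Ga h (Ga r (Gc \<beta>' x0))) \<cdot>\<^bsub>?K\<^esub> ?T (Ga h (Ga r (Gc \<alpha>' x0))))"
  proof -
    have "Gc (t \<triangleright> (s \<triangleright> ?c0)) x0 = Gc (t \<triangleright> (s \<triangleright> ?c2)) x0" using t(3) by simp
    then show ?thesis by simp
  qed
  have n: "?T (Ga h (Gc \<gamma> y)) \<cdot>\<^bsub>?K\<^esub> ?T (Ga h (Ga r (Ga w z))) = ?T (Ga h (Ga m z)) \<cdot>\<^bsub>?K\<^esub> ?T (Ga h (Gc \<gamma> x0))"
    if [simp]: "z \<in> Arr (Map0 G a0)" "Dom (Map0 G a0) z = x0" "Cod (Map0 G a0) z = y" for z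
  proof -
    have "Gc \<gamma> y \<cdot>\<^bsub>Map0 G (uc r)\<^esub> Ga r (Ga w z) = Ga m z \<cdot>\<^bsub>Map0 G (uc r)\<^esub> Gc \<gamma> x0"
      using Map2_nat[of \<gamma> a0 "uc r" z] by simp
    then have "?T (Ga h (Gc \<gamma> y \<cdot>\<^bsub>Map0 G (uc r)\<^esub> Ga r (Ga w z))) = ?T (Ga h (Ga m z \<cdot>\<^bsub>Map0 G (uc r)\<^esub> Gc \<gamma> x0))"
      by simp
    then show ?thesis by simp
  qed
  have k1: "k = Ga w f \<cdot>\<^bsub>Map0 G (uc u)\<^esub> (Gc \<beta> x0 \<cdot>\<^bsub>Map0 G (uc u)\<^esub> Gc \<alpha> x0)"
  proof -
    have "Gc \<beta> y \<cdot>\<^bsub>Map0 G (uc u)\<^esub> Ga p f = Ga w f \<cdot>\<^bsub>Map0 G (uc u)\<^esub> Gc \<beta> x0"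
      using Map2_nat[of \<beta> a0 "uc u" f] by simp
    moreover have "k = (Gc \<beta> y \<cdot>\<^bsub>Map0 G (uc u)\<^esub> Ga p f) \<cdot>\<^bsub>Map0 G (uc u)\<^esub> Gc \<alpha> x0"
      unfolding p(11) by (simp add: cat_assoc)
    ultimately show ?thesis by (simp add: cat_assoc)
  qed
  have k2: "k = Ga w g \<cdot>\<^bsub>Map0 G (uc u)\<^esub> (Gc \<beta>' x0 \<cdot>\<^bsub>Map0 G (uc u)\<^esub> Gc \<alpha>' x0)"
  proof -
    have "Gc \<beta>' y \<cdot>\<^bsub>Map0 G (uc u)\<^esub> Ga q g = Ga w g \<cdot>\<^bsub>Map0 G (uc u)\<^esub> Gc \<beta>' x0"
      using Map2_nat[of \<beta>' a0 "uc u" g] by simp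
    moreover have "k = (Gc \<beta>' y \<cdot>\<^bsub>Map0 G (uc u)\<^esub> Ga q g) \<cdot>\<^bsub>Map0 G (uc u)\<^esub> Gc \<alpha>' x0"
      unfolding q(11) by (simp add: cat_assoc)
    ultimately show ?thesis by (simp add: cat_assoc)
  qed
  have "?T (Ga h (Ga m f)) \<cdot>\<^bsub>?K\<^esub> ?x = (?T (Ga h (Ga m f)) \<cdot>\<^bsub>?K\<^esub> ?T (Ga h (Gc \<gamma> x0))) \<cdot>\<^bsub>?K\<^esub>
      (?T (Ga h (Ga r (Gc \<beta> x0))) \<cdot>\<^bsub>?K\<^esub> ?T (Ga h (Ga r (Gc \<alpha> x0))))"
    unfolding x1 by (simp add: cat_assoc)
  also have "\<dots> = ?T (Ga h (Gc \<gamma> y)) \<cdot>\<^bsub>?K\<^esub> ?T (Ga h (Ga r k))"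
    unfolding n[OF fg'(1-3), symmetric] k1 by (simp add: cat_assoc)
  also have "\<dots> = (?T (Ga h (Ga m g)) \<cdot>\<^bsub>?K\<^esub> ?T (Ga h (Gc \<gamma> x0))) \<cdot>\<^bsub>?K\<^esub>
      (?T (Ga h (Ga r (Gc \<beta>' x0))) \<cdot>\<^bsub>?K\<^esub> ?T (Ga h (Ga r (Gc \<alpha>' x0))))"
    unfolding n[OF fg'(4-6), symmetric] k2 by (simp add: cat_assoc)
  also have "\<dots> = ?T (Ga h (Ga m g)) \<cdot>\<^bsub>?K\<^esub> ?x"
    unfolding x2 by (simp add: cat_assoc)
  finally have fx: "?T (Ga h (Ga m f)) \<cdot>\<^bsub>?K\<^esub> ?x = ?T (Ga h (Ga m g)) \<cdot>\<^bsub>?K\<^esub> ?x" .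
  have "?T (Ga h (Ga m f)) = ?T (Ga h (Ga m g))"
    by (rule iso_epi[OF _ iso _ _ _ _ fx]) simp_all
  then show ?thesis by (intro bexI[of _ "t \<odot> (s \<odot> (h \<odot> m))"]) simp_all
qed

end

context sigma_colimit
begin

text \<open>The functor induced by the cone of germs based at the source of \<open>f\<close> sends
  the images of \<open>f\<close> and \<open>g\<close> to \<open>push f\<close> and
  \<open>push g\<close> on classes, so these agree. Evaluating at the germ of the identity, as in
  the Yoneda lemma, shows that \<open>f\<close> and \<open>g\<close> themselves have equivalent
  germs.\<close>

lemma colim_arr_eq:
  assumes a: "a \<in> Obj (Under A)" and f: "f \<in> Arr (Map0 G a)" "g \<in> Arr (Map0 G a)"
    "Dom (Map0 G a) g = Dom (Map0 G a) f" "Cod (Map0 G a) g = Cod (Map0 G a) f" and e: "l.Ta a f = l.Ta a g"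
  shows "\<exists>u\<in>\<Sigma>. Dom (Under A) u = a \<and> Ga u f = Ga u g"
proof -
  let ?x = "Dom (Map0 G a) f" and ?y = "Cod (Map0 G a) f"
  interpret g: germs A \<Sigma> G a ?x
    by (intro germs.intro filtered_diagram_axioms germs_axioms.intro) (use a f in simp_all)
  obtain H where H: "H \<in> Obj (Fun L Per)" "post_transf A (\<lambda>_. H) lam = g.germ_cone"
    using induced_exists[OF Per_cat g.germ_cone] by blast
  have "FArr (T0 g.germ_cone a) f = FArr (T0 g.germ_cone a) g"
    using post_transf_eqD(2)[OF H(2) a] f e by metis
  then have pm: "per_map (g.germ_eq a ?x) (g.push f) (g.germ_eq a ?y) = per_map (g.germ_eq a ?x) (g.push g) (g.germ_eq a ?y)"
    using a f by (simp add: g.germ_cone_def Let_def)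
  let ?i = "Ident (Under A) a"
  have g0: "g.germ a ?x (?i, ?i, Ident (Map0 G a) ?x)" using a f by (simp add: g.germ_def)
  have p: "g.push f (?i, ?i, Ident (Map0 G a) ?x) = (?i, ?i, f)" "g.push g (?i, ?i, Ident (Map0 G a) ?x) = (?i, ?i, g)"
    using a f by (simp_all add: g.push_def)
  have "g.germ a ?y (?i, ?i, g)" using a f by (simp add: g.germ_def)
  then have "((?i, ?i, Ident (Map0 G a) ?x), (?i, ?i, g)) \<in> fst (snd (per_map (g.germ_eq a ?x) (g.push g) (g.germ_eq a ?y)))"
    using g0 p by (simp add: per_map_def g.germ_eq_refl)
  then have "((?i, ?i, Ident (Map0 G a) ?x), (?i, ?i, g)) \<in> fst (snd (per_map (g.germ_eq a ?x) (g.push f) (g.germ_eq a ?y)))"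
    by (simp only: pm)
  then have "((?i, ?i, f), (?i, ?i, g)) \<in> g.germ_eq a ?y"
    using p(1) by (simp add: per_map_def)
  then show ?thesis
    by (intro g.germ_eq_arr[OF _ _ refl]) (use f in auto)
qed

end

section \<open>Weighted pseudo-limits\<close>

lemma transf_sel [simp]:
  "i \<in> Obj (Under I) \<Longrightarrow> T0 (post_transf I t \<theta>) i = t i \<cdot>F T0 \<theta> i"
  "u \<in> Arr (Under I) \<Longrightarrow> T1 (post_transf I t \<theta>) u = t (Cod (Under I) u) \<cdot>L T1 \<theta> u"
  "i \<in> Obj (Under I) \<Longrightarrow> T0 (pre_transf I \<theta>' s) i = T0 \<theta>' i \<cdot>F s i"
  "u \<in> Arr (Under I) \<Longrightarrow> T1 (pre_transf I \<theta>' s) u = T1 \<theta>' u \<cdot>R s (Dom (Under I) u)"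
  by (auto simp: post_transf_def pre_transf_def)

lemma modif_sel [simp]:
  "MSrc (post_modif I t \<rho>) = post_transf I t (MSrc \<rho>)" "MTgt (post_modif I t \<rho>) = post_transf I t (MTgt \<rho>)"
  "i \<in> Obj (Under I) \<Longrightarrow> MCmp (post_modif I t \<rho>) i = t i \<cdot>L MCmp \<rho> i"
  "MSrc (post_cell I s t m \<theta>) = post_transf I s \<theta>" "MTgt (post_cell I s t m \<theta>) = post_transf I t \<theta>"
  "i \<in> Obj (Under I) \<Longrightarrow> MCmp (post_cell I s t m \<theta>) i = m i \<cdot>R T0 \<theta> i"
  by (auto simp: post_modif_def post_cell_def)

locale weighted_diagram = W: diagram I W + G: diagram I G
  for I :: "('i, 'j, 'k) twocat" and W :: "('i, 'j, 'k, 'v, 'w) cat_valued"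
    and G :: "('i, 'j, 'k, 'o, 'm) cat_valued"
begin

section \<open>Pseudonatural transformations and modifications in components\<close>

abbreviation "pn \<equiv> pseudonatural I W G"

lemma pseudonaturalI:
  assumes ext: "T0 \<theta> \<in> extensional (Obj (Under I))" "T1 \<theta> \<in> extensional (Arr (Under I))"
    and T0: "\<And>i. i \<in> Obj (Under I) \<Longrightarrow>
      is_functor (T0 \<theta> i) \<and> FSrc (T0 \<theta> i) = Map0 W i \<and> FTgt (T0 \<theta> i) = Map0 G i"
    and T1: "\<And>u. u \<in> Arr (Under I) \<Longrightarrow> is_ntrans (T1 \<theta> u) \<and>
      NSrc (T1 \<theta> u) = T0 \<theta> (Cod (Under I) u) \<cdot>F Map1 W u \<and> NTgt (T1 \<theta> u) = Map1 G u \<cdot>F T0 \<theta> (Dom (Under I) u)"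
    and iso: "\<And>u x. u \<in> Arr (Under I) \<Longrightarrow> x \<in> Obj (Map0 W (Dom (Under I) u)) \<Longrightarrow>
      is_iso (Map0 G (Cod (Under I) u)) (NCmp (T1 \<theta> u) x)"
    and id: "\<And>i x. i \<in> Obj (Under I) \<Longrightarrow> x \<in> Obj (Map0 W i) \<Longrightarrow>
      NCmp (T1 \<theta> (Ident (Under I) i)) x = Ident (Map0 G i) (FObj (T0 \<theta> i) x)"
    and comp: "\<And>u v x. u \<in> Arr (Under I) \<Longrightarrow> v \<in> Arr (Under I) \<Longrightarrow> Cod (Under I) u = Dom (Under I) v \<Longrightarrow>
      x \<in> Obj (Map0 W (Dom (Under I) u)) \<Longrightarrow>
      NCmp (T1 \<theta> (v \<cdot>\<^bsub>Under I\<^esub> u)) x = FArr (Map1 G v) (NCmp (T1 \<theta> u) x) \<cdot>\<^bsub>Map0 G (Cod (Under I) v)\<^esub>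
        NCmp (T1 \<theta> v) (FObj (Map1 W u) x)"
    and cell: "\<And>\<mu> x. \<mu> \<in> Arr (Cells I) \<Longrightarrow> x \<in> Obj (Map0 W (Dom (Under I) (Dom (Cells I) \<mu>))) \<Longrightarrow>
      NCmp (Map2 G \<mu>) (FObj (T0 \<theta> (Dom (Under I) (Dom (Cells I) \<mu>))) x)
        \<cdot>\<^bsub>Map0 G (Cod (Under I) (Dom (Cells I) \<mu>))\<^esub> NCmp (T1 \<theta> (Dom (Cells I) \<mu>)) x
      = NCmp (T1 \<theta> (Cod (Cells I) \<mu>)) x \<cdot>\<^bsub>Map0 G (Cod (Under I) (Dom (Cells I) \<mu>))\<^esub>
        FArr (T0 \<theta> (Cod (Under I) (Dom (Cells I) \<mu>))) (NCmp (Map2 W \<mu>) x)"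
  shows "pn \<theta>"
proof -
  have T0s: "is_functor (T0 \<theta> i)" "FSrc (T0 \<theta> i) = Map0 W i" "FTgt (T0 \<theta> i) = Map0 G i"
    if "i \<in> Obj (Under I)" for i using T0 that by auto
  have T1s: "is_ntrans (T1 \<theta> u)" "NSrc (T1 \<theta> u) = T0 \<theta> (Cod (Under I) u) \<cdot>F Map1 W u"
    "NTgt (T1 \<theta> u) = Map1 G u \<cdot>F T0 \<theta> (Dom (Under I) u)" if "u \<in> Arr (Under I)" for u using T1 that by auto
  note [simp] = T0s T1s
  have "T1 \<theta> (Ident (Under I) i) = idn (T0 \<theta> i)" if "i \<in> Obj (Under I)" for i
    by (rule ntrans_eqI) (use that in \<open>simp_all add: id\<close>)
  moreover have "T1 \<theta> (v \<cdot>\<^bsub>Under I\<^esub> u) = (Map1 G v \<cdot>L T1 \<theta> u) \<cdot>N (T1 \<theta> v \<cdot>R Map1 W u)"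
    if "u \<in> Arr (Under I)" "v \<in> Arr (Under I)" "Cod (Under I) u = Dom (Under I) v" for u v
    by (rule ntrans_eqI) (use that in \<open>simp_all add: comp\<close>)
  moreover have "(Map2 G \<mu> \<cdot>R T0 \<theta> (cell_src I \<mu>)) \<cdot>N T1 \<theta> (Dom (Cells I) \<mu>)
          = T1 \<theta> (Cod (Cells I) \<mu>) \<cdot>N (T0 \<theta> (cell_tgt I \<mu>) \<cdot>L Map2 W \<mu>)"
    if "\<mu> \<in> Arr (Cells I)" for \<mu>
    unfolding cell_tgt_def cell_src_def by (rule ntrans_eqI) (use that in \<open>simp_all add: cell\<close>)
  moreover have "is_iso (Fun (Map0 W (Dom (Under I) u)) (Map0 G (Cod (Under I) u))) (T1 \<theta> u)"
    if "u \<in> Arr (Under I)" for u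
    by (subst is_iso_Fun_iff) (use that in \<open>simp_all add: iso\<close>)
  ultimately show ?thesis
    using ext by (auto simp: pseudonatural_def PiE_def)
qed

lemma pn_ext: "pn \<theta> \<Longrightarrow> T0 \<theta> \<in> extensional (Obj (Under I))" "pn \<theta> \<Longrightarrow> T1 \<theta> \<in> extensional (Arr (Under I))"
  by (auto simp: pseudonatural_def PiE_def)

lemma pn_T0 [simp]:
  assumes "pn \<theta>" "i \<in> Obj (Under I)"
  shows "is_functor (T0 \<theta> i)" "FSrc (T0 \<theta> i) = Map0 W i" "FTgt (T0 \<theta> i) = Map0 G i"
  using assms by (auto simp: pseudonatural_def)

lemma pn_T1 [simp]:
  assumes "pn \<theta>" "u \<in> Arr (Under I)"
  shows "is_ntrans (T1 \<theta> u)" "NSrc (T1 \<theta> u) = T0 \<theta> (Cod (Under I) u) \<cdot>F Map1 W u"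
    "NTgt (T1 \<theta> u) = Map1 G u \<cdot>F T0 \<theta> (Dom (Under I) u)"
proof -
  have "T1 \<theta> u \<in> hom (Fun (Map0 W (Dom (Under I) u)) (Map0 G (Cod (Under I) u)))
          (T0 \<theta> (Cod (Under I) u) \<cdot>F Map1 W u) (Map1 G u \<cdot>F T0 \<theta> (Dom (Under I) u))"
    using assms unfolding pseudonatural_def by blast
  then show "is_ntrans (T1 \<theta> u)" "NSrc (T1 \<theta> u) = T0 \<theta> (Cod (Under I) u) \<cdot>F Map1 W u"
    "NTgt (T1 \<theta> u) = Map1 G u \<cdot>F T0 \<theta> (Dom (Under I) u)" by simp_all
qed

lemma pn_iso [simp]:
  assumes "pn \<theta>" "u \<in> Arr (Under I)" "x \<in> Obj (Map0 W (Dom (Under I) u))" "j = Cod (Under I) u"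
  shows "is_iso (Map0 G j) (NCmp (T1 \<theta> u) x)"
proof -
  have "is_iso (Fun (Map0 W (Dom (Under I) u)) (Map0 G (Cod (Under I) u))) (T1 \<theta> u)"
    using assms unfolding pseudonatural_def by blast
  then show ?thesis using assms by (subst (asm) is_iso_Fun_iff) auto
qed

lemma pn_ident [simp]:
  assumes "pn \<theta>" "i \<in> Obj (Under I)" "x \<in> Obj (Map0 W i)"
  shows "NCmp (T1 \<theta> (Ident (Under I) i)) x = Ident (Map0 G i) (FObj (T0 \<theta> i) x)"
proof -
  have "T1 \<theta> (Ident (Under I) i) = idn (T0 \<theta> i)"
    using assms unfolding pseudonatural_def by blast
  then show ?thesis using assms by simp
qed

lemma pn_comp [simp]:
  assumes "pn \<theta>" "u \<in> Arr (Under I)" "v \<in> Arr (Under I)" "Cod (Under I) u = Dom (Under I) v"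
    "x \<in> Obj (Map0 W (Dom (Under I) u))"
  shows "NCmp (T1 \<theta> (v \<cdot>\<^bsub>Under I\<^esub> u)) x = FArr (Map1 G v) (NCmp (T1 \<theta> u) x) \<cdot>\<^bsub>Map0 G (Cod (Under I) v)\<^esub>
        NCmp (T1 \<theta> v) (FObj (Map1 W u) x)"
proof -
  have "T1 \<theta> (v \<cdot>\<^bsub>Under I\<^esub> u) = (Map1 G v \<cdot>L T1 \<theta> u) \<cdot>N (T1 \<theta> v \<cdot>R Map1 W u)"
    using assms unfolding pseudonatural_def by blast
  then show ?thesis using assms by simp
qed

lemma pn_cell:
  assumes "pn \<theta>" "\<mu> \<in> Arr (Cells I)" "i = Dom (Under I) (Dom (Cells I) \<mu>)" "j = Cod (Under I) (Dom (Cells I) \<mu>)"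
    "x \<in> Obj (Map0 W i)"
  shows "NCmp (Map2 G \<mu>) (FObj (T0 \<theta> i) x) \<cdot>\<^bsub>Map0 G j\<^esub> NCmp (T1 \<theta> (Dom (Cells I) \<mu>)) x
      = NCmp (T1 \<theta> (Cod (Cells I) \<mu>)) x \<cdot>\<^bsub>Map0 G j\<^esub> FArr (T0 \<theta> j) (NCmp (Map2 W \<mu>) x)"
proof -
  have "(Map2 G \<mu> \<cdot>R T0 \<theta> (cell_src I \<mu>)) \<cdot>N T1 \<theta> (Dom (Cells I) \<mu>)
          = T1 \<theta> (Cod (Cells I) \<mu>) \<cdot>N (T0 \<theta> (cell_tgt I \<mu>) \<cdot>L Map2 W \<mu>)"
    using assms unfolding pseudonatural_def by blast
  then have "NCmp ((Map2 G \<mu> \<cdot>R T0 \<theta> (cell_src I \<mu>)) \<cdot>N T1 \<theta> (Dom (Cells I) \<mu>)) x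
          = NCmp (T1 \<theta> (Cod (Cells I) \<mu>) \<cdot>N (T0 \<theta> (cell_tgt I \<mu>) \<cdot>L Map2 W \<mu>)) x" by simp
  then show ?thesis using assms by (simp add: cell_tgt_def cell_src_def)
qed

lemma pn_nat:
  assumes "pn \<theta>" "u \<in> Arr (Under I)" "m \<in> Arr (Map0 W i)" "i = Dom (Under I) u" "j = Cod (Under I) u"
  shows "NCmp (T1 \<theta> u) (Cod (Map0 W i) m) \<cdot>\<^bsub>Map0 G j\<^esub> FArr (T0 \<theta> j) (FArr (Map1 W u) m)
    = FArr (Map1 G u) (FArr (T0 \<theta> i) m) \<cdot>\<^bsub>Map0 G j\<^esub> NCmp (T1 \<theta> u) (Dom (Map0 W i) m)"
  using ntrans_nat[of "T1 \<theta> u" m "Map0 G j" "Map0 W i"] assms by simp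

lemma pn_eqI:
  assumes "pn \<theta>" "pn \<theta>'"
    and "\<And>i x. i \<in> Obj (Under I) \<Longrightarrow> x \<in> Obj (Map0 W i) \<Longrightarrow> FObj (T0 \<theta> i) x = FObj (T0 \<theta>' i) x"
    and "\<And>i m. i \<in> Obj (Under I) \<Longrightarrow> m \<in> Arr (Map0 W i) \<Longrightarrow> FArr (T0 \<theta> i) m = FArr (T0 \<theta>' i) m"
    and "\<And>u x. u \<in> Arr (Under I) \<Longrightarrow> x \<in> Obj (Map0 W (Dom (Under I) u)) \<Longrightarrow> NCmp (T1 \<theta> u) x = NCmp (T1 \<theta>' u) x"
  shows "\<theta> = \<theta>'"
proof -
  have e0: "T0 \<theta> i = T0 \<theta>' i" if "i \<in> Obj (Under I)" for i
    by (rule functor_eqI) (use that assms in simp_all)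
  have e1: "T1 \<theta> u = T1 \<theta>' u" if "u \<in> Arr (Under I)" for u
    by (rule ntrans_eqI) (use that assms in \<open>simp_all add: e0\<close>)
  show ?thesis
    by (rule transf.equality)
      (auto intro!: extensionalityI[OF pn_ext(1)[OF assms(1)] pn_ext(1)[OF assms(2)]]
        extensionalityI[OF pn_ext(2)[OF assms(1)] pn_ext(2)[OF assms(2)]] e0 e1)
qed

text \<open>The arrows of \<open>bilim I W G\<close>, with the equation of natural transformations
  replaced by its components; \<open>bilim_arr\<close> identifies the two descriptions.\<close>

definition modification :: "('i, 'j, 'v, 'w, 'o, 'm) modif \<Rightarrow> bool" where
  "modification \<rho> \<longleftrightarrow> pn (MSrc \<rho>) \<and> pn (MTgt \<rho>) \<and> MCmp \<rho> \<in> extensional (Obj (Under I)) \<and>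
     (\<forall>i \<in> Obj (Under I). is_ntrans (MCmp \<rho> i) \<and> NSrc (MCmp \<rho> i) = T0 (MSrc \<rho>) i \<and> NTgt (MCmp \<rho> i) = T0 (MTgt \<rho>) i) \<and>
     (\<forall>u \<in> Arr (Under I). \<forall>x \<in> Obj (Map0 W (Dom (Under I) u)).
        NCmp (T1 (MTgt \<rho>) u) x \<cdot>\<^bsub>Map0 G (Cod (Under I) u)\<^esub> NCmp (MCmp \<rho> (Cod (Under I) u)) (FObj (Map1 W u) x)
        = FArr (Map1 G u) (NCmp (MCmp \<rho> (Dom (Under I) u)) x) \<cdot>\<^bsub>Map0 G (Cod (Under I) u)\<^esub> NCmp (T1 (MSrc \<rho>) u) x)"

lemma modificationD:
  assumes "modification \<rho>"
  shows "pn (MSrc \<rho>)" "pn (MTgt \<rho>)" "MCmp \<rho> \<in> extensional (Obj (Under I))"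
    "i \<in> Obj (Under I) \<Longrightarrow> is_ntrans (MCmp \<rho> i)" "i \<in> Obj (Under I) \<Longrightarrow> NSrc (MCmp \<rho> i) = T0 (MSrc \<rho>) i"
    "i \<in> Obj (Under I) \<Longrightarrow> NTgt (MCmp \<rho> i) = T0 (MTgt \<rho>) i"
    "u \<in> Arr (Under I) \<Longrightarrow> x \<in> Obj (Map0 W (Dom (Under I) u)) \<Longrightarrow> j = Cod (Under I) u \<Longrightarrow>
        NCmp (T1 (MTgt \<rho>) u) x \<cdot>\<^bsub>Map0 G j\<^esub> NCmp (MCmp \<rho> j) (FObj (Map1 W u) x)
        = FArr (Map1 G u) (NCmp (MCmp \<rho> (Dom (Under I) u)) x) \<cdot>\<^bsub>Map0 G j\<^esub> NCmp (T1 (MSrc \<rho>) u) x"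
  using assms unfolding modification_def by blast+

declare modificationD(1,2,4,5,6) [simp]

lemma bilim_sel [simp]: "\<theta> \<in> Obj (bilim I W G) \<longleftrightarrow> pn \<theta>" "Dom (bilim I W G) = MSrc" "Cod (bilim I W G) = MTgt"
  "Ident (bilim I W G) \<theta> = \<lparr>MSrc = \<theta>, MTgt = \<theta>, MCmp = (\<lambda>i\<in>Obj (Under I). idn (T0 \<theta> i))\<rparr>"
  "\<rho>' \<cdot>\<^bsub>bilim I W G\<^esub> \<rho> = \<lparr>MSrc = MSrc \<rho>, MTgt = MTgt \<rho>', MCmp = (\<lambda>i\<in>Obj (Under I). MCmp \<rho>' i \<cdot>N MCmp \<rho> i)\<rparr>"
  by (auto simp: bilim_def modif_cat_def)

lemma bilim_arr [simp]: "\<rho> \<in> Arr (bilim I W G) \<longleftrightarrow> modification \<rho>"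
proof -
  have "T1 (MTgt \<rho>) u \<cdot>N (MCmp \<rho> (Cod (Under I) u) \<cdot>R Map1 W u)
            = (Map1 G u \<cdot>L MCmp \<rho> (Dom (Under I) u)) \<cdot>N T1 (MSrc \<rho>) u \<longleftrightarrow>
     (\<forall>x \<in> Obj (Map0 W (Dom (Under I) u)).
        NCmp (T1 (MTgt \<rho>) u) x \<cdot>\<^bsub>Map0 G (Cod (Under I) u)\<^esub> NCmp (MCmp \<rho> (Cod (Under I) u)) (FObj (Map1 W u) x)
        = FArr (Map1 G u) (NCmp (MCmp \<rho> (Dom (Under I) u)) x) \<cdot>\<^bsub>Map0 G (Cod (Under I) u)\<^esub> NCmp (T1 (MSrc \<rho>) u) x)"
    (is "?l = ?r \<longleftrightarrow> _")
    if p: "pn (MSrc \<rho>)" "pn (MTgt \<rho>)" and m: "\<And>i. i \<in> Obj (Under I) \<Longrightarrow> is_ntrans (MCmp \<rho> i) \<and>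
       NSrc (MCmp \<rho> i) = T0 (MSrc \<rho>) i \<and> NTgt (MCmp \<rho> i) = T0 (MTgt \<rho>) i" and u: "u \<in> Arr (Under I)" for u
  proof -
    have m' [simp]: "is_ntrans (MCmp \<rho> i)" "NSrc (MCmp \<rho> i) = T0 (MSrc \<rho>) i" "NTgt (MCmp \<rho> i) = T0 (MTgt \<rho>) i"
      if "i \<in> Obj (Under I)" for i using m that by auto
    have n: "is_ntrans ?l" "is_ntrans ?r" "NSrc ?l = NSrc ?r" "NTgt ?l = NTgt ?r" using p u by simp_all
    have c: "NCmp ?l x = NCmp (T1 (MTgt \<rho>) u) x \<cdot>\<^bsub>Map0 G (Cod (Under I) u)\<^esub> NCmp (MCmp \<rho> (Cod (Under I) u)) (FObj (Map1 W u) x)"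
      "NCmp ?r x = FArr (Map1 G u) (NCmp (MCmp \<rho> (Dom (Under I) u)) x) \<cdot>\<^bsub>Map0 G (Cod (Under I) u)\<^esub> NCmp (T1 (MSrc \<rho>) u) x"
      if "x \<in> Obj (Map0 W (Dom (Under I) u))" for x using p u that by simp_all
    have s: "FSrc (NSrc ?r) = Map0 W (Dom (Under I) u)" using p u by simp
    show ?thesis
    proof
      assume "?l = ?r" then show "\<forall>x \<in> Obj (Map0 W (Dom (Under I) u)). NCmp (T1 (MTgt \<rho>) u) x \<cdot>\<^bsub>Map0 G (Cod (Under I) u)\<^esub> NCmp (MCmp \<rho> (Cod (Under I) u)) (FObj (Map1 W u) x)
        = FArr (Map1 G u) (NCmp (MCmp \<rho> (Dom (Under I) u)) x) \<cdot>\<^bsub>Map0 G (Cod (Under I) u)\<^esub> NCmp (T1 (MSrc \<rho>) u) x"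
        using c by metis
    next
      assume *: "\<forall>x \<in> Obj (Map0 W (Dom (Under I) u)). NCmp (T1 (MTgt \<rho>) u) x \<cdot>\<^bsub>Map0 G (Cod (Under I) u)\<^esub> NCmp (MCmp \<rho> (Cod (Under I) u)) (FObj (Map1 W u) x)
        = FArr (Map1 G u) (NCmp (MCmp \<rho> (Dom (Under I) u)) x) \<cdot>\<^bsub>Map0 G (Cod (Under I) u)\<^esub> NCmp (T1 (MSrc \<rho>) u) x"
      show "?l = ?r"
      proof (rule ntrans_eqI[OF n])
        fix x assume "x \<in> Obj (FSrc (NSrc ?r))"
        then have x: "x \<in> Obj (Map0 W (Dom (Under I) u))" unfolding s .
        show "NCmp ?l x = NCmp ?r x" unfolding c(1)[OF x] c(2)[OF x] using * x by blast
      qed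
    qed
  qed
  then show ?thesis unfolding bilim_def modif_cat_def modification_def by (simp cong: conj_cong)
qed

lemma modification_eqI:
  assumes "modification \<rho>" "modification \<rho>'" "MSrc \<rho> = MSrc \<rho>'" "MTgt \<rho> = MTgt \<rho>'"
    "\<And>i x. i \<in> Obj (Under I) \<Longrightarrow> x \<in> Obj (Map0 W i) \<Longrightarrow> NCmp (MCmp \<rho> i) x = NCmp (MCmp \<rho>' i) x"
  shows "\<rho> = \<rho>'"
proof -
  have "MCmp \<rho> i = MCmp \<rho>' i" if "i \<in> Obj (Under I)" for i
    by (rule ntrans_eqI) (use that assms in simp_all)
  then show ?thesis using assms
    by (auto intro!: modif.equality extensionalityI[OF modificationD(3)[OF assms(1)] modificationD(3)[OF assms(2)]])
qed

lemma modificationI: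
  assumes "pn (MSrc \<rho>)" "pn (MTgt \<rho>)" "MCmp \<rho> \<in> extensional (Obj (Under I))"
    "\<And>i. i \<in> Obj (Under I) \<Longrightarrow> is_ntrans (MCmp \<rho> i) \<and> NSrc (MCmp \<rho> i) = T0 (MSrc \<rho>) i \<and> NTgt (MCmp \<rho> i) = T0 (MTgt \<rho>) i"
    "\<And>u x. u \<in> Arr (Under I) \<Longrightarrow> x \<in> Obj (Map0 W (Dom (Under I) u)) \<Longrightarrow>
        NCmp (T1 (MTgt \<rho>) u) x \<cdot>\<^bsub>Map0 G (Cod (Under I) u)\<^esub> NCmp (MCmp \<rho> (Cod (Under I) u)) (FObj (Map1 W u) x)
        = FArr (Map1 G u) (NCmp (MCmp \<rho> (Dom (Under I) u)) x) \<cdot>\<^bsub>Map0 G (Cod (Under I) u)\<^esub> NCmp (T1 (MSrc \<rho>) u) x"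
  shows "modification \<rho>"
  using assms unfolding modification_def by blast

lemma modification_comp:
  assumes m: "modification \<rho>" "modification \<rho>'" "MTgt \<rho> = MSrc \<rho>'"
  shows "modification (\<rho>' \<cdot>\<^bsub>bilim I W G\<^esub> \<rho>)"
proof (rule modificationI)
  fix u x assume u: "u \<in> Arr (Under I)" "x \<in> Obj (Map0 W (Dom (Under I) u))"
  let ?j = "Cod (Under I) u" and ?i = "Dom (Under I) u"
  note [simp] = m u
  note e1 = modificationD(7)[OF m(1) u refl] and e2 = modificationD(7)[OF m(2) u refl]
  have "NCmp (T1 (MTgt \<rho>') u) x \<cdot>\<^bsub>Map0 G ?j\<^esub> (NCmp (MCmp \<rho>' ?j) (FObj (Map1 W u) x) \<cdot>\<^bsub>Map0 G ?j\<^esub> NCmp (MCmp \<rho> ?j) (FObj (Map1 W u) x))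
    = (NCmp (T1 (MTgt \<rho>') u) x \<cdot>\<^bsub>Map0 G ?j\<^esub> NCmp (MCmp \<rho>' ?j) (FObj (Map1 W u) x)) \<cdot>\<^bsub>Map0 G ?j\<^esub> NCmp (MCmp \<rho> ?j) (FObj (Map1 W u) x)"
    by (simp add: cat_assoc)
  also have "\<dots> = FArr (Map1 G u) (NCmp (MCmp \<rho>' ?i) x) \<cdot>\<^bsub>Map0 G ?j\<^esub> (NCmp (T1 (MTgt \<rho>) u) x \<cdot>\<^bsub>Map0 G ?j\<^esub> NCmp (MCmp \<rho> ?j) (FObj (Map1 W u) x))"
    unfolding e2 by (simp add: cat_assoc)
  also have "\<dots> = FArr (Map1 G u) (NCmp (MCmp \<rho>' ?i) x \<cdot>\<^bsub>Map0 G ?i\<^esub> NCmp (MCmp \<rho> ?i) x) \<cdot>\<^bsub>Map0 G ?j\<^esub> NCmp (T1 (MSrc \<rho>) u) x"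
    unfolding e1 by (simp add: cat_assoc)
  finally show "NCmp (T1 (MTgt (\<rho>' \<cdot>\<^bsub>bilim I W G\<^esub> \<rho>)) u) x \<cdot>\<^bsub>Map0 G ?j\<^esub>
          NCmp (MCmp (\<rho>' \<cdot>\<^bsub>bilim I W G\<^esub> \<rho>) ?j) (FObj (Map1 W u) x)
      = FArr (Map1 G u) (NCmp (MCmp (\<rho>' \<cdot>\<^bsub>bilim I W G\<^esub> \<rho>) ?i) x) \<cdot>\<^bsub>Map0 G ?j\<^esub> NCmp (T1 (MSrc (\<rho>' \<cdot>\<^bsub>bilim I W G\<^esub> \<rho>)) u) x"
    by simp
qed (use m in simp_all)

lemma modification_ident: "pn \<theta> \<Longrightarrow> modification (Ident (bilim I W G) \<theta>)"
  by (rule modificationI) simp_all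

lemma bilim_cat [simp]: "category (bilim I W G)"
proof (rule categoryI)
  fix \<theta> assume "\<theta> \<in> Obj (bilim I W G)"
  then show "Ident (bilim I W G) \<theta> \<in> Arr (bilim I W G) \<and> Dom (bilim I W G) (Ident (bilim I W G) \<theta>) = \<theta> \<and>
    Cod (bilim I W G) (Ident (bilim I W G) \<theta>) = \<theta>" using modification_ident by simp
next
  fix \<rho> \<rho>' assume "\<rho> \<in> Arr (bilim I W G)" "\<rho>' \<in> Arr (bilim I W G)" "Cod (bilim I W G) \<rho> = Dom (bilim I W G) \<rho>'"
  then show "\<rho>' \<cdot>\<^bsub>bilim I W G\<^esub> \<rho> \<in> Arr (bilim I W G) \<and> Dom (bilim I W G) (\<rho>' \<cdot>\<^bsub>bilim I W G\<^esub> \<rho>) = Dom (bilim I W G) \<rho> \<and>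
    Cod (bilim I W G) (\<rho>' \<cdot>\<^bsub>bilim I W G\<^esub> \<rho>) = Cod (bilim I W G) \<rho>'" using modification_comp[of \<rho> \<rho>'] by simp
next
  fix \<rho> assume "\<rho> \<in> Arr (bilim I W G)"
  then have m: "modification \<rho>" by simp
  show "\<rho> \<cdot>\<^bsub>bilim I W G\<^esub> Ident (bilim I W G) (Dom (bilim I W G) \<rho>) = \<rho>"
    by (rule modification_eqI[OF modification_comp[OF modification_ident]]) (use m in simp_all)
  show "Ident (bilim I W G) (Cod (bilim I W G) \<rho>) \<cdot>\<^bsub>bilim I W G\<^esub> \<rho> = \<rho>"
    by (rule modification_eqI[OF modification_comp[OF _ modification_ident]]) (use m in simp_all)
next
  fix f g h assume "f \<in> Arr (bilim I W G)" "g \<in> Arr (bilim I W G)" "h \<in> Arr (bilim I W G)"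
    "Cod (bilim I W G) f = Dom (bilim I W G) g" "Cod (bilim I W G) g = Dom (bilim I W G) h"
  then have m: "modification f" "modification g" "modification h" "MTgt f = MSrc g" "MTgt g = MSrc h" by simp_all
  show "h \<cdot>\<^bsub>bilim I W G\<^esub> (g \<cdot>\<^bsub>bilim I W G\<^esub> f) = (h \<cdot>\<^bsub>bilim I W G\<^esub> g) \<cdot>\<^bsub>bilim I W G\<^esub> f"
    by (rule modification_eqI[OF modification_comp[OF modification_comp] modification_comp[OF _ modification_comp]])
      (use m in \<open>simp_all add: cat_assoc\<close>)
qed simp_all

text \<open>The componentwise inverses satisfy the modification law because both sides may be
  composed with the invertible component at the target of \<open>u\<close>, which reduces it to the
  law for \<open>\<rho>\<close>.\<close>

lemma bilim_iso:
  assumes m: "modification \<rho>"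
    and i: "\<And>i x. i \<in> Obj (Under I) \<Longrightarrow> x \<in> Obj (Map0 W i) \<Longrightarrow> is_iso (Map0 G i) (NCmp (MCmp \<rho> i) x)"
  shows "is_iso (bilim I W G) \<rho>"
proof -
  define \<beta> where "\<beta> i = cinv (Fun (Map0 W i) (Map0 G i)) (MCmp \<rho> i)" for i
  note [simp] = m i
  have fi: "is_iso (Fun (Map0 W i) (Map0 G i)) (MCmp \<rho> i)" if "i \<in> Obj (Under I)" for i
    by (subst is_iso_Fun_iff) (use that in simp_all)
  have b [simp]: "is_ntrans (\<beta> i)" "NSrc (\<beta> i) = T0 (MTgt \<rho>) i" "NTgt (\<beta> i) = T0 (MSrc \<rho>) i"
    if "i \<in> Obj (Under I)" for i
    using cinv_props(1-3)[OF fi[OF that]] that by (simp_all add: \<beta>_def)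
  have bc: "NCmp (\<beta> i) x \<cdot>\<^bsub>Map0 G i\<^esub> NCmp (MCmp \<rho> i) x = Ident (Map0 G i) (FObj (T0 (MSrc \<rho>) i) x)"
    "NCmp (MCmp \<rho> i) x \<cdot>\<^bsub>Map0 G i\<^esub> NCmp (\<beta> i) x = Ident (Map0 G i) (FObj (T0 (MTgt \<rho>) i) x)"
    if "i \<in> Obj (Under I)" "x \<in> Obj (Map0 W i)" for i x
  proof -
    have "\<beta> i \<cdot>N MCmp \<rho> i = idn (T0 (MSrc \<rho>) i)" "MCmp \<rho> i \<cdot>N \<beta> i = idn (T0 (MTgt \<rho>) i)"
      using cinv_props(4,5)[OF fi[OF that(1)]] that by (simp_all add: \<beta>_def)
    then have "NCmp (\<beta> i \<cdot>N MCmp \<rho> i) x = NCmp (idn (T0 (MSrc \<rho>) i)) x"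
      "NCmp (MCmp \<rho> i \<cdot>N \<beta> i) x = NCmp (idn (T0 (MTgt \<rho>) i)) x" by simp_all
    then show "NCmp (\<beta> i) x \<cdot>\<^bsub>Map0 G i\<^esub> NCmp (MCmp \<rho> i) x = Ident (Map0 G i) (FObj (T0 (MSrc \<rho>) i) x)"
    "NCmp (MCmp \<rho> i) x \<cdot>\<^bsub>Map0 G i\<^esub> NCmp (\<beta> i) x = Ident (Map0 G i) (FObj (T0 (MTgt \<rho>) i) x)"
      using that by simp_all
  qed
  let ?r = "\<lparr>MSrc = MTgt \<rho>, MTgt = MSrc \<rho>, MCmp = restrict \<beta> (Obj (Under I))\<rparr>"
  have r: "modification ?r"
  proof (rule modificationI)
    fix u x assume u [simp]: "u \<in> Arr (Under I)" "x \<in> Obj (Map0 W (Dom (Under I) u))"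
    let ?j = "Cod (Under I) u" and ?i = "Dom (Under I) u" and ?y = "FObj (Map1 W u) x"
    let ?G = "Map0 G ?j"
    note e = modificationD(7)[OF m u refl]
    have "NCmp (T1 (MSrc \<rho>) u) x \<cdot>\<^bsub>?G\<^esub> NCmp (\<beta> ?j) ?y = FArr (Map1 G u) (NCmp (\<beta> ?i) x) \<cdot>\<^bsub>?G\<^esub> NCmp (T1 (MTgt \<rho>) u) x"
    proof (rule iso_epi[of _ "NCmp (MCmp \<rho> ?j) ?y"])
      have "(FArr (Map1 G u) (NCmp (\<beta> ?i) x) \<cdot>\<^bsub>?G\<^esub> NCmp (T1 (MTgt \<rho>) u) x) \<cdot>\<^bsub>?G\<^esub> NCmp (MCmp \<rho> ?j) ?y
        = FArr (Map1 G u) (NCmp (\<beta> ?i) x) \<cdot>\<^bsub>?G\<^esub> (NCmp (T1 (MTgt \<rho>) u) x \<cdot>\<^bsub>?G\<^esub> NCmp (MCmp \<rho> ?j) ?y)"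
        by (simp add: cat_assoc)
      also have "\<dots> = FArr (Map1 G u) (NCmp (\<beta> ?i) x \<cdot>\<^bsub>Map0 G ?i\<^esub> NCmp (MCmp \<rho> ?i) x) \<cdot>\<^bsub>?G\<^esub> NCmp (T1 (MSrc \<rho>) u) x"
        unfolding e by (simp add: cat_assoc)
      also have "\<dots> = NCmp (T1 (MSrc \<rho>) u) x" using bc(1)[of ?i x] by simp
      also have "\<dots> = NCmp (T1 (MSrc \<rho>) u) x \<cdot>\<^bsub>?G\<^esub> (NCmp (\<beta> ?j) ?y \<cdot>\<^bsub>?G\<^esub> NCmp (MCmp \<rho> ?j) ?y)"
        using bc(1)[of ?j ?y] by simp
      finally show "(NCmp (T1 (MSrc \<rho>) u) x \<cdot>\<^bsub>?G\<^esub> NCmp (\<beta> ?j) ?y) \<cdot>\<^bsub>?G\<^esub> NCmp (MCmp \<rho> ?j) ?y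
        = (FArr (Map1 G u) (NCmp (\<beta> ?i) x) \<cdot>\<^bsub>?G\<^esub> NCmp (T1 (MTgt \<rho>) u) x) \<cdot>\<^bsub>?G\<^esub> NCmp (MCmp \<rho> ?j) ?y"
        by (simp add: cat_assoc)
    qed simp_all
    then show "NCmp (T1 (MTgt ?r) u) x \<cdot>\<^bsub>?G\<^esub> NCmp (MCmp ?r ?j) (FObj (Map1 W u) x)
      = FArr (Map1 G u) (NCmp (MCmp ?r ?i) x) \<cdot>\<^bsub>?G\<^esub> NCmp (T1 (MSrc ?r) u) x" by simp
  qed simp_all
  show ?thesis
  proof (rule is_isoI[of _ _ ?r])
    show "?r \<cdot>\<^bsub>bilim I W G\<^esub> \<rho> = Ident (bilim I W G) (Dom (bilim I W G) \<rho>)"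
      by (rule modification_eqI[OF modification_comp modification_ident]) (use r bc in simp_all)
    show "\<rho> \<cdot>\<^bsub>bilim I W G\<^esub> ?r = Ident (bilim I W G) (Cod (bilim I W G) \<rho>)"
      by (rule modification_eqI[OF modification_comp modification_ident]) (use r bc in simp_all)
  qed (use r in simp_all)
qed

text \<open>Conjugating \<open>\<theta>\<close> by the isomorphisms \<open>e i x\<close> gives an
  isomorphic transformation with prescribed values on objects. Its use is to turn values known up to
  isomorphism into values that are images under the universal cones on the nose.\<close>

lemma pn_transport:
  assumes p: "pn \<theta>"
    and e: "\<And>i x. i \<in> Obj (Under I) \<Longrightarrow> x \<in> Obj (Map0 W i) \<Longrightarrow>
      o' i x \<in> Obj (Map0 G i) \<and> e i x \<in> hom (Map0 G i) (o' i x) (FObj (T0 \<theta> i) x) \<and> is_iso (Map0 G i) (e i x)"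
  obtains \<theta>' \<rho> where "pn \<theta>'" "\<And>i x. i \<in> Obj (Under I) \<Longrightarrow> x \<in> Obj (Map0 W i) \<Longrightarrow> FObj (T0 \<theta>' i) x = o' i x"
    "modification \<rho>" "MSrc \<rho> = \<theta>'" "MTgt \<rho> = \<theta>" "is_iso (bilim I W G) \<rho>"
proof -
  have e' [simp]: "o' i x \<in> Obj (Map0 G i)" "e i x \<in> Arr (Map0 G i)" "Dom (Map0 G i) (e i x) = o' i x"
    "Cod (Map0 G i) (e i x) = FObj (T0 \<theta> i) x" "is_iso (Map0 G i) (e i x)"
    if "i \<in> Obj (Under I)" "x \<in> Obj (Map0 W i)" for i x using e[OF that] by auto
  note [simp] = p
  \<comment> \<open>The formulas for \<open>m'\<close> and \<open>c'\<close> are forced by the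
    requirement that \<open>e\<close> be a modification. The facts \<open>m'e\<close> and
    \<open>c'e\<close> record that requirement, and each law of the new transformation follows from
    them by cancelling an outer isomorphism.\<close>
  define m' where "m' i m = cinv (Map0 G i) (e i (Cod (Map0 W i) m)) \<cdot>\<^bsub>Map0 G i\<^esub>
    (FArr (T0 \<theta> i) m \<cdot>\<^bsub>Map0 G i\<^esub> e i (Dom (Map0 W i) m))" for i m
  have m' [simp]: "m' i m \<in> Arr (Map0 G i)" "Dom (Map0 G i) (m' i m) = o' i (Dom (Map0 W i) m)"
    "Cod (Map0 G i) (m' i m) = o' i (Cod (Map0 W i) m)"
    and m'e: "e i (Cod (Map0 W i) m) \<cdot>\<^bsub>Map0 G i\<^esub> m' i m = FArr (T0 \<theta> i) m \<cdot>\<^bsub>Map0 G i\<^esub> e i (Dom (Map0 W i) m)"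
    if "i \<in> Obj (Under I)" "m \<in> Arr (Map0 W i)" for i m
    using that by (simp_all add: m'_def cinv_cancel')
  let ?e = "\<lambda>u x. FArr (Map1 G u) (e (Dom (Under I) u) x)"
  define c' where "c' u x = cinv (Map0 G (Cod (Under I) u)) (?e u x) \<cdot>\<^bsub>Map0 G (Cod (Under I) u)\<^esub>
    (NCmp (T1 \<theta> u) x \<cdot>\<^bsub>Map0 G (Cod (Under I) u)\<^esub> e (Cod (Under I) u) (FObj (Map1 W u) x))" for u x
  have c' [simp]: "c' u x \<in> Arr (Map0 G j)" "Dom (Map0 G j) (c' u x) = o' j (FObj (Map1 W u) x)"
    "Cod (Map0 G j) (c' u x) = FObj (Map1 G u) (o' (Dom (Under I) u) x)" "is_iso (Map0 G j) (c' u x)"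
    and c'e: "?e u x \<cdot>\<^bsub>Map0 G j\<^esub> c' u x = NCmp (T1 \<theta> u) x \<cdot>\<^bsub>Map0 G j\<^esub> e j (FObj (Map1 W u) x)"
    if "u \<in> Arr (Under I)" "x \<in> Obj (Map0 W (Dom (Under I) u))" "Cod (Under I) u = j" for u x j
    using that by (auto simp add: c'_def cinv_cancel')
  let ?T = "\<lambda>i. mkF (Map0 W i) (Map0 G i) (o' i) (m' i)"
  define \<theta>' where "\<theta>' = \<lparr>T0 = restrict ?T (Obj (Under I)),
    T1 = (\<lambda>u\<in>Arr (Under I). mkN (?T (Cod (Under I) u) \<cdot>F Map1 W u) (Map1 G u \<cdot>F ?T (Dom (Under I) u)) (c' u))\<rparr>"
  have T [simp]: "is_functor (?T i)" if i: "i \<in> Obj (Under I)" for i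
  proof (rule is_functor_mkF)
    fix x assume x: "x \<in> Obj (Map0 W i)"
    show "m' i (Ident (Map0 W i) x) = Ident (Map0 G i) (o' i x)"
      by (rule iso_mono[of "Map0 G i" "e i x"]) (use i x m'e[of i "Ident (Map0 W i) x"] in simp_all)
  next
    fix m n assume mn: "m \<in> Arr (Map0 W i)" "n \<in> Arr (Map0 W i)" "Cod (Map0 W i) m = Dom (Map0 W i) n"
    have "e i (Cod (Map0 W i) n) \<cdot>\<^bsub>Map0 G i\<^esub> (m' i n \<cdot>\<^bsub>Map0 G i\<^esub> m' i m)
      = (e i (Cod (Map0 W i) n) \<cdot>\<^bsub>Map0 G i\<^esub> m' i n) \<cdot>\<^bsub>Map0 G i\<^esub> m' i m" using i mn by (simp add: cat_assoc)
    also have "\<dots> = FArr (T0 \<theta> i) n \<cdot>\<^bsub>Map0 G i\<^esub> (e i (Cod (Map0 W i) m) \<cdot>\<^bsub>Map0 G i\<^esub> m' i m)"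
      unfolding m'e[OF i mn(2)] using i mn by (simp add: cat_assoc)
    also have "\<dots> = e i (Cod (Map0 W i) n) \<cdot>\<^bsub>Map0 G i\<^esub> m' i (n \<cdot>\<^bsub>Map0 W i\<^esub> m)"
      using i mn m'e[of i "n \<cdot>\<^bsub>Map0 W i\<^esub> m"] m'e[OF i mn(1)] by (simp add: cat_assoc)
    finally have q: "e i (Cod (Map0 W i) n) \<cdot>\<^bsub>Map0 G i\<^esub> m' i (n \<cdot>\<^bsub>Map0 W i\<^esub> m)
      = e i (Cod (Map0 W i) n) \<cdot>\<^bsub>Map0 G i\<^esub> (m' i n \<cdot>\<^bsub>Map0 G i\<^esub> m' i m)" by simp
    show "m' i (n \<cdot>\<^bsub>Map0 W i\<^esub> m) = m' i n \<cdot>\<^bsub>Map0 G i\<^esub> m' i m"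
      by (rule iso_mono[OF _ _ _ _ _ _ q]) (use i mn in simp_all)
  qed (use i in simp_all)
  have N [simp]: "is_ntrans (mkN (?T (Cod (Under I) u) \<cdot>F Map1 W u) (Map1 G u \<cdot>F ?T (Dom (Under I) u)) (c' u))"
    if u: "u \<in> Arr (Under I)" for u
  proof (rule is_ntrans_mkN[where C="Map0 W (Dom (Under I) u)" and D="Map0 G (Cod (Under I) u)"])
    let ?i = "Dom (Under I) u" and ?j = "Cod (Under I) u"
    fix m assume m: "m \<in> Arr (Map0 W ?i)"
    let ?x = "Dom (Map0 W ?i) m" and ?y = "Cod (Map0 W ?i) m"
    note [simp] = u m
    have "?e u ?y \<cdot>\<^bsub>Map0 G ?j\<^esub> (c' u ?y \<cdot>\<^bsub>Map0 G ?j\<^esub> m' ?j (FArr (Map1 W u) m))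
      = (?e u ?y \<cdot>\<^bsub>Map0 G ?j\<^esub> c' u ?y) \<cdot>\<^bsub>Map0 G ?j\<^esub> m' ?j (FArr (Map1 W u) m)" by (simp add: cat_assoc)
    also have "\<dots> = NCmp (T1 \<theta> u) ?y \<cdot>\<^bsub>Map0 G ?j\<^esub> (e ?j (Cod (Map0 W ?j) (FArr (Map1 W u) m)) \<cdot>\<^bsub>Map0 G ?j\<^esub> m' ?j (FArr (Map1 W u) m))"
      by (subst c'e[of u ?y ?j]) (simp_all add: cat_assoc)
    also have "\<dots> = (NCmp (T1 \<theta> u) ?y \<cdot>\<^bsub>Map0 G ?j\<^esub> FArr (T0 \<theta> ?j) (FArr (Map1 W u) m)) \<cdot>\<^bsub>Map0 G ?j\<^esub> e ?j (FObj (Map1 W u) ?x)"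
      by (subst m'e) (simp_all add: cat_assoc)
    also have "\<dots> = FArr (Map1 G u) (FArr (T0 \<theta> ?i) m) \<cdot>\<^bsub>Map0 G ?j\<^esub> (NCmp (T1 \<theta> u) ?x \<cdot>\<^bsub>Map0 G ?j\<^esub> e ?j (FObj (Map1 W u) ?x))"
      by (subst pn_nat[OF p u m refl refl]) (simp add: cat_assoc)
    also have "\<dots> = FArr (Map1 G u) (FArr (T0 \<theta> ?i) m \<cdot>\<^bsub>Map0 G ?i\<^esub> e ?i ?x) \<cdot>\<^bsub>Map0 G ?j\<^esub> c' u ?x"
      by (subst c'e[of u ?x ?j, symmetric]) (simp_all add: cat_assoc)
    also have "\<dots> = ?e u ?y \<cdot>\<^bsub>Map0 G ?j\<^esub> (FArr (Map1 G u) (m' ?i m) \<cdot>\<^bsub>Map0 G ?j\<^esub> c' u ?x)"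
      by (subst m'e[of ?i m, symmetric]) (simp_all add: cat_assoc)
    finally have q: "?e u ?y \<cdot>\<^bsub>Map0 G ?j\<^esub> (c' u ?y \<cdot>\<^bsub>Map0 G ?j\<^esub> m' ?j (FArr (Map1 W u) m))
      = ?e u ?y \<cdot>\<^bsub>Map0 G ?j\<^esub> (FArr (Map1 G u) (m' ?i m) \<cdot>\<^bsub>Map0 G ?j\<^esub> c' u ?x)" .
    have "c' u ?y \<cdot>\<^bsub>Map0 G ?j\<^esub> m' ?j (FArr (Map1 W u) m) = FArr (Map1 G u) (m' ?i m) \<cdot>\<^bsub>Map0 G ?j\<^esub> c' u ?x"
      by (rule iso_mono[OF _ _ _ _ _ _ q]) simp_all
    then show "c' u ?y \<cdot>\<^bsub>Map0 G ?j\<^esub> FArr (?T ?j \<cdot>F Map1 W u) m = FArr (Map1 G u \<cdot>F ?T ?i) m \<cdot>\<^bsub>Map0 G ?j\<^esub> c' u ?x"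
      by simp
  qed (use u in simp_all)
  have s [simp]: "i \<in> Obj (Under I) \<Longrightarrow> T0 \<theta>' i = ?T i"
    "u \<in> Arr (Under I) \<Longrightarrow> T1 \<theta>' u = mkN (?T (Cod (Under I) u) \<cdot>F Map1 W u) (Map1 G u \<cdot>F ?T (Dom (Under I) u)) (c' u)" for i u
    by (auto simp: \<theta>'_def)
  have p': "pn \<theta>'"
  proof (rule pseudonaturalI)
    fix i x assume i: "i \<in> Obj (Under I)" "x \<in> Obj (Map0 W i)"
    have "c' (Ident (Under I) i) x = Ident (Map0 G i) (o' i x)"
      by (rule iso_mono[of "Map0 G i" "e i x"]) (use i c'e[of "Ident (Under I) i" x i] c'[of "Ident (Under I) i" x i] in simp_all)
    then show "NCmp (T1 \<theta>' (Ident (Under I) i)) x = Ident (Map0 G i) (FObj (T0 \<theta>' i) x)" using i by simp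
  next
    fix u v x assume u: "u \<in> Arr (Under I)" "v \<in> Arr (Under I)" "Cod (Under I) u = Dom (Under I) v" "x \<in> Obj (Map0 W (Dom (Under I) u))"
    note [simp] = u
    let ?k = "Cod (Under I) v" and ?j = "Dom (Under I) v" and ?vu = "v \<cdot>\<^bsub>Under I\<^esub> u" and ?y = "FObj (Map1 W u) x"
    have "?e ?vu x \<cdot>\<^bsub>Map0 G ?k\<^esub> c' ?vu x = NCmp (T1 \<theta> ?vu) x \<cdot>\<^bsub>Map0 G ?k\<^esub> e ?k (FObj (Map1 W ?vu) x)"
      by (rule c'e) simp_all
    also have "\<dots> = FArr (Map1 G v) (NCmp (T1 \<theta> u) x) \<cdot>\<^bsub>Map0 G ?k\<^esub> (NCmp (T1 \<theta> v) ?y \<cdot>\<^bsub>Map0 G ?k\<^esub> e ?k (FObj (Map1 W v) ?y))"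
      by (simp add: cat_assoc)
    also have "\<dots> = FArr (Map1 G v) (NCmp (T1 \<theta> u) x \<cdot>\<^bsub>Map0 G ?j\<^esub> e ?j ?y) \<cdot>\<^bsub>Map0 G ?k\<^esub> c' v ?y"
      by (subst c'e[of v ?y ?k, symmetric]) (simp_all add: cat_assoc)
    also have "\<dots> = ?e ?vu x \<cdot>\<^bsub>Map0 G ?k\<^esub> (FArr (Map1 G v) (c' u x) \<cdot>\<^bsub>Map0 G ?k\<^esub> c' v ?y)"
      by (subst c'e[of u x ?j, symmetric]) (simp_all add: cat_assoc)
    finally have q: "?e ?vu x \<cdot>\<^bsub>Map0 G ?k\<^esub> c' ?vu x = ?e ?vu x \<cdot>\<^bsub>Map0 G ?k\<^esub> (FArr (Map1 G v) (c' u x) \<cdot>\<^bsub>Map0 G ?k\<^esub> c' v ?y)" .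
    have "c' ?vu x = FArr (Map1 G v) (c' u x) \<cdot>\<^bsub>Map0 G ?k\<^esub> c' v ?y"
      by (rule iso_mono[OF _ _ _ _ _ _ q]) (use c'[of ?vu x ?k] in simp_all)
    then show "NCmp (T1 \<theta>' ?vu) x = FArr (Map1 G v) (NCmp (T1 \<theta>' u) x) \<cdot>\<^bsub>Map0 G ?k\<^esub> NCmp (T1 \<theta>' v) ?y"
      by simp
  next
    fix \<mu> x assume m: "\<mu> \<in> Arr (Cells I)" "x \<in> Obj (Map0 W (Dom (Under I) (Dom (Cells I) \<mu>)))"
    note [simp] = m
    let ?u = "Dom (Cells I) \<mu>" and ?v = "Cod (Cells I) \<mu>"
    let ?i = "Dom (Under I) ?u" and ?j = "Cod (Under I) ?u"
    have n: "NCmp (Map2 G \<mu>) (FObj (T0 \<theta> ?i) x) \<cdot>\<^bsub>Map0 G ?j\<^esub> ?e ?u x = ?e ?v x \<cdot>\<^bsub>Map0 G ?j\<^esub> NCmp (Map2 G \<mu>) (o' ?i x)"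
      using G.Map2_nat[of \<mu> ?i ?j "e ?i x"] by simp
    have "?e ?v x \<cdot>\<^bsub>Map0 G ?j\<^esub> (NCmp (Map2 G \<mu>) (o' ?i x) \<cdot>\<^bsub>Map0 G ?j\<^esub> c' ?u x)
      = (?e ?v x \<cdot>\<^bsub>Map0 G ?j\<^esub> NCmp (Map2 G \<mu>) (o' ?i x)) \<cdot>\<^bsub>Map0 G ?j\<^esub> c' ?u x" by (simp add: cat_assoc)
    also have "\<dots> = NCmp (Map2 G \<mu>) (FObj (T0 \<theta> ?i) x) \<cdot>\<^bsub>Map0 G ?j\<^esub> (?e ?u x \<cdot>\<^bsub>Map0 G ?j\<^esub> c' ?u x)"
      unfolding n[symmetric] by (simp add: cat_assoc)
    also have "\<dots> = (NCmp (Map2 G \<mu>) (FObj (T0 \<theta> ?i) x) \<cdot>\<^bsub>Map0 G ?j\<^esub> NCmp (T1 \<theta> ?u) x) \<cdot>\<^bsub>Map0 G ?j\<^esub> e ?j (FObj (Map1 W ?u) x)"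
      by (subst c'e[of ?u x ?j]) (simp_all add: cat_assoc)
    also have "\<dots> = NCmp (T1 \<theta> ?v) x \<cdot>\<^bsub>Map0 G ?j\<^esub> (FArr (T0 \<theta> ?j) (NCmp (Map2 W \<mu>) x) \<cdot>\<^bsub>Map0 G ?j\<^esub> e ?j (FObj (Map1 W ?u) x))"
      by (subst pn_cell[OF p m(1) refl refl m(2)]) (simp add: cat_assoc)
    also have "\<dots> = (NCmp (T1 \<theta> ?v) x \<cdot>\<^bsub>Map0 G ?j\<^esub> e ?j (FObj (Map1 W ?v) x)) \<cdot>\<^bsub>Map0 G ?j\<^esub> m' ?j (NCmp (Map2 W \<mu>) x)"
      using m'e[of ?j "NCmp (Map2 W \<mu>) x", symmetric] by (simp add: cat_assoc)
    also have "\<dots> = ?e ?v x \<cdot>\<^bsub>Map0 G ?j\<^esub> (c' ?v x \<cdot>\<^bsub>Map0 G ?j\<^esub> m' ?j (NCmp (Map2 W \<mu>) x))"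
      by (subst c'e[of ?v x ?j, symmetric]) (simp_all add: cat_assoc)
    finally have q: "?e ?v x \<cdot>\<^bsub>Map0 G ?j\<^esub> (NCmp (Map2 G \<mu>) (o' ?i x) \<cdot>\<^bsub>Map0 G ?j\<^esub> c' ?u x)
      = ?e ?v x \<cdot>\<^bsub>Map0 G ?j\<^esub> (c' ?v x \<cdot>\<^bsub>Map0 G ?j\<^esub> m' ?j (NCmp (Map2 W \<mu>) x))" .
    have "NCmp (Map2 G \<mu>) (o' ?i x) \<cdot>\<^bsub>Map0 G ?j\<^esub> c' ?u x = c' ?v x \<cdot>\<^bsub>Map0 G ?j\<^esub> m' ?j (NCmp (Map2 W \<mu>) x)"
      by (rule iso_mono[OF _ _ _ _ _ _ q]) simp_all
    then show "NCmp (Map2 G \<mu>) (FObj (T0 \<theta>' ?i) x) \<cdot>\<^bsub>Map0 G ?j\<^esub> NCmp (T1 \<theta>' ?u) x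
      = NCmp (T1 \<theta>' ?v) x \<cdot>\<^bsub>Map0 G ?j\<^esub> FArr (T0 \<theta>' ?j) (NCmp (Map2 W \<mu>) x)"
      by simp
  qed (simp_all, simp_all add: \<theta>'_def)
  let ?r = "\<lparr>MSrc = \<theta>', MTgt = \<theta>, MCmp = (\<lambda>i\<in>Obj (Under I). mkN (?T i) (T0 \<theta> i) (e i))\<rparr>"
  have n: "is_ntrans (mkN (?T i) (T0 \<theta> i) (e i))" if i: "i \<in> Obj (Under I)" for i
    by (rule is_ntrans_mkN[where C="Map0 W i" and D="Map0 G i"]) (use i m'e in simp_all)
  have r: "modification ?r"
    by (rule modificationI) (use p' n c'e in simp_all)
  have "is_iso (bilim I W G) ?r"
    by (rule bilim_iso[OF r]) simp
  then show ?thesis using that[OF p' _ r] by simp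
qed

end

subsection \<open>Functoriality in the diagram\<close>

text \<open>A 2-natural transformation from \<open>G\<close> to \<open>H\<close>. Its strictness is
  what lets \<open>post_transf\<close> whisker with \<open>t\<close> without inserting structure
  cells of \<open>t\<close>.\<close>

locale natural_family = WG: weighted_diagram I W G + WH: weighted_diagram I W H
  for I :: "('i, 'j, 'k) twocat" and W :: "('i, 'j, 'k, 'v, 'w) cat_valued"
    and G :: "('i, 'j, 'k, 'o, 'm) cat_valued" and H :: "('i, 'j, 'k, 'p, 'n) cat_valued" +
  fixes t :: "'i \<Rightarrow> ('o, 'm, 'p, 'n) cfunctor"
  assumes t_functor: "i \<in> Obj (Under I) \<Longrightarrow> is_functor (t i)" "i \<in> Obj (Under I) \<Longrightarrow> FSrc (t i) = Map0 G i"
    "i \<in> Obj (Under I) \<Longrightarrow> FTgt (t i) = Map0 H i"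
    and t_arr: "u \<in> Arr (Under I) \<Longrightarrow> t (Cod (Under I) u) \<cdot>F Map1 G u = Map1 H u \<cdot>F t (Dom (Under I) u)"
    and t_cell: "\<mu> \<in> Arr (Cells I) \<Longrightarrow> x \<in> Obj (Map0 G (Dom (Under I) (Dom (Cells I) \<mu>))) \<Longrightarrow>
      FArr (t (Cod (Under I) (Dom (Cells I) \<mu>))) (NCmp (Map2 G \<mu>) x)
      = NCmp (Map2 H \<mu>) (FObj (t (Dom (Under I) (Dom (Cells I) \<mu>))) x)"
begin

declare t_functor [simp]

lemma t_mor: "u \<in> Arr (Under I) \<Longrightarrow> Cod (Under I) u = j \<Longrightarrow> m \<in> Arr (Map0 G (Dom (Under I) u)) \<Longrightarrow>
    FArr (t j) (FArr (Map1 G u) m) = FArr (Map1 H u) (FArr (t (Dom (Under I) u)) m)"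
  using arg_cong[OF t_arr[of u], of "\<lambda>K. FArr K m"] by auto

lemma pn_post [simp]:
  assumes p: "WG.pn \<theta>"
  shows "WH.pn (post_transf I t \<theta>)"
proof (rule WH.pseudonaturalI)
  fix u assume u: "u \<in> Arr (Under I)"
  have "t (Cod (Under I) u) \<cdot>F (Map1 G u \<cdot>F T0 \<theta> (Dom (Under I) u))
    = (t (Cod (Under I) u) \<cdot>F Map1 G u) \<cdot>F T0 \<theta> (Dom (Under I) u)" using u p by simp
  also have "\<dots> = Map1 H u \<cdot>F (t (Dom (Under I) u) \<cdot>F T0 \<theta> (Dom (Under I) u))"
    unfolding t_arr[OF u] using u p by simp
  finally show "is_ntrans (T1 (post_transf I t \<theta>) u) \<and>
      NSrc (T1 (post_transf I t \<theta>) u) = T0 (post_transf I t \<theta>) (Cod (Under I) u) \<cdot>F Map1 W u \<and>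
      NTgt (T1 (post_transf I t \<theta>) u) = Map1 H u \<cdot>F T0 (post_transf I t \<theta>) (Dom (Under I) u)"
    using u p by simp
next
  fix u v x assume "u \<in> Arr (Under I)" "v \<in> Arr (Under I)" "Cod (Under I) u = Dom (Under I) v"
    "x \<in> Obj (Map0 W (Dom (Under I) u))"
  then show "NCmp (T1 (post_transf I t \<theta>) (v \<cdot>\<^bsub>Under I\<^esub> u)) x =
      FArr (Map1 H v) (NCmp (T1 (post_transf I t \<theta>) u) x) \<cdot>\<^bsub>Map0 H (Cod (Under I) v)\<^esub>
      NCmp (T1 (post_transf I t \<theta>) v) (FObj (Map1 W u) x)"
    using p by (simp add: t_mor)
next
  fix \<mu> x assume m: "\<mu> \<in> Arr (Cells I)" "x \<in> Obj (Map0 W (Dom (Under I) (Dom (Cells I) \<mu>)))"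
  let ?i = "Dom (Under I) (Dom (Cells I) \<mu>)" and ?j = "Cod (Under I) (Dom (Cells I) \<mu>)"
  have "FArr (t ?j) (NCmp (Map2 G \<mu>) (FObj (T0 \<theta> ?i) x) \<cdot>\<^bsub>Map0 G ?j\<^esub> NCmp (T1 \<theta> (Dom (Cells I) \<mu>)) x)
    = FArr (t ?j) (NCmp (T1 \<theta> (Cod (Cells I) \<mu>)) x \<cdot>\<^bsub>Map0 G ?j\<^esub> FArr (T0 \<theta> ?j) (NCmp (Map2 W \<mu>) x))"
    by (subst WG.pn_cell[OF p m(1) refl refl m(2)]) simp
  then show "NCmp (Map2 H \<mu>) (FObj (T0 (post_transf I t \<theta>) ?i) x) \<cdot>\<^bsub>Map0 H ?j\<^esub> NCmp (T1 (post_transf I t \<theta>) (Dom (Cells I) \<mu>)) x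
    = NCmp (T1 (post_transf I t \<theta>) (Cod (Cells I) \<mu>)) x \<cdot>\<^bsub>Map0 H ?j\<^esub> FArr (T0 (post_transf I t \<theta>) ?j) (NCmp (Map2 W \<mu>) x)"
    using p m by (simp add: t_cell)
qed (use p in \<open>simp_all\<close>, simp_all add: post_transf_def)

lemma modification_post [simp]:
  assumes m: "WG.modification \<rho>"
  shows "WH.modification (post_modif I t \<rho>)"
proof (rule WH.modificationI)
  fix u x assume u: "u \<in> Arr (Under I)" "x \<in> Obj (Map0 W (Dom (Under I) u))"
  have "FArr (t (Cod (Under I) u)) (NCmp (T1 (MTgt \<rho>) u) x \<cdot>\<^bsub>Map0 G (Cod (Under I) u)\<^esub> NCmp (MCmp \<rho> (Cod (Under I) u)) (FObj (Map1 W u) x))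
    = FArr (t (Cod (Under I) u)) (FArr (Map1 G u) (NCmp (MCmp \<rho> (Dom (Under I) u)) x) \<cdot>\<^bsub>Map0 G (Cod (Under I) u)\<^esub> NCmp (T1 (MSrc \<rho>) u) x)"
    by (subst WG.modificationD(7)[OF m u refl]) simp
  then show "NCmp (T1 (MTgt (post_modif I t \<rho>)) u) x \<cdot>\<^bsub>Map0 H (Cod (Under I) u)\<^esub>
       NCmp (MCmp (post_modif I t \<rho>) (Cod (Under I) u)) (FObj (Map1 W u) x) =
       FArr (Map1 H u) (NCmp (MCmp (post_modif I t \<rho>) (Dom (Under I) u)) x) \<cdot>\<^bsub>Map0 H (Cod (Under I) u)\<^esub>
       NCmp (T1 (MSrc (post_modif I t \<rho>)) u) x"
    using u m by (simp add: t_mor)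
qed (use m in \<open>simp_all\<close>, simp_all add: post_modif_def)

lemma bilim_map_sel [simp]:
  "FSrc (bilim_map I W G H t) = bilim I W G" "FTgt (bilim_map I W G H t) = bilim I W H"
  "WG.pn \<theta> \<Longrightarrow> FObj (bilim_map I W G H t) \<theta> = post_transf I t \<theta>"
  "WG.modification \<rho> \<Longrightarrow> FArr (bilim_map I W G H t) \<rho> = post_modif I t \<rho>"
  by (auto simp: bilim_map_def)

lemma bilim_map_functor [simp]: "is_functor (bilim_map I W G H t)"
proof (rule is_functorI)
  fix \<theta> assume "\<theta> \<in> Obj (FSrc (bilim_map I W G H t))"
  then have p: "WG.pn \<theta>" by simp
  have "post_modif I t (Ident (bilim I W G) \<theta>) = Ident (bilim I W H) (post_transf I t \<theta>)"
    by (rule WH.modification_eqI[OF modification_post[OF WG.modification_ident] WH.modification_ident])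
      (use p in simp_all)
  then show "FArr (bilim_map I W G H t) (Ident (FSrc (bilim_map I W G H t)) \<theta>) =
      Ident (FTgt (bilim_map I W G H t)) (FObj (bilim_map I W G H t) \<theta>)"
    using p WG.modification_ident[OF p] by (simp del: WG.bilim_sel WH.bilim_sel)
next
  fix m n assume "m \<in> Arr (FSrc (bilim_map I W G H t))" "n \<in> Arr (FSrc (bilim_map I W G H t))"
    "Cod (FSrc (bilim_map I W G H t)) m = Dom (FSrc (bilim_map I W G H t)) n"
  then have m: "WG.modification m" "WG.modification n" "MTgt m = MSrc n" by simp_all
  have "post_modif I t (n \<cdot>\<^bsub>bilim I W G\<^esub> m) = post_modif I t n \<cdot>\<^bsub>bilim I W H\<^esub> post_modif I t m"
    by (rule WH.modification_eqI[OF modification_post[OF WG.modification_comp] WH.modification_comp])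
      (use m in simp_all)
  then show "FArr (bilim_map I W G H t) (n \<cdot>\<^bsub>FSrc (bilim_map I W G H t)\<^esub> m) =
       FArr (bilim_map I W G H t) n \<cdot>\<^bsub>FTgt (bilim_map I W G H t)\<^esub> FArr (bilim_map I W G H t) m"
    using m WG.modification_comp[OF m] by (simp del: WG.bilim_sel WH.bilim_sel)
qed (simp_all, simp_all add: bilim_map_def)

end

text \<open>The known object here is a modification \<open>m\<close> between the 2-natural
  transformations \<open>s\<close> and \<open>t\<close>.\<close>

locale natural_family_cell = S: natural_family I W G H s + T: natural_family I W G H t
  for I :: "('i, 'j, 'k) twocat" and W :: "('i, 'j, 'k, 'v, 'w) cat_valued"
    and G :: "('i, 'j, 'k, 'o, 'm) cat_valued" and H :: "('i, 'j, 'k, 'p, 'n) cat_valued"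
    and s t :: "'i \<Rightarrow> ('o, 'm, 'p, 'n) cfunctor" +
  fixes m :: "'i \<Rightarrow> ('o, 'm, 'p, 'n) ntrans"
  assumes m_ntrans: "i \<in> Obj (Under I) \<Longrightarrow> is_ntrans (m i)" "i \<in> Obj (Under I) \<Longrightarrow> NSrc (m i) = s i"
    "i \<in> Obj (Under I) \<Longrightarrow> NTgt (m i) = t i"
    and m_arr: "u \<in> Arr (Under I) \<Longrightarrow> x \<in> Obj (Map0 G (Dom (Under I) u)) \<Longrightarrow>
      NCmp (m (Cod (Under I) u)) (FObj (Map1 G u) x) = FArr (Map1 H u) (NCmp (m (Dom (Under I) u)) x)"
begin

declare m_ntrans [simp]

lemma modification_post_cell [simp]:
  assumes p: "S.WG.pn \<theta>"
  shows "S.WH.modification (post_cell I s t m \<theta>)"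
proof (rule S.WH.modificationI)
  fix u x assume u: "u \<in> Arr (Under I)" "x \<in> Obj (Map0 W (Dom (Under I) u))"
  let ?j = "Cod (Under I) u" and ?i = "Dom (Under I) u"
  have "NCmp (m ?j) (Cod (Map0 G ?j) (NCmp (T1 \<theta> u) x)) \<cdot>\<^bsub>Map0 H ?j\<^esub> FArr (s ?j) (NCmp (T1 \<theta> u) x)
    = FArr (t ?j) (NCmp (T1 \<theta> u) x) \<cdot>\<^bsub>Map0 H ?j\<^esub> NCmp (m ?j) (Dom (Map0 G ?j) (NCmp (T1 \<theta> u) x))"
    using ntrans_nat[of "m ?j" "NCmp (T1 \<theta> u) x" "Map0 H ?j" "Map0 G ?j"] u p by simp
  then show "NCmp (T1 (MTgt (post_cell I s t m \<theta>)) u) x \<cdot>\<^bsub>Map0 H ?j\<^esub>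
       NCmp (MCmp (post_cell I s t m \<theta>) ?j) (FObj (Map1 W u) x) =
       FArr (Map1 H u) (NCmp (MCmp (post_cell I s t m \<theta>) ?i) x) \<cdot>\<^bsub>Map0 H ?j\<^esub>
       NCmp (T1 (MSrc (post_cell I s t m \<theta>)) u) x"
    using u p by (simp add: m_arr)
qed (use p in \<open>simp_all\<close>, simp_all add: post_cell_def)

lemma bilim_cell_sel [simp]:
  "NSrc (bilim_cell I W G H s t m) = bilim_map I W G H s" "NTgt (bilim_cell I W G H s t m) = bilim_map I W G H t"
  "S.WG.pn \<theta> \<Longrightarrow> NCmp (bilim_cell I W G H s t m) \<theta> = post_cell I s t m \<theta>"
  by (auto simp: bilim_cell_def)

lemma bilim_cell_ntrans [simp]: "is_ntrans (bilim_cell I W G H s t m)"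
proof (rule is_ntransI)
  fix \<rho> assume "\<rho> \<in> Arr (FSrc (NSrc (bilim_cell I W G H s t m)))"
  then have r: "S.WG.modification \<rho>" by simp
  have "post_cell I s t m (MTgt \<rho>) \<cdot>\<^bsub>bilim I W H\<^esub> post_modif I s \<rho> = post_modif I t \<rho> \<cdot>\<^bsub>bilim I W H\<^esub> post_cell I s t m (MSrc \<rho>)"
  proof (rule S.WH.modification_eqI[OF S.WH.modification_comp S.WH.modification_comp])
    fix i x assume i: "i \<in> Obj (Under I)" "x \<in> Obj (Map0 W i)"
    have "NCmp (m i) (Cod (Map0 G i) (NCmp (MCmp \<rho> i) x)) \<cdot>\<^bsub>Map0 H i\<^esub> FArr (s i) (NCmp (MCmp \<rho> i) x)
      = FArr (t i) (NCmp (MCmp \<rho> i) x) \<cdot>\<^bsub>Map0 H i\<^esub> NCmp (m i) (Dom (Map0 G i) (NCmp (MCmp \<rho> i) x))"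
      using ntrans_nat[of "m i" "NCmp (MCmp \<rho> i) x" "Map0 H i" "Map0 G i"] i r by simp
    then show "NCmp (MCmp (post_cell I s t m (MTgt \<rho>) \<cdot>\<^bsub>bilim I W H\<^esub> post_modif I s \<rho>) i) x
      = NCmp (MCmp (post_modif I t \<rho> \<cdot>\<^bsub>bilim I W H\<^esub> post_cell I s t m (MSrc \<rho>)) i) x"
      using i r by simp
  qed (use r in simp_all)
  then show "NCmp (bilim_cell I W G H s t m) (Cod (FSrc (NSrc (bilim_cell I W G H s t m))) \<rho>)
       \<cdot>\<^bsub>FTgt (NSrc (bilim_cell I W G H s t m))\<^esub> FArr (NSrc (bilim_cell I W G H s t m)) \<rho>
     = FArr (NTgt (bilim_cell I W G H s t m)) \<rho> \<cdot>\<^bsub>FTgt (NSrc (bilim_cell I W G H s t m))\<^esub>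
       NCmp (bilim_cell I W G H s t m) (Dom (FSrc (NSrc (bilim_cell I W G H s t m))) \<rho>)"
    using r by (simp del: S.WH.bilim_sel(5))
qed (simp_all, simp_all add: bilim_cell_def)

end

lemma natural_family_comp:
  assumes "natural_family I W G H t" "natural_family I W H K t'"
  shows "natural_family I W G K (\<lambda>i. t' i \<cdot>F t i)"
proof -
  interpret s: natural_family I W G H t by fact
  interpret t: natural_family I W H K t' by fact
  show ?thesis
  proof (intro natural_family.intro s.WG.weighted_diagram_axioms t.WH.weighted_diagram_axioms natural_family_axioms.intro)
    fix u assume u: "u \<in> Arr (Under I)"
    have "(t' (Cod (Under I) u) \<cdot>F t (Cod (Under I) u)) \<cdot>F Map1 G u = t' (Cod (Under I) u) \<cdot>F (t (Cod (Under I) u) \<cdot>F Map1 G u)"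
      using u by simp
    also have "\<dots> = (t' (Cod (Under I) u) \<cdot>F Map1 H u) \<cdot>F t (Dom (Under I) u)"
      unfolding s.t_arr[OF u] using u by simp
    also have "\<dots> = Map1 K u \<cdot>F (t' (Dom (Under I) u) \<cdot>F t (Dom (Under I) u))"
      unfolding t.t_arr[OF u] using u by simp
    finally show "(t' (Cod (Under I) u) \<cdot>F t (Cod (Under I) u)) \<cdot>F Map1 G u = Map1 K u \<cdot>F (t' (Dom (Under I) u) \<cdot>F t (Dom (Under I) u))" .
  qed (simp_all add: s.t_cell t.t_cell)
qed

section \<open>The comparison cone\<close>

locale comparison = filtered_pair A \<Sigma>
  for A :: "('a, 'f, 'c) twocat" and \<Sigma> +
  fixes I :: "('i, 'j, 'k) twocat"
    and F :: "('a \<times> 'i, 'f \<times> 'j, 'c \<times> 'k, 'o, 'm) cat_valued"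
    and W :: "('i, 'j, 'k, 'v, 'w) cat_valued"
    and L :: "'i \<Rightarrow> ('l, 'h) cat"
    and lam :: "'i \<Rightarrow> ('a, 'f, 'o, 'm, 'l, 'h) transf"
  assumes finI: "finite_two_category I"
    and functorF: "two_functor (prod_twocat A I) Cat F"
    and finW: "finite_weight I W"
    and colims: "i \<in> Obj (Under I) \<Longrightarrow> is_sigma_colimit A \<Sigma> (fix_right I F i) (L i) (lam i)"
begin

section \<open>The 2-functor of two variables and its restrictions\<close>

abbreviation "uc \<equiv> Cod (Under A)"
abbreviation "ud \<equiv> Dom (Under A)"
abbreviation "ic \<equiv> Cod (Under I)"
abbreviation "id' \<equiv> Dom (Under I)"
abbreviation "FR \<equiv> fix_right I F"
abbreviation "FL \<equiv> fix_left A F"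
abbreviation "C \<equiv> colim_functor A \<Sigma> I F L lam"
abbreviation "B \<equiv> bilim_functor A I W F"

lemma twoI [simp]: "two_category I" using finI by (simp add: finite_two_category_def)

lemma functorW: "two_functor I Cat W" using finW by (simp add: finite_weight_def)

lemma Map0_fix [simp]: "Map0 (FR i) a = Map0 F (a, i)" "Map0 (FL a) i = Map0 F (a, i)"
  by (auto simp: fix_right_def fix_left_def)

lemma prod_sel:
  "Obj (Under (prod_twocat A I)) = Obj (Under A) \<times> Obj (Under I)"
  "Arr (Under (prod_twocat A I)) = Arr (Under A) \<times> Arr (Under I)"
  "Arr (Cells (prod_twocat A I)) = Arr (Cells A) \<times> Arr (Cells I)"
  "Dom (Under (prod_twocat A I)) (f, u) = (ud f, id' u)"
  "Cod (Under (prod_twocat A I)) (f, u) = (uc f, ic u)"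
  "Dom (Cells (prod_twocat A I)) (\<alpha>, \<mu>) = (Dom (Cells A) \<alpha>, Dom (Cells I) \<mu>)"
  "Cod (Cells (prod_twocat A I)) (\<alpha>, \<mu>) = (Cod (Cells A) \<alpha>, Cod (Cells I) \<mu>)"
  "Ident (Under (prod_twocat A I)) (a, i) = (Ident (Under A) a, Ident (Under I) i)"
  "Ident (Cells (prod_twocat A I)) (f, u) = (Ident (Cells A) f, Ident (Cells I) u)"
  "(g, v) \<cdot>\<^bsub>Under (prod_twocat A I)\<^esub> (f, u) = (g \<cdot>\<^bsub>Under A\<^esub> f, v \<cdot>\<^bsub>Under I\<^esub> u)"
  "(\<beta>, \<nu>) \<cdot>\<^bsub>Cells (prod_twocat A I)\<^esub> (\<alpha>, \<mu>) = (\<beta> \<cdot>\<^bsub>Cells A\<^esub> \<alpha>, \<nu> \<cdot>\<^bsub>Cells I\<^esub> \<mu>)"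
  "HComp (prod_twocat A I) (\<beta>, \<nu>) (\<alpha>, \<mu>) = (HComp A \<beta> \<alpha>, HComp I \<nu> \<mu>)"
  by (auto simp: prod_twocat_def prod_cat_def)

lemma F_cat [simp]: "a \<in> Obj (Under A) \<Longrightarrow> i \<in> Obj (Under I) \<Longrightarrow> category (Map0 F (a, i))"
  using functorF by (auto simp: two_functor_def prod_sel)

lemma F_functor:
  assumes "f \<in> Arr (Under A)" "u \<in> Arr (Under I)"
  shows "is_functor (Map1 F (f, u))" "FSrc (Map1 F (f, u)) = Map0 F (ud f, id' u)"
    "FTgt (Map1 F (f, u)) = Map0 F (uc f, ic u)"
proof -
  have "(f, u) \<in> Arr (Under (prod_twocat A I))" using assms by (simp add: prod_sel)
  then have "Map1 F (f, u) \<in> hom (Under Cat) (Map0 F (Dom (Under (prod_twocat A I)) (f, u))) (Map0 F (Cod (Under (prod_twocat A I)) (f, u)))"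
    using functorF unfolding two_functor_def by blast
  then show "is_functor (Map1 F (f, u))" "FSrc (Map1 F (f, u)) = Map0 F (ud f, id' u)"
    "FTgt (Map1 F (f, u)) = Map0 F (uc f, ic u)" by (simp_all add: prod_sel)
qed

lemma F_ntrans:
  assumes "\<alpha> \<in> Arr (Cells A)" "\<mu> \<in> Arr (Cells I)"
  shows "is_ntrans (Map2 F (\<alpha>, \<mu>))" "NSrc (Map2 F (\<alpha>, \<mu>)) = Map1 F (Dom (Cells A) \<alpha>, Dom (Cells I) \<mu>)"
    "NTgt (Map2 F (\<alpha>, \<mu>)) = Map1 F (Cod (Cells A) \<alpha>, Cod (Cells I) \<mu>)"
proof -
  have "(\<alpha>, \<mu>) \<in> Arr (Cells (prod_twocat A I))" using assms by (simp add: prod_sel)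
  then have "Map2 F (\<alpha>, \<mu>) \<in> hom (Cells Cat) (Map1 F (Dom (Cells (prod_twocat A I)) (\<alpha>, \<mu>))) (Map1 F (Cod (Cells (prod_twocat A I)) (\<alpha>, \<mu>)))"
    using functorF unfolding two_functor_def by blast
  then show "is_ntrans (Map2 F (\<alpha>, \<mu>))" "NSrc (Map2 F (\<alpha>, \<mu>)) = Map1 F (Dom (Cells A) \<alpha>, Dom (Cells I) \<mu>)"
    "NTgt (Map2 F (\<alpha>, \<mu>)) = Map1 F (Cod (Cells A) \<alpha>, Cod (Cells I) \<mu>)" by (simp_all add: prod_sel)
qed

lemma F_pres:
  shows "a \<in> Obj (Under A) \<Longrightarrow> i \<in> Obj (Under I) \<Longrightarrow> Map1 F (Ident (Under A) a, Ident (Under I) i) = idf (Map0 F (a, i))"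
    and "\<lbrakk>f \<in> Arr (Under A); g \<in> Arr (Under A); uc f = ud g; u \<in> Arr (Under I); v \<in> Arr (Under I); ic u = id' v\<rbrakk>
      \<Longrightarrow> Map1 F (g \<cdot>\<^bsub>Under A\<^esub> f, v \<cdot>\<^bsub>Under I\<^esub> u) = Map1 F (g, v) \<cdot>F Map1 F (f, u)"
    and "f \<in> Arr (Under A) \<Longrightarrow> u \<in> Arr (Under I) \<Longrightarrow> Map2 F (Ident (Cells A) f, Ident (Cells I) u) = idn (Map1 F (f, u))"
    and "\<lbrakk>\<alpha> \<in> Arr (Cells A); \<beta> \<in> Arr (Cells A); Cod (Cells A) \<alpha> = Dom (Cells A) \<beta>;
        \<mu> \<in> Arr (Cells I); \<nu> \<in> Arr (Cells I); Cod (Cells I) \<mu> = Dom (Cells I) \<nu>\<rbrakk>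
      \<Longrightarrow> Map2 F (\<beta> \<cdot>\<^bsub>Cells A\<^esub> \<alpha>, \<nu> \<cdot>\<^bsub>Cells I\<^esub> \<mu>) = Map2 F (\<beta>, \<nu>) \<cdot>N Map2 F (\<alpha>, \<mu>)"
    and "\<lbrakk>\<alpha> \<in> Arr (Cells A); \<beta> \<in> Arr (Cells A); uc (Dom (Cells A) \<alpha>) = ud (Dom (Cells A) \<beta>);
        \<mu> \<in> Arr (Cells I); \<nu> \<in> Arr (Cells I); ic (Dom (Cells I) \<mu>) = id' (Dom (Cells I) \<nu>)\<rbrakk>
      \<Longrightarrow> Map2 F (HComp A \<beta> \<alpha>, HComp I \<nu> \<mu>) = hcomp (Map2 F (\<beta>, \<nu>)) (Map2 F (\<alpha>, \<mu>))"
proof -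
  have f: "\<And>a. a \<in> Obj (Under (prod_twocat A I)) \<Longrightarrow> Map1 F (Ident (Under (prod_twocat A I)) a) = idf (Map0 F a)"
    "\<And>f g. \<lbrakk>f \<in> Arr (Under (prod_twocat A I)); g \<in> Arr (Under (prod_twocat A I));
       Cod (Under (prod_twocat A I)) f = Dom (Under (prod_twocat A I)) g\<rbrakk> \<Longrightarrow>
       Map1 F (g \<cdot>\<^bsub>Under (prod_twocat A I)\<^esub> f) = Map1 F g \<cdot>F Map1 F f"
    "\<And>f. f \<in> Arr (Under (prod_twocat A I)) \<Longrightarrow> Map2 F (Ident (Cells (prod_twocat A I)) f) = idn (Map1 F f)"
    "\<And>f g. \<lbrakk>f \<in> Arr (Cells (prod_twocat A I)); g \<in> Arr (Cells (prod_twocat A I));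
       Cod (Cells (prod_twocat A I)) f = Dom (Cells (prod_twocat A I)) g\<rbrakk> \<Longrightarrow>
       Map2 F (g \<cdot>\<^bsub>Cells (prod_twocat A I)\<^esub> f) = Map2 F g \<cdot>N Map2 F f"
    "\<And>f g. \<lbrakk>f \<in> Arr (Cells (prod_twocat A I)); g \<in> Arr (Cells (prod_twocat A I));
       cell_tgt (prod_twocat A I) f = cell_src (prod_twocat A I) g\<rbrakk> \<Longrightarrow>
       Map2 F (HComp (prod_twocat A I) g f) = hcomp (Map2 F g) (Map2 F f)"
    using functorF unfolding two_functor_def Cat_sel by blast+
  show "a \<in> Obj (Under A) \<Longrightarrow> i \<in> Obj (Under I) \<Longrightarrow> Map1 F (Ident (Under A) a, Ident (Under I) i) = idf (Map0 F (a, i))"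
    using f(1)[of "(a, i)"] by (simp add: prod_sel)
  show "\<lbrakk>f \<in> Arr (Under A); g \<in> Arr (Under A); uc f = ud g; u \<in> Arr (Under I); v \<in> Arr (Under I); ic u = id' v\<rbrakk>
      \<Longrightarrow> Map1 F (g \<cdot>\<^bsub>Under A\<^esub> f, v \<cdot>\<^bsub>Under I\<^esub> u) = Map1 F (g, v) \<cdot>F Map1 F (f, u)"
    using f(2)[of "(f, u)" "(g, v)"] by (simp add: prod_sel)
  show "f \<in> Arr (Under A) \<Longrightarrow> u \<in> Arr (Under I) \<Longrightarrow> Map2 F (Ident (Cells A) f, Ident (Cells I) u) = idn (Map1 F (f, u))"
    using f(3)[of "(f, u)"] by (simp add: prod_sel)
  show "\<lbrakk>\<alpha> \<in> Arr (Cells A); \<beta> \<in> Arr (Cells A); Cod (Cells A) \<alpha> = Dom (Cells A) \<beta>;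
        \<mu> \<in> Arr (Cells I); \<nu> \<in> Arr (Cells I); Cod (Cells I) \<mu> = Dom (Cells I) \<nu>\<rbrakk>
      \<Longrightarrow> Map2 F (\<beta> \<cdot>\<^bsub>Cells A\<^esub> \<alpha>, \<nu> \<cdot>\<^bsub>Cells I\<^esub> \<mu>) = Map2 F (\<beta>, \<nu>) \<cdot>N Map2 F (\<alpha>, \<mu>)"
    using f(4)[of "(\<alpha>, \<mu>)" "(\<beta>, \<nu>)"] by (simp add: prod_sel)
  show "\<lbrakk>\<alpha> \<in> Arr (Cells A); \<beta> \<in> Arr (Cells A); uc (Dom (Cells A) \<alpha>) = ud (Dom (Cells A) \<beta>);
        \<mu> \<in> Arr (Cells I); \<nu> \<in> Arr (Cells I); ic (Dom (Cells I) \<mu>) = id' (Dom (Cells I) \<nu>)\<rbrakk>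
      \<Longrightarrow> Map2 F (HComp A \<beta> \<alpha>, HComp I \<nu> \<mu>) = hcomp (Map2 F (\<beta>, \<nu>)) (Map2 F (\<alpha>, \<mu>))"
    using f(5)[of "(\<alpha>, \<mu>)" "(\<beta>, \<nu>)"] by (simp add: prod_sel cell_tgt_def cell_src_def)
qed

lemma diagFR:
  assumes i: "i \<in> Obj (Under I)"
  shows "diagram A (FR i)"
proof (intro diagram.intro)
  let ?i = "Ident (Under I) i" and ?ii = "Ident (Cells I) (Ident (Under I) i)"
  have h: "HComp I ?ii ?ii = ?ii"
    using two_category.hcomp_ident[OF twoI, of ?i i i ?i i] i by simp
  show "two_functor A Cat (FR i)"
    unfolding two_functor_def fix_right_def twofunctor.select_convs Cat_sel in_hom_iff mem_Collect_eq cell_tgt_def cell_src_def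
  proof (intro conjI ballI impI)
    fix f g assume "f \<in> Arr (Under A)" "g \<in> Arr (Under A)" "uc f = ud g"
    then show "Map1 F (g \<cdot>\<^bsub>Under A\<^esub> f, ?i) = Map1 F (g, ?i) \<cdot>F Map1 F (f, ?i)"
      using F_pres(2)[of f g ?i ?i] i by simp
  next
    fix f g assume "f \<in> Arr (Cells A)" "g \<in> Arr (Cells A)" "Cod (Cells A) f = Dom (Cells A) g"
    then show "Map2 F (g \<cdot>\<^bsub>Cells A\<^esub> f, ?ii) = Map2 F (g, ?ii) \<cdot>N Map2 F (f, ?ii)"
      using F_pres(4)[of f g ?ii ?ii] i by simp
  next
    fix f g assume "f \<in> Arr (Cells A)" "g \<in> Arr (Cells A)" "uc (Dom (Cells A) f) = ud (Dom (Cells A) g)"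
    then show "Map2 F (HComp A g f, ?ii) = hcomp (Map2 F (g, ?ii)) (Map2 F (f, ?ii))"
      using F_pres(5)[of f g ?ii ?ii] i by (simp add: h)
  qed (use i in \<open>simp_all add: F_functor F_ntrans F_pres\<close>)
qed simp

lemma diagFL:
  assumes a: "a \<in> Obj (Under A)"
  shows "diagram I (FL a)"
proof (intro diagram.intro)
  let ?i = "Ident (Under A) a" and ?ii = "Ident (Cells A) (Ident (Under A) a)"
  have h: "HComp A ?ii ?ii = ?ii"
    using two_category.hcomp_ident[OF two_catA, of ?i a a ?i a] a by simp
  show "two_functor I Cat (FL a)"
    unfolding two_functor_def fix_left_def twofunctor.select_convs Cat_sel in_hom_iff mem_Collect_eq cell_tgt_def cell_src_def
  proof (intro conjI ballI impI)
    fix f g assume "f \<in> Arr (Under I)" "g \<in> Arr (Under I)" "ic f = id' g"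
    then show "Map1 F (?i, g \<cdot>\<^bsub>Under I\<^esub> f) = Map1 F (?i, g) \<cdot>F Map1 F (?i, f)"
      using F_pres(2)[of ?i ?i f g] a by simp
  next
    fix f g assume "f \<in> Arr (Cells I)" "g \<in> Arr (Cells I)" "Cod (Cells I) f = Dom (Cells I) g"
    then show "Map2 F (?ii, g \<cdot>\<^bsub>Cells I\<^esub> f) = Map2 F (?ii, g) \<cdot>N Map2 F (?ii, f)"
      using F_pres(4)[of ?ii ?ii f g] a by simp
  next
    fix f g assume "f \<in> Arr (Cells I)" "g \<in> Arr (Cells I)" "ic (Dom (Cells I) f) = id' (Dom (Cells I) g)"
    then show "Map2 F (?ii, HComp I g f) = hcomp (Map2 F (?ii, g)) (Map2 F (?ii, f))"
      using F_pres(5)[of ?ii ?ii f g] a by (simp add: h)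
  qed (use a in \<open>simp_all add: F_functor F_ntrans F_pres\<close>)
qed simp

lemmas FR_simps [simp] =
  diagram.Map1_functor[OF diagFR, unfolded Map0_fix] diagram.Map2_ntrans[OF diagFR]
  diagram.Map_pres[OF diagFR, unfolded Map0_fix] diagram.Map2_is_iso[OF diagFR, unfolded Map0_fix]

lemmas FL_simps [simp] =
  diagram.Map1_functor[OF diagFL, unfolded Map0_fix] diagram.Map2_ntrans[OF diagFL]
  diagram.Map_pres[OF diagFL, unfolded Map0_fix] diagram.Map2_is_iso[OF diagFL, unfolded Map0_fix]

text \<open>Both composites equal the value of \<open>F\<close> at the pair \<open>(f, u)\<close>,
  factored in the product in the two possible orders. The variants below for a 2-cell in one
  variable have the same reason, with horizontal composition.\<close>

lemma F_commute:
  assumes "f \<in> Arr (Under A)" "u \<in> Arr (Under I)"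
  shows "Map1 (FR (ic u)) f \<cdot>F Map1 (FL (ud f)) u = Map1 (FL (uc f)) u \<cdot>F Map1 (FR (id' u)) f"
proof -
  have "Map1 F (f, Ident (Under I) (ic u)) \<cdot>F Map1 F (Ident (Under A) (ud f), u) = Map1 F (f, u)"
    using F_pres(2)[of "Ident (Under A) (ud f)" f u "Ident (Under I) (ic u)"] assms by simp
  also have "\<dots> = Map1 F (Ident (Under A) (uc f), u) \<cdot>F Map1 F (f, Ident (Under I) (id' u))"
    using F_pres(2)[of f "Ident (Under A) (uc f)" "Ident (Under I) (id' u)" u] assms by simp
  finally show ?thesis by (simp add: fix_right_def fix_left_def)
qed

lemma F_commute_obj:
  assumes "f \<in> Arr (Under A)" "u \<in> Arr (Under I)" "ic u = j" "ud f = a" "x \<in> Obj (Map0 F (a, id' u))"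
  shows "FObj (Map1 (FR j) f) (FObj (Map1 (FL a) u) x) = FObj (Map1 (FL (uc f)) u) (FObj (Map1 (FR (id' u)) f) x)"
  using arg_cong[OF F_commute[OF assms(1,2)], of "\<lambda>K. FObj K x"] assms by auto

lemma F_commute_arr:
  assumes "f \<in> Arr (Under A)" "u \<in> Arr (Under I)" "ic u = j" "ud f = a" "m \<in> Arr (Map0 F (a, id' u))"
  shows "FArr (Map1 (FR j) f) (FArr (Map1 (FL a) u) m) = FArr (Map1 (FL (uc f)) u) (FArr (Map1 (FR (id' u)) f) m)"
  using arg_cong[OF F_commute[OF assms(1,2)], of "\<lambda>K. FArr K m"] assms by auto

lemma F_commute_cell:
  assumes "\<alpha> \<in> Arr (Cells A)" "u \<in> Arr (Under I)" "ic u = j" "ud (Dom (Cells A) \<alpha>) = a" "x \<in> Obj (Map0 F (a, id' u))"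
  shows "NCmp (Map2 (FR j) \<alpha>) (FObj (Map1 (FL a) u) x)
    = FArr (Map1 (FL (uc (Dom (Cells A) \<alpha>))) u) (NCmp (Map2 (FR (id' u)) \<alpha>) x)"
proof -
  let ?a = "Ident (Under A) a" and ?b = "Ident (Under A) (uc (Dom (Cells A) \<alpha>))"
  have u: "HComp A \<alpha> (Ident (Cells A) ?a) = \<alpha>" "HComp A (Ident (Cells A) ?b) \<alpha> = \<alpha>"
    using two_category.hcomp_unit_right[OF two_catA assms(1)] two_category.hcomp_unit_left[OF two_catA assms(1)] assms(4)
    by (simp_all add: cell_src_def cell_tgt_def)
  have j: "j \<in> Obj (Under I)" using assms by auto
  have v: "HComp I (Ident (Cells I) (Ident (Under I) (ic u))) (Ident (Cells I) u) = Ident (Cells I) u"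
    "HComp I (Ident (Cells I) u) (Ident (Cells I) (Ident (Under I) (id' u))) = Ident (Cells I) u"
    using two_category.hcomp_ident[OF twoI, of u "id' u" "ic u" "Ident (Under I) (ic u)" "ic u"]
      two_category.hcomp_ident[OF twoI, of "Ident (Under I) (id' u)" "id' u" "id' u" u "ic u"] assms j by simp_all
  have a: "a \<in> Obj (Under A)" using assms by auto
  have l: "hcomp (Map2 F (\<alpha>, Ident (Cells I) (Ident (Under I) (ic u)))) (Map2 F (Ident (Cells A) ?a, Ident (Cells I) u)) = Map2 F (\<alpha>, Ident (Cells I) u)"
    using F_pres(5)[of "Ident (Cells A) ?a" \<alpha> "Ident (Cells I) u" "Ident (Cells I) (Ident (Under I) (ic u))"] assms a j u v by simp
  have r: "hcomp (Map2 F (Ident (Cells A) ?b, Ident (Cells I) u)) (Map2 F (\<alpha>, Ident (Cells I) (Ident (Under I) (id' u)))) = Map2 F (\<alpha>, Ident (Cells I) u)"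
    using F_pres(5)[of \<alpha> "Ident (Cells A) ?b" "Ident (Cells I) (Ident (Under I) (id' u))" "Ident (Cells I) u"] assms a j u v by simp
  have "hcomp (Map2 (FR (ic u)) \<alpha>) (idn (Map1 (FL a) u)) = hcomp (idn (Map1 (FL (uc (Dom (Cells A) \<alpha>))) u)) (Map2 (FR (id' u)) \<alpha>)"
    using l[folded r] assms a j by (simp add: fix_right_def fix_left_def F_pres)
  from arg_cong[OF this, of "\<lambda>n. NCmp n x"] show ?thesis using assms a j by auto
qed

lemma F_commute_cell':
  assumes "f \<in> Arr (Under A)" "\<mu> \<in> Arr (Cells I)" "ic (Dom (Cells I) \<mu>) = j" "ud f = a" "x \<in> Obj (Map0 F (a, id' (Dom (Cells I) \<mu>)))"
  shows "FArr (Map1 (FR j) f) (NCmp (Map2 (FL a) \<mu>) x)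
    = NCmp (Map2 (FL (uc f)) \<mu>) (FObj (Map1 (FR (id' (Dom (Cells I) \<mu>))) f) x)"
proof -
  let ?i = "Ident (Under I) (id' (Dom (Cells I) \<mu>))" and ?j = "Ident (Under I) (ic (Dom (Cells I) \<mu>))"
  have u: "HComp I \<mu> (Ident (Cells I) ?i) = \<mu>" "HComp I (Ident (Cells I) ?j) \<mu> = \<mu>"
    using two_category.hcomp_unit_right[OF twoI assms(2)] two_category.hcomp_unit_left[OF twoI assms(2)]
    by (simp_all add: cell_src_def cell_tgt_def)
  have a: "a \<in> Obj (Under A)" and j: "j \<in> Obj (Under I)" using assms by auto
  have v: "HComp A (Ident (Cells A) (Ident (Under A) (uc f))) (Ident (Cells A) f) = Ident (Cells A) f"
    "HComp A (Ident (Cells A) f) (Ident (Cells A) (Ident (Under A) (ud f))) = Ident (Cells A) f"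
    using two_category.hcomp_ident[OF two_catA, of f "ud f" "uc f" "Ident (Under A) (uc f)" "uc f"]
      two_category.hcomp_ident[OF two_catA, of "Ident (Under A) (ud f)" "ud f" "ud f" f "uc f"] assms a by simp_all
  have l: "hcomp (Map2 F (Ident (Cells A) f, Ident (Cells I) ?j)) (Map2 F (Ident (Cells A) (Ident (Under A) a), \<mu>)) = Map2 F (Ident (Cells A) f, \<mu>)"
    using F_pres(5)[of "Ident (Cells A) (Ident (Under A) a)" "Ident (Cells A) f" \<mu> "Ident (Cells I) ?j"] assms a j u v by simp
  have r: "hcomp (Map2 F (Ident (Cells A) (Ident (Under A) (uc f)), \<mu>)) (Map2 F (Ident (Cells A) f, Ident (Cells I) ?i)) = Map2 F (Ident (Cells A) f, \<mu>)"
    using F_pres(5)[of "Ident (Cells A) f" "Ident (Cells A) (Ident (Under A) (uc f))" "Ident (Cells I) ?i" \<mu>] assms a j u v by simp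
  have "hcomp (idn (Map1 (FR (ic (Dom (Cells I) \<mu>))) f)) (Map2 (FL a) \<mu>) = hcomp (Map2 (FL (uc f)) \<mu>) (idn (Map1 (FR (id' (Dom (Cells I) \<mu>))) f))"
    using l[folded r] assms a j by (simp add: fix_right_def fix_left_def F_pres)
  from arg_cong[OF this, of "\<lambda>n. NCmp n x"] show ?thesis using assms a j by auto
qed

lemma filtFR: "i \<in> Obj (Under I) \<Longrightarrow> filtered_diagram A \<Sigma> (FR i)"
  by (intro filtered_diagram.intro filtered_pair_axioms diagFR)

lemma colimR: "i \<in> Obj (Under I) \<Longrightarrow> sigma_colimit A \<Sigma> (FR i) (L i) (lam i)"
  by (intro sigma_colimit.intro filtFR sigma_colimit_axioms.intro colims)

lemma coneR:
  assumes "i \<in> Obj (Under I)"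
  shows "cone A \<Sigma> (FR i) (L i) (lam i)"
proof -
  interpret sigma_colimit A \<Sigma> "FR i" "L i" "lam i" by (rule colimR[OF assms])
  show ?thesis by (rule l.cone_axioms)
qed

lemmas cone_simps [simp] =
  cone.catE[OF coneR] cone.T0_functor[OF coneR, unfolded Map0_fix] cone.T1_ntrans[OF coneR]
  cone.Tc_ident[OF coneR, unfolded Map0_fix] cone.Tc_comp[OF coneR, unfolded Map0_fix]
  cone.Tc_iso[OF coneR, unfolded Map0_fix]

lemmas colim_eqI = sigma_colimit.functor_colim_eqI[OF colimR, unfolded Map0_fix]

subsection \<open>The 2-functor of pointwise colimits\<close>

abbreviation "ucone u \<equiv> pre_transf A (lam (ic u)) (\<lambda>a. Map1 (FL a) u)"

text \<open>Interchange of the two variables gives the structure cells the right source; the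
  remaining laws are those of the cone at the codomain of \<open>u\<close>, read at objects moved
  along \<open>u\<close>.\<close>

lemma ucone:
  assumes u: "u \<in> Arr (Under I)"
  shows "sigma_cone A \<Sigma> (FR (id' u)) (L (ic u)) (ucone u)"
proof (rule filtered_diagram.sigma_coneI[OF filtFR])
  fix f assume f: "f \<in> Arr (Under A)"
  have "(T0 (lam (ic u)) (uc f) \<cdot>F Map1 (FR (ic u)) f) \<cdot>F Map1 (FL (ud f)) u
    = T0 (lam (ic u)) (uc f) \<cdot>F (Map1 (FR (ic u)) f \<cdot>F Map1 (FL (ud f)) u)" using f u by simp
  also have "\<dots> = (T0 (lam (ic u)) (uc f) \<cdot>F Map1 (FL (uc f)) u) \<cdot>F Map1 (FR (id' u)) f"
    unfolding F_commute[OF f u] using f u by simp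
  finally show "is_ntrans (T1 (ucone u) f) \<and> NSrc (T1 (ucone u) f) = T0 (ucone u) (uc f) \<cdot>F Map1 (FR (id' u)) f \<and>
      NTgt (T1 (ucone u) f) = T0 (ucone u) (ud f)"
    using f u by simp
next
  fix f g x assume "f \<in> Arr (Under A)" "g \<in> Arr (Under A)" "uc f = ud g" "x \<in> Obj (Map0 (FR (id' u)) (ud f))"
  then show "NCmp (T1 (ucone u) (g \<cdot>\<^bsub>Under A\<^esub> f)) x =
       NCmp (T1 (ucone u) f) x \<cdot>\<^bsub>L (ic u)\<^esub> NCmp (T1 (ucone u) g) (FObj (Map1 (FR (id' u)) f) x)"
    using u by (simp add: F_commute_obj)
next
  fix \<gamma> x assume g: "\<gamma> \<in> Arr (Cells A)" "x \<in> Obj (Map0 (FR (id' u)) (ud (Dom (Cells A) \<gamma>)))"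
  then show "NCmp (T1 (ucone u) (Dom (Cells A) \<gamma>)) x =
       NCmp (T1 (ucone u) (Cod (Cells A) \<gamma>)) x \<cdot>\<^bsub>L (ic u)\<^esub>
       FArr (T0 (ucone u) (uc (Dom (Cells A) \<gamma>))) (NCmp (Map2 (FR (id' u)) \<gamma>) x)"
    using u cone.Tc_cell[OF coneR, of "ic u" \<gamma> "FObj (Map1 (FL (ud (Dom (Cells A) \<gamma>))) u) x"]
    by (simp add: F_commute_cell)
qed (use u in \<open>simp_all\<close>, simp_all add: pre_transf_def)

lemma Map0_C [simp]: "Map0 C i = L i" by (simp add: colim_functor_def Let_def)

lemma Map1_C:
  assumes u: "u \<in> Arr (Under I)"
  shows "Map1 C u \<in> Obj (Fun (L (id' u)) (L (ic u)))" "post_transf A (\<lambda>_. Map1 C u) (lam (id' u)) = ucone u"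
  using sigma_colimit.induced_functor_props[OF colimR _ ucone[OF u]] u
  by (simp_all add: colim_functor_def Let_def)

lemma Map1_C_functor [simp]:
  assumes "u \<in> Arr (Under I)"
  shows "is_functor (Map1 C u)" "FSrc (Map1 C u) = L (id' u)" "FTgt (Map1 C u) = L (ic u)"
  using Map1_C(1)[OF assms] by auto

lemma Map1_C_sel [simp]:
  assumes "u \<in> Arr (Under I)" "i = id' u"
  shows "a \<in> Obj (Under A) \<Longrightarrow> x \<in> Obj (Map0 F (a, i)) \<Longrightarrow>
      FObj (Map1 C u) (FObj (T0 (lam i) a) x) = FObj (T0 (lam (ic u)) a) (FObj (Map1 (FL a) u) x)"
    "a \<in> Obj (Under A) \<Longrightarrow> m \<in> Arr (Map0 F (a, i)) \<Longrightarrow>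
      FArr (Map1 C u) (FArr (T0 (lam i) a) m) = FArr (T0 (lam (ic u)) a) (FArr (Map1 (FL a) u) m)"
    "f \<in> Arr (Under A) \<Longrightarrow> z \<in> Obj (Map0 F (ud f, i)) \<Longrightarrow>
      FArr (Map1 C u) (NCmp (T1 (lam i) f) z) = NCmp (T1 (lam (ic u)) f) (FObj (Map1 (FL (ud f)) u) z)"
  using sigma_colimit.post_transf_eqD[OF colimR Map1_C(2)[OF assms(1)], unfolded Map0_fix] assms by simp_all

text \<open>\<open>induced_ntrans\<close> is a definite description, so existence and uniqueness are
  both required. Existence is naturality on generators; uniqueness holds because every object of the
  colimit is the image of an object at some index.\<close>

lemma Map2_C:
  assumes m: "\<mu> \<in> Arr (Cells I)"
  shows "is_ntrans (Map2 C \<mu>)" "NSrc (Map2 C \<mu>) = Map1 C (Dom (Cells I) \<mu>)"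
    "NTgt (Map2 C \<mu>) = Map1 C (Cod (Cells I) \<mu>)"
    "a \<in> Obj (Under A) \<Longrightarrow> x \<in> Obj (Map0 F (a, id' (Dom (Cells I) \<mu>))) \<Longrightarrow>
      NCmp (Map2 C \<mu>) (FObj (T0 (lam (id' (Dom (Cells I) \<mu>))) a) x)
      = FArr (T0 (lam (ic (Dom (Cells I) \<mu>))) a) (NCmp (Map2 (FL a) \<mu>) x)"
proof -
  let ?u = "Dom (Cells I) \<mu>" and ?v = "Cod (Cells I) \<mu>"
  let ?i = "id' ?u" and ?j = "ic ?u"
  interpret c: sigma_colimit A \<Sigma> "FR ?i" "L ?i" "lam ?i" by (rule colimR) (use m in simp)
  let ?t = "\<lambda>a x. FArr (T0 (lam ?j) a) (NCmp (Map2 (FL a) \<mu>) x)"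
  have H: "Map1 C ?u \<in> Obj (Fun (L ?i) (L ?j))" "Map1 C ?v \<in> Obj (Fun (L ?i) (L ?j))" using m by simp_all
  obtain \<alpha> where a: "is_ntrans \<alpha>" "NSrc \<alpha> = Map1 C ?u" "NTgt \<alpha> = Map1 C ?v"
    "\<And>a x. a \<in> Obj (Under A) \<Longrightarrow> x \<in> Obj (Map0 (FR ?i) a) \<Longrightarrow> NCmp \<alpha> (FObj (T0 (lam ?i) a) x) = ?t a x"
  proof (rule c.induced_ntrans_exists[OF H, of ?t])
    fix a g assume g: "a \<in> Obj (Under A)" "g \<in> Arr (Map0 (FR ?i) a)"
    have "FArr (T0 (lam ?j) a) (NCmp (Map2 (FL a) \<mu>) (Cod (Map0 F (a, ?i)) g) \<cdot>\<^bsub>Map0 F (a, ?j)\<^esub> FArr (Map1 (FL a) ?u) g)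
      = FArr (T0 (lam ?j) a) (FArr (Map1 (FL a) ?v) g \<cdot>\<^bsub>Map0 F (a, ?j)\<^esub> NCmp (Map2 (FL a) \<mu>) (Dom (Map0 F (a, ?i)) g))"
      using diagram.Map2_nat[OF diagFL, of a \<mu> ?i ?j g] m g by simp
    then show "?t a (Cod (Map0 (FR ?i) a) g) \<cdot>\<^bsub>L ?j\<^esub> FArr (Map1 C ?u) (FArr (T0 (lam ?i) a) g)
      = FArr (Map1 C ?v) (FArr (T0 (lam ?i) a) g) \<cdot>\<^bsub>L ?j\<^esub> ?t a (Dom (Map0 (FR ?i) a) g)"
      using m g by simp
  next
    fix f x assume f: "f \<in> Arr (Under A)" "x \<in> Obj (Map0 (FR ?i) (ud f))"
    show "?t (ud f) x \<cdot>\<^bsub>L ?j\<^esub> FArr (Map1 C ?u) (NCmp (T1 (lam ?i) f) x)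
      = FArr (Map1 C ?v) (NCmp (T1 (lam ?i) f) x) \<cdot>\<^bsub>L ?j\<^esub> ?t (uc f) (FObj (Map1 (FR ?i) f) x)"
      using m f cone.Tc_nat[OF coneR, of ?j f "NCmp (Map2 (FL (ud f)) \<mu>) x" "ud f" "uc f"]
      by (simp add: F_commute_cell')
  qed (use m in simp_all)
  let ?K = "cone_functor A \<Sigma> (FR ?i) (L ?i) (lam ?i) (L ?j)"
  let ?phi = "\<lparr>MSrc = ucone ?u, MTgt = ucone ?v, MCmp = (\<lambda>a\<in>Obj (Under A). T0 (lam ?j) a \<cdot>L Map2 (FL a) \<mu>)\<rparr>"
  have K: "FArr ?K \<beta> = post_cell A (\<lambda>_. NSrc \<beta>) (\<lambda>_. NTgt \<beta>) (\<lambda>_. \<beta>) (lam ?i)" if "\<beta> \<in> Arr (Fun (L ?i) (L ?j))" for \<beta>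
    using that by (simp add: cone_functor_def del: in_Fun_arr)
  have aA: "\<alpha> \<in> Arr (Fun (L ?i) (L ?j))" using a m by simp
  have e: "Map2 C \<mu> = induced_ntrans A \<Sigma> (FR ?i) (L ?i) (lam ?i) (L ?j) ?phi"
    using m by (simp add: colim_functor_def Let_def cell_src_def cell_tgt_def)
  also have "\<dots> = \<alpha>"
    unfolding induced_ntrans_def
  proof (rule the_equality)
    have "\<alpha> \<cdot>R T0 (lam ?i) a = T0 (lam ?j) a \<cdot>L Map2 (FL a) \<mu>" if "a \<in> Obj (Under A)" for a
    proof (rule ntrans_eqI)
      have "T0 (post_transf A (\<lambda>_. Map1 C w) (lam (id' w))) a = T0 (ucone w) a" if "w \<in> Arr (Under I)" for w
        using Map1_C(2)[OF that] by simp
      then have *: "Map1 C w \<cdot>F T0 (lam (id' w)) a = T0 (lam (ic w)) a \<cdot>F Map1 (FL a) w" if "w \<in> Arr (Under I)" for w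
        using that \<open>a \<in> Obj (Under A)\<close> by simp
      show "NSrc (\<alpha> \<cdot>R T0 (lam ?i) a) = NSrc (T0 (lam ?j) a \<cdot>L Map2 (FL a) \<mu>)"
        "NTgt (\<alpha> \<cdot>R T0 (lam ?i) a) = NTgt (T0 (lam ?j) a \<cdot>L Map2 (FL a) \<mu>)"
        using *[of ?u] *[of ?v] a m that by simp_all
    qed (use a m that in simp_all)
    then have "post_cell A (\<lambda>_. NSrc \<alpha>) (\<lambda>_. NTgt \<alpha>) (\<lambda>_. \<alpha>) (lam ?i) = ?phi"
      using Map1_C(2)[of ?u] Map1_C(2)[of ?v] m unfolding post_cell_def a(2,3)
      by (auto intro!: modif.equality)
    then show "\<alpha> \<in> Arr (Fun (L ?i) (L ?j)) \<and> FArr ?K \<alpha> = ?phi" using aA K by simp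
    fix \<beta> assume b: "\<beta> \<in> Arr (Fun (L ?i) (L ?j)) \<and> FArr ?K \<beta> = ?phi"
    then have bp: "post_cell A (\<lambda>_. NSrc \<beta>) (\<lambda>_. NTgt \<beta>) (\<lambda>_. \<beta>) (lam ?i) = ?phi"
      and b1: "is_ntrans \<beta>" "FSrc (NSrc \<beta>) = L ?i" "FTgt (NSrc \<beta>) = L ?j" using K[of \<beta>] by simp_all
    have bs: "post_transf A (\<lambda>_. NSrc \<beta>) (lam ?i) = ucone ?u" "post_transf A (\<lambda>_. NTgt \<beta>) (lam ?i) = ucone ?v"
      using arg_cong[OF bp, of MSrc] arg_cong[OF bp, of MTgt] by simp_all
    have bc: "\<beta> \<cdot>R T0 (lam ?i) a = T0 (lam ?j) a \<cdot>L Map2 (FL a) \<mu>" if "a \<in> Obj (Under A)" for a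
      using fun_cong[OF arg_cong[OF bp, of MCmp], of a] that by simp
    have du: "?u \<in> Arr (Under I)" and dv: "?v \<in> Arr (Under I)" using m by simp_all
    \<comment> \<open>A competitor \<open>\<beta>\<close> is not given with source and target; these
      are recovered from the cones that they induce.\<close>
    have s: "NSrc \<beta> = Map1 C ?u" "NTgt \<beta> = Map1 C ?v"
      using c.post_transf_eqD[OF bs(1)] c.post_transf_eqD[OF bs(2)]
        c.post_transf_eqD[OF Map1_C(2)[OF du]] c.post_transf_eqD[OF Map1_C(2)[OF dv, unfolded two_cat_cell(3,4)[OF twoI m]]] m b1 H
      by (auto intro!: c.functor_colim_eqI[where E="L ?j"])
    show "\<beta> = \<alpha>"
    proof (rule ntrans_eqI)
      fix p assume "p \<in> Obj (FSrc (NSrc \<alpha>))"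
      then have "p \<in> Obj (L ?i)" using a m by simp
      then obtain d x where d: "d \<in> Obj (Under A)" "x \<in> Obj (Map0 (FR ?i) d)" "p = FObj (T0 (lam ?i) d) x"
        by (rule c.colim_obj)
      have "NCmp (\<beta> \<cdot>R T0 (lam ?i) d) x = NCmp (T0 (lam ?j) d \<cdot>L Map2 (FL d) \<mu>) x" using bc[OF d(1)] by simp
      then show "NCmp \<beta> p = NCmp \<alpha> p" using d m a(4)[of d x] by simp
    qed (use s a b1 in simp_all)
  qed
  finally have e: "Map2 C \<mu> = \<alpha>" .
  show "is_ntrans (Map2 C \<mu>)" "NSrc (Map2 C \<mu>) = Map1 C (Dom (Cells I) \<mu>)"
    "NTgt (Map2 C \<mu>) = Map1 C (Cod (Cells I) \<mu>)"
    "a \<in> Obj (Under A) \<Longrightarrow> x \<in> Obj (Map0 F (a, id' (Dom (Cells I) \<mu>))) \<Longrightarrow>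
      NCmp (Map2 C \<mu>) (FObj (T0 (lam (id' (Dom (Cells I) \<mu>))) a) x)
      = FArr (T0 (lam (ic (Dom (Cells I) \<mu>))) a) (NCmp (Map2 (FL a) \<mu>) x)"
    unfolding e using a by simp_all
qed

lemma Map2_C_simps [simp]:
  assumes "\<mu> \<in> Arr (Cells I)"
  shows "is_ntrans (Map2 C \<mu>)" "NSrc (Map2 C \<mu>) = Map1 C (Dom (Cells I) \<mu>)"
    "NTgt (Map2 C \<mu>) = Map1 C (Cod (Cells I) \<mu>)"
    "id' (Dom (Cells I) \<mu>) = i \<Longrightarrow> a \<in> Obj (Under A) \<Longrightarrow> x \<in> Obj (Map0 F (a, i)) \<Longrightarrow>
      NCmp (Map2 C \<mu>) (FObj (T0 (lam i) a) x) = FArr (T0 (lam (ic (Dom (Cells I) \<mu>))) a) (NCmp (Map2 (FL a) \<mu>) x)"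
  using Map2_C[OF assms] by auto

lemma C_ntrans_eqI:
  assumes "is_ntrans m" "is_ntrans n" "NSrc m = NSrc n" "NTgt m = NTgt n" "FSrc (NSrc n) = L i" "i \<in> Obj (Under I)"
    and "\<And>a x. a \<in> Obj (Under A) \<Longrightarrow> x \<in> Obj (Map0 F (a, i)) \<Longrightarrow>
      NCmp m (FObj (T0 (lam i) a) x) = NCmp n (FObj (T0 (lam i) a) x)"
  shows "m = n"
proof (rule ntrans_eqI[OF assms(1-4)])
  interpret c: sigma_colimit A \<Sigma> "FR i" "L i" "lam i" by (rule colimR[OF assms(6)])
  fix p assume "p \<in> Obj (FSrc (NSrc n))"
  then have "p \<in> Obj (L i)" using assms by simp
  then show "NCmp m p = NCmp n p" by (rule c.colim_obj) (use assms(7) in auto)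
qed

lemma Map1_C_comp:
  assumes u: "u \<in> Arr (Under I)" "v \<in> Arr (Under I)" "ic u = id' v"
  shows "Map1 C (v \<cdot>\<^bsub>Under I\<^esub> u) = Map1 C v \<cdot>F Map1 C u"
proof -
  have vu: "v \<cdot>\<^bsub>Under I\<^esub> u \<in> Arr (Under I)" using u by simp
  show ?thesis
    by (rule colim_eqI[of "id' u", where E="L (ic v)"])
      (use u vu Map1_C_sel[OF vu, of "id' u"] in simp_all)
qed

text \<open>Each law is an equality of functors or natural transformations out of some
  \<open>L i\<close>, so it may be tested on the universal cone, where it becomes the corresponding
  law of \<open>F(a, -)\<close>.\<close>

lemma diagC: "diagram I C"
proof (intro diagram.intro)
  show "two_functor I Cat C"
    unfolding two_functor_def Cat_sel in_hom_iff mem_Collect_eq cell_tgt_def cell_src_def Map0_C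
  proof (intro conjI ballI impI)
    fix i assume i: "i \<in> Obj (Under I)"
    show "Map1 C (Ident (Under I) i) = idf (L i)"
      by (rule colim_eqI[OF i, where E="L i"]) (use i Map1_C_sel[of "Ident (Under I) i" i] in simp_all)
  next
    fix u v assume u: "u \<in> Arr (Under I)" "v \<in> Arr (Under I)" "ic u = id' v"
    then show "Map1 C (v \<cdot>\<^bsub>Under I\<^esub> u) = Map1 C v \<cdot>F Map1 C u" by (rule Map1_C_comp)
  next
    fix u assume u: "u \<in> Arr (Under I)"
    show "Map2 C (Ident (Cells I) u) = idn (Map1 C u)"
      by (rule C_ntrans_eqI[of _ _ "id' u"]) (use u in simp_all)
  next
    fix \<mu> \<nu> assume m: "\<mu> \<in> Arr (Cells I)" "\<nu> \<in> Arr (Cells I)" "Cod (Cells I) \<mu> = Dom (Cells I) \<nu>"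
    have i: "id' (Dom (Cells I) \<nu>) = id' (Dom (Cells I) \<mu>)" "ic (Dom (Cells I) \<nu>) = ic (Dom (Cells I) \<mu>)"
      using m two_cat_cell(3,4)[OF twoI m(1)] by simp_all
    show "Map2 C (\<nu> \<cdot>\<^bsub>Cells I\<^esub> \<mu>) = Map2 C \<nu> \<cdot>N Map2 C \<mu>"
      by (rule C_ntrans_eqI[of _ _ "id' (Dom (Cells I) \<mu>)"]) (use m i in simp_all)
  next
    fix \<mu> \<nu> assume m: "\<mu> \<in> Arr (Cells I)" "\<nu> \<in> Arr (Cells I)" "ic (Dom (Cells I) \<mu>) = id' (Dom (Cells I) \<nu>)"
    show "Map2 C (HComp I \<nu> \<mu>) = hcomp (Map2 C \<nu>) (Map2 C \<mu>)"
      by (rule C_ntrans_eqI[of _ _ "id' (Dom (Cells I) \<mu>)"])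
        (use m in \<open>simp_all add: Map1_C_comp\<close>)
  qed simp_all
qed simp

section \<open>The bilimits at each index and their functoriality\<close>

lemma wdL: "a \<in> Obj (Under A) \<Longrightarrow> weighted_diagram I W (FL a)"
  by (intro weighted_diagram.intro diagram.intro twoI functorW diagram.functorG[OF diagFL])

lemma wdC: "weighted_diagram I W C"
  by (intro weighted_diagram.intro diagram.intro twoI functorW diagram.functorG[OF diagC])

lemma NF:
  assumes f: "f \<in> Arr (Under A)" "ud f = a" "uc f = b"
  shows "natural_family I W (FL a) (FL b) (\<lambda>i. Map1 (FR i) f)"
  by (intro natural_family.intro wdL natural_family_axioms.intro)
    (use f F_commute[OF f(1)] F_commute_cell'[OF f(1)] in auto)

text \<open>\<open>Map1 C u\<close> is induced by \<open>ucone u\<close>, and the defining equation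
  of the induced functor, read at \<open>a\<close>, is the naturality square of the legs at
  \<open>a\<close>.\<close>

lemma NL:
  assumes a: "a \<in> Obj (Under A)"
  shows "natural_family I W (FL a) C (\<lambda>i. T0 (lam i) a)"
proof (intro natural_family.intro wdL wdC natural_family_axioms.intro a)
  fix u assume u: "u \<in> Arr (Under I)"
  have "T0 (post_transf A (\<lambda>_. Map1 C u) (lam (id' u))) a = T0 (ucone u) a" using Map1_C(2)[OF u] by simp
  then show "T0 (lam (ic u)) a \<cdot>F Map1 (FL a) u = Map1 C u \<cdot>F T0 (lam (id' u)) a" using a by simp
qed (use a in simp_all)

lemma NFc:
  assumes "\<alpha> \<in> Arr (Cells A)" "Dom (Cells A) \<alpha> = f" "Cod (Cells A) \<alpha> = g" "ud f = a" "uc f = b"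
  shows "natural_family_cell I W (FL a) (FL b) (\<lambda>i. Map1 (FR i) f) (\<lambda>i. Map1 (FR i) g) (\<lambda>i. Map2 (FR i) \<alpha>)"
  by (intro natural_family_cell.intro NF natural_family_cell_axioms.intro)
    (use assms two_cat_cell[OF two_catA assms(1)] F_commute_cell[OF assms(1)] in auto)

lemma NLc:
  assumes f: "f \<in> Arr (Under A)" "ud f = a" "uc f = b"
  shows "natural_family_cell I W (FL a) C (\<lambda>i. T0 (lam i) b \<cdot>F Map1 (FR i) f) (\<lambda>i. T0 (lam i) a) (\<lambda>i. T1 (lam i) f)"
  by (intro natural_family_cell.intro natural_family_comp[OF NF NL] NL natural_family_cell_axioms.intro)
    (use f in auto)

lemma B_sel: "Map0 B a = bilim I W (FL a)"
  "Map1 B f = bilim_map I W (FL (ud f)) (FL (uc f)) (\<lambda>i. Map1 (FR i) f)"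
  "Map2 B \<alpha> = bilim_cell I W (FL (ud (Dom (Cells A) \<alpha>))) (FL (uc (Dom (Cells A) \<alpha>)))
     (\<lambda>i. Map1 (FR i) (Dom (Cells A) \<alpha>)) (\<lambda>i. Map1 (FR i) (Cod (Cells A) \<alpha>)) (\<lambda>i. Map2 (FR i) \<alpha>)"
  by (simp_all add: bilim_functor_def cell_src_def cell_tgt_def)

lemma W_simps [simp]:
  "i \<in> Obj (Under I) \<Longrightarrow> category (Map0 W i)"
  "u \<in> Arr (Under I) \<Longrightarrow> is_functor (Map1 W u)"
  "u \<in> Arr (Under I) \<Longrightarrow> FSrc (Map1 W u) = Map0 W (id' u)"
  "u \<in> Arr (Under I) \<Longrightarrow> FTgt (Map1 W u) = Map0 W (ic u)"
  using diagram.Map0_cat[OF diagram.intro[OF twoI functorW]] diagram.Map1_functor[OF diagram.intro[OF twoI functorW]] by auto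

text \<open>Post-composition acts on components, so each law reduces to one of
  \<open>F(-, i)\<close>. Equality of modifications includes equality of their sources and targets,
  which is why post-composed transformations are compared first.\<close>

lemma diagB: "diagram A B"
proof (intro diagram.intro)
  show "two_functor A Cat B"
    unfolding two_functor_def Cat_sel in_hom_iff mem_Collect_eq cell_tgt_def cell_src_def
  proof (intro conjI ballI impI)
    fix a assume "a \<in> Obj (Under A)"
    then show "category (Map0 B a)" unfolding B_sel by (intro weighted_diagram.bilim_cat wdL)
  next
    fix f assume f: "f \<in> Arr (Under A)"
    interpret N: natural_family I W "FL (ud f)" "FL (uc f)" "\<lambda>i. Map1 (FR i) f" by (rule NF[OF f refl refl])
    show "is_functor (Map1 B f)" "FSrc (Map1 B f) = Map0 B (ud f)" "FTgt (Map1 B f) = Map0 B (uc f)"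
      unfolding B_sel by simp_all
  next
    fix \<alpha> assume a: "\<alpha> \<in> Arr (Cells A)"
    interpret N: natural_family_cell I W "FL (ud (Dom (Cells A) \<alpha>))" "FL (uc (Dom (Cells A) \<alpha>))"
      "\<lambda>i. Map1 (FR i) (Dom (Cells A) \<alpha>)" "\<lambda>i. Map1 (FR i) (Cod (Cells A) \<alpha>)" "\<lambda>i. Map2 (FR i) \<alpha>"
      by (rule NFc[OF a refl refl refl refl])
    show "is_ntrans (Map2 B \<alpha>)" "NSrc (Map2 B \<alpha>) = Map1 B (Dom (Cells A) \<alpha>)"
      "NTgt (Map2 B \<alpha>) = Map1 B (Cod (Cells A) \<alpha>)"
      unfolding B_sel using a by simp_all
  next
    fix a assume a: "a \<in> Obj (Under A)"
    interpret N: natural_family I W "FL a" "FL a" "\<lambda>i. Map1 (FR i) (Ident (Under A) a)"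
      by (rule NF) (use a in simp_all)
    show "Map1 B (Ident (Under A) a) = idf (Map0 B a)"
    proof (rule functor_eqI)
      fix \<theta> assume "\<theta> \<in> Obj (FSrc (idf (Map0 B a)))"
      then have p: "N.WG.pn \<theta>" by (simp add: B_sel)
      have "post_transf I (\<lambda>i. Map1 (FR i) (Ident (Under A) a)) \<theta> = \<theta>"
        by (rule N.WG.pn_eqI) (use p a in simp_all)
      then show "FObj (Map1 B (Ident (Under A) a)) \<theta> = FObj (idf (Map0 B a)) \<theta>"
        using p a by (simp add: B_sel)
    next
      fix \<rho> assume "\<rho> \<in> Arr (FSrc (idf (Map0 B a)))"
      then have p: "N.WG.modification \<rho>" by (simp add: B_sel)
      have e: "post_transf I (\<lambda>i. Map1 (FR i) (Ident (Under A) a)) \<theta> = \<theta>" if "N.WG.pn \<theta>" for \<theta>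
        by (rule N.WG.pn_eqI) (use that a in simp_all)
      have "post_modif I (\<lambda>i. Map1 (FR i) (Ident (Under A) a)) \<rho> = \<rho>"
        by (rule N.WG.modification_eqI) (use p a in \<open>simp_all add: e\<close>)
      then show "FArr (Map1 B (Ident (Under A) a)) \<rho> = FArr (idf (Map0 B a)) \<rho>"
        using p a by (simp add: B_sel)
    qed (use a in \<open>simp_all add: B_sel\<close>)
  next
    fix f g assume f: "f \<in> Arr (Under A)" "g \<in> Arr (Under A)" "uc f = ud g"
    interpret Nf: natural_family I W "FL (ud f)" "FL (ud g)" "\<lambda>i. Map1 (FR i) f" by (rule NF) (use f in simp_all)
    interpret Ng: natural_family I W "FL (ud g)" "FL (uc g)" "\<lambda>i. Map1 (FR i) g" by (rule NF) (use f in simp_all)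
    interpret Ngf: natural_family I W "FL (ud f)" "FL (uc g)" "\<lambda>i. Map1 (FR i) (g \<cdot>\<^bsub>Under A\<^esub> f)"
      by (rule NF) (use f in simp_all)
    have e: "post_transf I (\<lambda>i. Map1 (FR i) (g \<cdot>\<^bsub>Under A\<^esub> f)) \<theta>
      = post_transf I (\<lambda>i. Map1 (FR i) g) (post_transf I (\<lambda>i. Map1 (FR i) f) \<theta>)" if "Nf.WG.pn \<theta>" for \<theta>
      by (rule Ng.WH.pn_eqI) (use that f in simp_all)
    show "Map1 B (g \<cdot>\<^bsub>Under A\<^esub> f) = Map1 B g \<cdot>F Map1 B f"
    proof (rule functor_eqI)
      fix \<theta> assume "\<theta> \<in> Obj (FSrc (Map1 B g \<cdot>F Map1 B f))"
      then have p: "Nf.WG.pn \<theta>" using f by (simp add: B_sel)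
      then show "FObj (Map1 B (g \<cdot>\<^bsub>Under A\<^esub> f)) \<theta> = FObj (Map1 B g \<cdot>F Map1 B f) \<theta>"
        using f by (simp add: B_sel e)
    next
      fix \<rho> assume "\<rho> \<in> Arr (FSrc (Map1 B g \<cdot>F Map1 B f))"
      then have p: "Nf.WG.modification \<rho>" using f by (simp add: B_sel)
      have "post_modif I (\<lambda>i. Map1 (FR i) (g \<cdot>\<^bsub>Under A\<^esub> f)) \<rho>
        = post_modif I (\<lambda>i. Map1 (FR i) g) (post_modif I (\<lambda>i. Map1 (FR i) f) \<rho>)"
        by (rule Ng.WH.modification_eqI) (use p f in \<open>simp_all add: e\<close>)
      then show "FArr (Map1 B (g \<cdot>\<^bsub>Under A\<^esub> f)) \<rho> = FArr (Map1 B g \<cdot>F Map1 B f) \<rho>"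
        using p f by (simp add: B_sel)
    qed (use f in \<open>simp_all add: B_sel\<close>)
  next
    fix f assume f: "f \<in> Arr (Under A)"
    interpret N: natural_family_cell I W "FL (ud f)" "FL (uc f)"
      "\<lambda>i. Map1 (FR i) f" "\<lambda>i. Map1 (FR i) f" "\<lambda>i. Map2 (FR i) (Ident (Cells A) f)"
      by (rule NFc) (use f in simp_all)
    show "Map2 B (Ident (Cells A) f) = idn (Map1 B f)"
    proof (rule ntrans_eqI)
      fix \<theta> assume "\<theta> \<in> Obj (FSrc (NSrc (idn (Map1 B f))))"
      then have p: "N.S.WG.pn \<theta>" by (simp add: B_sel)
      have "post_cell I (\<lambda>i. Map1 (FR i) f) (\<lambda>i. Map1 (FR i) f) (\<lambda>i. Map2 (FR i) (Ident (Cells A) f)) \<theta>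
        = Ident (bilim I W (FL (uc f))) (post_transf I (\<lambda>i. Map1 (FR i) f) \<theta>)"
        by (rule N.S.WH.modification_eqI[OF _ N.S.WH.modification_ident]) (use p f in simp_all)
      then show "NCmp (Map2 B (Ident (Cells A) f)) \<theta> = NCmp (idn (Map1 B f)) \<theta>"
        using p f by (simp add: B_sel)
    qed (use f in \<open>simp_all add: B_sel\<close>)
  next
    fix \<alpha> \<beta> assume c: "\<alpha> \<in> Arr (Cells A)" "\<beta> \<in> Arr (Cells A)" "Cod (Cells A) \<alpha> = Dom (Cells A) \<beta>"
    let ?f = "Dom (Cells A) \<alpha>" and ?g = "Dom (Cells A) \<beta>" and ?h = "Cod (Cells A) \<beta>"
    have s: "ud ?g = ud ?f" "uc ?g = uc ?f" using two_cat_cell(3,4)[OF two_catA c(1)] c by simp_all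
    interpret Na: natural_family_cell I W "FL (ud ?f)" "FL (uc ?f)"
      "\<lambda>i. Map1 (FR i) ?f" "\<lambda>i. Map1 (FR i) ?g" "\<lambda>i. Map2 (FR i) \<alpha>"
      by (rule NFc) (use c in simp_all)
    interpret Nb: natural_family_cell I W "FL (ud ?f)" "FL (uc ?f)"
      "\<lambda>i. Map1 (FR i) ?g" "\<lambda>i. Map1 (FR i) ?h" "\<lambda>i. Map2 (FR i) \<beta>"
      by (rule NFc) (use c s in simp_all)
    interpret Nc: natural_family_cell I W "FL (ud ?f)" "FL (uc ?f)"
      "\<lambda>i. Map1 (FR i) ?f" "\<lambda>i. Map1 (FR i) ?h" "\<lambda>i. Map2 (FR i) (\<beta> \<cdot>\<^bsub>Cells A\<^esub> \<alpha>)"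
      by (rule NFc) (use c s in simp_all)
    show "Map2 B (\<beta> \<cdot>\<^bsub>Cells A\<^esub> \<alpha>) = Map2 B \<beta> \<cdot>N Map2 B \<alpha>"
    proof (rule ntrans_eqI)
      fix \<theta> assume "\<theta> \<in> Obj (FSrc (NSrc (Map2 B \<beta> \<cdot>N Map2 B \<alpha>)))"
      then have p: "Na.S.WG.pn \<theta>" using c s by (simp add: B_sel)
      have "post_cell I (\<lambda>i. Map1 (FR i) ?f) (\<lambda>i. Map1 (FR i) ?h) (\<lambda>i. Map2 (FR i) (\<beta> \<cdot>\<^bsub>Cells A\<^esub> \<alpha>)) \<theta>
        = post_cell I (\<lambda>i. Map1 (FR i) ?g) (\<lambda>i. Map1 (FR i) ?h) (\<lambda>i. Map2 (FR i) \<beta>) \<theta> \<cdot>\<^bsub>bilim I W (FL (uc ?f))\<^esub>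
          post_cell I (\<lambda>i. Map1 (FR i) ?f) (\<lambda>i. Map1 (FR i) ?g) (\<lambda>i. Map2 (FR i) \<alpha>) \<theta>"
        by (rule Na.S.WH.modification_eqI[OF _ Na.S.WH.modification_comp]) (use p c s in simp_all)
      then show "NCmp (Map2 B (\<beta> \<cdot>\<^bsub>Cells A\<^esub> \<alpha>)) \<theta> = NCmp (Map2 B \<beta> \<cdot>N Map2 B \<alpha>) \<theta>"
        using p c s by (simp add: B_sel del: Na.S.WH.bilim_sel(5))
    qed (use c s in \<open>simp_all add: B_sel\<close>)
  next
    fix \<alpha> \<beta> assume c: "\<alpha> \<in> Arr (Cells A)" "\<beta> \<in> Arr (Cells A)" "uc (Dom (Cells A) \<alpha>) = ud (Dom (Cells A) \<beta>)"
    let ?f = "Dom (Cells A) \<alpha>" and ?f' = "Cod (Cells A) \<alpha>" and ?g = "Dom (Cells A) \<beta>" and ?g' = "Cod (Cells A) \<beta>"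
    have s: "ud ?f' = ud ?f" "uc ?f' = ud ?g" "ud ?g' = ud ?g" "uc ?g' = uc ?g"
      using two_cat_cell(3,4)[OF two_catA c(1)] two_cat_cell(3,4)[OF two_catA c(2)] c(3) by simp_all
    interpret Na: natural_family_cell I W "FL (ud ?f)" "FL (ud ?g)"
      "\<lambda>i. Map1 (FR i) ?f" "\<lambda>i. Map1 (FR i) ?f'" "\<lambda>i. Map2 (FR i) \<alpha>"
      by (rule NFc) (use c in simp_all)
    interpret Nb: natural_family_cell I W "FL (ud ?g)" "FL (uc ?g)"
      "\<lambda>i. Map1 (FR i) ?g" "\<lambda>i. Map1 (FR i) ?g'" "\<lambda>i. Map2 (FR i) \<beta>"
      by (rule NFc) (use c s in simp_all)
    interpret Nc: natural_family_cell I W "FL (ud ?f)" "FL (uc ?g)"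
      "\<lambda>i. Map1 (FR i) (?g \<cdot>\<^bsub>Under A\<^esub> ?f)" "\<lambda>i. Map1 (FR i) (?g' \<cdot>\<^bsub>Under A\<^esub> ?f')" "\<lambda>i. Map2 (FR i) (HComp A \<beta> \<alpha>)"
      by (rule NFc) (use c s in simp_all)
    have e: "post_transf I (\<lambda>i. Map1 (FR i) (?g \<cdot>\<^bsub>Under A\<^esub> ?f)) \<theta>
      = post_transf I (\<lambda>i. Map1 (FR i) ?g) (post_transf I (\<lambda>i. Map1 (FR i) ?f) \<theta>)"
      "post_transf I (\<lambda>i. Map1 (FR i) (?g' \<cdot>\<^bsub>Under A\<^esub> ?f')) \<theta>
      = post_transf I (\<lambda>i. Map1 (FR i) ?g') (post_transf I (\<lambda>i. Map1 (FR i) ?f') \<theta>)" if "Na.S.WG.pn \<theta>" for \<theta>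
      by (rule Nb.S.WH.pn_eqI, use that c s in simp_all)+
    have m: "post_modif I (\<lambda>i. Map1 (FR i) (?g \<cdot>\<^bsub>Under A\<^esub> ?f)) \<rho>
      = post_modif I (\<lambda>i. Map1 (FR i) ?g) (post_modif I (\<lambda>i. Map1 (FR i) ?f) \<rho>)"
      "post_modif I (\<lambda>i. Map1 (FR i) (?g' \<cdot>\<^bsub>Under A\<^esub> ?f')) \<rho>
      = post_modif I (\<lambda>i. Map1 (FR i) ?g') (post_modif I (\<lambda>i. Map1 (FR i) ?f') \<rho>)" if "Na.S.WG.modification \<rho>" for \<rho>
      by (rule Nb.S.WH.modification_eqI, use that c s in \<open>simp_all add: e\<close>)+
    show "Map2 B (HComp A \<beta> \<alpha>) = hcomp (Map2 B \<beta>) (Map2 B \<alpha>)"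
    proof (rule ntrans_eqI)
      show "NSrc (Map2 B (HComp A \<beta> \<alpha>)) = NSrc (hcomp (Map2 B \<beta>) (Map2 B \<alpha>))"
        by (rule functor_eqI) (use c s in \<open>simp_all add: B_sel e m\<close>)
      show "NTgt (Map2 B (HComp A \<beta> \<alpha>)) = NTgt (hcomp (Map2 B \<beta>) (Map2 B \<alpha>))"
        by (rule functor_eqI) (use c s in \<open>simp_all add: B_sel e m\<close>)
      fix \<theta> assume "\<theta> \<in> Obj (FSrc (NSrc (hcomp (Map2 B \<beta>) (Map2 B \<alpha>))))"
      then have p: "Na.S.WG.pn \<theta>" using c by (simp add: B_sel)
      have "post_cell I (\<lambda>i. Map1 (FR i) (?g \<cdot>\<^bsub>Under A\<^esub> ?f)) (\<lambda>i. Map1 (FR i) (?g' \<cdot>\<^bsub>Under A\<^esub> ?f')) (\<lambda>i. Map2 (FR i) (HComp A \<beta> \<alpha>)) \<theta>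
        = post_cell I (\<lambda>i. Map1 (FR i) ?g) (\<lambda>i. Map1 (FR i) ?g') (\<lambda>i. Map2 (FR i) \<beta>) (post_transf I (\<lambda>i. Map1 (FR i) ?f') \<theta>)
          \<cdot>\<^bsub>bilim I W (FL (uc ?g))\<^esub>
          post_modif I (\<lambda>i. Map1 (FR i) ?g) (post_cell I (\<lambda>i. Map1 (FR i) ?f) (\<lambda>i. Map1 (FR i) ?f') (\<lambda>i. Map2 (FR i) \<alpha>) \<theta>)"
        by (rule Nb.S.WH.modification_eqI[OF _ Nb.S.WH.modification_comp]) (use p c s in \<open>simp_all add: e\<close>)
      then show "NCmp (Map2 B (HComp A \<beta> \<alpha>)) \<theta> = NCmp (hcomp (Map2 B \<beta>) (Map2 B \<alpha>)) \<theta>"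
        using p c s by (simp add: B_sel del: Nb.S.WH.bilim_sel(5))
    qed (use c s in \<open>simp_all add: B_sel\<close>)
  qed
qed simp

lemma filtB: "filtered_diagram A \<Sigma> B"
  by (intro filtered_diagram.intro filtered_pair_axioms diagB)

abbreviation "cone0 \<equiv> comparison_cone A \<Sigma> I W F L lam"

lemma cone0_sel [simp]:
  "a \<in> Obj (Under A) \<Longrightarrow> T0 cone0 a = bilim_map I W (FL a) C (\<lambda>i. T0 (lam i) a)"
  "f \<in> Arr (Under A) \<Longrightarrow> T1 cone0 f = bilim_cell I W (FL (ud f)) C
     (\<lambda>i. T0 (lam i) (uc f) \<cdot>F Map1 (FR i) f) (\<lambda>i. T0 (lam i) (ud f)) (\<lambda>i. T1 (lam i) f)"
  by (auto simp: comparison_cone_def)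

text \<open>Each axiom is the axiom of the cones \<open>lam i\<close>, read at the objects
  \<open>FObj (T0 \<theta> i) x\<close>. Invertibility for arrows of \<open>\<Sigma>\<close> passes
  from the components to the modification by \<open>bilim_iso\<close>.\<close>

lemma comparison_cone: "sigma_cone A \<Sigma> B (bilim I W C) cone0"
proof (rule filtered_diagram.sigma_coneI[OF filtB])
  show "category (bilim I W C)" by (rule weighted_diagram.bilim_cat[OF wdC])
  show "T0 cone0 \<in> extensional (Obj (Under A))" "T1 cone0 \<in> extensional (Arr (Under A))"
    by (simp_all add: comparison_cone_def)
next
  fix a assume a: "a \<in> Obj (Under A)"
  interpret N: natural_family I W "FL a" C "\<lambda>i. T0 (lam i) a" by (rule NL[OF a])
  show "is_functor (T0 cone0 a) \<and> FSrc (T0 cone0 a) = Map0 B a \<and> FTgt (T0 cone0 a) = bilim I W C"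
    using a by (simp add: B_sel)
  fix \<theta> assume "\<theta> \<in> Obj (Map0 B a)"
  then have p: "N.WG.pn \<theta>" by (simp add: B_sel)
  interpret M: natural_family_cell I W "FL a" C "\<lambda>i. T0 (lam i) a \<cdot>F Map1 (FR i) (Ident (Under A) a)" "\<lambda>i. T0 (lam i) a"
    "\<lambda>i. T1 (lam i) (Ident (Under A) a)" by (rule NLc) (use a in simp_all)
  have e: "post_transf I (\<lambda>i. T0 (lam i) a \<cdot>F Map1 (FR i) (Ident (Under A) a)) \<theta> = post_transf I (\<lambda>i. T0 (lam i) a) \<theta>"
    by (rule N.WH.pn_eqI) (use p a in simp_all)
  have "post_cell I (\<lambda>i. T0 (lam i) a \<cdot>F Map1 (FR i) (Ident (Under A) a)) (\<lambda>i. T0 (lam i) a)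
      (\<lambda>i. T1 (lam i) (Ident (Under A) a)) \<theta> = Ident (bilim I W C) (post_transf I (\<lambda>i. T0 (lam i) a) \<theta>)"
    by (rule N.WH.modification_eqI[OF _ N.WH.modification_ident]) (use p a e in simp_all)
  then show "NCmp (T1 cone0 (Ident (Under A) a)) \<theta> = Ident (bilim I W C) (FObj (T0 cone0 a) \<theta>)"
    using p a by simp
next
  fix f assume f: "f \<in> Arr (Under A)"
  interpret Nf: natural_family I W "FL (ud f)" "FL (uc f)" "\<lambda>i. Map1 (FR i) f" by (rule NF) (use f in simp_all)
  interpret N: natural_family I W "FL (uc f)" C "\<lambda>i. T0 (lam i) (uc f)" by (rule NL) (use f in simp)
  interpret M: natural_family_cell I W "FL (ud f)" C "\<lambda>i. T0 (lam i) (uc f) \<cdot>F Map1 (FR i) f" "\<lambda>i. T0 (lam i) (ud f)"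
    "\<lambda>i. T1 (lam i) f" by (rule NLc) (use f in simp_all)
  have e: "post_transf I (\<lambda>i. T0 (lam i) (uc f) \<cdot>F Map1 (FR i) f) \<theta>
    = post_transf I (\<lambda>i. T0 (lam i) (uc f)) (post_transf I (\<lambda>i. Map1 (FR i) f) \<theta>)" if "Nf.WG.pn \<theta>" for \<theta>
    by (rule N.WH.pn_eqI) (use that f in simp_all)
  have m: "post_modif I (\<lambda>i. T0 (lam i) (uc f) \<cdot>F Map1 (FR i) f) \<rho>
    = post_modif I (\<lambda>i. T0 (lam i) (uc f)) (post_modif I (\<lambda>i. Map1 (FR i) f) \<rho>)" if "Nf.WG.modification \<rho>" for \<rho>
    by (rule N.WH.modification_eqI) (use that f in \<open>simp_all add: e\<close>)
  have "bilim_map I W (FL (ud f)) C (\<lambda>i. T0 (lam i) (uc f) \<cdot>F Map1 (FR i) f)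
    = bilim_map I W (FL (uc f)) C (\<lambda>i. T0 (lam i) (uc f)) \<cdot>F Map1 B f"
    by (rule functor_eqI) (use f in \<open>simp_all add: B_sel e m\<close>)
  then show "is_ntrans (T1 cone0 f) \<and> NSrc (T1 cone0 f) = T0 cone0 (uc f) \<cdot>F Map1 B f \<and> NTgt (T1 cone0 f) = T0 cone0 (ud f)"
    using f by simp
next
  fix f g \<theta> assume f: "f \<in> Arr (Under A)" "g \<in> Arr (Under A)" "uc f = ud g" and "\<theta> \<in> Obj (Map0 B (ud f))"
  then have p: "pseudonatural I W (FL (ud f)) \<theta>" using weighted_diagram.bilim_sel(1)[OF wdL, of "ud f"] by (simp add: B_sel)
  interpret Nf: natural_family I W "FL (ud f)" "FL (ud g)" "\<lambda>i. Map1 (FR i) f" by (rule NF) (use f in simp_all)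
  interpret Mf: natural_family_cell I W "FL (ud f)" C "\<lambda>i. T0 (lam i) (ud g) \<cdot>F Map1 (FR i) f" "\<lambda>i. T0 (lam i) (ud f)"
    "\<lambda>i. T1 (lam i) f" by (rule NLc) (use f in simp_all)
  interpret Mg: natural_family_cell I W "FL (ud g)" C "\<lambda>i. T0 (lam i) (uc g) \<cdot>F Map1 (FR i) g" "\<lambda>i. T0 (lam i) (ud g)"
    "\<lambda>i. T1 (lam i) g" by (rule NLc) (use f in simp_all)
  interpret Mgf: natural_family_cell I W "FL (ud f)" C "\<lambda>i. T0 (lam i) (uc g) \<cdot>F Map1 (FR i) (g \<cdot>\<^bsub>Under A\<^esub> f)" "\<lambda>i. T0 (lam i) (ud f)"
    "\<lambda>i. T1 (lam i) (g \<cdot>\<^bsub>Under A\<^esub> f)" by (rule NLc) (use f in simp_all)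
  have e1: "post_transf I (\<lambda>i. T0 (lam i) (uc g) \<cdot>F Map1 (FR i) (g \<cdot>\<^bsub>Under A\<^esub> f)) \<theta>
    = post_transf I (\<lambda>i. T0 (lam i) (uc g) \<cdot>F Map1 (FR i) g) (post_transf I (\<lambda>i. Map1 (FR i) f) \<theta>)"
    by (rule Mf.S.WH.pn_eqI) (use p f in simp_all)
  have e2: "post_transf I (\<lambda>i. T0 (lam i) (ud g) \<cdot>F Map1 (FR i) f) \<theta>
    = post_transf I (\<lambda>i. T0 (lam i) (ud g)) (post_transf I (\<lambda>i. Map1 (FR i) f) \<theta>)"
    by (rule Mf.S.WH.pn_eqI) (use p f in simp_all)
  have "post_cell I (\<lambda>i. T0 (lam i) (uc g) \<cdot>F Map1 (FR i) (g \<cdot>\<^bsub>Under A\<^esub> f)) (\<lambda>i. T0 (lam i) (ud f)) (\<lambda>i. T1 (lam i) (g \<cdot>\<^bsub>Under A\<^esub> f)) \<theta>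
    = post_cell I (\<lambda>i. T0 (lam i) (ud g) \<cdot>F Map1 (FR i) f) (\<lambda>i. T0 (lam i) (ud f)) (\<lambda>i. T1 (lam i) f) \<theta> \<cdot>\<^bsub>bilim I W C\<^esub>
      post_cell I (\<lambda>i. T0 (lam i) (uc g) \<cdot>F Map1 (FR i) g) (\<lambda>i. T0 (lam i) (ud g)) (\<lambda>i. T1 (lam i) g) (post_transf I (\<lambda>i. Map1 (FR i) f) \<theta>)"
    by (rule Mf.S.WH.modification_eqI[OF _ Mf.S.WH.modification_comp]) (use p f e1 e2 in simp_all)
  then show "NCmp (T1 cone0 (g \<cdot>\<^bsub>Under A\<^esub> f)) \<theta> = NCmp (T1 cone0 f) \<theta> \<cdot>\<^bsub>bilim I W C\<^esub> NCmp (T1 cone0 g) (FObj (Map1 B f) \<theta>)"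
    using p f by (simp add: B_sel del: Mf.S.WH.bilim_sel(5))
next
  fix \<gamma> \<theta> assume g: "\<gamma> \<in> Arr (Cells A)" and "\<theta> \<in> Obj (Map0 B (ud (Dom (Cells A) \<gamma>)))"
  let ?f = "Dom (Cells A) \<gamma>" and ?g = "Cod (Cells A) \<gamma>"
  have p: "pseudonatural I W (FL (ud ?f)) \<theta>"
    using weighted_diagram.bilim_sel(1)[OF wdL, of "ud ?f"] \<open>\<theta> \<in> _\<close> g by (simp add: B_sel)
  interpret Nc: natural_family_cell I W "FL (ud ?f)" "FL (uc ?f)"
    "\<lambda>i. Map1 (FR i) ?f" "\<lambda>i. Map1 (FR i) ?g" "\<lambda>i. Map2 (FR i) \<gamma>"
    by (rule NFc) (use g in simp_all)
  interpret N: natural_family I W "FL (uc ?f)" C "\<lambda>i. T0 (lam i) (uc ?f)" by (rule NL) (use g in simp)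
  interpret Mf: natural_family_cell I W "FL (ud ?f)" C "\<lambda>i. T0 (lam i) (uc ?f) \<cdot>F Map1 (FR i) ?f" "\<lambda>i. T0 (lam i) (ud ?f)"
    "\<lambda>i. T1 (lam i) ?f" by (rule NLc) (use g in simp_all)
  interpret Mg: natural_family_cell I W "FL (ud ?f)" C "\<lambda>i. T0 (lam i) (uc ?f) \<cdot>F Map1 (FR i) ?g" "\<lambda>i. T0 (lam i) (ud ?f)"
    "\<lambda>i. T1 (lam i) ?g" by (rule NLc) (use g in simp_all)
  have e: "post_transf I (\<lambda>i. T0 (lam i) (uc ?f) \<cdot>F Map1 (FR i) h) \<theta>
    = post_transf I (\<lambda>i. T0 (lam i) (uc ?f)) (post_transf I (\<lambda>i. Map1 (FR i) h) \<theta>)" if "h = ?f \<or> h = ?g" for h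
    by (rule N.WH.pn_eqI) (use p g that in auto)
  have "post_cell I (\<lambda>i. T0 (lam i) (uc ?f) \<cdot>F Map1 (FR i) ?f) (\<lambda>i. T0 (lam i) (ud ?f)) (\<lambda>i. T1 (lam i) ?f) \<theta>
    = post_cell I (\<lambda>i. T0 (lam i) (uc ?f) \<cdot>F Map1 (FR i) ?g) (\<lambda>i. T0 (lam i) (ud ?f)) (\<lambda>i. T1 (lam i) ?g) \<theta> \<cdot>\<^bsub>bilim I W C\<^esub>
      post_modif I (\<lambda>i. T0 (lam i) (uc ?f)) (post_cell I (\<lambda>i. Map1 (FR i) ?f) (\<lambda>i. Map1 (FR i) ?g) (\<lambda>i. Map2 (FR i) \<gamma>) \<theta>)"
  proof (rule N.WH.modification_eqI[OF _ N.WH.modification_comp])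
    fix i x assume "i \<in> Obj (Under I)" "x \<in> Obj (Map0 W i)"
    then show "NCmp (MCmp (post_cell I (\<lambda>i. T0 (lam i) (uc ?f) \<cdot>F Map1 (FR i) ?f) (\<lambda>i. T0 (lam i) (ud ?f)) (\<lambda>i. T1 (lam i) ?f) \<theta>) i) x
      = NCmp (MCmp (post_cell I (\<lambda>i. T0 (lam i) (uc ?f) \<cdot>F Map1 (FR i) ?g) (\<lambda>i. T0 (lam i) (ud ?f)) (\<lambda>i. T1 (lam i) ?g) \<theta> \<cdot>\<^bsub>bilim I W C\<^esub>
      post_modif I (\<lambda>i. T0 (lam i) (uc ?f)) (post_cell I (\<lambda>i. Map1 (FR i) ?f) (\<lambda>i. Map1 (FR i) ?g) (\<lambda>i. Map2 (FR i) \<gamma>) \<theta>)) i) x"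
      using p g cone.Tc_cell[OF coneR, of i \<gamma> "FObj (T0 \<theta> i) x" "uc ?f"] by simp
  qed (use p g e in simp_all)
  then show "NCmp (T1 cone0 ?f) \<theta> = NCmp (T1 cone0 ?g) \<theta> \<cdot>\<^bsub>bilim I W C\<^esub> FArr (T0 cone0 (uc ?f)) (NCmp (Map2 B \<gamma>) \<theta>)"
    using p g by (simp add: B_sel del: N.WH.bilim_sel(5))
next
  fix f \<theta> assume f: "f \<in> \<Sigma>" and "\<theta> \<in> Obj (Map0 B (ud f))"
  then have p: "pseudonatural I W (FL (ud f)) \<theta>" using weighted_diagram.bilim_sel(1)[OF wdL, of "ud f"] by (simp add: B_sel)
  interpret M: natural_family_cell I W "FL (ud f)" C "\<lambda>i. T0 (lam i) (uc f) \<cdot>F Map1 (FR i) f" "\<lambda>i. T0 (lam i) (ud f)"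
    "\<lambda>i. T1 (lam i) f" by (rule NLc) (use f in simp_all)
  have "is_iso (bilim I W C) (post_cell I (\<lambda>i. T0 (lam i) (uc f) \<cdot>F Map1 (FR i) f) (\<lambda>i. T0 (lam i) (ud f)) (\<lambda>i. T1 (lam i) f) \<theta>)"
    by (rule M.S.WH.bilim_iso) (use p f in simp_all)
  then show "is_iso (bilim I W C) (NCmp (T1 cone0 f) \<theta>)" using p f by simp
qed

end

section \<open>The comparison functor\<close>

context comparison
begin

section \<open>Lifting finitely many arrows and equations to one index\<close>

abbreviation "fr i \<equiv> cone.frac A \<Sigma> (FR i) (L i) (lam i)"

lemmas frD = cone.fracD[OF coneR, unfolded Map0_fix]

lemma finite_W:
  "finite (SIGMA i:Obj (Under I). Obj (Map0 W i))" "finite (SIGMA i:Obj (Under I). Arr (Map0 W i))"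
  "finite (SIGMA w:Arr (Under I). Obj (Map0 W (id' w)))" "finite (SIGMA w:Arr (Under I). Arr (Map0 W (id' w)))"
  "finite (SIGMA \<mu>:Arr (Cells I). Obj (Map0 W (id' (Dom (Cells I) \<mu>))))"
  "finite (Arr (Under I))"
  using finI finW by (auto simp: finite_two_category_def finite_weight_def finite_cat_def)

text \<open>Having a presentation with both legs equal to the stage persists by
  \<open>frac_ext\<close>, and can be reached from any stage: \<open>colim_arr\<close> gives some
  legs and \<open>frac_legs\<close> moves them. Equal legs are possible because all endpoints come
  from the same index \<open>a\<close>.\<close>

lemma lift_finite:
  assumes S: "finite S" and a: "a \<in> Obj (Under A)"
    and m: "\<And>i m x y. (i, m, x, y) \<in> S \<Longrightarrow> i \<in> Obj (Under I) \<and> x \<in> Obj (Map0 F (a, i)) \<and> y \<in> Obj (Map0 F (a, i)) \<and>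
      m \<in> hom (L i) (FObj (T0 (lam i) a) x) (FObj (T0 (lam i) a) y)"
  shows "\<exists>u\<in>\<Sigma>. ud u = a \<and> (\<forall>(i, m, x, y)\<in>S. \<exists>f. fr i m x y u u f)"
proof -
  let ?\<Phi> = "\<lambda>(i, m, x, y) u. \<exists>f. fr i m x y u u f"
  have "\<exists>h\<in>\<Sigma>. ud h = uc (Ident (Under A) a) \<and> (\<forall>s\<in>S. ?\<Phi> s (h \<cdot>\<^bsub>Under A\<^esub> Ident (Under A) a))"
  proof (rule eventually_finite[OF S, where a=a])
    fix s u h assume s: "s \<in> S" "u \<in> \<Sigma>" "h \<in> \<Sigma>" "ud h = uc u" "?\<Phi> s u"
    obtain i m x y where e: "s = (i, m, x, y)" by (cases s)
    have "i \<in> Obj (Under I)" using m[of i] s e by blast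
    then show "?\<Phi> s (h \<cdot>\<^bsub>Under A\<^esub> u)" using s cone.frac_ext[OF coneR, of i m x y u u _ h] unfolding e by auto
  next
    fix s u assume s: "s \<in> S" "u \<in> \<Sigma>" "ud u = a"
    obtain i m x y where e: "s = (i, m, x, y)" by (cases s)
    note mm = m[OF s(1)[unfolded e]]
    interpret c: sigma_colimit A \<Sigma> "FR i" "L i" "lam i" by (rule colimR) (use mm in simp)
    obtain v w f where f: "fr i m x y v w f" "ud v = a" "ud w = a"
      by (rule c.colim_arr[of a x a y m]) (use mm a in auto)
    obtain h f' where "h \<in> \<Sigma>" "ud h = uc u" "fr i m x y (h \<cdot>\<^bsub>Under A\<^esub> u) (h \<cdot>\<^bsub>Under A\<^esub> u) f'"
      by (rule c.l.frac_legs[OF f(1), of u u]) (use s f in simp_all)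
    then show "\<exists>h\<in>\<Sigma>. ud h = uc u \<and> ?\<Phi> s (h \<cdot>\<^bsub>Under A\<^esub> u)" unfolding e by auto
  qed (use a in auto)
  then obtain h where "h \<in> \<Sigma>" "ud h = a" "\<forall>s\<in>S. ?\<Phi> s h" using a by auto
  then show ?thesis by (intro bexI[of _ h]) auto
qed

text \<open>Equality at a stage persists by functoriality. To reach it from a stage
  \<open>u\<close>, the images of the arrows pushed along \<open>u\<close> are still equal in the
  colimit, by \<open>Ta_eq_Ga\<close>, so \<open>colim_arr_eq\<close> applies at the codomain of
  \<open>u\<close>.\<close>

lemma equalize_finite:
  assumes Q: "finite Q" and a: "a \<in> Obj (Under A)"
    and m: "\<And>i f g. (i, f, g) \<in> Q \<Longrightarrow> i \<in> Obj (Under I) \<and> f \<in> Arr (Map0 F (a, i)) \<and> g \<in> Arr (Map0 F (a, i)) \<and>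
      Dom (Map0 F (a, i)) g = Dom (Map0 F (a, i)) f \<and> Cod (Map0 F (a, i)) g = Cod (Map0 F (a, i)) f \<and>
      FArr (T0 (lam i) a) f = FArr (T0 (lam i) a) g"
  shows "\<exists>u\<in>\<Sigma>. ud u = a \<and> (\<forall>(i, f, g)\<in>Q. FArr (Map1 (FR i) u) f = FArr (Map1 (FR i) u) g)"
proof -
  let ?\<Phi> = "\<lambda>(i, f, g) u. FArr (Map1 (FR i) u) f = FArr (Map1 (FR i) u) g"
  have "\<exists>h\<in>\<Sigma>. ud h = uc (Ident (Under A) a) \<and> (\<forall>s\<in>Q. ?\<Phi> s (h \<cdot>\<^bsub>Under A\<^esub> Ident (Under A) a))"
  proof (rule eventually_finite[OF Q, where a=a])
    fix s u h assume s: "s \<in> Q" "u \<in> \<Sigma>" "ud u = a" "h \<in> \<Sigma>" "ud h = uc u" "?\<Phi> s u"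
    obtain i f g where e: "s = (i, f, g)" by (cases s)
    note mm = m[OF s(1)[unfolded e]]
    show "?\<Phi> s (h \<cdot>\<^bsub>Under A\<^esub> u)" using s mm unfolding e by simp
  next
    fix s u assume s: "s \<in> Q" "u \<in> \<Sigma>" "ud u = a"
    obtain i f g where e: "s = (i, f, g)" by (cases s)
    note mm = m[OF s(1)[unfolded e]]
    interpret c: sigma_colimit A \<Sigma> "FR i" "L i" "lam i" by (rule colimR) (use mm in simp)
    have "\<exists>h\<in>\<Sigma>. ud h = uc u \<and> FArr (Map1 (FR i) h) (FArr (Map1 (FR i) u) f) = FArr (Map1 (FR i) h) (FArr (Map1 (FR i) u) g)"
      by (rule c.colim_arr_eq) (use s mm c.l.Ta_eq_Ga[of u a f g] in simp_all)
    then show "\<exists>h\<in>\<Sigma>. ud h = uc u \<and> ?\<Phi> s (h \<cdot>\<^bsub>Under A\<^esub> u)" unfolding e using s mm by auto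
  qed (use a in auto)
  then obtain h where "h \<in> \<Sigma>" "ud h = a" "\<forall>s\<in>Q. ?\<Phi> s h" using a by auto
  then show ?thesis by (intro bexI[of _ h]) auto
qed

text \<open>The universal cones are natural in the object of \<open>I\<close>, so applying
  \<open>Map1 C w\<close> to the equation of a fraction turns each term into its counterpart at
  \<open>ic w\<close>. This presents the side of an equation on which the diagram acts on a lifted
  arrow.\<close>

lemma frac_weight:
  assumes w: "w \<in> Arr (Under I)" and f: "fr (id' w) m x y u u f" and a: "a = ud u" and j: "j = ic w"
  shows "fr j (FArr (Map1 C w) m) (FObj (Map1 (FL a) w) x) (FObj (Map1 (FL a) w) y) u u (FArr (Map1 (FL (uc u)) w) f)"
proof -
  have i: "id' w \<in> Obj (Under I)" "ic w \<in> Obj (Under I)" using w by simp_all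
  note d = frD[OF i(1) f]
  have "FArr (Map1 C w) (m \<cdot>\<^bsub>L (id' w)\<^esub> NCmp (T1 (lam (id' w)) u) x)
    = FArr (Map1 C w) (NCmp (T1 (lam (id' w)) u) y \<cdot>\<^bsub>L (id' w)\<^esub> FArr (T0 (lam (id' w)) (uc u)) f)"
    unfolding d(12) ..
  then show ?thesis unfolding cone.frac_def[OF coneR[OF i(2)]] a j
    using w d(1-11) by (simp add: F_commute_obj)
qed

text \<open>An arrow that comes from index \<open>a\<close> is presented over every stage by its
  push along that stage, so the given parts of an equation can be written over the same legs as the
  lifted ones.\<close>

lemma fr_arr:
  assumes "i \<in> Obj (Under I)" "u \<in> \<Sigma>" "ud u = a" "f \<in> Arr (Map0 F (a, i))" "Dom (Map0 F (a, i)) f = x" "Cod (Map0 F (a, i)) f = y"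
  shows "fr i (FArr (T0 (lam i) a) f) x y u u (FArr (Map1 (FR i) u) f)"
  using cone.frac_same_arr[OF coneR[OF assms(1)] assms(2) assms(3)[symmetric], of f] assms(4-6) by simp

lemma fr_ident:
  assumes "i \<in> Obj (Under I)" "u \<in> \<Sigma>" "ud u = a" "x \<in> Obj (Map0 F (a, i))"
  shows "fr i (Ident (L i) (FObj (T0 (lam i) a) x)) x x u u (Ident (Map0 F (uc u, i)) (FObj (Map1 (FR i) u) x))"
proof -
  have a: "a \<in> Obj (Under A)" using assms(2,3) by auto
  have "fr i (FArr (T0 (lam i) a) (Ident (Map0 F (a, i)) x)) x x u u (FArr (Map1 (FR i) u) (Ident (Map0 F (a, i)) x))"
    by (rule fr_arr[OF assms(1-3)]) (use assms a in simp_all)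
  then show ?thesis using assms a by simp
qed

lemma fr_comp:
  "i \<in> Obj (Under I) \<Longrightarrow> fr i m x y u u f \<Longrightarrow> fr i n y z u u g \<Longrightarrow>
    fr i (n \<cdot>\<^bsub>L i\<^esub> m) x z u u (g \<cdot>\<^bsub>Map0 F (uc u, i)\<^esub> f)"
  using cone.frac_same_comp[OF coneR, of i m x y u f n z g] by simp

lemma fr_ext:
  "i \<in> Obj (Under I) \<Longrightarrow> fr i m x y u u f \<Longrightarrow> h \<in> \<Sigma> \<Longrightarrow> ud h = uc u \<Longrightarrow>
    fr i m x y (h \<cdot>\<^bsub>Under A\<^esub> u) (h \<cdot>\<^bsub>Under A\<^esub> u) (FArr (Map1 (FR i) h) f)"
  using cone.frac_ext[OF coneR] by blast

text \<open>Two representatives of one arrow over the same legs have equal images by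
  \<open>frac_same_unique\<close>, so they agree at a later stage. An equation in the
  \<open>L i\<close> is lifted by presenting both of its sides over \<open>u\<close> and applying
  this.\<close>

lemma equalize_fr:
  assumes Q: "finite Q" and u: "u \<in> \<Sigma>"
    and m: "\<And>i f g. (i, f, g) \<in> Q \<Longrightarrow> i \<in> Obj (Under I) \<and> (\<exists>m x y. fr i m x y u u f \<and> fr i m x y u u g)"
  obtains h where "h \<in> \<Sigma>" "ud h = uc u"
    "\<And>i f g. (i, f, g) \<in> Q \<Longrightarrow> FArr (Map1 (FR i) h) f = FArr (Map1 (FR i) h) g"
proof -
  have "\<exists>h\<in>\<Sigma>. ud h = uc u \<and> (\<forall>(i, f, g)\<in>Q. FArr (Map1 (FR i) h) f = FArr (Map1 (FR i) h) g)"
  proof (rule equalize_finite[OF Q])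
    fix i f g assume "(i, f, g) \<in> Q"
    from m[OF this] obtain m x y where i: "i \<in> Obj (Under I)" and fg: "fr i m x y u u f" "fr i m x y u u g" by blast
    note d = frD[OF i fg(1)] and e = frD[OF i fg(2)]
    show "i \<in> Obj (Under I) \<and> f \<in> Arr (Map0 F (uc u, i)) \<and> g \<in> Arr (Map0 F (uc u, i)) \<and>
      Dom (Map0 F (uc u, i)) g = Dom (Map0 F (uc u, i)) f \<and> Cod (Map0 F (uc u, i)) g = Cod (Map0 F (uc u, i)) f \<and>
      FArr (T0 (lam i) (uc u)) f = FArr (T0 (lam i) (uc u)) g"
      using i d(6-8) e(6-8) cone.frac_same_unique[OF coneR[OF i] fg] by simp
  qed (use u in simp)
  then show ?thesis using that by blast
qed

end

locale comparison_colimit = comparison A \<Sigma> I F W L lam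
  for A :: "('a, 'f, 'c) twocat" and \<Sigma> and I :: "('i, 'j, 'k) twocat"
    and F :: "('a \<times> 'i, 'f \<times> 'j, 'c \<times> 'k, 'o, 'm) cat_valued"
    and W :: "('i, 'j, 'k, 'v, 'w) cat_valued"
    and L :: "'i \<Rightarrow> ('l, 'h) cat"
    and lam :: "'i \<Rightarrow> ('a, 'f, 'o, 'm, 'l, 'h) transf" +
  fixes P :: "('p, 'q) cat"
    and \<kappa> :: "('a, 'f, ('i, 'j, 'v, 'w, 'o, 'm) transf, ('i, 'j, 'v, 'w, 'o, 'm) modif, 'p, 'q) transf"
  assumes colimP: "is_sigma_colimit A \<Sigma> (bilim_functor A I W F) P \<kappa>"
begin

sublocale p: sigma_colimit A \<Sigma> B P \<kappa>
  by (intro sigma_colimit.intro filtB sigma_colimit_axioms.intro colimP)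

sublocale E: weighted_diagram I W C rewrites "\<And>i. Map0 C i = L i"
  by (rule wdC) simp

section \<open>Values of the comparison functor on generators\<close>

abbreviation "K \<equiv> comparison_functor A \<Sigma> I W F L lam P \<kappa>"

lemma K_props: "K \<in> Obj (Fun P (bilim I W C))" "post_transf A (\<lambda>_. K) \<kappa> = cone0"
  unfolding comparison_functor_def
  using p.induced_functor_props[OF weighted_diagram.bilim_cat[OF wdC] comparison_cone] by auto

lemma K_functor [simp]: "is_functor K" "FSrc K = P" "FTgt K = bilim I W C"
  using K_props(1) by auto

abbreviation "md a \<equiv> weighted_diagram.modification I W (FL a)"
abbreviation "pnL a \<equiv> pseudonatural I W (FL a)"

lemma B_obj [simp]: "a \<in> Obj (Under A) \<Longrightarrow> \<theta> \<in> Obj (Map0 B a) \<longleftrightarrow> pnL a \<theta>"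
  "a \<in> Obj (Under A) \<Longrightarrow> \<rho> \<in> Arr (Map0 B a) \<longleftrightarrow> md a \<rho>"
  "a \<in> Obj (Under A) \<Longrightarrow> Dom (Map0 B a) = MSrc" "a \<in> Obj (Under A) \<Longrightarrow> Cod (Map0 B a) = MTgt"
  unfolding B_sel by (simp_all add: weighted_diagram.bilim_sel[OF wdL] weighted_diagram.bilim_arr[OF wdL])

lemma B_map:
  assumes f: "f \<in> Arr (Under A)" "a = ud f"
  shows "pnL a \<theta> \<Longrightarrow> FObj (Map1 B f) \<theta> = post_transf I (\<lambda>i. Map1 (FR i) f) \<theta>"
    "md a \<rho> \<Longrightarrow> FArr (Map1 B f) \<rho> = post_modif I (\<lambda>i. Map1 (FR i) f) \<rho>"
    "pnL a \<theta> \<Longrightarrow> pnL (uc f) (post_transf I (\<lambda>i. Map1 (FR i) f) \<theta>)"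
    "md a \<rho> \<Longrightarrow> md (uc f) (post_modif I (\<lambda>i. Map1 (FR i) f) \<rho>)"
proof -
  interpret N: natural_family I W "FL (ud f)" "FL (uc f)" "\<lambda>i. Map1 (FR i) f" by (rule NF) (use f in simp_all)
  show "pnL a \<theta> \<Longrightarrow> FObj (Map1 B f) \<theta> = post_transf I (\<lambda>i. Map1 (FR i) f) \<theta>"
    "md a \<rho> \<Longrightarrow> FArr (Map1 B f) \<rho> = post_modif I (\<lambda>i. Map1 (FR i) f) \<rho>"
    "pnL a \<theta> \<Longrightarrow> pnL (uc f) (post_transf I (\<lambda>i. Map1 (FR i) f) \<theta>)"
    "md a \<rho> \<Longrightarrow> md (uc f) (post_modif I (\<lambda>i. Map1 (FR i) f) \<rho>)"
    using f by (simp_all add: B_sel)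
qed

text \<open>These are the values that the defining equation of the induced functor gives on the
  generators of \<open>P\<close>. The proofs of fullness, faithfulness and essential surjectivity
  know \<open>K\<close> only through them.\<close>

lemma K_map:
  assumes "a \<in> Obj (Under A)"
  shows "pnL a \<theta> \<Longrightarrow> FObj K (p.l.To a \<theta>) = post_transf I (\<lambda>i. T0 (lam i) a) \<theta>"
    "md a \<rho> \<Longrightarrow> FArr K (p.l.Ta a \<rho>) = post_modif I (\<lambda>i. T0 (lam i) a) \<rho>"
    "f \<in> Arr (Under A) \<Longrightarrow> ud f = a \<Longrightarrow> pnL a \<theta> \<Longrightarrow> FArr K (p.l.Tc f \<theta>)
      = post_cell I (\<lambda>i. T0 (lam i) (uc f) \<cdot>F Map1 (FR i) f) (\<lambda>i. T0 (lam i) a) (\<lambda>i. T1 (lam i) f) \<theta>"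
    "pnL a \<theta> \<Longrightarrow> E.pn (post_transf I (\<lambda>i. T0 (lam i) a) \<theta>)"
    "md a \<rho> \<Longrightarrow> E.modification (post_modif I (\<lambda>i. T0 (lam i) a) \<rho>)"
proof -
  interpret N: natural_family I W "FL a" C "\<lambda>i. T0 (lam i) a" by (rule NL[OF assms])
  show "pnL a \<theta> \<Longrightarrow> FObj K (p.l.To a \<theta>) = post_transf I (\<lambda>i. T0 (lam i) a) \<theta>"
    using p.post_transf_eqD(1)[OF K_props(2), of a \<theta>] assms by simp
  show "md a \<rho> \<Longrightarrow> FArr K (p.l.Ta a \<rho>) = post_modif I (\<lambda>i. T0 (lam i) a) \<rho>"
    using p.post_transf_eqD(2)[OF K_props(2), of a \<rho>] assms by simp
  show "pnL a \<theta> \<Longrightarrow> E.pn (post_transf I (\<lambda>i. T0 (lam i) a) \<theta>)" by simp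
  show "md a \<rho> \<Longrightarrow> E.modification (post_modif I (\<lambda>i. T0 (lam i) a) \<rho>)" by simp
  assume f: "f \<in> Arr (Under A)" "ud f = a" and t: "pnL a \<theta>"
  interpret M: natural_family_cell I W "FL a" C "\<lambda>i. T0 (lam i) (uc f) \<cdot>F Map1 (FR i) f" "\<lambda>i. T0 (lam i) a"
    "\<lambda>i. T1 (lam i) f" by (rule NLc) (use f in simp_all)
  show "FArr K (p.l.Tc f \<theta>)
      = post_cell I (\<lambda>i. T0 (lam i) (uc f) \<cdot>F Map1 (FR i) f) (\<lambda>i. T0 (lam i) a) (\<lambda>i. T1 (lam i) f) \<theta>"
    using p.post_transf_eqD(3)[OF K_props(2) f(1), of \<theta>] f t assms by simp
qed

section \<open>Faithfulness of the comparison functor\<close>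

lemma K_comp: "m \<in> Arr P \<Longrightarrow> n \<in> Arr P \<Longrightarrow> Cod P m = Dom P n \<Longrightarrow>
    FArr K (n \<cdot>\<^bsub>P\<^esub> m) = FArr K n \<cdot>\<^bsub>bilim I W C\<^esub> FArr K m"
  using functor_comp[of K P m n] by (simp del: E.bilim_sel)

text \<open>By \<open>frac_legs\<close> both arrows are fractions over the same legs, represented by
  modifications \<open>f\<close> and \<open>g\<close> at one index. Applying \<open>K\<close> and
  cancelling the invertible leg shows that the finitely many components of \<open>f\<close> and
  \<open>g\<close> have equal images in the \<open>L i\<close>. They become equal at a later stage,
  where the two modifications therefore coincide.\<close>

lemma K_faithful:
  assumes m: "m \<in> Arr P" "n \<in> Arr P" "Dom P m = Dom P n" "Cod P m = Cod P n" and e: "FArr K m = FArr K n"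
  shows "m = n"
proof -
  obtain a \<theta> where a: "a \<in> Obj (Under A)" "\<theta> \<in> Obj (Map0 B a)" "Dom P m = p.l.To a \<theta>"
    by (rule p.colim_obj[of "Dom P m"]) (use m in auto)
  obtain b \<theta>' where b: "b \<in> Obj (Under A)" "\<theta>' \<in> Obj (Map0 B b)" "Cod P m = p.l.To b \<theta>'"
    by (rule p.colim_obj[of "Cod P m"]) (use m in auto)
  obtain u0 v0 f0 where f0: "p.l.frac m \<theta> \<theta>' u0 v0 f0" "ud u0 = a" "ud v0 = b"
    by (rule p.colim_arr[of a \<theta> b \<theta>' m]) (use a b m in auto)
  obtain u1 v1 g0 where g0: "p.l.frac n \<theta> \<theta>' u1 v1 g0" "ud u1 = a" "ud v1 = b"
    by (rule p.colim_arr[of a \<theta> b \<theta>' n]) (use a b m in auto)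
  note d0 = p.l.fracD[OF f0(1)]
  obtain h g where h: "h \<in> \<Sigma>" "ud h = uc u0" "p.l.frac n \<theta> \<theta>' (h \<cdot>\<^bsub>Under A\<^esub> u0) (h \<cdot>\<^bsub>Under A\<^esub> v0) g"
    by (rule p.l.frac_legs[OF g0(1), of u0 v0]) (use f0 g0 d0 in auto)
  let ?u = "h \<cdot>\<^bsub>Under A\<^esub> u0" and ?v = "h \<cdot>\<^bsub>Under A\<^esub> v0"
  define f where "f = FArr (Map1 B h) f0"
  have F: "p.l.frac m \<theta> \<theta>' ?u ?v f" unfolding f_def by (rule p.l.frac_ext[OF f0(1) h(1,2)])
  note df = p.l.fracD[OF F] and dg = p.l.fracD[OF h(3)]
  let ?c = "uc ?u"
  have c: "?c \<in> Obj (Under A)" using df by simp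
  have fm: "md ?c f" "md ?c g" using df(6) dg(6) c by simp_all
  have par: "MSrc g = MSrc f" "MTgt g = MTgt f" using df(7,8) dg(7,8) c by simp_all
  interpret c: weighted_diagram I W "FL ?c" rewrites "\<And>i. Map0 (FL ?c) i = Map0 F (?c, i)" by (rule wdL[OF c]) simp
  have "FArr K (p.l.Ta ?c f) = FArr K (p.l.Ta ?c g)"
  proof (rule iso_mono[of "bilim I W C" "FArr K (p.l.Tc ?v \<theta>')"])
    have "FArr K (m \<cdot>\<^bsub>P\<^esub> p.l.Tc ?u \<theta>) = FArr K (n \<cdot>\<^bsub>P\<^esub> p.l.Tc ?u \<theta>)"
      using functor_comp[of K P "p.l.Tc ?u \<theta>" m] functor_comp[of K P "p.l.Tc ?u \<theta>" n] e df(1-11) dg(1-11) by simp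
    then have "FArr K (p.l.Tc ?v \<theta>' \<cdot>\<^bsub>P\<^esub> p.l.Ta ?c f) = FArr K (p.l.Tc ?v \<theta>' \<cdot>\<^bsub>P\<^esub> p.l.Ta ?c g)"
      unfolding df(12) dg(12) .
    moreover have "FArr K (p.l.Tc ?v \<theta>' \<cdot>\<^bsub>P\<^esub> p.l.Ta ?c f) = FArr K (p.l.Tc ?v \<theta>') \<cdot>\<^bsub>bilim I W C\<^esub> FArr K (p.l.Ta ?c f)"
      by (rule K_comp) (use df(1-11) in simp_all)
    moreover have "FArr K (p.l.Tc ?v \<theta>' \<cdot>\<^bsub>P\<^esub> p.l.Ta ?c g) = FArr K (p.l.Tc ?v \<theta>') \<cdot>\<^bsub>bilim I W C\<^esub> FArr K (p.l.Ta ?c g)"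
      by (rule K_comp) (use dg(1-11) in simp_all)
    ultimately show "FArr K (p.l.Tc ?v \<theta>') \<cdot>\<^bsub>bilim I W C\<^esub> FArr K (p.l.Ta ?c f) = FArr K (p.l.Tc ?v \<theta>') \<cdot>\<^bsub>bilim I W C\<^esub> FArr K (p.l.Ta ?c g)"
      by simp
    show "is_iso (bilim I W C) (FArr K (p.l.Tc ?v \<theta>'))"
      by (rule functor_is_iso) (use df(1-5) in simp_all)
    have fA: "p.l.Ta ?c f \<in> Arr P" "p.l.Ta ?c g \<in> Arr P" "p.l.Tc ?v \<theta>' \<in> Arr P" using df(1-11) dg(6) by simp_all
    then show "FArr K (p.l.Ta ?c f) \<in> Arr (bilim I W C)" "FArr K (p.l.Ta ?c g) \<in> Arr (bilim I W C)"
      using functor_arr(1)[OF K_functor(1,3)] by simp_all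
    have "Cod P (p.l.Ta ?c f) = Dom P (p.l.Tc ?v \<theta>')" using df(1-11) by simp
    moreover have "Cod P (p.l.Ta ?c g) = Dom P (p.l.Tc ?v \<theta>')" using dg(1-11) by simp
    ultimately show "Cod (bilim I W C) (FArr K (p.l.Ta ?c f)) = Dom (bilim I W C) (FArr K (p.l.Tc ?v \<theta>'))"
      "Cod (bilim I W C) (FArr K (p.l.Ta ?c g)) = Dom (bilim I W C) (FArr K (p.l.Tc ?v \<theta>'))"
      using functor_arr[OF K_functor(1,3)] fA unfolding K_functor(2) by metis+
  qed (rule E.bilim_cat)
  then have pe: "post_modif I (\<lambda>i. T0 (lam i) ?c) f = post_modif I (\<lambda>i. T0 (lam i) ?c) g"
    using K_map(2)[OF c fm(1)] K_map(2)[OF c fm(2)] by simp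
  have le: "FArr (T0 (lam i) ?c) (NCmp (MCmp f i) x) = FArr (T0 (lam i) ?c) (NCmp (MCmp g i) x)"
    if "i \<in> Obj (Under I)" "x \<in> Obj (Map0 W i)" for i x
  proof -
    have "NCmp (MCmp (post_modif I (\<lambda>i. T0 (lam i) ?c) f) i) x = NCmp (MCmp (post_modif I (\<lambda>i. T0 (lam i) ?c) g) i) x"
      using pe by simp
    then show ?thesis using that fm by simp
  qed
  \<comment> \<open>One equation for each object \<open>i\<close> of \<open>I\<close> and each
    object of the weight at \<open>i\<close>; here both finiteness assumptions enter.\<close>
  have "\<exists>k\<in>\<Sigma>. ud k = ?c \<and> (\<forall>(i, f, g)\<in>(\<lambda>(i, x). (i, NCmp (MCmp f i) x, NCmp (MCmp g i) x)) ` (SIGMA i:Obj (Under I). Obj (Map0 W i)).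
      FArr (Map1 (FR i) k) f = FArr (Map1 (FR i) k) g)"
    by (rule equalize_finite[OF finite_imageI[OF finite_W(1)] c]) (use fm par le in auto)
  then obtain k where k: "k \<in> \<Sigma>" "ud k = ?c" "\<And>i x. i \<in> Obj (Under I) \<Longrightarrow> x \<in> Obj (Map0 W i) \<Longrightarrow>
      FArr (Map1 (FR i) k) (NCmp (MCmp f i) x) = FArr (Map1 (FR i) k) (NCmp (MCmp g i) x)" by auto
  have km: "md (uc k) (post_modif I (\<lambda>i. Map1 (FR i) k) f)" "md (uc k) (post_modif I (\<lambda>i. Map1 (FR i) k) g)"
    using B_map(4)[of k ?c] k fm by simp_all
  have "FArr (Map1 B k) f = FArr (Map1 B k) g"
  proof -
    interpret N: natural_family I W "FL ?c" "FL (uc k)" "\<lambda>i. Map1 (FR i) k" by (rule NF) (use k in simp_all)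
    have "post_modif I (\<lambda>i. Map1 (FR i) k) f = post_modif I (\<lambda>i. Map1 (FR i) k) g"
      by (rule N.WH.modification_eqI[OF km]) (use fm par k in simp_all)
    then show ?thesis using B_map(2)[of k ?c] k fm by simp
  qed
  then have "p.l.Ta ?c f = p.l.Ta ?c g"
    by (intro p.l.Ga_eq_Ta[OF k(1,2)]) (use df dg in simp_all)
  then show "m = n" using p.l.frac_eq[OF F] p.l.frac_eq[OF h(3)] by simp
qed

section \<open>Fullness of the comparison functor\<close>

lemma Tc_props:
  assumes "u \<in> \<Sigma>" "ud u = a" "pnL a \<theta>"
  shows "p.l.Tc u \<theta> \<in> Arr P" "Dom P (p.l.Tc u \<theta>) = p.l.To (uc u) (post_transf I (\<lambda>i. Map1 (FR i) u) \<theta>)"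
    "Cod P (p.l.Tc u \<theta>) = p.l.To a \<theta>" "is_iso P (p.l.Tc u \<theta>)"
proof -
  have u: "u \<in> Arr (Under A)" "a \<in> Obj (Under A)" using assms by auto
  show "p.l.Tc u \<theta> \<in> Arr P" "Dom P (p.l.Tc u \<theta>) = p.l.To (uc u) (post_transf I (\<lambda>i. Map1 (FR i) u) \<theta>)"
    "Cod P (p.l.Tc u \<theta>) = p.l.To a \<theta>" "is_iso P (p.l.Tc u \<theta>)"
    using assms u B_map(1)[of u a \<theta>] by simp_all
qed

text \<open>The components of \<open>\<rho>\<close> are finitely many arrows and lift to one stage
  \<open>u\<close>. Their naturality and the modification law are finitely many equations that hold
  in the colimits, hence between the lifts after a further arrow \<open>h\<close>. The lifts then
  form a modification \<open>\<phi>\<close>, and conjugating its image by the invertible legs of the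
  universal cone gives the preimage of \<open>\<rho>\<close>.\<close>

lemma K_full_same:
  assumes a: "a \<in> Obj (Under A)" and t: "pnL a \<theta>" "pnL a \<theta>'"
    and r: "E.modification \<rho>" "MSrc \<rho> = post_transf I (\<lambda>i. T0 (lam i) a) \<theta>" "MTgt \<rho> = post_transf I (\<lambda>i. T0 (lam i) a) \<theta>'"
  shows "\<exists>m\<in>hom P (p.l.To a \<theta>) (p.l.To a \<theta>'). FArr K m = \<rho>"
proof -
  interpret N: natural_family I W "FL a" C "\<lambda>i. T0 (lam i) a" rewrites "\<And>i. Map0 (FL a) i = Map0 F (a, i)" and "\<And>i. Map0 C i = L i"
    by (rule NL[OF a]) simp_all
  note [simp] = a t r
  define \<sigma> where "\<sigma> i x = NCmp (MCmp \<rho> i) x" for i x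
  have \<sigma> [simp]: "\<sigma> i x \<in> Arr (L i)" "Dom (L i) (\<sigma> i x) = FObj (T0 (lam i) a) (FObj (T0 \<theta> i) x)"
    "Cod (L i) (\<sigma> i x) = FObj (T0 (lam i) a) (FObj (T0 \<theta>' i) x)" if "i \<in> Obj (Under I)" "x \<in> Obj (Map0 W i)" for i x
    using that by (simp_all add: \<sigma>_def)
  have \<sigma>_nat: "\<sigma> i (Cod (Map0 W i) m) \<cdot>\<^bsub>L i\<^esub> FArr (T0 (lam i) a) (FArr (T0 \<theta> i) m)
     = FArr (T0 (lam i) a) (FArr (T0 \<theta>' i) m) \<cdot>\<^bsub>L i\<^esub> \<sigma> i (Dom (Map0 W i) m)"
    if "i \<in> Obj (Under I)" "m \<in> Arr (Map0 W i)" for i m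
    using ntrans_nat[of "MCmp \<rho> i" m "L i" "Map0 W i"] that by (simp add: \<sigma>_def)
  have \<sigma>_mod: "FArr (T0 (lam (ic w)) a) (NCmp (T1 \<theta>' w) x) \<cdot>\<^bsub>L (ic w)\<^esub> \<sigma> (ic w) (FObj (Map1 W w) x)
     = FArr (Map1 C w) (\<sigma> (id' w) x) \<cdot>\<^bsub>L (ic w)\<^esub> FArr (T0 (lam (ic w)) a) (NCmp (T1 \<theta> w) x)"
    if "w \<in> Arr (Under I)" "x \<in> Obj (Map0 W (id' w))" for w x
    using E.modificationD(7)[OF r(1) that refl] that by (simp add: \<sigma>_def)
  let ?S = "(\<lambda>(i, x). (i, \<sigma> i x, FObj (T0 \<theta> i) x, FObj (T0 \<theta>' i) x)) ` (SIGMA i:Obj (Under I). Obj (Map0 W i))"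
  have "\<exists>u\<in>\<Sigma>. ud u = a \<and> (\<forall>(i, m, x, y)\<in>?S. \<exists>f. fr i m x y u u f)"
    by (rule lift_finite[OF finite_imageI[OF finite_W(1)] a]) auto
  then obtain u where u: "u \<in> \<Sigma>" "ud u = a"
    "\<And>i x. i \<in> Obj (Under I) \<Longrightarrow> x \<in> Obj (Map0 W i) \<Longrightarrow> \<exists>f. fr i (\<sigma> i x) (FObj (T0 \<theta> i) x) (FObj (T0 \<theta>' i) x) u u f"
    by force
  then obtain f where f: "\<And>i x. i \<in> Obj (Under I) \<Longrightarrow> x \<in> Obj (Map0 W i) \<Longrightarrow>
    fr i (\<sigma> i x) (FObj (T0 \<theta> i) x) (FObj (T0 \<theta>' i) x) u u (f i x)" by metis
  note [simp] = u(1,2)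
  let ?d = "uc u"
  \<comment> \<open>\<open>?Q1\<close> collects the naturality squares of the components and
    \<open>?Q2\<close> the modification equations; each side is written as a representative over
    \<open>u\<close>.\<close>
  let ?Q1 = "(\<lambda>(i, m). (i, f i (Cod (Map0 W i) m) \<cdot>\<^bsub>Map0 F (?d, i)\<^esub> FArr (Map1 (FR i) u) (FArr (T0 \<theta> i) m),
     FArr (Map1 (FR i) u) (FArr (T0 \<theta>' i) m) \<cdot>\<^bsub>Map0 F (?d, i)\<^esub> f i (Dom (Map0 W i) m))) ` (SIGMA i:Obj (Under I). Arr (Map0 W i))"
  let ?Q2 = "(\<lambda>(w, x). (ic w, FArr (Map1 (FR (ic w)) u) (NCmp (T1 \<theta>' w) x) \<cdot>\<^bsub>Map0 F (?d, ic w)\<^esub> f (ic w) (FObj (Map1 W w) x),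
     FArr (Map1 (FL ?d) w) (f (id' w) x) \<cdot>\<^bsub>Map0 F (?d, ic w)\<^esub> FArr (Map1 (FR (ic w)) u) (NCmp (T1 \<theta> w) x))) ` (SIGMA w:Arr (Under I). Obj (Map0 W (id' w)))"
  have q1: "\<exists>k x y. fr i k x y u u (f i (Cod (Map0 W i) m) \<cdot>\<^bsub>Map0 F (?d, i)\<^esub> FArr (Map1 (FR i) u) (FArr (T0 \<theta> i) m)) \<and>
     fr i k x y u u (FArr (Map1 (FR i) u) (FArr (T0 \<theta>' i) m) \<cdot>\<^bsub>Map0 F (?d, i)\<^esub> f i (Dom (Map0 W i) m))"
    if im [simp]: "i \<in> Obj (Under I)" "m \<in> Arr (Map0 W i)" for i m
  proof -
    have "fr i (\<sigma> i (Cod (Map0 W i) m) \<cdot>\<^bsub>L i\<^esub> FArr (T0 (lam i) a) (FArr (T0 \<theta> i) m)) (FObj (T0 \<theta> i) (Dom (Map0 W i) m)) (FObj (T0 \<theta>' i) (Cod (Map0 W i) m)) u u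
       (f i (Cod (Map0 W i) m) \<cdot>\<^bsub>Map0 F (?d, i)\<^esub> FArr (Map1 (FR i) u) (FArr (T0 \<theta> i) m))"
      by (rule fr_comp[OF im(1) fr_arr f]) simp_all
    moreover have "fr i (FArr (T0 (lam i) a) (FArr (T0 \<theta>' i) m) \<cdot>\<^bsub>L i\<^esub> \<sigma> i (Dom (Map0 W i) m)) (FObj (T0 \<theta> i) (Dom (Map0 W i) m)) (FObj (T0 \<theta>' i) (Cod (Map0 W i) m)) u u
       (FArr (Map1 (FR i) u) (FArr (T0 \<theta>' i) m) \<cdot>\<^bsub>Map0 F (?d, i)\<^esub> f i (Dom (Map0 W i) m))"
      by (rule fr_comp[OF im(1) f fr_arr]) simp_all
    ultimately show ?thesis unfolding \<sigma>_nat[OF im] by blast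
  qed
  have q2: "\<exists>k y z. fr (ic w) k y z u u (FArr (Map1 (FR (ic w)) u) (NCmp (T1 \<theta>' w) x) \<cdot>\<^bsub>Map0 F (?d, ic w)\<^esub> f (ic w) (FObj (Map1 W w) x)) \<and>
     fr (ic w) k y z u u (FArr (Map1 (FL ?d) w) (f (id' w) x) \<cdot>\<^bsub>Map0 F (?d, ic w)\<^esub> FArr (Map1 (FR (ic w)) u) (NCmp (T1 \<theta> w) x))"
    if w [simp]: "w \<in> Arr (Under I)" "x \<in> Obj (Map0 W (id' w))" for w x
  proof -
    have j: "ic w \<in> Obj (Under I)" by simp
    have "fr (ic w) (FArr (T0 (lam (ic w)) a) (NCmp (T1 \<theta>' w) x) \<cdot>\<^bsub>L (ic w)\<^esub> \<sigma> (ic w) (FObj (Map1 W w) x))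
       (FObj (T0 \<theta> (ic w)) (FObj (Map1 W w) x)) (FObj (Map1 (FL a) w) (FObj (T0 \<theta>' (id' w)) x)) u u
      (FArr (Map1 (FR (ic w)) u) (NCmp (T1 \<theta>' w) x) \<cdot>\<^bsub>Map0 F (?d, ic w)\<^esub> f (ic w) (FObj (Map1 W w) x))"
      by (rule fr_comp[OF j f fr_arr]) simp_all
    moreover have "fr (ic w) (FArr (Map1 C w) (\<sigma> (id' w) x) \<cdot>\<^bsub>L (ic w)\<^esub> FArr (T0 (lam (ic w)) a) (NCmp (T1 \<theta> w) x))
       (FObj (T0 \<theta> (ic w)) (FObj (Map1 W w) x)) (FObj (Map1 (FL a) w) (FObj (T0 \<theta>' (id' w)) x)) u u
      (FArr (Map1 (FL ?d) w) (f (id' w) x) \<cdot>\<^bsub>Map0 F (?d, ic w)\<^esub> FArr (Map1 (FR (ic w)) u) (NCmp (T1 \<theta> w) x))"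
      by (rule fr_comp[OF j fr_arr frac_weight[OF w(1) f]]) simp_all
    ultimately show ?thesis unfolding \<sigma>_mod[OF w] by blast
  qed
  obtain h where h: "h \<in> \<Sigma>" "ud h = uc u"
    "\<And>i f g. (i, f, g) \<in> ?Q1 \<union> ?Q2 \<Longrightarrow> FArr (Map1 (FR i) h) f = FArr (Map1 (FR i) h) g"
  proof (rule equalize_fr[of "?Q1 \<union> ?Q2" u])
    show "finite (?Q1 \<union> ?Q2)" using finite_W by blast
    fix i f g assume "(i, f, g) \<in> ?Q1 \<union> ?Q2"
    then show "i \<in> Obj (Under I) \<and> (\<exists>m x y. fr i m x y u u f \<and> fr i m x y u u g)"
      using q1 q2 by auto
  qed simp_all
  note [simp] = h(1,2)
  let ?u = "h \<cdot>\<^bsub>Under A\<^esub> u" and ?e = "uc h"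
  define g where "g i x = FArr (Map1 (FR i) h) (f i x)" for i x
  have g: "fr i (\<sigma> i x) (FObj (T0 \<theta> i) x) (FObj (T0 \<theta>' i) x) ?u ?u (g i x)"
    if "i \<in> Obj (Under I)" "x \<in> Obj (Map0 W i)" for i x
    unfolding g_def by (rule fr_ext[OF that(1) f[OF that] h(1,2)])
  have fs [simp]: "f i x \<in> Arr (Map0 F (?d, i))" "Dom (Map0 F (?d, i)) (f i x) = FObj (Map1 (FR i) u) (FObj (T0 \<theta> i) x)"
    "Cod (Map0 F (?d, i)) (f i x) = FObj (Map1 (FR i) u) (FObj (T0 \<theta>' i) x)"
    if "i \<in> Obj (Under I)" "x \<in> Obj (Map0 W i)" for i x
    using frD(6-8)[OF that(1) f[OF that]] by simp_all
  have gs [simp]: "g i x \<in> Arr (Map0 F (?e, i))" "Dom (Map0 F (?e, i)) (g i x) = FObj (Map1 (FR i) h) (FObj (Map1 (FR i) u) (FObj (T0 \<theta> i) x))"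
    "Cod (Map0 F (?e, i)) (g i x) = FObj (Map1 (FR i) h) (FObj (Map1 (FR i) u) (FObj (T0 \<theta>' i) x))"
    if "i \<in> Obj (Under I)" "x \<in> Obj (Map0 W i)" for i x
    using that by (simp_all add: g_def)
  have g_nat: "g i (Cod (Map0 W i) m) \<cdot>\<^bsub>Map0 F (?e, i)\<^esub> FArr (Map1 (FR i) h) (FArr (Map1 (FR i) u) (FArr (T0 \<theta> i) m))
     = FArr (Map1 (FR i) h) (FArr (Map1 (FR i) u) (FArr (T0 \<theta>' i) m)) \<cdot>\<^bsub>Map0 F (?e, i)\<^esub> g i (Dom (Map0 W i) m)"
    if "i \<in> Obj (Under I)" "m \<in> Arr (Map0 W i)" for i m
  proof -
    have "FArr (Map1 (FR i) h) (f i (Cod (Map0 W i) m) \<cdot>\<^bsub>Map0 F (?d, i)\<^esub> FArr (Map1 (FR i) u) (FArr (T0 \<theta> i) m))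
      = FArr (Map1 (FR i) h) (FArr (Map1 (FR i) u) (FArr (T0 \<theta>' i) m) \<cdot>\<^bsub>Map0 F (?d, i)\<^esub> f i (Dom (Map0 W i) m))"
      by (rule h(3)) (use that in force)
    then show ?thesis using that by (simp add: g_def)
  qed
  have g_mod: "FArr (Map1 (FR (ic w)) h) (FArr (Map1 (FR (ic w)) u) (NCmp (T1 \<theta>' w) x)) \<cdot>\<^bsub>Map0 F (?e, ic w)\<^esub> g (ic w) (FObj (Map1 W w) x)
     = FArr (Map1 (FL ?e) w) (g (id' w) x) \<cdot>\<^bsub>Map0 F (?e, ic w)\<^esub> FArr (Map1 (FR (ic w)) h) (FArr (Map1 (FR (ic w)) u) (NCmp (T1 \<theta> w) x))"
    if "w \<in> Arr (Under I)" "x \<in> Obj (Map0 W (id' w))" for w x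
  proof -
    have "FArr (Map1 (FR (ic w)) h) (FArr (Map1 (FR (ic w)) u) (NCmp (T1 \<theta>' w) x) \<cdot>\<^bsub>Map0 F (?d, ic w)\<^esub> f (ic w) (FObj (Map1 W w) x))
      = FArr (Map1 (FR (ic w)) h) (FArr (Map1 (FL ?d) w) (f (id' w) x) \<cdot>\<^bsub>Map0 F (?d, ic w)\<^esub> FArr (Map1 (FR (ic w)) u) (NCmp (T1 \<theta> w) x))"
      by (rule h(3)) (use that in force)
    then show ?thesis using that by (simp add: g_def F_commute_arr F_commute_obj)
  qed
  have us: "?u \<in> \<Sigma>" "ud ?u = a" "uc ?u = ?e" by simp_all
  let ?t = "\<lambda>i. Map1 (FR i) ?u"
  interpret M: natural_family I W "FL a" "FL ?e" ?t
    rewrites "\<And>i. Map0 (FL a) i = Map0 F (a, i)" and "\<And>i. Map0 (FL ?e) i = Map0 F (?e, i)"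
    by (rule NF) simp_all
  define \<phi> where "\<phi> = \<lparr>MSrc = post_transf I ?t \<theta>, MTgt = post_transf I ?t \<theta>',
    MCmp = (\<lambda>i\<in>Obj (Under I). mkN (?t i \<cdot>F T0 \<theta> i) (?t i \<cdot>F T0 \<theta>' i) (g i))\<rparr>"
  have n: "is_ntrans (mkN (?t i \<cdot>F T0 \<theta> i) (?t i \<cdot>F T0 \<theta>' i) (g i))" if "i \<in> Obj (Under I)" for i
    by (rule is_ntrans_mkN[where C="Map0 W i" and D="Map0 F (?e, i)"]) (use that g_nat in simp_all)
  have \<phi>s [simp]: "MSrc \<phi> = post_transf I ?t \<theta>" "MTgt \<phi> = post_transf I ?t \<theta>'"
    "i \<in> Obj (Under I) \<Longrightarrow> MCmp \<phi> i = mkN (?t i \<cdot>F T0 \<theta> i) (?t i \<cdot>F T0 \<theta>' i) (g i)" for i by (simp_all add: \<phi>_def)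
  have \<phi>m: "md ?e \<phi>"
    by (rule M.WH.modificationI) (use n g_mod in \<open>simp_all, simp_all add: \<phi>_def\<close>)
  have pt: "pnL ?e (post_transf I ?t \<theta>)" "pnL ?e (post_transf I ?t \<theta>')" by simp_all
  let ?x = "p.l.Tc ?u \<theta>" and ?y = "p.l.Tc ?u \<theta>'" and ?z = "p.l.Ta ?e \<phi>"
  have eo: "?e \<in> Obj (Under A)" by simp
  have bo: "FObj (Map1 B ?u) \<theta> = post_transf I ?t \<theta>" "FObj (Map1 B ?u) \<theta>' = post_transf I ?t \<theta>'"
    using B_map(1)[of ?u a] by simp_all
  have uA: "?u \<in> Arr (Under A)" using us by simp
  have bs: "\<theta> \<in> Obj (Map0 B (ud ?u))" "\<theta>' \<in> Obj (Map0 B (ud ?u))" unfolding us by simp_all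
  have xs: "?x \<in> Arr P" "Dom P ?x = p.l.To ?e (post_transf I ?t \<theta>)" "Cod P ?x = p.l.To a \<theta>"
    "?y \<in> Arr P" "Dom P ?y = p.l.To ?e (post_transf I ?t \<theta>')" "Cod P ?y = p.l.To a \<theta>'" "is_iso P ?x" "is_iso P ?y"
    using Tc_props[OF us(1,2) t(1)] Tc_props[OF us(1,2) t(2)] unfolding us by blast+
  note ix = xs(7,8)
  have zs: "?z \<in> Arr P" "Dom P ?z = Dom P ?x" "Cod P ?z = Dom P ?y"
    using functor_arr[OF p.l.T0_functor(1,3)[OF eo], of \<phi>] p.l.T0_functor(2)[OF eo] \<phi>m eo xs by simp_all
  \<comment> \<open>The arrow of \<open>P\<close> that is the fraction with both legs
    \<open>h u\<close> and representative \<open>\<phi>\<close>.\<close>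
  let ?m = "(?y \<cdot>\<^bsub>P\<^esub> ?z) \<cdot>\<^bsub>P\<^esub> cinv P ?x"
  have ms: "?m \<in> Arr P" "Dom P ?m = p.l.To a \<theta>" "Cod P ?m = p.l.To a \<theta>'" using xs zs ix by simp_all
  have "?m \<cdot>\<^bsub>P\<^esub> ?x = ?y \<cdot>\<^bsub>P\<^esub> ?z" using xs zs ix by (simp add: cat_assoc)
  then have "FArr K (?m \<cdot>\<^bsub>P\<^esub> ?x) = FArr K (?y \<cdot>\<^bsub>P\<^esub> ?z)" by simp
  moreover have "FArr K (?m \<cdot>\<^bsub>P\<^esub> ?x) = FArr K ?m \<cdot>\<^bsub>bilim I W C\<^esub> FArr K ?x"
    by (rule K_comp) (use xs ms in simp_all)
  moreover have "FArr K (?y \<cdot>\<^bsub>P\<^esub> ?z) = FArr K ?y \<cdot>\<^bsub>bilim I W C\<^esub> FArr K ?z"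
    by (rule K_comp) (use xs zs in simp_all)
  ultimately have e1: "FArr K ?m \<cdot>\<^bsub>bilim I W C\<^esub> FArr K ?x = FArr K ?y \<cdot>\<^bsub>bilim I W C\<^esub> FArr K ?z" by simp
  interpret Mc: natural_family_cell I W "FL a" C "\<lambda>i. T0 (lam i) ?e \<cdot>F ?t i" "\<lambda>i. T0 (lam i) a" "\<lambda>i. T1 (lam i) ?u"
    rewrites "\<And>i. Map0 (FL a) i = Map0 F (a, i)" and "\<And>i. Map0 C i = L i"
    by (rule NLc) simp_all
  have kx: "FArr K ?x = post_cell I (\<lambda>i. T0 (lam i) ?e \<cdot>F ?t i) (\<lambda>i. T0 (lam i) a) (\<lambda>i. T1 (lam i) ?u) \<theta>"
    "FArr K ?y = post_cell I (\<lambda>i. T0 (lam i) ?e \<cdot>F ?t i) (\<lambda>i. T0 (lam i) a) (\<lambda>i. T1 (lam i) ?u) \<theta>'"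
    using K_map(3)[OF a uA us(2) t(1)] K_map(3)[OF a uA us(2) t(2)] unfolding us(3) .
  have kz: "FArr K ?z = post_modif I (\<lambda>i. T0 (lam i) ?e) \<phi>" by (rule K_map(2)[OF eo \<phi>m])
  have zm: "E.modification (post_modif I (\<lambda>i. T0 (lam i) ?e) \<phi>)" by (rule K_map(5)[OF eo \<phi>m])
  have pe: "post_transf I (\<lambda>i. T0 (lam i) ?e) (post_transf I ?t z) = post_transf I (\<lambda>i. T0 (lam i) ?e \<cdot>F ?t i) z"
    if "pnL a z" for z
    by (rule E.pn_eqI[OF K_map(4)[OF eo]]) (use that in simp_all)
  \<comment> \<open>On components this is the defining equation of the fraction that presents
    \<open>\<sigma> i x\<close> with representative \<open>g i x\<close>.\<close>
  have e2: "FArr K ?y \<cdot>\<^bsub>bilim I W C\<^esub> FArr K ?z = \<rho> \<cdot>\<^bsub>bilim I W C\<^esub> FArr K ?x"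
    unfolding kx kz
  proof (rule E.modification_eqI[OF E.modification_comp E.modification_comp])
    fix i x assume i: "i \<in> Obj (Under I)" "x \<in> Obj (Map0 W i)"
    show "NCmp (MCmp (post_cell I (\<lambda>i. T0 (lam i) ?e \<cdot>F ?t i) (\<lambda>i. T0 (lam i) a) (\<lambda>i. T1 (lam i) ?u) \<theta>' \<cdot>\<^bsub>bilim I W C\<^esub>
        post_modif I (\<lambda>i. T0 (lam i) ?e) \<phi>) i) x
      = NCmp (MCmp (\<rho> \<cdot>\<^bsub>bilim I W C\<^esub> post_cell I (\<lambda>i. T0 (lam i) ?e \<cdot>F ?t i) (\<lambda>i. T0 (lam i) a) (\<lambda>i. T1 (lam i) ?u) \<theta>) i) x"
      using i frD(12)[OF i(1) g[OF i]] by (simp add: \<sigma>_def)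
  qed (use zm pe in simp_all)
  have "FArr K ?m = \<rho>"
  proof (rule iso_epi[OF E.bilim_cat])
    show "is_iso (bilim I W C) (FArr K ?x)" by (rule functor_is_iso) (use ix in simp_all)
    show "FArr K ?m \<cdot>\<^bsub>bilim I W C\<^esub> FArr K ?x = \<rho> \<cdot>\<^bsub>bilim I W C\<^esub> FArr K ?x" unfolding e1 e2 ..
    show "FArr K ?m \<in> Arr (bilim I W C)" using functor_arr(1)[OF K_functor(1,3)] ms by simp
    have "Dom (bilim I W C) (FArr K ?m) = FObj K (Dom P ?m)" "Cod (bilim I W C) (FArr K ?x) = FObj K (Cod P ?x)"
      using functor_arr(2,3)[OF K_functor(1,3)] ms xs unfolding K_functor(2) by blast+
    then show "Dom (bilim I W C) (FArr K ?m) = Cod (bilim I W C) (FArr K ?x)" unfolding ms xs by simp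
    have "Cod (bilim I W C) (FArr K ?x) = post_transf I (\<lambda>i. T0 (lam i) a) \<theta>" unfolding kx by simp
    then show "Dom (bilim I W C) \<rho> = Cod (bilim I W C) (FArr K ?x)" using r by simp
  qed (use r in simp)
  then show ?thesis using ms by (intro bexI[of _ ?m]) simp_all
qed

text \<open>Arbitrary objects of \<open>P\<close> come from different indices. F0 joins these, and
  the legs of the universal cone at arrows of \<open>\<Sigma>\<close> are isomorphisms onto the
  given objects, so the problem is conjugated to one over a single index.\<close>

lemma K_full:
  assumes "x \<in> Obj P" "y \<in> Obj P" and g: "g \<in> hom (bilim I W C) (FObj K x) (FObj K y)"
  shows "\<exists>m\<in>hom P x y. FArr K m = g"
proof -
  obtain a \<theta> where a: "a \<in> Obj (Under A)" "\<theta> \<in> Obj (Map0 B a)" "x = p.l.To a \<theta>" using assms(1) by (rule p.colim_obj)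
  obtain b \<theta>' where b: "b \<in> Obj (Under A)" "\<theta>' \<in> Obj (Map0 B b)" "y = p.l.To b \<theta>'" using assms(2) by (rule p.colim_obj)
  obtain u v where u: "u \<in> \<Sigma>" "v \<in> \<Sigma>" "ud u = a" "ud v = b" "uc v = uc u" by (rule F0[OF a(1) b(1)])
  let ?D = "bilim I W C" and ?c = "uc u"
  have c: "?c \<in> Obj (Under A)" using u by simp
  let ?s = "FObj (Map1 B u) \<theta>" and ?t = "FObj (Map1 B v) \<theta>'"
  have st: "?s \<in> Obj (Map0 B ?c)" "?t \<in> Obj (Map0 B ?c)"
    using functor_obj[OF p.Map1_functor(1,3), of u \<theta>] functor_obj[OF p.Map1_functor(1,3), of v \<theta>'] p.Map1_functor(2)[of u]
      p.Map1_functor(2)[of v] u a b by simp_all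
  let ?x = "p.l.Tc u \<theta>" and ?y = "p.l.Tc v \<theta>'"
  have ix: "is_iso P ?x" "is_iso P ?y" using u a b by simp_all
  have xs: "?x \<in> Arr P" "Dom P ?x = p.l.To ?c ?s" "Cod P ?x = x" "?y \<in> Arr P" "Dom P ?y = p.l.To ?c ?t" "Cod P ?y = y"
    using u a b by simp_all
  have ik: "is_iso ?D (FArr K ?x)" "is_iso ?D (FArr K ?y)" using ix by (auto intro!: functor_is_iso)
  have ks: "FArr K m \<in> Arr ?D" "Dom ?D (FArr K m) = FObj K (Dom P m)" "Cod ?D (FArr K m) = FObj K (Cod P m)" if "m \<in> Arr P" for m
    using functor_arr[OF K_functor(1,3), of m] that unfolding K_functor(2) by blast+
  have gs: "g \<in> Arr ?D" "Dom ?D g = FObj K x" "Cod ?D g = FObj K y" using g unfolding in_hom_iff by blast+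
  let ?\<rho> = "cinv ?D (FArr K ?y) \<cdot>\<^bsub>?D\<^esub> (g \<cdot>\<^bsub>?D\<^esub> FArr K ?x)"
  have cy: "cinv ?D (FArr K ?y) \<in> Arr ?D" "Dom ?D (cinv ?D (FArr K ?y)) = FObj K y" "Cod ?D (cinv ?D (FArr K ?y)) = FObj K (p.l.To ?c ?t)"
    using cinv_props(1-3)[OF ik(2)] ks[OF xs(4)] unfolding xs by simp_all
  have gx: "g \<cdot>\<^bsub>?D\<^esub> FArr K ?x \<in> Arr ?D" "Dom ?D (g \<cdot>\<^bsub>?D\<^esub> FArr K ?x) = FObj K (p.l.To ?c ?s)" "Cod ?D (g \<cdot>\<^bsub>?D\<^esub> FArr K ?x) = FObj K y"
    using cat_comp[OF E.bilim_cat ks(1)[OF xs(1)] gs(1)] ks[OF xs(1)] gs unfolding xs by metis+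
  have rs: "?\<rho> \<in> Arr ?D" "Dom ?D ?\<rho> = FObj K (p.l.To ?c ?s)" "Cod ?D ?\<rho> = FObj K (p.l.To ?c ?t)"
    using cat_comp[OF E.bilim_cat gx(1) cy(1)] gx cy by metis+
  have "\<exists>m\<in>hom P (p.l.To ?c ?s) (p.l.To ?c ?t). FArr K m = ?\<rho>"
  proof (rule K_full_same[OF c])
    have pn: "pnL ?c ?s" "pnL ?c ?t" using st c by simp_all
    show "pnL ?c ?s" "pnL ?c ?t" by (fact pn)+
    show "MSrc ?\<rho> = post_transf I (\<lambda>i. T0 (lam i) ?c) ?s"
      using rs(2) unfolding K_map(1)[OF c pn(1)] E.bilim_sel(2) .
    show "MTgt ?\<rho> = post_transf I (\<lambda>i. T0 (lam i) ?c) ?t"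
      using rs(3) unfolding K_map(1)[OF c pn(2)] E.bilim_sel(3) .
    show "E.modification ?\<rho>" using rs(1) unfolding E.bilim_arr .
  qed
  then obtain m where m: "m \<in> Arr P" "Dom P m = p.l.To ?c ?s" "Cod P m = p.l.To ?c ?t" "FArr K m = ?\<rho>" by auto
  let ?n = "(?y \<cdot>\<^bsub>P\<^esub> m) \<cdot>\<^bsub>P\<^esub> cinv P ?x"
  have ns: "?n \<in> Arr P" "Dom P ?n = x" "Cod P ?n = y" using xs m ix by simp_all
  have "?n \<cdot>\<^bsub>P\<^esub> ?x = ?y \<cdot>\<^bsub>P\<^esub> m" using xs m ix by (simp add: cat_assoc)
  then have "FArr K ?n \<cdot>\<^bsub>?D\<^esub> FArr K ?x = FArr K ?y \<cdot>\<^bsub>?D\<^esub> FArr K m"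
    using K_comp[of ?x ?n] K_comp[of m ?y] xs m(1-3) ns by simp
  also have "\<dots> = g \<cdot>\<^bsub>?D\<^esub> FArr K ?x"
    unfolding m(4) by (rule cinv_cancel'[OF E.bilim_cat ik(2) gx(1)]) (simp only: gx ks[OF xs(4)] xs)
  finally have e: "FArr K ?n \<cdot>\<^bsub>?D\<^esub> FArr K ?x = g \<cdot>\<^bsub>?D\<^esub> FArr K ?x" .
  have "FArr K ?n = g"
    by (rule iso_epi[OF E.bilim_cat ik(1) ks(1)[OF ns(1)] gs(1) _ _ e]) (simp_all only: ks[OF ns(1)] ks[OF xs(1)] ns xs gs)
  then show ?thesis using ns by (intro bexI[of _ ?n]) simp_all
qed

section \<open>Essential surjectivity of the comparison functor\<close>

lemma finite_pairs:
  "finite {(i, m, n). i \<in> Obj (Under I) \<and> m \<in> Arr (Map0 W i) \<and> n \<in> Arr (Map0 W i) \<and> Cod (Map0 W i) m = Dom (Map0 W i) n}"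
  "finite {(w, v, x). w \<in> Arr (Under I) \<and> v \<in> Arr (Under I) \<and> ic w = id' v \<and> x \<in> Obj (Map0 W (id' w))}"
proof -
  have f: "finite (SIGMA i:Obj (Under I). Arr (Map0 W i) \<times> Arr (Map0 W i))"
    "finite (SIGMA w:Arr (Under I). Arr (Under I) \<times> Obj (Map0 W (id' w)))"
    using finI finW by (auto simp: finite_two_category_def finite_weight_def finite_cat_def)
  show "finite {(i, m, n). i \<in> Obj (Under I) \<and> m \<in> Arr (Map0 W i) \<and> n \<in> Arr (Map0 W i) \<and> Cod (Map0 W i) m = Dom (Map0 W i) n}"
    by (rule finite_subset[OF _ f(1)]) auto
  show "finite {(w, v, x). w \<in> Arr (Under I) \<and> v \<in> Arr (Under I) \<and> ic w = id' v \<and> x \<in> Obj (Map0 W (id' w))}"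
    by (rule finite_subset[OF _ f(2)]) auto
qed

text \<open>Objects of the \<open>L i\<close> lift to unrelated indices. Moving a lift along an
  arrow \<open>u\<close> of \<open>\<Sigma>\<close> changes its image by the isomorphism
  \<open>\<lambda>\<^sub>u\<close>, so what persists is an isomorphism onto the given value, not
  equality; hence the family \<open>e\<close>.\<close>

lemma common_lift:
  assumes p: "E.pn \<theta>"
  obtains a t e where "a \<in> Obj (Under A)" "\<And>i x. i \<in> Obj (Under I) \<Longrightarrow> x \<in> Obj (Map0 W i) \<Longrightarrow>
    t i x \<in> Obj (Map0 F (a, i)) \<and> e i x \<in> hom (L i) (FObj (T0 (lam i) a) (t i x)) (FObj (T0 \<theta> i) x) \<and> is_iso (L i) (e i x)"
proof -
  let ?\<Psi> = "\<lambda>(i, x) a. \<exists>t\<in>Obj (Map0 F (a, i)). \<exists>e\<in>hom (L i) (FObj (T0 (lam i) a) t) (FObj (T0 \<theta> i) x). is_iso (L i) e"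
  have "\<exists>a\<in>Obj (Under A). \<forall>s\<in>(SIGMA i:Obj (Under I). Obj (Map0 W i)). ?\<Psi> s a"
  proof (rule common_object[OF finite_W(1)])
    fix s assume "s \<in> (SIGMA i:Obj (Under I). Obj (Map0 W i))"
    then obtain i x where s: "s = (i, x)" "i \<in> Obj (Under I)" "x \<in> Obj (Map0 W i)" by auto
    interpret c: sigma_colimit A \<Sigma> "FR i" "L i" "lam i" by (rule colimR) (use s in simp)
    have "FObj (T0 \<theta> i) x \<in> Obj (L i)" using s p by simp
    then obtain a t where "a \<in> Obj (Under A)" "t \<in> Obj (Map0 (FR i) a)" "FObj (T0 \<theta> i) x = c.l.To a t" by (rule c.colim_obj)
    then show "\<exists>a\<in>Obj (Under A). ?\<Psi> s a" using s
      by (intro bexI[of _ a]) (auto intro!: bexI[of _ t] bexI[of _ "Ident (L i) (c.l.To a t)"])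
  next
    fix s u assume "s \<in> (SIGMA i:Obj (Under I). Obj (Map0 W i))" and u: "u \<in> \<Sigma>" and s1: "?\<Psi> s (ud u)"
    then obtain i x where s: "s = (i, x)" "i \<in> Obj (Under I)" "x \<in> Obj (Map0 W i)" by auto
    from s1 obtain t e where t: "t \<in> Obj (Map0 F (ud u, i))" "e \<in> Arr (L i)" "Dom (L i) e = FObj (T0 (lam i) (ud u)) t"
      "Cod (L i) e = FObj (T0 \<theta> i) x" "is_iso (L i) e" unfolding s by auto
    show "?\<Psi> s (uc u)" unfolding s prod.case
      by (rule bexI[of _ "FObj (Map1 (FR i) u) t"], rule bexI[of _ "e \<cdot>\<^bsub>L i\<^esub> NCmp (T1 (lam i) u) t"])
        (use s t u in simp_all)
  qed
  then obtain a where a: "a \<in> Obj (Under A)" "\<And>i x. i \<in> Obj (Under I) \<Longrightarrow> x \<in> Obj (Map0 W i) \<Longrightarrow> ?\<Psi> (i, x) a" by auto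
  then have "\<forall>i x. \<exists>t e. i \<in> Obj (Under I) \<longrightarrow> x \<in> Obj (Map0 W i) \<longrightarrow>
    t \<in> Obj (Map0 F (a, i)) \<and> e \<in> hom (L i) (FObj (T0 (lam i) a) t) (FObj (T0 \<theta> i) x) \<and> is_iso (L i) e"
    unfolding prod.case by meson
  then obtain t where "\<forall>i x. \<exists>e. i \<in> Obj (Under I) \<longrightarrow> x \<in> Obj (Map0 W i) \<longrightarrow>
    t i x \<in> Obj (Map0 F (a, i)) \<and> e \<in> hom (L i) (FObj (T0 (lam i) a) (t i x)) (FObj (T0 \<theta> i) x) \<and> is_iso (L i) e"
    by metis
  then obtain e where "\<forall>i x. i \<in> Obj (Under I) \<longrightarrow> x \<in> Obj (Map0 W i) \<longrightarrow>
    t i x \<in> Obj (Map0 F (a, i)) \<and> e i x \<in> hom (L i) (FObj (T0 (lam i) a) (t i x)) (FObj (T0 \<theta> i) x) \<and> is_iso (L i) (e i x)"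
    by metis
  then show ?thesis using that[OF a(1), of t e] by blast
qed

text \<open>Once object values are images on the nose, a pseudonatural transformation is a finite
  family of arrows subject to finitely many equations. The arrows are lifted to one stage and all
  equations are then enforced together at a later one; the stage in the conclusion is the composite
  of both.\<close>

lemma lift_structure:
  assumes a [simp]: "a \<in> Obj (Under A)" and p [simp]: "E.pn \<theta>"
    and t: "\<And>i x. i \<in> Obj (Under I) \<Longrightarrow> x \<in> Obj (Map0 W i) \<Longrightarrow> t i x \<in> Obj (Map0 F (a, i))"
    and \<theta>t: "\<And>i x. i \<in> Obj (Under I) \<Longrightarrow> x \<in> Obj (Map0 W i) \<Longrightarrow> FObj (T0 \<theta> i) x = FObj (T0 (lam i) a) (t i x)"
  obtains u f g where "u \<in> \<Sigma>" "ud u = a"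
    and "\<And>i m. i \<in> Obj (Under I) \<Longrightarrow> m \<in> Arr (Map0 W i) \<Longrightarrow>
      fr i (FArr (T0 \<theta> i) m) (t i (Dom (Map0 W i) m)) (t i (Cod (Map0 W i) m)) u u (f i m)"
    and "\<And>w x. w \<in> Arr (Under I) \<Longrightarrow> x \<in> Obj (Map0 W (id' w)) \<Longrightarrow>
      fr (ic w) (NCmp (T1 \<theta> w) x) (t (ic w) (FObj (Map1 W w) x)) (FObj (Map1 (FL a) w) (t (id' w) x)) u u (g w x)"
    and "\<And>i m n. i \<in> Obj (Under I) \<Longrightarrow> m \<in> Arr (Map0 W i) \<Longrightarrow> n \<in> Arr (Map0 W i) \<Longrightarrow>
      Cod (Map0 W i) m = Dom (Map0 W i) n \<Longrightarrow> f i (n \<cdot>\<^bsub>Map0 W i\<^esub> m) = f i n \<cdot>\<^bsub>Map0 F (uc u, i)\<^esub> f i m"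
    and "\<And>i x. i \<in> Obj (Under I) \<Longrightarrow> x \<in> Obj (Map0 W i) \<Longrightarrow>
      f i (Ident (Map0 W i) x) = Ident (Map0 F (uc u, i)) (FObj (Map1 (FR i) u) (t i x))"
    and "\<And>w x. w \<in> Arr (Under I) \<Longrightarrow> x \<in> Obj (Map0 W (id' w)) \<Longrightarrow> is_iso (Map0 F (uc u, ic w)) (g w x)"
    and "\<And>w m. w \<in> Arr (Under I) \<Longrightarrow> m \<in> Arr (Map0 W (id' w)) \<Longrightarrow>
      g w (Cod (Map0 W (id' w)) m) \<cdot>\<^bsub>Map0 F (uc u, ic w)\<^esub> f (ic w) (FArr (Map1 W w) m)
      = FArr (Map1 (FL (uc u)) w) (f (id' w) m) \<cdot>\<^bsub>Map0 F (uc u, ic w)\<^esub> g w (Dom (Map0 W (id' w)) m)"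
    and "\<And>i x. i \<in> Obj (Under I) \<Longrightarrow> x \<in> Obj (Map0 W i) \<Longrightarrow>
      g (Ident (Under I) i) x = Ident (Map0 F (uc u, i)) (FObj (Map1 (FR i) u) (t i x))"
    and "\<And>w v x. w \<in> Arr (Under I) \<Longrightarrow> v \<in> Arr (Under I) \<Longrightarrow> ic w = id' v \<Longrightarrow> x \<in> Obj (Map0 W (id' w)) \<Longrightarrow>
      g (v \<cdot>\<^bsub>Under I\<^esub> w) x = FArr (Map1 (FL (uc u)) v) (g w x) \<cdot>\<^bsub>Map0 F (uc u, ic v)\<^esub> g v (FObj (Map1 W w) x)"
    and "\<And>\<mu> w x. \<mu> \<in> Arr (Cells I) \<Longrightarrow> w = Dom (Cells I) \<mu> \<Longrightarrow> x \<in> Obj (Map0 W (id' w)) \<Longrightarrow>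
      NCmp (Map2 (FL (uc u)) \<mu>) (FObj (Map1 (FR (id' w)) u) (t (id' w) x)) \<cdot>\<^bsub>Map0 F (uc u, ic w)\<^esub> g w x
      = g (Cod (Cells I) \<mu>) x \<cdot>\<^bsub>Map0 F (uc u, ic w)\<^esub> f (ic w) (NCmp (Map2 W \<mu>) x)"
proof -
  note [simp] = t \<theta>t
  note cat_assoc [simp]
  interpret W: diagram I W by (intro diagram.intro twoI functorW)
  let ?S1 = "(\<lambda>(i, m). (i, FArr (T0 \<theta> i) m, t i (Dom (Map0 W i) m), t i (Cod (Map0 W i) m))) ` (SIGMA i:Obj (Under I). Arr (Map0 W i))"
  let ?S2 = "(\<lambda>(w, x). (ic w, NCmp (T1 \<theta> w) x, t (ic w) (FObj (Map1 W w) x), FObj (Map1 (FL a) w) (t (id' w) x))) ` (SIGMA w:Arr (Under I). Obj (Map0 W (id' w)))"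
  \<comment> \<open>A lift of an invertible arrow need not be invertible at its stage. The inverses
    of the structure cells are therefore lifted as arrows in their own right, so that the inverse
    laws become two more equations to enforce.\<close>
  let ?S3 = "(\<lambda>(w, x). (ic w, cinv (L (ic w)) (NCmp (T1 \<theta> w) x), FObj (Map1 (FL a) w) (t (id' w) x), t (ic w) (FObj (Map1 W w) x))) ` (SIGMA w:Arr (Under I). Obj (Map0 W (id' w)))"
  have "\<exists>u\<in>\<Sigma>. ud u = a \<and> (\<forall>(i, m, x, y)\<in>?S1 \<union> ?S2 \<union> ?S3. \<exists>f. fr i m x y u u f)"
  proof (rule lift_finite[OF _ a])
    show "finite (?S1 \<union> ?S2 \<union> ?S3)" using finite_W by blast
  qed auto
  then obtain u where u [simp]: "u \<in> \<Sigma>" "ud u = a"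
    and u1: "\<And>i m. i \<in> Obj (Under I) \<Longrightarrow> m \<in> Arr (Map0 W i) \<Longrightarrow> \<exists>f. fr i (FArr (T0 \<theta> i) m) (t i (Dom (Map0 W i) m)) (t i (Cod (Map0 W i) m)) u u f"
    and u2: "\<And>w x. w \<in> Arr (Under I) \<Longrightarrow> x \<in> Obj (Map0 W (id' w)) \<Longrightarrow>
      \<exists>f. fr (ic w) (NCmp (T1 \<theta> w) x) (t (ic w) (FObj (Map1 W w) x)) (FObj (Map1 (FL a) w) (t (id' w) x)) u u f"
    and u3: "\<And>w x. w \<in> Arr (Under I) \<Longrightarrow> x \<in> Obj (Map0 W (id' w)) \<Longrightarrow>
      \<exists>f. fr (ic w) (cinv (L (ic w)) (NCmp (T1 \<theta> w) x)) (FObj (Map1 (FL a) w) (t (id' w) x)) (t (ic w) (FObj (Map1 W w) x)) u u f"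
    unfolding ball_Un by force
  obtain f where f: "\<And>i m. i \<in> Obj (Under I) \<Longrightarrow> m \<in> Arr (Map0 W i) \<Longrightarrow>
      fr i (FArr (T0 \<theta> i) m) (t i (Dom (Map0 W i) m)) (t i (Cod (Map0 W i) m)) u u (f i m)" using u1 by metis
  obtain g where g: "\<And>w x. w \<in> Arr (Under I) \<Longrightarrow> x \<in> Obj (Map0 W (id' w)) \<Longrightarrow>
      fr (ic w) (NCmp (T1 \<theta> w) x) (t (ic w) (FObj (Map1 W w) x)) (FObj (Map1 (FL a) w) (t (id' w) x)) u u (g w x)"
    using u2 by metis
  obtain g' where g': "\<And>w x. w \<in> Arr (Under I) \<Longrightarrow> x \<in> Obj (Map0 W (id' w)) \<Longrightarrow>
      fr (ic w) (cinv (L (ic w)) (NCmp (T1 \<theta> w) x)) (FObj (Map1 (FL a) w) (t (id' w) x)) (t (ic w) (FObj (Map1 W w) x)) u u (g' w x)"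
    using u3 by metis
  let ?d = "uc u"
  let ?F = "\<lambda>i. Map0 F (?d, i)"
  have ti: "FObj (Map1 (FL a) (Ident (Under I) i)) x = x" if "i \<in> Obj (Under I)" "x \<in> Obj (Map0 F (a, i))" for i x
    using that by simp
  \<comment> \<open>In order: preservation of composites and of identities, the two inverse laws for
    \<open>g\<close> and \<open>g'\<close>, naturality of the structure cells, their unit and
    composition laws, and compatibility with 2-cells. In the last family the 2-cell is taken at
    \<open>a\<close> and pushed along \<open>u\<close>, since this is the form in which it
    represents an arrow over \<open>u\<close>.\<close>
  define Q where "Q = (\<lambda>(i, m, n). (i, f i (n \<cdot>\<^bsub>Map0 W i\<^esub> m), f i n \<cdot>\<^bsub>?F i\<^esub> f i m)) `
       {(i, m, n). i \<in> Obj (Under I) \<and> m \<in> Arr (Map0 W i) \<and> n \<in> Arr (Map0 W i) \<and> Cod (Map0 W i) m = Dom (Map0 W i) n}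
    \<union> (\<lambda>(i, x). (i, f i (Ident (Map0 W i) x), Ident (?F i) (FObj (Map1 (FR i) u) (t i x)))) ` (SIGMA i:Obj (Under I). Obj (Map0 W i))
    \<union> (\<lambda>(w, x). (ic w, g' w x \<cdot>\<^bsub>?F (ic w)\<^esub> g w x, Ident (?F (ic w)) (FObj (Map1 (FR (ic w)) u) (t (ic w) (FObj (Map1 W w) x))))) `
       (SIGMA w:Arr (Under I). Obj (Map0 W (id' w)))
    \<union> (\<lambda>(w, x). (ic w, g w x \<cdot>\<^bsub>?F (ic w)\<^esub> g' w x, Ident (?F (ic w)) (FObj (Map1 (FR (ic w)) u) (FObj (Map1 (FL a) w) (t (id' w) x))))) `
       (SIGMA w:Arr (Under I). Obj (Map0 W (id' w)))
    \<union> (\<lambda>(w, m). (ic w, g w (Cod (Map0 W (id' w)) m) \<cdot>\<^bsub>?F (ic w)\<^esub> f (ic w) (FArr (Map1 W w) m),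
         FArr (Map1 (FL ?d) w) (f (id' w) m) \<cdot>\<^bsub>?F (ic w)\<^esub> g w (Dom (Map0 W (id' w)) m))) ` (SIGMA w:Arr (Under I). Arr (Map0 W (id' w)))
    \<union> (\<lambda>(i, x). (i, g (Ident (Under I) i) x, Ident (?F i) (FObj (Map1 (FR i) u) (t i x)))) ` (SIGMA i:Obj (Under I). Obj (Map0 W i))
    \<union> (\<lambda>(w, v, x). (ic v, g (v \<cdot>\<^bsub>Under I\<^esub> w) x, FArr (Map1 (FL ?d) v) (g w x) \<cdot>\<^bsub>?F (ic v)\<^esub> g v (FObj (Map1 W w) x))) `
       {(w, v, x). w \<in> Arr (Under I) \<and> v \<in> Arr (Under I) \<and> ic w = id' v \<and> x \<in> Obj (Map0 W (id' w))}
    \<union> (\<lambda>(\<mu>, x). (ic (Dom (Cells I) \<mu>),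
         FArr (Map1 (FR (ic (Dom (Cells I) \<mu>))) u) (NCmp (Map2 (FL a) \<mu>) (t (id' (Dom (Cells I) \<mu>)) x)) \<cdot>\<^bsub>?F (ic (Dom (Cells I) \<mu>))\<^esub> g (Dom (Cells I) \<mu>) x,
         g (Cod (Cells I) \<mu>) x \<cdot>\<^bsub>?F (ic (Dom (Cells I) \<mu>))\<^esub> f (ic (Dom (Cells I) \<mu>)) (NCmp (Map2 W \<mu>) x))) `
       (SIGMA \<mu>:Arr (Cells I). Obj (Map0 W (id' (Dom (Cells I) \<mu>))))"
  \<comment> \<open>For each family the two sides represent the same arrow of some
    \<open>L i\<close>, by the corresponding law of \<open>\<theta>\<close>; \<open>Q1\<close> to
    \<open>Q8\<close> follow the order of the families in \<open>Q\<close>.\<close>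
  have Q1: "\<exists>k y z. fr i k y z u u (f i (n \<cdot>\<^bsub>Map0 W i\<^esub> m)) \<and> fr i k y z u u (f i n \<cdot>\<^bsub>?F i\<^esub> f i m)"
    if [simp]: "i \<in> Obj (Under I)" "m \<in> Arr (Map0 W i)" "n \<in> Arr (Map0 W i)" and mn: "Cod (Map0 W i) m = Dom (Map0 W i) n" for i m n
  proof -
    have "fr i (FArr (T0 \<theta> i) n \<cdot>\<^bsub>L i\<^esub> FArr (T0 \<theta> i) m) (t i (Dom (Map0 W i) m)) (t i (Cod (Map0 W i) n)) u u (f i n \<cdot>\<^bsub>?F i\<^esub> f i m)"
      by (rule fr_comp[OF _ f[of i m, unfolded mn] f]) simp_all
    moreover have "fr i (FArr (T0 \<theta> i) n \<cdot>\<^bsub>L i\<^esub> FArr (T0 \<theta> i) m) (t i (Dom (Map0 W i) m)) (t i (Cod (Map0 W i) n)) u u (f i (n \<cdot>\<^bsub>Map0 W i\<^esub> m))"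
      using f[of i "n \<cdot>\<^bsub>Map0 W i\<^esub> m"] mn by simp
    ultimately show ?thesis by blast
  qed
  have Q2: "\<exists>k y z. fr i k y z u u (f i (Ident (Map0 W i) x)) \<and> fr i k y z u u (Ident (?F i) (FObj (Map1 (FR i) u) (t i x)))"
    if [simp]: "i \<in> Obj (Under I)" "x \<in> Obj (Map0 W i)" for i x
  proof -
    have "fr i (Ident (L i) (FObj (T0 (lam i) a) (t i x))) (t i x) (t i x) u u (f i (Ident (Map0 W i) x))"
      using f[of i "Ident (Map0 W i) x"] by simp
    moreover have "fr i (Ident (L i) (FObj (T0 (lam i) a) (t i x))) (t i x) (t i x) u u (Ident (?F i) (FObj (Map1 (FR i) u) (t i x)))"
      by (rule fr_ident) simp_all
    ultimately show ?thesis by blast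
  qed
  have Q3: "\<exists>k y z. fr (ic w) k y z u u (g' w x \<cdot>\<^bsub>?F (ic w)\<^esub> g w x) \<and>
      fr (ic w) k y z u u (Ident (?F (ic w)) (FObj (Map1 (FR (ic w)) u) (t (ic w) (FObj (Map1 W w) x))))"
    if [simp]: "w \<in> Arr (Under I)" "x \<in> Obj (Map0 W (id' w))" for w x
  proof -
    have "fr (ic w) (Ident (L (ic w)) (FObj (T0 (lam (ic w)) a) (t (ic w) (FObj (Map1 W w) x)))) (t (ic w) (FObj (Map1 W w) x)) (t (ic w) (FObj (Map1 W w) x)) u u (g' w x \<cdot>\<^bsub>?F (ic w)\<^esub> g w x)"
      using fr_comp[OF _ g[of w x] g'[of w x]] by simp
    moreover have "fr (ic w) (Ident (L (ic w)) (FObj (T0 (lam (ic w)) a) (t (ic w) (FObj (Map1 W w) x)))) (t (ic w) (FObj (Map1 W w) x)) (t (ic w) (FObj (Map1 W w) x)) u u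
      (Ident (?F (ic w)) (FObj (Map1 (FR (ic w)) u) (t (ic w) (FObj (Map1 W w) x))))"
      by (rule fr_ident) simp_all
    ultimately show ?thesis by blast
  qed
  have Q4: "\<exists>k y z. fr (ic w) k y z u u (g w x \<cdot>\<^bsub>?F (ic w)\<^esub> g' w x) \<and>
      fr (ic w) k y z u u (Ident (?F (ic w)) (FObj (Map1 (FR (ic w)) u) (FObj (Map1 (FL a) w) (t (id' w) x))))"
    if [simp]: "w \<in> Arr (Under I)" "x \<in> Obj (Map0 W (id' w))" for w x
  proof -
    let ?y = "FObj (Map1 (FL a) w) (t (id' w) x)"
    have "fr (ic w) (Ident (L (ic w)) (FObj (T0 (lam (ic w)) a) ?y)) ?y ?y u u (g w x \<cdot>\<^bsub>?F (ic w)\<^esub> g' w x)"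
      using fr_comp[OF _ g'[of w x] g[of w x]] by simp
    moreover have "fr (ic w) (Ident (L (ic w)) (FObj (T0 (lam (ic w)) a) ?y)) ?y ?y u u (Ident (?F (ic w)) (FObj (Map1 (FR (ic w)) u) ?y))"
      by (rule fr_ident) simp_all
    ultimately show ?thesis by blast
  qed
  have Q5: "\<exists>k y z. fr (ic w) k y z u u (g w (Cod (Map0 W (id' w)) m) \<cdot>\<^bsub>?F (ic w)\<^esub> f (ic w) (FArr (Map1 W w) m)) \<and>
      fr (ic w) k y z u u (FArr (Map1 (FL ?d) w) (f (id' w) m) \<cdot>\<^bsub>?F (ic w)\<^esub> g w (Dom (Map0 W (id' w)) m))"
    if w [simp]: "w \<in> Arr (Under I)" "m \<in> Arr (Map0 W (id' w))" for w m
  proof -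
    have j: "ic w \<in> Obj (Under I)" by simp
    let ?x = "Dom (Map0 W (id' w)) m" and ?y = "Cod (Map0 W (id' w)) m"
    have "fr (ic w) (NCmp (T1 \<theta> w) ?y \<cdot>\<^bsub>L (ic w)\<^esub> FArr (T0 \<theta> (ic w)) (FArr (Map1 W w) m)) (t (ic w) (FObj (Map1 W w) ?x)) (FObj (Map1 (FL a) w) (t (id' w) ?y)) u u
      (g w ?y \<cdot>\<^bsub>?F (ic w)\<^esub> f (ic w) (FArr (Map1 W w) m))"
      using fr_comp[OF j f[of "ic w" "FArr (Map1 W w) m"], of _ "FObj (Map1 (FL a) w) (t (id' w) ?y)" "g w ?y"] g[of w ?y] by simp
    moreover have "fr (ic w) (FArr (Map1 C w) (FArr (T0 \<theta> (id' w)) m) \<cdot>\<^bsub>L (ic w)\<^esub> NCmp (T1 \<theta> w) ?x) (t (ic w) (FObj (Map1 W w) ?x)) (FObj (Map1 (FL a) w) (t (id' w) ?y)) u u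
      (FArr (Map1 (FL ?d) w) (f (id' w) m) \<cdot>\<^bsub>?F (ic w)\<^esub> g w ?x)"
      by (rule fr_comp[OF j g frac_weight[OF w(1) f]]) simp_all
    ultimately show ?thesis unfolding E.pn_nat[OF p w(1) w(2) refl refl, simplified] by blast
  qed
  have Q6: "\<exists>k y z. fr i k y z u u (g (Ident (Under I) i) x) \<and> fr i k y z u u (Ident (?F i) (FObj (Map1 (FR i) u) (t i x)))"
    if [simp]: "i \<in> Obj (Under I)" "x \<in> Obj (Map0 W i)" for i x
  proof -
    have "fr i (Ident (L i) (FObj (T0 (lam i) a) (t i x))) (t i x) (t i x) u u (g (Ident (Under I) i) x)"
      using g[of "Ident (Under I) i" x] by simp
    moreover have "fr i (Ident (L i) (FObj (T0 (lam i) a) (t i x))) (t i x) (t i x) u u (Ident (?F i) (FObj (Map1 (FR i) u) (t i x)))"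
      by (rule fr_ident) simp_all
    ultimately show ?thesis by blast
  qed
  have Q7: "\<exists>k y z. fr (ic v) k y z u u (g (v \<cdot>\<^bsub>Under I\<^esub> w) x) \<and>
      fr (ic v) k y z u u (FArr (Map1 (FL ?d) v) (g w x) \<cdot>\<^bsub>?F (ic v)\<^esub> g v (FObj (Map1 W w) x))"
    if w [simp]: "w \<in> Arr (Under I)" "v \<in> Arr (Under I)" "x \<in> Obj (Map0 W (id' w))" and wv: "ic w = id' v" for w v x
  proof -
    let ?m = "FArr (Map1 C v) (NCmp (T1 \<theta> w) x) \<cdot>\<^bsub>L (ic v)\<^esub> NCmp (T1 \<theta> v) (FObj (Map1 W w) x)"
    let ?y = "t (ic v) (FObj (Map1 W v) (FObj (Map1 W w) x))" and ?z = "FObj (Map1 (FL a) v) (FObj (Map1 (FL a) w) (t (id' w) x))"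
    have "fr (ic v) ?m ?y ?z u u (g (v \<cdot>\<^bsub>Under I\<^esub> w) x)"
      using g[of "v \<cdot>\<^bsub>Under I\<^esub> w" x] wv by simp
    moreover have "fr (ic v) ?m ?y ?z u u (FArr (Map1 (FL ?d) v) (g w x) \<cdot>\<^bsub>?F (ic v)\<^esub> g v (FObj (Map1 W w) x))"
      by (rule fr_comp[OF _ g frac_weight[OF w(2) g[of w x, unfolded wv]]]) (use wv in simp_all)
    ultimately show ?thesis by blast
  qed
  have Q8: "\<exists>k y z. fr (ic w) k y z u u (FArr (Map1 (FR (ic w)) u) (NCmp (Map2 (FL a) \<mu>) (t (id' w) x)) \<cdot>\<^bsub>?F (ic w)\<^esub> g w x) \<and>
      fr (ic w) k y z u u (g (Cod (Cells I) \<mu>) x \<cdot>\<^bsub>?F (ic w)\<^esub> f (ic w) (NCmp (Map2 W \<mu>) x))"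
    if m [simp]: "\<mu> \<in> Arr (Cells I)" and w: "w = Dom (Cells I) \<mu>" and x [simp]: "x \<in> Obj (Map0 W (id' w))" for \<mu> w x
  proof -
    have [simp]: "w \<in> Arr (Under I)" and x' [simp]: "x \<in> Obj (Map0 W (id' (Dom (Cells I) \<mu>)))" using w x by simp_all
    have j: "ic w \<in> Obj (Under I)" by simp
    let ?v = "Cod (Cells I) \<mu>" and ?c = "NCmp (Map2 (FL a) \<mu>) (t (id' w) x)"
    let ?m = "FArr (T0 (lam (ic w)) a) ?c \<cdot>\<^bsub>L (ic w)\<^esub> NCmp (T1 \<theta> w) x"
    let ?y = "t (ic w) (FObj (Map1 W w) x)" and ?z = "FObj (Map1 (FL a) ?v) (t (id' w) x)"
    have "fr (ic w) ?m ?y ?z u u (FArr (Map1 (FR (ic w)) u) ?c \<cdot>\<^bsub>?F (ic w)\<^esub> g w x)"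
      by (rule fr_comp[OF j g fr_arr]) (simp_all add: w)
    \<comment> \<open>The law of \<open>\<theta>\<close> for \<open>\<mu>\<close> identifies the
      arrows represented by the two sides.\<close>
    moreover have "?m = NCmp (T1 \<theta> ?v) x \<cdot>\<^bsub>L (ic w)\<^esub> FArr (T0 \<theta> (ic w)) (NCmp (Map2 W \<mu>) x)"
      using E.pn_cell[OF p m refl refl x'] by (simp add: w)
    moreover have "fr (ic w) (NCmp (T1 \<theta> ?v) x \<cdot>\<^bsub>L (ic w)\<^esub> FArr (T0 \<theta> (ic w)) (NCmp (Map2 W \<mu>) x)) ?y ?z u u
       (g ?v x \<cdot>\<^bsub>?F (ic w)\<^esub> f (ic w) (NCmp (Map2 W \<mu>) x))"
      using fr_comp[OF j f[of "ic w" "NCmp (Map2 W \<mu>) x"], of _ ?z "g ?v x"] g[of ?v x] by (simp add: w)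
    ultimately show ?thesis by metis
  qed
  obtain h where h [simp]: "h \<in> \<Sigma>" "ud h = uc u"
    and hQ: "\<And>i f g. (i, f, g) \<in> Q \<Longrightarrow> FArr (Map1 (FR i) h) f = FArr (Map1 (FR i) h) g"
  proof (rule equalize_fr[of Q u])
    show "finite Q" unfolding Q_def using finite_W finite_pairs by blast
    fix i f g assume q: "(i, f, g) \<in> Q"
    show "i \<in> Obj (Under I) \<and> (\<exists>m x y. fr i m x y u u f \<and> fr i m x y u u g)"
      \<comment> \<open>Membership in the union is split into the eight families, and each case is
        closed by the matching one of \<open>Q1\<close> to \<open>Q8\<close>.\<close>
      by (insert q[unfolded Q_def], elim UnE imageE SigmaE CollectE case_prodE conjE; simp only: prod.case Pair_inject; clarify;
        (rule conjI, (simp; fail))?, rule Q1 Q2 Q3 Q4 Q5 Q6 Q7 Q8; (assumption | rule refl))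
  qed simp_all
  have H1: "FArr (Map1 (FR i) h) (f i (n \<cdot>\<^bsub>Map0 W i\<^esub> m)) = FArr (Map1 (FR i) h) (f i n \<cdot>\<^bsub>?F i\<^esub> f i m)"
    if "i \<in> Obj (Under I)" "m \<in> Arr (Map0 W i)" "n \<in> Arr (Map0 W i)" "Cod (Map0 W i) m = Dom (Map0 W i) n" for i m n
    \<comment> \<open>The union associates to the left, so the first family lies deepest; the number
      of uses of \<open>UnI1\<close> locates each family, and the last one is reached by
      \<open>UnI2\<close> alone.\<close>
    by (rule hQ, unfold Q_def, rule UnI1, rule UnI1, rule UnI1, rule UnI1, rule UnI1, rule UnI1, rule UnI1, rule rev_image_eqI[of "(i, m, n)"]) (use that in simp_all)
  have H2: "FArr (Map1 (FR i) h) (f i (Ident (Map0 W i) x)) = FArr (Map1 (FR i) h) (Ident (?F i) (FObj (Map1 (FR i) u) (t i x)))"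
    if "i \<in> Obj (Under I)" "x \<in> Obj (Map0 W i)" for i x
    by (rule hQ, unfold Q_def, rule UnI1, rule UnI1, rule UnI1, rule UnI1, rule UnI1, rule UnI1, rule UnI2, rule rev_image_eqI[of "(i, x)"]) (use that in simp_all)
  have H3: "FArr (Map1 (FR (ic w)) h) (g' w x \<cdot>\<^bsub>?F (ic w)\<^esub> g w x)
      = FArr (Map1 (FR (ic w)) h) (Ident (?F (ic w)) (FObj (Map1 (FR (ic w)) u) (t (ic w) (FObj (Map1 W w) x))))"
    if "w \<in> Arr (Under I)" "x \<in> Obj (Map0 W (id' w))" for w x
    by (rule hQ, unfold Q_def, rule UnI1, rule UnI1, rule UnI1, rule UnI1, rule UnI1, rule UnI2, rule rev_image_eqI[of "(w, x)"]) (use that in simp_all)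
  have H4: "FArr (Map1 (FR (ic w)) h) (g w x \<cdot>\<^bsub>?F (ic w)\<^esub> g' w x)
      = FArr (Map1 (FR (ic w)) h) (Ident (?F (ic w)) (FObj (Map1 (FR (ic w)) u) (FObj (Map1 (FL a) w) (t (id' w) x))))"
    if "w \<in> Arr (Under I)" "x \<in> Obj (Map0 W (id' w))" for w x
    by (rule hQ, unfold Q_def, rule UnI1, rule UnI1, rule UnI1, rule UnI1, rule UnI2, rule rev_image_eqI[of "(w, x)"]) (use that in simp_all)
  have H5: "FArr (Map1 (FR (ic w)) h) (g w (Cod (Map0 W (id' w)) m) \<cdot>\<^bsub>?F (ic w)\<^esub> f (ic w) (FArr (Map1 W w) m))
      = FArr (Map1 (FR (ic w)) h) (FArr (Map1 (FL ?d) w) (f (id' w) m) \<cdot>\<^bsub>?F (ic w)\<^esub> g w (Dom (Map0 W (id' w)) m))"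
    if "w \<in> Arr (Under I)" "m \<in> Arr (Map0 W (id' w))" for w m
    by (rule hQ, unfold Q_def, rule UnI1, rule UnI1, rule UnI1, rule UnI2, rule rev_image_eqI[of "(w, m)"]) (use that in simp_all)
  have H6: "FArr (Map1 (FR i) h) (g (Ident (Under I) i) x) = FArr (Map1 (FR i) h) (Ident (?F i) (FObj (Map1 (FR i) u) (t i x)))"
    if "i \<in> Obj (Under I)" "x \<in> Obj (Map0 W i)" for i x
    by (rule hQ, unfold Q_def, rule UnI1, rule UnI1, rule UnI2, rule rev_image_eqI[of "(i, x)"]) (use that in simp_all)
  have H7: "FArr (Map1 (FR (ic v)) h) (g (v \<cdot>\<^bsub>Under I\<^esub> w) x)
      = FArr (Map1 (FR (ic v)) h) (FArr (Map1 (FL ?d) v) (g w x) \<cdot>\<^bsub>?F (ic v)\<^esub> g v (FObj (Map1 W w) x))"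
    if "w \<in> Arr (Under I)" "v \<in> Arr (Under I)" "ic w = id' v" "x \<in> Obj (Map0 W (id' w))" for w v x
    by (rule hQ, unfold Q_def, rule UnI1, rule UnI2, rule rev_image_eqI[of "(w, v, x)"]) (use that in simp_all)
  have H8: "FArr (Map1 (FR (ic w)) h) (FArr (Map1 (FR (ic w)) u) (NCmp (Map2 (FL a) \<mu>) (t (id' w) x)) \<cdot>\<^bsub>?F (ic w)\<^esub> g w x)
      = FArr (Map1 (FR (ic w)) h) (g (Cod (Cells I) \<mu>) x \<cdot>\<^bsub>?F (ic w)\<^esub> f (ic w) (NCmp (Map2 W \<mu>) x))"
    if "\<mu> \<in> Arr (Cells I)" "w = Dom (Cells I) \<mu>" "x \<in> Obj (Map0 W (id' w))" for \<mu> w x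
    by (rule hQ, unfold Q_def, rule UnI2, rule rev_image_eqI[of "(\<mu>, x)"]) (use that in simp_all)
  have fs [simp]: "f i m \<in> Arr (Map0 F (?d, i))" "Dom (Map0 F (?d, i)) (f i m) = FObj (Map1 (FR i) u) (t i (Dom (Map0 W i) m))"
    "Cod (Map0 F (?d, i)) (f i m) = FObj (Map1 (FR i) u) (t i (Cod (Map0 W i) m))"
    if "i \<in> Obj (Under I)" "m \<in> Arr (Map0 W i)" for i m
    using frD(6-8)[OF that(1) f[OF that]] by simp_all
  have gs [simp]: "g w x \<in> Arr (Map0 F (?d, j))" "Dom (Map0 F (?d, j)) (g w x) = FObj (Map1 (FR j) u) (t j (FObj (Map1 W w) x))"
    "Cod (Map0 F (?d, j)) (g w x) = FObj (Map1 (FR j) u) (FObj (Map1 (FL a) w) (t (id' w) x))"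
    "g' w x \<in> Arr (Map0 F (?d, j))" "Dom (Map0 F (?d, j)) (g' w x) = FObj (Map1 (FR j) u) (FObj (Map1 (FL a) w) (t (id' w) x))"
    "Cod (Map0 F (?d, j)) (g' w x) = FObj (Map1 (FR j) u) (t j (FObj (Map1 W w) x))"
    if "w \<in> Arr (Under I)" "x \<in> Obj (Map0 W (id' w))" "j = ic w" for w x j
    using frD(6-8)[OF _ g[OF that(1,2)]] frD(6-8)[OF _ g'[OF that(1,2)]] that by simp_all
  show ?thesis
  proof (rule that[of "h \<cdot>\<^bsub>Under A\<^esub> u" "\<lambda>i m. FArr (Map1 (FR i) h) (f i m)" "\<lambda>w x. FArr (Map1 (FR (ic w)) h) (g w x)"])
    show "h \<cdot>\<^bsub>Under A\<^esub> u \<in> \<Sigma>" "ud (h \<cdot>\<^bsub>Under A\<^esub> u) = a" by simp_all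
  next
    fix i m assume i: "i \<in> Obj (Under I)" "m \<in> Arr (Map0 W i)"
    show "fr i (FArr (T0 \<theta> i) m) (t i (Dom (Map0 W i) m)) (t i (Cod (Map0 W i) m)) (h \<cdot>\<^bsub>Under A\<^esub> u) (h \<cdot>\<^bsub>Under A\<^esub> u) (FArr (Map1 (FR i) h) (f i m))"
      by (rule fr_ext[OF i(1) f[OF i] h])
  next
    fix w x assume w: "w \<in> Arr (Under I)" "x \<in> Obj (Map0 W (id' w))"
    have j: "ic w \<in> Obj (Under I)" using w by simp
    show "fr (ic w) (NCmp (T1 \<theta> w) x) (t (ic w) (FObj (Map1 W w) x)) (FObj (Map1 (FL a) w) (t (id' w) x))
        (h \<cdot>\<^bsub>Under A\<^esub> u) (h \<cdot>\<^bsub>Under A\<^esub> u) (FArr (Map1 (FR (ic w)) h) (g w x))"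
      by (rule fr_ext[OF j g[OF w] h])
  next
    fix i m n assume i: "i \<in> Obj (Under I)" "m \<in> Arr (Map0 W i)" "n \<in> Arr (Map0 W i)" "Cod (Map0 W i) m = Dom (Map0 W i) n"
    show "FArr (Map1 (FR i) h) (f i (n \<cdot>\<^bsub>Map0 W i\<^esub> m))
      = FArr (Map1 (FR i) h) (f i n) \<cdot>\<^bsub>Map0 F (uc (h \<cdot>\<^bsub>Under A\<^esub> u), i)\<^esub> FArr (Map1 (FR i) h) (f i m)"
      using H1[OF i] i by simp
  next
    fix i x assume i: "i \<in> Obj (Under I)" "x \<in> Obj (Map0 W i)"
    show "FArr (Map1 (FR i) h) (f i (Ident (Map0 W i) x))
      = Ident (Map0 F (uc (h \<cdot>\<^bsub>Under A\<^esub> u), i)) (FObj (Map1 (FR i) (h \<cdot>\<^bsub>Under A\<^esub> u)) (t i x))"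
      using H2[OF i] i by simp
    show "FArr (Map1 (FR (ic (Ident (Under I) i))) h) (g (Ident (Under I) i) x)
      = Ident (Map0 F (uc (h \<cdot>\<^bsub>Under A\<^esub> u), i)) (FObj (Map1 (FR i) (h \<cdot>\<^bsub>Under A\<^esub> u)) (t i x))"
      using H6[OF i] i by simp
  next
    fix w x assume w: "w \<in> Arr (Under I)" "x \<in> Obj (Map0 W (id' w))"
    show "is_iso (Map0 F (uc (h \<cdot>\<^bsub>Under A\<^esub> u), ic w)) (FArr (Map1 (FR (ic w)) h) (g w x))"
      \<comment> \<open>After \<open>h\<close> both inverse laws hold, so the lifted inverse has
        become an actual inverse.\<close>
      by (rule is_isoI[of _ _ "FArr (Map1 (FR (ic w)) h) (g' w x)"]) (use w H3[OF w] H4[OF w] in simp_all)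
  next
    fix w m assume w: "w \<in> Arr (Under I)" "m \<in> Arr (Map0 W (id' w))"
    show "FArr (Map1 (FR (ic w)) h) (g w (Cod (Map0 W (id' w)) m)) \<cdot>\<^bsub>Map0 F (uc (h \<cdot>\<^bsub>Under A\<^esub> u), ic w)\<^esub> FArr (Map1 (FR (ic w)) h) (f (ic w) (FArr (Map1 W w) m))
      = FArr (Map1 (FL (uc (h \<cdot>\<^bsub>Under A\<^esub> u))) w) (FArr (Map1 (FR (id' w)) h) (f (id' w) m)) \<cdot>\<^bsub>Map0 F (uc (h \<cdot>\<^bsub>Under A\<^esub> u), ic w)\<^esub> FArr (Map1 (FR (ic w)) h) (g w (Dom (Map0 W (id' w)) m))"
      using H5[OF w] w by (simp add: F_commute_arr F_commute_obj)
  next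
    fix w v x assume w: "w \<in> Arr (Under I)" "v \<in> Arr (Under I)" "ic w = id' v" "x \<in> Obj (Map0 W (id' w))"
    show "FArr (Map1 (FR (ic (v \<cdot>\<^bsub>Under I\<^esub> w))) h) (g (v \<cdot>\<^bsub>Under I\<^esub> w) x)
      = FArr (Map1 (FL (uc (h \<cdot>\<^bsub>Under A\<^esub> u))) v) (FArr (Map1 (FR (ic w)) h) (g w x)) \<cdot>\<^bsub>Map0 F (uc (h \<cdot>\<^bsub>Under A\<^esub> u), ic v)\<^esub> FArr (Map1 (FR (ic v)) h) (g v (FObj (Map1 W w) x))"
      using H7[OF w] w by (simp add: F_commute_arr F_commute_obj)
  next
    fix \<mu> w x assume m: "\<mu> \<in> Arr (Cells I)" "w = Dom (Cells I) \<mu>" "x \<in> Obj (Map0 W (id' w))"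
    show "NCmp (Map2 (FL (uc (h \<cdot>\<^bsub>Under A\<^esub> u))) \<mu>) (FObj (Map1 (FR (id' w)) (h \<cdot>\<^bsub>Under A\<^esub> u)) (t (id' w) x)) \<cdot>\<^bsub>Map0 F (uc (h \<cdot>\<^bsub>Under A\<^esub> u), ic w)\<^esub> FArr (Map1 (FR (ic w)) h) (g w x)
      = FArr (Map1 (FR (ic (Cod (Cells I) \<mu>))) h) (g (Cod (Cells I) \<mu>) x) \<cdot>\<^bsub>Map0 F (uc (h \<cdot>\<^bsub>Under A\<^esub> u), ic w)\<^esub> FArr (Map1 (FR (ic w)) h) (f (ic w) (NCmp (Map2 W \<mu>) x))"
      \<comment> \<open>By interchange of the two variables, the 2-cell at \<open>a\<close> pushed
        along \<open>u\<close> and \<open>h\<close> is the 2-cell at the final index.\<close>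
      using H8[OF m] m by (simp add: F_commute_cell' F_commute_obj)
  qed
qed

text \<open>The lifted data form a pseudonatural transformation \<open>\<zeta>\<close> at the
  codomain of \<open>u\<close>. Its image need not be \<open>\<theta>\<close>, since objects have
  been moved along \<open>u\<close>, but the legs \<open>\<lambda>\<^sub>u\<close> at the lifted
  objects form an invertible modification onto \<open>\<theta>\<close>: naturality and the
  modification law are the defining equations of the lifted fractions.\<close>

lemma K_surj_lifted:
  assumes a [simp]: "a \<in> Obj (Under A)" and p [simp]: "E.pn \<theta>"
    and t: "\<And>i x. i \<in> Obj (Under I) \<Longrightarrow> x \<in> Obj (Map0 W i) \<Longrightarrow> t i x \<in> Obj (Map0 F (a, i))"
    and \<theta>t: "\<And>i x. i \<in> Obj (Under I) \<Longrightarrow> x \<in> Obj (Map0 W i) \<Longrightarrow> FObj (T0 \<theta> i) x = FObj (T0 (lam i) a) (t i x)"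
  shows "\<exists>c\<in>Obj P. \<exists>e\<in>hom (bilim I W C) (FObj K c) \<theta>. is_iso (bilim I W C) e"
proof -
  obtain u f g where u: "u \<in> \<Sigma>" "ud u = a"
    and f: "\<And>i m. i \<in> Obj (Under I) \<Longrightarrow> m \<in> Arr (Map0 W i) \<Longrightarrow>
      fr i (FArr (T0 \<theta> i) m) (t i (Dom (Map0 W i) m)) (t i (Cod (Map0 W i) m)) u u (f i m)"
    and g: "\<And>w x. w \<in> Arr (Under I) \<Longrightarrow> x \<in> Obj (Map0 W (id' w)) \<Longrightarrow>
      fr (ic w) (NCmp (T1 \<theta> w) x) (t (ic w) (FObj (Map1 W w) x)) (FObj (Map1 (FL a) w) (t (id' w) x)) u u (g w x)"
    and f_comp: "\<And>i m n. i \<in> Obj (Under I) \<Longrightarrow> m \<in> Arr (Map0 W i) \<Longrightarrow> n \<in> Arr (Map0 W i) \<Longrightarrow>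
      Cod (Map0 W i) m = Dom (Map0 W i) n \<Longrightarrow> f i (n \<cdot>\<^bsub>Map0 W i\<^esub> m) = f i n \<cdot>\<^bsub>Map0 F (uc u, i)\<^esub> f i m"
    and f_ident: "\<And>i x. i \<in> Obj (Under I) \<Longrightarrow> x \<in> Obj (Map0 W i) \<Longrightarrow>
      f i (Ident (Map0 W i) x) = Ident (Map0 F (uc u, i)) (FObj (Map1 (FR i) u) (t i x))"
    and g_iso: "\<And>w x. w \<in> Arr (Under I) \<Longrightarrow> x \<in> Obj (Map0 W (id' w)) \<Longrightarrow> is_iso (Map0 F (uc u, ic w)) (g w x)"
    and g_nat: "\<And>w m. w \<in> Arr (Under I) \<Longrightarrow> m \<in> Arr (Map0 W (id' w)) \<Longrightarrow>
      g w (Cod (Map0 W (id' w)) m) \<cdot>\<^bsub>Map0 F (uc u, ic w)\<^esub> f (ic w) (FArr (Map1 W w) m)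
      = FArr (Map1 (FL (uc u)) w) (f (id' w) m) \<cdot>\<^bsub>Map0 F (uc u, ic w)\<^esub> g w (Dom (Map0 W (id' w)) m)"
    and g_ident: "\<And>i x. i \<in> Obj (Under I) \<Longrightarrow> x \<in> Obj (Map0 W i) \<Longrightarrow>
      g (Ident (Under I) i) x = Ident (Map0 F (uc u, i)) (FObj (Map1 (FR i) u) (t i x))"
    and g_comp: "\<And>w v x. w \<in> Arr (Under I) \<Longrightarrow> v \<in> Arr (Under I) \<Longrightarrow> ic w = id' v \<Longrightarrow> x \<in> Obj (Map0 W (id' w)) \<Longrightarrow>
      g (v \<cdot>\<^bsub>Under I\<^esub> w) x = FArr (Map1 (FL (uc u)) v) (g w x) \<cdot>\<^bsub>Map0 F (uc u, ic v)\<^esub> g v (FObj (Map1 W w) x)"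
    and g_cell: "\<And>\<mu> w x. \<mu> \<in> Arr (Cells I) \<Longrightarrow> w = Dom (Cells I) \<mu> \<Longrightarrow> x \<in> Obj (Map0 W (id' w)) \<Longrightarrow>
      NCmp (Map2 (FL (uc u)) \<mu>) (FObj (Map1 (FR (id' w)) u) (t (id' w) x)) \<cdot>\<^bsub>Map0 F (uc u, ic w)\<^esub> g w x
      = g (Cod (Cells I) \<mu>) x \<cdot>\<^bsub>Map0 F (uc u, ic w)\<^esub> f (ic w) (NCmp (Map2 W \<mu>) x)"
  proof (rule lift_structure[OF a p t \<theta>t], goal_cases)
    case (5 u f g)
    show ?case by (rule 5(1)) (fact 5)+
  qed
  note [simp] = t \<theta>t u
  let ?e = "uc u"
  let ?F = "\<lambda>i. Map0 F (?e, i)"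
  have e [simp]: "?e \<in> Obj (Under A)" by simp
  interpret W: diagram I W by (intro diagram.intro twoI functorW)
  interpret Le: weighted_diagram I W "FL ?e" rewrites "\<And>i. Map0 (FL ?e) i = ?F i" by (rule wdL[OF e]) simp
  interpret N: natural_family I W "FL ?e" C "\<lambda>i. T0 (lam i) ?e" rewrites "\<And>i. Map0 (FL ?e) i = ?F i" and "\<And>i. Map0 C i = L i"
    by (rule NL[OF e]) simp_all
  have fs [simp]: "f i m \<in> Arr (?F i)" "Dom (?F i) (f i m) = FObj (Map1 (FR i) u) (t i (Dom (Map0 W i) m))"
    "Cod (?F i) (f i m) = FObj (Map1 (FR i) u) (t i (Cod (Map0 W i) m))"
    if "i \<in> Obj (Under I)" "m \<in> Arr (Map0 W i)" for i m
    using frD(6-8)[OF that(1) f[OF that]] by simp_all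
  have gs [simp]: "g w x \<in> Arr (?F j)" "Dom (?F j) (g w x) = FObj (Map1 (FR j) u) (t j (FObj (Map1 W w) x))"
    "Cod (?F j) (g w x) = FObj (Map1 (FL ?e) w) (FObj (Map1 (FR (id' w)) u) (t (id' w) x))"
    if "w \<in> Arr (Under I)" "x \<in> Obj (Map0 W (id' w))" "j = ic w" for w x j
    \<comment> \<open>Interchange of the two variables rewrites the target from a value of the
      diagram at \<open>a\<close> pushed along \<open>u\<close> to a value of the diagram at the new
      index.\<close>
    using frD(6-8)[OF _ g[OF that(1,2)]] that by (simp_all add: F_commute_obj)
  let ?T = "\<lambda>i. mkF (Map0 W i) (?F i) (\<lambda>x. FObj (Map1 (FR i) u) (t i x)) (f i)"
  define \<zeta> where "\<zeta> = \<lparr>T0 = restrict ?T (Obj (Under I)),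
    T1 = (\<lambda>w\<in>Arr (Under I). mkN (?T (ic w) \<cdot>F Map1 W w) (Map1 (FL ?e) w \<cdot>F ?T (id' w)) (g w))\<rparr>"
  have T [simp]: "is_functor (?T i)" if i: "i \<in> Obj (Under I)" for i
    by (rule is_functor_mkF) (use i f_ident f_comp in simp_all)
  have N [simp]: "is_ntrans (mkN (?T (ic w) \<cdot>F Map1 W w) (Map1 (FL ?e) w \<cdot>F ?T (id' w)) (g w))"
    if w: "w \<in> Arr (Under I)" for w
    by (rule is_ntrans_mkN[where C="Map0 W (id' w)" and D="?F (ic w)"]) (use w g_nat in simp_all)
  have s [simp]: "i \<in> Obj (Under I) \<Longrightarrow> T0 \<zeta> i = ?T i"
    "w \<in> Arr (Under I) \<Longrightarrow> T1 \<zeta> w = mkN (?T (ic w) \<cdot>F Map1 W w) (Map1 (FL ?e) w \<cdot>F ?T (id' w)) (g w)" for i w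
    by (auto simp: \<zeta>_def)
  have p' [simp]: "Le.pn \<zeta>"
  proof (rule Le.pseudonaturalI)
    fix w v x assume w: "w \<in> Arr (Under I)" "v \<in> Arr (Under I)" "ic w = id' v" "x \<in> Obj (Map0 W (id' w))"
    show "NCmp (T1 \<zeta> (v \<cdot>\<^bsub>Under I\<^esub> w)) x = FArr (Map1 (FL ?e) v) (NCmp (T1 \<zeta> w) x) \<cdot>\<^bsub>?F (ic v)\<^esub> NCmp (T1 \<zeta> v) (FObj (Map1 W w) x)"
      using w g_comp[OF w] by simp
  next
    fix \<mu> x assume m: "\<mu> \<in> Arr (Cells I)" "x \<in> Obj (Map0 W (id' (Dom (Cells I) \<mu>)))"
    show "NCmp (Map2 (FL ?e) \<mu>) (FObj (T0 \<zeta> (id' (Dom (Cells I) \<mu>))) x) \<cdot>\<^bsub>?F (ic (Dom (Cells I) \<mu>))\<^esub> NCmp (T1 \<zeta> (Dom (Cells I) \<mu>)) x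
      = NCmp (T1 \<zeta> (Cod (Cells I) \<mu>)) x \<cdot>\<^bsub>?F (ic (Dom (Cells I) \<mu>))\<^esub> FArr (T0 \<zeta> (ic (Dom (Cells I) \<mu>))) (NCmp (Map2 W \<mu>) x)"
      using m g_cell[OF m(1) refl m(2)] by simp
  qed (use g_iso g_ident in simp_all, simp_all add: \<zeta>_def)
  define \<phi> where "\<phi> = \<lparr>MSrc = post_transf I (\<lambda>i. T0 (lam i) ?e) \<zeta>, MTgt = \<theta>,
    MCmp = (\<lambda>i\<in>Obj (Under I). mkN (T0 (lam i) ?e \<cdot>F ?T i) (T0 \<theta> i) (\<lambda>x. NCmp (T1 (lam i) u) (t i x)))\<rparr>"
  have \<phi>s [simp]: "MSrc \<phi> = post_transf I (\<lambda>i. T0 (lam i) ?e) \<zeta>" "MTgt \<phi> = \<theta>"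
    "i \<in> Obj (Under I) \<Longrightarrow> MCmp \<phi> i = mkN (T0 (lam i) ?e \<cdot>F ?T i) (T0 \<theta> i) (\<lambda>x. NCmp (T1 (lam i) u) (t i x))" for i
    by (simp_all add: \<phi>_def)
  have n [simp]: "is_ntrans (mkN (T0 (lam i) ?e \<cdot>F ?T i) (T0 \<theta> i) (\<lambda>x. NCmp (T1 (lam i) u) (t i x)))" if i: "i \<in> Obj (Under I)" for i
    \<comment> \<open>Naturality at an arrow \<open>m\<close> of the weight is the equation that
      presents \<open>FArr (T0 \<theta> i) m\<close> with representative
      \<open>f i m\<close>.\<close>
    by (rule is_ntrans_mkN[where C="Map0 W i" and D="L i"]) (use i frD(12)[OF i f[OF i]] in simp_all)
  have \<phi>m: "E.modification \<phi>"
  proof (rule E.modificationI)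
    fix w x assume w: "w \<in> Arr (Under I)" "x \<in> Obj (Map0 W (id' w))"
    have j: "ic w \<in> Obj (Under I)" using w by simp
    show "NCmp (T1 (MTgt \<phi>) w) x \<cdot>\<^bsub>L (ic w)\<^esub> NCmp (MCmp \<phi> (ic w)) (FObj (Map1 W w) x)
      = FArr (Map1 C w) (NCmp (MCmp \<phi> (id' w)) x) \<cdot>\<^bsub>L (ic w)\<^esub> NCmp (T1 (MSrc \<phi>) w) x"
      using w frD(12)[OF j g[OF w]] by simp
  qed (simp_all, simp_all add: \<phi>_def)
  have i: "is_iso (bilim I W C) \<phi>"
    by (rule E.bilim_iso[OF \<phi>m]) simp
  show ?thesis
  proof (intro bexI)
    show "is_iso (bilim I W C) \<phi>" by (fact i)
    show "\<phi> \<in> hom (bilim I W C) (FObj K (p.l.To ?e \<zeta>)) \<theta>"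
      using \<phi>m K_map(1)[OF e p'] by simp
    show "p.l.To ?e \<zeta> \<in> Obj P"
      using functor_obj[OF p.l.T0_functor(1,3)[OF e], of \<zeta>] p.l.T0_functor(2)[OF e] by simp
  qed
qed

text \<open>Over a common index the values of \<open>\<theta>\<close> are at first only isomorphic
  to images under the universal cones; \<open>pn_transport\<close> replaces \<open>\<theta>\<close>
  by an isomorphic transformation whose values are such images. The strict case applies to it, and
  the two isomorphisms compose.\<close>

lemma K_surj:
  assumes "\<theta> \<in> Obj (bilim I W C)"
  shows "\<exists>c\<in>Obj P. \<exists>e\<in>hom (bilim I W C) (FObj K c) \<theta>. is_iso (bilim I W C) e"
proof -
  have p: "E.pn \<theta>" using assms by simp
  obtain a t e where a: "a \<in> Obj (Under A)" and te: "\<And>i x. i \<in> Obj (Under I) \<Longrightarrow> x \<in> Obj (Map0 W i) \<Longrightarrow>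
    t i x \<in> Obj (Map0 F (a, i)) \<and> e i x \<in> hom (L i) (FObj (T0 (lam i) a) (t i x)) (FObj (T0 \<theta> i) x) \<and> is_iso (L i) (e i x)"
  proof (rule common_lift[OF p], goal_cases)
    case (1 a t e)
    show ?case by (rule 1(1)) (fact 1)+
  qed
  obtain \<theta>' \<rho> where r: "E.pn \<theta>'" "\<And>i x. i \<in> Obj (Under I) \<Longrightarrow> x \<in> Obj (Map0 W i) \<Longrightarrow> FObj (T0 \<theta>' i) x = FObj (T0 (lam i) a) (t i x)"
    "E.modification \<rho>" "MSrc \<rho> = \<theta>'" "MTgt \<rho> = \<theta>" "is_iso (bilim I W C) \<rho>"
    by (rule E.pn_transport[OF p, of "\<lambda>i x. FObj (T0 (lam i) a) (t i x)" e]) (use te a in auto)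
  obtain c e' where c: "c \<in> Obj P" "e' \<in> hom (bilim I W C) (FObj K c) \<theta>'" "is_iso (bilim I W C) e'"
    using K_surj_lifted[OF a r(1) _ r(2)] te by blast
  have c': "e' \<in> Arr (bilim I W C)" "Dom (bilim I W C) e' = FObj K c" "Cod (bilim I W C) e' = Dom (bilim I W C) \<rho>"
    "\<rho> \<in> Arr (bilim I W C)" "Cod (bilim I W C) \<rho> = \<theta>"
    using c r by (auto simp del: E.bilim_sel(5))
  show ?thesis
  proof (intro bexI[OF _ c(1)] bexI[of _ "\<rho> \<cdot>\<^bsub>bilim I W C\<^esub> e'"])
    show "is_iso (bilim I W C) (\<rho> \<cdot>\<^bsub>bilim I W C\<^esub> e')"
      by (rule is_iso_comp[OF E.bilim_cat c(3) r(6) c'(3)])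
    show "\<rho> \<cdot>\<^bsub>bilim I W C\<^esub> e' \<in> hom (bilim I W C) (FObj K c) \<theta>"
      unfolding in_hom_iff using cat_comp[OF E.bilim_cat c'(1,4,3)] unfolding c' by blast
  qed
qed

end

theorem theorem3p2:
  fixes A :: "('a, 'f, 'c) twocat" and \<Sigma> :: "'f set"
    and I :: "('i, 'j, 'k) twocat"
    and F :: "('a \<times> 'i, 'f \<times> 'j, 'c \<times> 'k, 'o, 'm) cat_valued"
    and W :: "('i, 'j, 'k, 'v, 'w) cat_valued"
    and L :: "'i \<Rightarrow> ('l, 'h) cat"
    and lam :: "'i \<Rightarrow> ('a, 'f, 'o, 'm, 'l, 'h) transf"
    and P :: "('p, 'q) cat"
    and \<kappa> :: "('a, 'f, ('i, 'j, 'v, 'w, 'o, 'm) transf, ('i, 'j, 'v, 'w, 'o, 'm) modif, 'p, 'q) transf"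
  assumes "sigma_filtered A \<Sigma>"
    and "finite_two_category I"
    and "two_functor (prod_twocat A I) Cat F"
    and "finite_weight I W"
    and "\<And>i. i \<in> Obj (Under I) \<Longrightarrow> is_sigma_colimit A \<Sigma> (fix_right I F i) (L i) (lam i)"
    and "is_sigma_colimit A \<Sigma> (bilim_functor A I W F) P \<kappa>"
  shows "is_equivalence P (bilim I W (colim_functor A \<Sigma> I F L lam))
           (comparison_functor A \<Sigma> I W F L lam P \<kappa>)"
proof -
  interpret comparison_colimit A \<Sigma> I F W L lam P \<kappa>
    by unfold_locales (fact assms)+
  show ?thesis
    by (rule is_equivalenceI[OF K_props(1) K_faithful K_full K_surj])
qed

end
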